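(* Assume the standing setup, either Setting A or Setting B, and the Gibbs-measure and observable conventions and complex-perturbation quantities below. Assume: (a) $\operatorname{ess\,sup}_\omega E_\omega<\infty$; (b) in Setting A, additionally $\tilde H_\omega\le\gamma_{\theta\omega}^\alpha-1$ $\mathbb P$-a.s.; (c) for some $p>8$, $\bar D_\omega\in L^{2p}(\mathbb P)$ and $K_\omega$, $M_\omega$, $\sup|\tilde u_\omega|$ belong to $L^p(\mathbb P)$; (d) there is a constant $\sigma>0$ with $\sigma^2=\lim_n\frac1n\sigma^2_{\omega,n}$ for $\mathbb P$-a.e. $\omega$. Let $(a_n)$ be positive with $a_nn^{-\max(6/p,1/2)}\to\infty$ and $a_n=o(n^{1-8/p})$. Then for $\mathbb P$-a.e. $\omega$ and every Borel set $\Gamma\subset\mathbb R$, $$-\inf_{x\in\Gamma^{o}}\frac{x^2}{2\sigma^2}\le\liminf_{n\to\infty}\frac{n}{a_n^2}\ln\mu_\omega\Big(\frac{S^\omega_n\tilde u}{a_n}\in\Gamma\Big)\le\limsup_{n\to\infty}\frac{n}{a_n^2}\ln\mu_\omega\Big(\frac{S^\omega_n\tilde u}{a_n}\in\Gamma\Big)\le-\inf_{x\in\overline\Gamma}\frac{x^2}{2\sigma^2},$$ where $\Gamma^o$ and $\overline\Gamma$ are the interior and closure of $\Gamma$ and $S^\omega_n\tilde u=\sum_{j=0}^{n-1}\tilde u_{\theta^j\omega}\circ T^j_\omega$.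
   Context: Standing setup. $(\Omega,\mathcal F,\mathbb P)$ is a probability space and $\theta:\Omega\to\Omega$ is invertible, measurable, $\mathbb P$-preserving and ergodic. $(\mathcal X,d)$ is a compact metric space with $\operatorname{diam}\mathcal X\le1$; $\mathcal E\subset\Omega\times\mathcal X$ is $\mathcal F\otimes\mathcal B(\mathcal X)$-measurable with compact fibres $\mathcal E_\omega=\{x:(\omega,x)\in\mathcal E\}$; $T_\omega:\mathcal E_\omega\to\mathcal E_{\theta\omega}$ are maps with $(\omega,x)\mapsto T_\omega x$ measurable, and $T^n_\omega=T_{\theta^{n-1}\omega}\circ\cdots\circ T_\omega$. "Random variable" means a measurable function of $\omega$. An exponent $\alpha\in(0,1]$ is fixed. For $g:\mathcal E_\omega\to\mathbb C$ let $v(g)=\sup_{x\ne x'}|g(x)-g(x')|/d(x,x')^\alpha$ and $\|g\|=\sup|g|+v(g)$; $\mathcal H_\omega$ is the space of real functions $g$ on $\mathcal E_\omega$ with $\|g\|<\infty$, and $\mathbf 1$ is the constant function $1$. A measurable potential $\phi:\mathcal E\to\mathbb R$ is given with $\phi_\omega=\phi(\omega,\cdot)$ bounded. The transfer operator is $\mathcal L_\omega g(x)=\sum_{y\in T_\omega^{-1}\{x\}}e^{\phi_\omega(y)}g(y)$, $x\in\mathcal E_{\theta\omega}$, and $\mathcal L^n_\omega=\mathcal L_{\theta^{n-1}\omega}\circ\cdots\circ\mathcal L_\omega$. Write $\rho_{\omega,n}=\prod_{j=0}^{n-1}\rho(\theta^j\omega)$ and $\lambda_{\omega,n}=\prod_{j=0}^{n-1}\lambda_{\theta^j\omega}$.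 Setting A (properly expanding maps). There are random variables $\gamma_\omega>1$, $H_\omega\ge0$, $D_\omega<\infty$ such that $\mathbb P$-a.s.: for every $x\in\mathcal E_{\theta\omega}$ the preimages are listed as $T_\omega^{-1}\{x\}=\{y_{i,\omega}(x):i\in I_\omega\}$ (index set $I_\omega$ finite or countable, independent of $x$, $i\mapsto y_{i,\omega}(x)$ bijective), and for all $x,x'\in\mathcal E_{\theta\omega}$ and $i\in I_\omega$: $d(y_{i,\omega}(x),y_{i,\omega}(x'))\le\gamma_\omega^{-1}d(x,x')$ and $|\phi_\omega(y_{i,\omega}(x))-\phi_\omega(y_{i,\omega}(x'))|\le H_\omega d(x,x')^\alpha$; moreover $H_\omega\le\gamma_{\theta\omega}^\alpha-1$ and $\sup_{x\in\mathcal E_{\theta\omega}}\sum_{y\in T_\omega^{-1}\{x\}}e^{\phi_\omega(y)}\le D_\omega$. In Setting A put $q(\omega)=(H_\omega+1)\gamma_{\theta\omega}^{-\alpha}$, $D(\omega)=\gamma_{\theta\omega}^\alpha+2\ln\frac{1+q(\omega)}{1-q(\omega)}$, $\rho(\omega)=\tanh(D(\omega)/4)$ (with $\rho(\omega)=1$ if $q(\omega)=1$), $B_\omega=24e^{4\gamma_\omega^\alpha}(1+\gamma_\omega^\alpha)^2$, $B_{\omega,1}=e^{\gamma_\omega^\alpha}$, $K_\omega=(1+\gamma_\omega^\alpha)e^{\gamma_\omega^\alpha}$, $M_\omega=8(1-e^{-\gamma_\omega^\alpha})^{-2}$, and $\mathcal C_\omega=\{g\in\mathcal H_\omega:g\ge0,\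 g(x)\le e^{\gamma_\omega^\alpha d(x,x')^\alpha}g(x')\ \forall x,x'\in\mathcal E_\omega\}$. Setting B (partially expanding maps). There are random variables $l_\omega\ge1$, $\sigma_\omega>1$ and positive integer valued $q_\omega<d_\omega$ such that $\mathbb P$-a.s. every $x\in\mathcal E_{\theta\omega}$ has exactly $d_\omega$ preimages, listed as $T_\omega^{-1}\{x\}=\{y_{1,\omega}(x),\dots,y_{d_\omega,\omega}(x)\}$, and for all $x,x'\in\mathcal E_{\theta\omega}$: $d(y_{i,\omega}(x),y_{i,\omega}(x'))\le l_\omega d(x,x')$ for $i\le q_\omega$ and $d(y_{i,\omega}(x),y_{i,\omega}(x'))\le\sigma_\omega^{-1}d(x,x')$ for $q_\omega<i\le d_\omega$. Let $a_\omega=(q_\omega l_\omega^\alpha+(d_\omega-q_\omega)\sigma_\omega^{-\alpha})/d_\omega$, $\varepsilon_\omega=\sup\phi_\omega-\inf\phi_\omega$, $H_\omega=\max_{i\le d_\omega}v(\phi_\omega\circ y_{i,\omega})$ (assumed finite), and assume $s_\omega:=e^{\varepsilon_\omega}a_\omega<1$ and $e^{\varepsilon_\omega}H_\omega\le(s_{\theta\omega}^{-1}-1)/(1+s_\omega^{-1})$. In Setting B put $\zeta_\omega=s_{\theta\omega}\big(1+(1+s_\omega^{-1})e^{\varepsilon_\omega}H_\omega\big)$, $D(\omega)=2\ln\frac{1+\zeta_\omega}{1-\zeta_\omega}+2\ln(1+\zeta_\omega s_\omega^{-1})$, $\rho(\omega)=\tanh(D(\omega)/4)$ (with $\rho(\omega)=1$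 if $\zeta_\omega=1$), $B_\omega=12(1+2s_\omega^{-1})^4$, $B_{\omega,1}=1+s_\omega^{-1}$, $K_\omega=1+2s_\omega^{-1}$, $M_\omega=6s_\omega^{-1}$, $D_\omega=d_\omega e^{\sup|\phi_\omega|}$, and $\mathcal C_\omega=\{g\in\mathcal H_\omega:g>0,\ v(g)\le s_\omega^{-1}\inf g\}$. Gibbs measures. In either setting, $\mathbb P$-a.s. the limits $\nu_\omega(g)=\lim_n\mathcal L^n_\omega g(x_n)/\mathcal L^n_\omega\mathbf 1(x_n)$ ($g\in\mathcal H_\omega$, any $x_n\in\mathcal E_{\theta^n\omega}$), $\lambda_\omega=\nu_{\theta\omega}(\mathcal L_\omega\mathbf 1)$ and $h_\omega=\lim_n\mathcal L^n_{\theta^{-n}\omega}\mathbf 1/\lambda_{\theta^{-n}\omega,n}$ exist, $\nu_\omega$ is a Borel probability measure, and $\mu_\omega:=h_\omega\nu_\omega$ is the random Gibbs measure; it satisfies $(T_\omega)_*\mu_\omega=\mu_{\theta\omega}$. Observables. $u:\mathcal E\to\mathbb R$ is measurable with $u_\omega=u(\omega,\cdot)\in\mathcal H_\omega$; $\tilde u_\omega=u_\omega-\mu_\omega(u_\omega)$; $S^\omega_nu=\sum_{j=0}^{n-1}u_{\theta^j\omega}\circ T^j_\omega$, viewed as a random variable on $(\mathcal E_\omega,\mu_\omega)$; $\sigma^2_{\omega,n}=\mathrm{Var}_{\mu_\omega}(S^\omega_nu)$. Complex-perturbation quantities. In Setting A: $\tilde H_\omega=\gamma_\omega^{-\alpha}v(u_\omega)+H_\omega$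 and $c_0(\omega)=3\sup|\tilde u_\omega|+\tilde H_\omega/(\gamma_{\theta\omega}^\alpha-1-\tilde H_\omega)$. In Setting B: $\tilde H_\omega=H_\omega$ and $c_0(\omega)=32s_{\theta\omega}(1+2s_\omega^{-1})e^{\sup|\tilde u_\omega|+2\sup|\phi_\omega|}\|\tilde u_\omega\|(1+H_\omega)/(1-\zeta_\omega)$. In both settings: $E_\omega=c_0(\omega)\big(1+\cosh(7D(\omega)/2)\big)$ and $\bar D_\omega=16e^{\sup|\tilde u_\omega|}(1+v(u_\omega))(1+\tilde H_\omega)D_\omega$. *)

theory Defs
  imports "HOL-Probability.Probability"
begin

definition fib :: "('w \<times> 'x) set \<Rightarrow> 'w \<Rightarrow> 'x set" where
  "fib E \<omega> = {x. (\<omega>, x) \<in> E}"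

definition holder :: "real \<Rightarrow> 'x::metric_space set \<Rightarrow> ('x \<Rightarrow> real) \<Rightarrow> bool" where
  "holder \<alpha> S g \<longleftrightarrow> (\<exists>B. \<forall>x\<in>S. \<bar>g x\<bar> \<le> B) \<and>
     (\<exists>C. \<forall>x\<in>S. \<forall>x'\<in>S. \<bar>g x - g x'\<bar> \<le> C * dist x x' powr \<alpha>)"

text \<open>Hoelder seminorm v(g) = sup over x different from x' of |g x - g x'| / d(x,x')^alpha
  (taken to be 0 if there are no such pairs).\<close>
definition hv :: "real \<Rightarrow> 'x::metric_space set \<Rightarrow> ('x \<Rightarrow> real) \<Rightarrow> real" where
  "hv \<alpha> S g = Sup ({0} \<union> {\<bar>g x - g x'\<bar> / dist x x' powr \<alpha> | x x'. x \<in> S \<and> x' \<in> S \<and> x \<noteq> x'})"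

definition supabs :: "'x set \<Rightarrow> ('x \<Rightarrow> real) \<Rightarrow> real" where
  "supabs S g = Sup ((\<lambda>x. \<bar>g x\<bar>) ` S)"

definition supf :: "'x set \<Rightarrow> ('x \<Rightarrow> real) \<Rightarrow> real" where
  "supf S g = Sup (g ` S)"

definition inff :: "'x set \<Rightarrow> ('x \<Rightarrow> real) \<Rightarrow> real" where
  "inff S g = Inf (g ` S)"

definition in_Lp :: "'w measure \<Rightarrow> real \<Rightarrow> ('w \<Rightarrow> real) \<Rightarrow> bool" where
  "in_Lp P p f \<longleftrightarrow> f \<in> borel_measurable P \<and> integrable P (\<lambda>\<omega>. \<bar>f \<omega>\<bar> powr p)"

definition ergodic_ip :: "'w measure \<Rightarrow> ('w \<Rightarrow> 'w) \<Rightarrow> bool" where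
  "ergodic_ip P \<theta> \<longleftrightarrow> prob_space P \<and> bij_betw \<theta> (space P) (space P) \<and>
     \<theta> \<in> P \<rightarrow>\<^sub>M P \<and> the_inv_into (space P) \<theta> \<in> P \<rightarrow>\<^sub>M P \<and> distr P P \<theta> = P \<and>
     (\<forall>A\<in>sets P. \<theta> -` A \<inter> space P = A \<longrightarrow> emeasure P A = 0 \<or> emeasure P A = 1)"

definition thinv :: "'w measure \<Rightarrow> ('w \<Rightarrow> 'w) \<Rightarrow> 'w \<Rightarrow> 'w" where
  "thinv P \<theta> = the_inv_into (space P) \<theta>"

definition standing :: "'w measure \<Rightarrow> ('w \<Rightarrow> 'w) \<Rightarrow> 'x::metric_space set \<Rightarrow> ('w \<times> 'x) set
    \<Rightarrow> ('w \<Rightarrow> 'x \<Rightarrow> 'x) \<Rightarrow> real \<Rightarrow> ('w \<Rightarrow> 'x \<Rightarrow> real) \<Rightarrow> ('w \<Rightarrow> 'x \<Rightarrow> real) \<Rightarrow> bool" where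
  "standing P \<theta> Xs E T \<alpha> \<phi> u \<longleftrightarrow>
     ergodic_ip P \<theta> \<and> compact Xs \<and> (\<forall>x\<in>Xs. \<forall>y\<in>Xs. dist x y \<le> 1) \<and>
     E \<in> sets (P \<Otimes>\<^sub>M borel) \<and> E \<subseteq> space P \<times> Xs \<and>
     (\<forall>\<omega>\<in>space P. compact (fib E \<omega>)) \<and>
     (\<forall>\<omega>\<in>space P. \<forall>x\<in>fib E \<omega>. T \<omega> x \<in> fib E (\<theta> \<omega>)) \<and>
     (\<lambda>(\<omega>, x). T \<omega> x) \<in> restrict_space (P \<Otimes>\<^sub>M borel) E \<rightarrow>\<^sub>M borel \<and>
     0 < \<alpha> \<and> \<alpha> \<le> 1 \<and>
     (\<lambda>(\<omega>, x). \<phi> \<omega> x) \<in> borel_measurable (restrict_space (P \<Otimes>\<^sub>M borel) E) \<and>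
     (\<forall>\<omega>\<in>space P. \<exists>B. \<forall>x\<in>fib E \<omega>. \<bar>\<phi> \<omega> x\<bar> \<le> B) \<and>
     (\<lambda>(\<omega>, x). u \<omega> x) \<in> borel_measurable (restrict_space (P \<Otimes>\<^sub>M borel) E) \<and>
     (\<forall>\<omega>\<in>space P. holder \<alpha> (fib E \<omega>) (u \<omega>))"

definition Lop :: "('w \<times> 'x) set \<Rightarrow> ('w \<Rightarrow> 'x \<Rightarrow> 'x) \<Rightarrow> ('w \<Rightarrow> 'x \<Rightarrow> real) \<Rightarrow> 'w
    \<Rightarrow> ('x \<Rightarrow> real) \<Rightarrow> 'x \<Rightarrow> real" where
  "Lop E T \<phi> \<omega> g x = infsum (\<lambda>y. exp (\<phi> \<omega> y) * g y) {y \<in> fib E \<omega>. T \<omega> y = x}"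

fun Lpow :: "('w \<Rightarrow> 'w) \<Rightarrow> ('w \<Rightarrow> ('x \<Rightarrow> real) \<Rightarrow> 'x \<Rightarrow> real) \<Rightarrow> nat \<Rightarrow> 'w
    \<Rightarrow> ('x \<Rightarrow> real) \<Rightarrow> 'x \<Rightarrow> real" where
  "Lpow \<theta> L 0 \<omega> g = g"
| "Lpow \<theta> L (Suc n) \<omega> g = L ((\<theta> ^^ n) \<omega>) (Lpow \<theta> L n \<omega> g)"

fun Tpow :: "('w \<Rightarrow> 'w) \<Rightarrow> ('w \<Rightarrow> 'x \<Rightarrow> 'x) \<Rightarrow> nat \<Rightarrow> 'w \<Rightarrow> 'x \<Rightarrow> 'x" where
  "Tpow \<theta> T 0 \<omega> x = x"
| "Tpow \<theta> T (Suc n) \<omega> x = T ((\<theta> ^^ n) \<omega>) (Tpow \<theta> T n \<omega> x)"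

text \<open>nu is the family of limit (conformal) measures: the P-a.s. defining property of the paper.\<close>
definition nu_limit :: "'w measure \<Rightarrow> ('w \<Rightarrow> 'w) \<Rightarrow> ('w \<times> 'x::metric_space) set
    \<Rightarrow> ('w \<Rightarrow> ('x \<Rightarrow> real) \<Rightarrow> 'x \<Rightarrow> real) \<Rightarrow> real \<Rightarrow> ('w \<Rightarrow> 'x measure) \<Rightarrow> bool" where
  "nu_limit P \<theta> E L \<alpha> \<nu> \<longleftrightarrow>
     (AE \<omega> in P. prob_space (\<nu> \<omega>) \<and> space (\<nu> \<omega>) = fib E \<omega> \<and>
        sets (\<nu> \<omega>) = sets (restrict_space borel (fib E \<omega>)) \<and>
        (\<forall>g. holder \<alpha> (fib E \<omega>) g \<longrightarrow>
           (\<forall>xs. (\<forall>n. xs n \<in> fib E ((\<theta> ^^ n) \<omega>)) \<longrightarrow>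
              (\<lambda>n. Lpow \<theta> L n \<omega> g (xs n) / Lpow \<theta> L n \<omega> (\<lambda>_. 1) (xs n))
                \<longlonglongrightarrow> integral\<^sup>L (\<nu> \<omega>) g)))"

definition lam :: "('w \<Rightarrow> 'w) \<Rightarrow> ('w \<Rightarrow> ('x \<Rightarrow> real) \<Rightarrow> 'x \<Rightarrow> real) \<Rightarrow> ('w \<Rightarrow> 'x measure) \<Rightarrow> 'w \<Rightarrow> real" where
  "lam \<theta> L \<nu> \<omega> = integral\<^sup>L (\<nu> (\<theta> \<omega>)) (L \<omega> (\<lambda>_. 1))"

definition lamprod :: "('w \<Rightarrow> 'w) \<Rightarrow> ('w \<Rightarrow> ('x \<Rightarrow> real) \<Rightarrow> 'x \<Rightarrow> real) \<Rightarrow> ('w \<Rightarrow> 'x measure) \<Rightarrow> 'w \<Rightarrow> nat \<Rightarrow> real" where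
  "lamprod \<theta> L \<nu> \<omega> n = (\<Prod>j<n. lam \<theta> L \<nu> ((\<theta> ^^ j) \<omega>))"

definition hden :: "'w measure \<Rightarrow> ('w \<Rightarrow> 'w) \<Rightarrow> ('w \<Rightarrow> ('x \<Rightarrow> real) \<Rightarrow> 'x \<Rightarrow> real) \<Rightarrow> ('w \<Rightarrow> 'x measure)
    \<Rightarrow> 'w \<Rightarrow> 'x \<Rightarrow> real" where
  "hden P \<theta> L \<nu> \<omega> x = lim (\<lambda>n. Lpow \<theta> L n ((thinv P \<theta> ^^ n) \<omega>) (\<lambda>_. 1) x
                                   / lamprod \<theta> L \<nu> ((thinv P \<theta> ^^ n) \<omega>) n)"

definition gmu :: "'w measure \<Rightarrow> ('w \<Rightarrow> 'w) \<Rightarrow> ('w \<times> 'x) set \<Rightarrow> ('w \<Rightarrow> 'x \<Rightarrow> 'x)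
    \<Rightarrow> ('w \<Rightarrow> 'x \<Rightarrow> real) \<Rightarrow> ('w \<Rightarrow> 'x measure) \<Rightarrow> 'w \<Rightarrow> 'x measure" where
  "gmu P \<theta> E T \<phi> \<nu> \<omega> = density (\<nu> \<omega>) (\<lambda>x. ennreal (hden P \<theta> (Lop E T \<phi>) \<nu> \<omega> x))"

definition cent :: "('w \<Rightarrow> 'x measure) \<Rightarrow> ('w \<Rightarrow> 'x \<Rightarrow> real) \<Rightarrow> 'w \<Rightarrow> 'x \<Rightarrow> real" where
  "cent \<mu> u \<omega> x = u \<omega> x - integral\<^sup>L (\<mu> \<omega>) (u \<omega>)"

definition bsum :: "('w \<Rightarrow> 'w) \<Rightarrow> ('w \<Rightarrow> 'x \<Rightarrow> 'x) \<Rightarrow> ('w \<Rightarrow> 'x \<Rightarrow> real) \<Rightarrow> nat \<Rightarrow> 'w \<Rightarrow> 'x \<Rightarrow> real" where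
  "bsum \<theta> T f n \<omega> x = (\<Sum>j<n. f ((\<theta> ^^ j) \<omega>) (Tpow \<theta> T j \<omega> x))"

definition mvar :: "'x measure \<Rightarrow> ('x \<Rightarrow> real) \<Rightarrow> real" where
  "mvar M f = integral\<^sup>L M (\<lambda>x. (f x - integral\<^sup>L M f)\<^sup>2)"

definition settingA :: "'w measure \<Rightarrow> ('w \<Rightarrow> 'w) \<Rightarrow> ('w \<times> 'x::metric_space) set \<Rightarrow> ('w \<Rightarrow> 'x \<Rightarrow> 'x)
    \<Rightarrow> real \<Rightarrow> ('w \<Rightarrow> 'x \<Rightarrow> real) \<Rightarrow> ('w \<Rightarrow> real) \<Rightarrow> ('w \<Rightarrow> real) \<Rightarrow> ('w \<Rightarrow> real)
    \<Rightarrow> ('w \<Rightarrow> nat set) \<Rightarrow> ('w \<Rightarrow> nat \<Rightarrow> 'x \<Rightarrow> 'x) \<Rightarrow> bool" where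
  "settingA P \<theta> E T \<alpha> \<phi> \<gamma> H Dd I y \<longleftrightarrow>
     \<gamma> \<in> borel_measurable P \<and> H \<in> borel_measurable P \<and> Dd \<in> borel_measurable P \<and>
     (\<forall>\<omega>\<in>space P. 1 < \<gamma> \<omega> \<and> 0 \<le> H \<omega>) \<and>
     (AE \<omega> in P.
        (\<forall>x\<in>fib E (\<theta> \<omega>). bij_betw (\<lambda>i. y \<omega> i x) (I \<omega>) {z \<in> fib E \<omega>. T \<omega> z = x}) \<and>
        (\<forall>x\<in>fib E (\<theta> \<omega>). \<forall>x'\<in>fib E (\<theta> \<omega>). \<forall>i\<in>I \<omega>.
            dist (y \<omega> i x) (y \<omega> i x') \<le> dist x x' / \<gamma> \<omega> \<and>
            \<bar>\<phi> \<omega> (y \<omega> i x) - \<phi> \<omega> (y \<omega> i x')\<bar> \<le> H \<omega> * dist x x' powr \<alpha>) \<and>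
        H \<omega> \<le> \<gamma> (\<theta> \<omega>) powr \<alpha> - 1 \<and>
        (\<forall>x\<in>fib E (\<theta> \<omega>). (\<lambda>z. exp (\<phi> \<omega> z)) summable_on {z \<in> fib E \<omega>. T \<omega> z = x} \<and>
            infsum (\<lambda>z. exp (\<phi> \<omega> z)) {z \<in> fib E \<omega>. T \<omega> z = x} \<le> Dd \<omega>))"

definition HtA :: "('w \<times> 'x::metric_space) set \<Rightarrow> real \<Rightarrow> ('w \<Rightarrow> real) \<Rightarrow> ('w \<Rightarrow> real)
    \<Rightarrow> ('w \<Rightarrow> 'x \<Rightarrow> real) \<Rightarrow> 'w \<Rightarrow> real" where
  "HtA E \<alpha> \<gamma> H u \<omega> = \<gamma> \<omega> powr (-\<alpha>) * hv \<alpha> (fib E \<omega>) (u \<omega>) + H \<omega>"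

text \<open>E_omega in Setting A (value infinity when q(omega) = 1 or the denominator of c_0 vanishes).\<close>
definition EA :: "('w \<Rightarrow> 'w) \<Rightarrow> ('w \<times> 'x::metric_space) set \<Rightarrow> real \<Rightarrow> ('w \<Rightarrow> real) \<Rightarrow> ('w \<Rightarrow> real)
    \<Rightarrow> ('w \<Rightarrow> 'x measure) \<Rightarrow> ('w \<Rightarrow> 'x \<Rightarrow> real) \<Rightarrow> 'w \<Rightarrow> ereal" where
  "EA \<theta> E \<alpha> \<gamma> H \<mu> u \<omega> =
     (let Ht = HtA E \<alpha> \<gamma> H u \<omega>;
          g = \<gamma> (\<theta> \<omega>) powr \<alpha>;
          q = (H \<omega> + 1) * \<gamma> (\<theta> \<omega>) powr (-\<alpha>);
          D = g + 2 * ln ((1 + q) / (1 - q));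
          c0 = 3 * supabs (fib E \<omega>) (cent \<mu> u \<omega>) + Ht / (g - 1 - Ht)
      in if q < 1 \<and> Ht < g - 1 then ereal (c0 * (1 + cosh (7 * D / 2))) else \<infinity>)"

definition KA :: "real \<Rightarrow> ('w \<Rightarrow> real) \<Rightarrow> 'w \<Rightarrow> real" where
  "KA \<alpha> \<gamma> \<omega> = (1 + \<gamma> \<omega> powr \<alpha>) * exp (\<gamma> \<omega> powr \<alpha>)"

definition MA :: "real \<Rightarrow> ('w \<Rightarrow> real) \<Rightarrow> 'w \<Rightarrow> real" where
  "MA \<alpha> \<gamma> \<omega> = 8 / (1 - exp (- (\<gamma> \<omega> powr \<alpha>)))\<^sup>2"

definition DbarA :: "('w \<times> 'x::metric_space) set \<Rightarrow> real \<Rightarrow> ('w \<Rightarrow> real) \<Rightarrow> ('w \<Rightarrow> real) \<Rightarrow> ('w \<Rightarrow> real)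
    \<Rightarrow> ('w \<Rightarrow> 'x measure) \<Rightarrow> ('w \<Rightarrow> 'x \<Rightarrow> real) \<Rightarrow> 'w \<Rightarrow> real" where
  "DbarA E \<alpha> \<gamma> H Dd \<mu> u \<omega> = 16 * exp (supabs (fib E \<omega>) (cent \<mu> u \<omega>))
      * (1 + hv \<alpha> (fib E \<omega>) (u \<omega>)) * (1 + HtA E \<alpha> \<gamma> H u \<omega>) * Dd \<omega>"

definition aB :: "real \<Rightarrow> ('w \<Rightarrow> real) \<Rightarrow> ('w \<Rightarrow> real) \<Rightarrow> ('w \<Rightarrow> nat) \<Rightarrow> ('w \<Rightarrow> nat) \<Rightarrow> 'w \<Rightarrow> real" where
  "aB \<alpha> l sg q dd \<omega> = (real (q \<omega>) * l \<omega> powr \<alpha> + (real (dd \<omega>) - real (q \<omega>)) * sg \<omega> powr (-\<alpha>))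
                          / real (dd \<omega>)"

definition epsB :: "('w \<times> 'x) set \<Rightarrow> ('w \<Rightarrow> 'x \<Rightarrow> real) \<Rightarrow> 'w \<Rightarrow> real" where
  "epsB E \<phi> \<omega> = supf (fib E \<omega>) (\<phi> \<omega>) - inff (fib E \<omega>) (\<phi> \<omega>)"

definition sB :: "('w \<times> 'x) set \<Rightarrow> ('w \<Rightarrow> 'x \<Rightarrow> real) \<Rightarrow> real \<Rightarrow> ('w \<Rightarrow> real) \<Rightarrow> ('w \<Rightarrow> real)
    \<Rightarrow> ('w \<Rightarrow> nat) \<Rightarrow> ('w \<Rightarrow> nat) \<Rightarrow> 'w \<Rightarrow> real" where
  "sB E \<phi> \<alpha> l sg q dd \<omega> = exp (epsB E \<phi> \<omega>) * aB \<alpha> l sg q dd \<omega>"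

definition HB :: "('w \<Rightarrow> 'w) \<Rightarrow> ('w \<times> 'x::metric_space) set \<Rightarrow> ('w \<Rightarrow> 'x \<Rightarrow> real) \<Rightarrow> real
    \<Rightarrow> ('w \<Rightarrow> nat) \<Rightarrow> ('w \<Rightarrow> nat \<Rightarrow> 'x \<Rightarrow> 'x) \<Rightarrow> 'w \<Rightarrow> real" where
  "HB \<theta> E \<phi> \<alpha> dd y \<omega> = Max ((\<lambda>i. hv \<alpha> (fib E (\<theta> \<omega>)) (\<lambda>x. \<phi> \<omega> (y \<omega> i x))) ` {1..dd \<omega>})"

definition settingB :: "'w measure \<Rightarrow> ('w \<Rightarrow> 'w) \<Rightarrow> ('w \<times> 'x::metric_space) set \<Rightarrow> ('w \<Rightarrow> 'x \<Rightarrow> 'x)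
    \<Rightarrow> real \<Rightarrow> ('w \<Rightarrow> 'x \<Rightarrow> real) \<Rightarrow> ('w \<Rightarrow> real) \<Rightarrow> ('w \<Rightarrow> real) \<Rightarrow> ('w \<Rightarrow> nat)
    \<Rightarrow> ('w \<Rightarrow> nat) \<Rightarrow> ('w \<Rightarrow> nat \<Rightarrow> 'x \<Rightarrow> 'x) \<Rightarrow> bool" where
  "settingB P \<theta> E T \<alpha> \<phi> l sg q dd y \<longleftrightarrow>
     l \<in> borel_measurable P \<and> sg \<in> borel_measurable P \<and>
     q \<in> P \<rightarrow>\<^sub>M count_space UNIV \<and> dd \<in> P \<rightarrow>\<^sub>M count_space UNIV \<and>
     (\<forall>\<omega>\<in>space P. 1 \<le> l \<omega> \<and> 1 < sg \<omega> \<and> 0 < q \<omega> \<and> q \<omega> < dd \<omega>) \<and>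
     (AE \<omega> in P.
        (\<forall>x\<in>fib E (\<theta> \<omega>). bij_betw (\<lambda>i. y \<omega> i x) {1..dd \<omega>} {z \<in> fib E \<omega>. T \<omega> z = x}) \<and>
        (\<forall>x\<in>fib E (\<theta> \<omega>). \<forall>x'\<in>fib E (\<theta> \<omega>).
            (\<forall>i\<in>{1..q \<omega>}. dist (y \<omega> i x) (y \<omega> i x') \<le> l \<omega> * dist x x') \<and>
            (\<forall>i\<in>{q \<omega><..dd \<omega>}. dist (y \<omega> i x) (y \<omega> i x') \<le> dist x x' / sg \<omega>)) \<and>
        (\<forall>i\<in>{1..dd \<omega>}. holder \<alpha> (fib E (\<theta> \<omega>)) (\<lambda>x. \<phi> \<omega> (y \<omega> i x))) \<and>
        sB E \<phi> \<alpha> l sg q dd \<omega> < 1 \<and>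
        exp (epsB E \<phi> \<omega>) * HB \<theta> E \<phi> \<alpha> dd y \<omega>
          \<le> (1 / sB E \<phi> \<alpha> l sg q dd (\<theta> \<omega>) - 1) / (1 + 1 / sB E \<phi> \<alpha> l sg q dd \<omega>))"

definition zetaB :: "('w \<Rightarrow> 'w) \<Rightarrow> ('w \<times> 'x::metric_space) set \<Rightarrow> ('w \<Rightarrow> 'x \<Rightarrow> real) \<Rightarrow> real
    \<Rightarrow> ('w \<Rightarrow> real) \<Rightarrow> ('w \<Rightarrow> real) \<Rightarrow> ('w \<Rightarrow> nat) \<Rightarrow> ('w \<Rightarrow> nat) \<Rightarrow> ('w \<Rightarrow> nat \<Rightarrow> 'x \<Rightarrow> 'x)
    \<Rightarrow> 'w \<Rightarrow> real" where
  "zetaB \<theta> E \<phi> \<alpha> l sg q dd y \<omega> =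
     sB E \<phi> \<alpha> l sg q dd (\<theta> \<omega>) *
       (1 + (1 + 1 / sB E \<phi> \<alpha> l sg q dd \<omega>) * exp (epsB E \<phi> \<omega>) * HB \<theta> E \<phi> \<alpha> dd y \<omega>)"

text \<open>E_omega in Setting B (value infinity when zeta_omega = 1).\<close>
definition EB :: "('w \<Rightarrow> 'w) \<Rightarrow> ('w \<times> 'x::metric_space) set \<Rightarrow> ('w \<Rightarrow> 'x \<Rightarrow> real) \<Rightarrow> real
    \<Rightarrow> ('w \<Rightarrow> real) \<Rightarrow> ('w \<Rightarrow> real) \<Rightarrow> ('w \<Rightarrow> nat) \<Rightarrow> ('w \<Rightarrow> nat) \<Rightarrow> ('w \<Rightarrow> nat \<Rightarrow> 'x \<Rightarrow> 'x)
    \<Rightarrow> ('w \<Rightarrow> 'x measure) \<Rightarrow> ('w \<Rightarrow> 'x \<Rightarrow> real) \<Rightarrow> 'w \<Rightarrow> ereal" where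
  "EB \<theta> E \<phi> \<alpha> l sg q dd y \<mu> u \<omega> =
     (let z = zetaB \<theta> E \<phi> \<alpha> l sg q dd y \<omega>;
          s = sB E \<phi> \<alpha> l sg q dd \<omega>;
          s1 = sB E \<phi> \<alpha> l sg q dd (\<theta> \<omega>);
          H = HB \<theta> E \<phi> \<alpha> dd y \<omega>;
          ut = cent \<mu> u \<omega>;
          D = 2 * ln ((1 + z) / (1 - z)) + 2 * ln (1 + z / s);
          c0 = 32 * s1 * (1 + 2 / s) * exp (supabs (fib E \<omega>) ut + 2 * supabs (fib E \<omega>) (\<phi> \<omega>))
               * (supabs (fib E \<omega>) ut + hv \<alpha> (fib E \<omega>) ut) * (1 + H) / (1 - z)
      in if z < 1 then ereal (c0 * (1 + cosh (7 * D / 2))) else \<infinity>)"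

definition KB :: "('w \<times> 'x) set \<Rightarrow> ('w \<Rightarrow> 'x \<Rightarrow> real) \<Rightarrow> real \<Rightarrow> ('w \<Rightarrow> real) \<Rightarrow> ('w \<Rightarrow> real)
    \<Rightarrow> ('w \<Rightarrow> nat) \<Rightarrow> ('w \<Rightarrow> nat) \<Rightarrow> 'w \<Rightarrow> real" where
  "KB E \<phi> \<alpha> l sg q dd \<omega> = 1 + 2 / sB E \<phi> \<alpha> l sg q dd \<omega>"

definition MB :: "('w \<times> 'x) set \<Rightarrow> ('w \<Rightarrow> 'x \<Rightarrow> real) \<Rightarrow> real \<Rightarrow> ('w \<Rightarrow> real) \<Rightarrow> ('w \<Rightarrow> real)
    \<Rightarrow> ('w \<Rightarrow> nat) \<Rightarrow> ('w \<Rightarrow> nat) \<Rightarrow> 'w \<Rightarrow> real" where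
  "MB E \<phi> \<alpha> l sg q dd \<omega> = 6 / sB E \<phi> \<alpha> l sg q dd \<omega>"

definition DbarB :: "('w \<Rightarrow> 'w) \<Rightarrow> ('w \<times> 'x::metric_space) set \<Rightarrow> ('w \<Rightarrow> 'x \<Rightarrow> real) \<Rightarrow> real
    \<Rightarrow> ('w \<Rightarrow> nat) \<Rightarrow> ('w \<Rightarrow> nat \<Rightarrow> 'x \<Rightarrow> 'x)
    \<Rightarrow> ('w \<Rightarrow> 'x measure) \<Rightarrow> ('w \<Rightarrow> 'x \<Rightarrow> real) \<Rightarrow> 'w \<Rightarrow> real" where
  "DbarB \<theta> E \<phi> \<alpha> dd y \<mu> u \<omega> = 16 * exp (supabs (fib E \<omega>) (cent \<mu> u \<omega>))
      * (1 + hv \<alpha> (fib E \<omega>) (u \<omega>)) * (1 + HB \<theta> E \<phi> \<alpha> dd y \<omega>)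
      * (real (dd \<omega>) * exp (supabs (fib E \<omega>) (\<phi> \<omega>)))"

definition eln :: "real \<Rightarrow> ereal" where
  "eln x = (if 0 < x then ereal (ln x) else -\<infinity>)"

definition mdq :: "('w \<Rightarrow> 'w) \<Rightarrow> ('w \<times> 'x) set \<Rightarrow> ('w \<Rightarrow> 'x \<Rightarrow> 'x) \<Rightarrow> ('w \<Rightarrow> 'x measure)
    \<Rightarrow> ('w \<Rightarrow> 'x \<Rightarrow> real) \<Rightarrow> (nat \<Rightarrow> real) \<Rightarrow> 'w \<Rightarrow> real set \<Rightarrow> nat \<Rightarrow> ereal" where
  "mdq \<theta> E T \<mu> u a \<omega> \<Gamma> n =
     ereal (real n / (a n)\<^sup>2) *
       eln (measure (\<mu> \<omega>) {x \<in> fib E \<omega>. bsum \<theta> T (cent \<mu> u) n \<omega> x / a n \<in> \<Gamma>})"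

end

theory Submission
  imports Defs
begin

text \<open>Along an orbit the transfer operators act on cones, and in the order of these cones the
  normalised operator contracts mean-zero functions by \<open>1 - \<kappa>\<close>. The bound on \<open>E\<close> says that
  multiplication by the centred observable costs at most a constant times \<open>\<kappa>\<close> (in Setting B also a
  power \<open>K\<^sup>2\<close>), so correlations are summed by the telescoping estimate
  \<open>\<Sum> \<kappa>\<^sub>j \<Prod> (1 - \<kappa>\<^sub>i) \<le> 1\<close> rather than by an exponential rate. Expanding the normalised densities of the
  real tilts \<open>exp (t S\<^sub>n)\<close> to second order in \<open>t\<close> gives
  \<open>ln \<mu>(exp (t S\<^sub>n)) = t\<^sup>2 Var(S\<^sub>n) / 2 + O(n \<bar>t\<bar>\<^sup>3 A\<^sub>n\<^sup>3)\<close> with \<open>A\<^sub>n\<^sup>3 = O(n\<^bsup>8/p\<^esup>)\<close>, and the quadratic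
  limit of the logarithmic moment generating function yields the principle by exponential tilting.
  Ergodicity is replaced by Poincare recurrence, which makes the backward products of \<open>1 - \<kappa>\<close> vanish.\<close>

section \<open>Large deviations from a quadratic logarithmic moment generating function\<close>

text \<open>The obstacle is that \<open>\<kappa>\<close> has no positive lower bound in \<omega>, so
  perturbing an operator with a uniform spectral gap is not possible. Sizes are therefore measured
  by the cone order with the invariant density \<open>h\<close> of the same fibre as unit. The
  operators map unit to unit, so the factor \<open>1 - \<kappa>\<close> comes without constants that
  compare fibres. With \<epsilon> = |t| A, one step along the orbit loses a fraction
  \<open>\<kappa>\<close> of an error C \<epsilon> and adds at most C' \<epsilon> \<kappa>, with the
  same \<open>\<kappa>\<close>. Since (1 - \<kappa>) C \<epsilon> + C' \<epsilon> \<kappa> \<le> C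
  \<epsilon> for C \<ge> C', errors reproduce themselves for any number of steps, however small
  \<open>\<kappa>\<close> is. The exponent 8/p arises as follows. An L^p function K grows along
  almost every orbit at most like j^(4/(3p)), where 4/3 > 1 gives summability. Thus A, of order K^2,
  is at most of order n^(8/(3p)), and its cube of order n^(8/p). For t of order a_n / n the error
  relative to the main term n t^2 is |t| A^3, which vanishes when a_n = o(n^(1 - 8/p)).\<close>

lemma eventually_exp_le_of_log_limit:
  fixes r m :: "nat \<Rightarrow> real"
  assumes r: "filterlim r at_top sequentially" and pos: "\<And>n. 0 < m n"
    and lim: "(\<lambda>n. ln (m n) / r n) \<longlonglongrightarrow> l" and "l < c"
  shows "\<forall>\<^sub>F n in sequentially. m n \<le> exp (r n * c)"
proof -
  have "\<forall>\<^sub>F n in sequentially. ln (m n) / r n < c"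
    using lim \<open>l < c\<close> by (rule order_tendstoD)
  moreover have "\<forall>\<^sub>F n in sequentially. 0 < r n"
    using r by (auto simp: filterlim_at_top_dense)
  ultimately show ?thesis
  proof eventually_elim
    case (elim n)
    then have "ln (m n) < r n * c" by (simp add: field_simps)
    then show ?case using pos[of n] by (metis exp_le_cancel_iff exp_ln less_imp_le)
  qed
qed

lemma eventually_exp_ge_of_log_limit:
  fixes r m :: "nat \<Rightarrow> real"
  assumes r: "filterlim r at_top sequentially" and pos: "\<And>n. 0 < m n"
    and lim: "(\<lambda>n. ln (m n) / r n) \<longlonglongrightarrow> l" and "c < l"
  shows "\<forall>\<^sub>F n in sequentially. exp (r n * c) \<le> m n"
proof -
  have "\<forall>\<^sub>F n in sequentially. c < ln (m n) / r n"
    using lim \<open>c < l\<close> by (rule order_tendstoD)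
  moreover have "\<forall>\<^sub>F n in sequentially. 0 < r n"
    using r by (auto simp: filterlim_at_top_dense)
  ultimately show ?thesis
  proof eventually_elim
    case (elim n)
    then have "r n * c < ln (m n)" by (simp add: field_simps)
    then show ?case using pos[of n] by (metis exp_le_cancel_iff exp_ln less_imp_le)
  qed
qed

lemma eln_mono: "x \<le> y \<Longrightarrow> eln x \<le> eln y"
  by (auto simp: eln_def)

lemma eln_scaled_le:
  assumes "0 < r" "m \<le> exp (r * c)"
  shows "ereal (1 / r) * eln m \<le> ereal c"
proof -
  have "eln m \<le> ereal (r * c)"
    using eln_mono[OF assms(2)] by (simp add: eln_def)
  then have "ereal (1 / r) * eln m \<le> ereal (1 / r) * ereal (r * c)"
    using assms(1) by (intro ereal_mult_left_mono) auto
  then show ?thesis using assms(1) by simp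
qed

lemma eln_scaled_ge:
  assumes "0 < r" "exp (r * c) \<le> m"
  shows "ereal c \<le> ereal (1 / r) * eln m"
proof -
  have "ereal (r * c) \<le> eln m"
    using eln_mono[OF assms(2)] by (simp add: eln_def)
  then have "ereal (1 / r) * ereal (r * c) \<le> ereal (1 / r) * eln m"
    using assms(1) by (intro ereal_mult_left_mono) auto
  then show ?thesis using assms(1) by simp
qed

text \<open>These are the hypotheses of the Gaertner-Ellis theorem for a quadratic limit, with
  \<open>t\<close> ranging over all reals. The measure \<open>M\<close> does not vary with
  \<open>n\<close>: for a given \<omega> a single Gibbs measure carries all Birkhoff sums.\<close>

locale quadratic_log_mgf = prob_space M for M :: "'x measure" +
  fixes Y :: "nat \<Rightarrow> 'x \<Rightarrow> real" and r :: "nat \<Rightarrow> real" and \<sigma> :: real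
  assumes Y_measurable [measurable]: "Y n \<in> borel_measurable M"
    and exp_integrable: "integrable M (\<lambda>x. exp (t * r n * Y n x))"
    and speed: "filterlim r at_top sequentially"
    and sigma_pos: "0 < \<sigma>"
    and log_mgf: "(\<lambda>n. ln (\<integral>x. exp (t * r n * Y n x) \<partial>M) / r n) \<longlonglongrightarrow> t\<^sup>2 * \<sigma>\<^sup>2 / 2"
begin

definition mgf :: "nat \<Rightarrow> real \<Rightarrow> real" where
  "mgf n t = (\<integral>x. exp (t * r n * Y n x) \<partial>M)"

lemma mgf_pos: "0 < mgf n t"
proof -
  have "mgf n t \<noteq> 0"
    unfolding mgf_def
    by (subst integral_nonneg_eq_0_iff_AE[OF exp_integrable]) simp_all
  moreover have "0 \<le> mgf n t" unfolding mgf_def by simp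
  ultimately show ?thesis by simp
qed

lemma log_mgf': "(\<lambda>n. ln (mgf n t) / r n) \<longlonglongrightarrow> t\<^sup>2 * \<sigma>\<^sup>2 / 2"
  using log_mgf by (simp add: mgf_def)

lemma speed_pos: "\<forall>\<^sub>F n in sequentially. 0 < r n"
  using speed by (auto simp: filterlim_at_top_dense)

text \<open>Exponential Chebyshev inequality: the indicator of the tail is dominated by
  \<open>exp (t * r n * (Y n x - b))\<close>.\<close>

lemma prob_ge_le_mgf:
  assumes "0 \<le> t * r n"
  shows "prob {x \<in> space M. b \<le> Y n x} \<le> exp (- (t * r n * b)) * mgf n t"
proof -
  have "prob {x \<in> space M. b \<le> Y n x} = (\<integral>x. indicator {x \<in> space M. b \<le> Y n x} x \<partial>M)"
    by simp
  also have "\<dots> \<le> (\<integral>x. exp (- (t * r n * b)) * exp (t * r n * Y n x) \<partial>M)"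
  proof (intro integral_mono)
    show "integrable M (\<lambda>x. exp (- (t * r n * b)) * exp (t * r n * Y n x))"
      using exp_integrable by simp
    show "indicator {x \<in> space M. b \<le> Y n x} x \<le> exp (- (t * r n * b)) * exp (t * r n * Y n x)" for x
    proof (cases "b \<le> Y n x")
      case True
      then have "0 \<le> - (t * r n * b) + t * r n * Y n x"
        using mult_left_mono[OF True assms] by simp
      then have "1 \<le> exp (- (t * r n * b) + t * r n * Y n x)" by simp
      then show ?thesis by (auto simp: exp_add[symmetric] indicator_def)
    qed (auto simp: indicator_def)
  qed (simp add: integrable_indicator_iff emeasure_eq_measure)
  finally show ?thesis by (simp add: mgf_def)
qed

lemma upper_tail:
  assumes "0 < b" "c < b\<^sup>2 / (2 * \<sigma>\<^sup>2)"
  shows "\<forall>\<^sub>F n in sequentially. prob {x \<in> space M. b \<le> Y n x} \<le> exp (r n * (- c))"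
proof -
  \<comment> \<open>The maximiser of t b - t^2 \<sigma>^2 / 2; the maximum is b^2 / (2
    \<sigma>^2).\<close>
  let ?t = "b / \<sigma>\<^sup>2"
  have eq: "?t\<^sup>2 * \<sigma>\<^sup>2 / 2 = ?t * b - b\<^sup>2 / (2 * \<sigma>\<^sup>2)"
    using sigma_pos by (simp add: field_simps power2_eq_square)
  have "\<forall>\<^sub>F n in sequentially. mgf n ?t \<le> exp (r n * (?t * b - c))"
    by (rule eventually_exp_le_of_log_limit[OF speed mgf_pos log_mgf']) (use assms eq in auto)
  then show ?thesis using speed_pos
  proof eventually_elim
    case (elim n)
    have "prob {x \<in> space M. b \<le> Y n x} \<le> exp (- (?t * r n * b)) * mgf n ?t"
      by (rule prob_ge_le_mgf) (use elim assms in auto)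
    also have "\<dots> \<le> exp (- (?t * r n * b)) * exp (r n * (?t * b - c))"
      using elim by simp
    also have "\<dots> = exp (r n * (- c))"
      by (simp add: exp_add[symmetric] algebra_simps)
    finally show ?case .
  qed
qed

text \<open>The limit is even in \<open>t\<close>, so the hypotheses survive a change of sign, and
  lower tails become upper tails.\<close>

lemma reflect: "quadratic_log_mgf M (\<lambda>n x. - Y n x) r \<sigma>"
proof
  fix t n
  show "integrable M (\<lambda>x. exp (t * r n * - Y n x))"
    using exp_integrable[of "-t" n] by simp
  show "(\<lambda>n. ln (\<integral>x. exp (t * r n * - Y n x) \<partial>M) / r n) \<longlonglongrightarrow> t\<^sup>2 * \<sigma>\<^sup>2 / 2"
    using log_mgf[of "-t"] by simp
qed (use speed sigma_pos in auto)

lemma two_sided_tail: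
  assumes "0 < b" "c < b\<^sup>2 / (2 * \<sigma>\<^sup>2)"
  shows "\<forall>\<^sub>F n in sequentially. prob {x \<in> space M. b \<le> \<bar>Y n x\<bar>} \<le> exp (r n * (- c))"
proof -
  interpret R: quadratic_log_mgf M "\<lambda>n x. - Y n x" r \<sigma> by (rule reflect)
  \<comment> \<open>The room between \<open>c\<close> and \<open>c'\<close> absorbs the factor 2 of
    the union bound once \<open>r n\<close> is large.\<close>
  obtain c' where c': "c < c'" "c' < b\<^sup>2 / (2 * \<sigma>\<^sup>2)" using assms dense by blast
  have "\<forall>\<^sub>F n in sequentially. ln 2 / (c' - c) < r n"
    using speed by (auto simp: filterlim_at_top_dense)
  with upper_tail[OF assms(1) c'(2)] R.upper_tail[OF assms(1) c'(2)] show ?thesis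
  proof eventually_elim
    case (elim n)
    have "prob {x \<in> space M. b \<le> \<bar>Y n x\<bar>} \<le>
        prob ({x \<in> space M. b \<le> Y n x} \<union> {x \<in> space M. b \<le> - Y n x})"
      by (intro finite_measure_mono) auto
    also have "\<dots> \<le> prob {x \<in> space M. b \<le> Y n x} + prob {x \<in> space M. b \<le> - Y n x}"
      by (intro measure_Un_le) auto
    also have "\<dots> \<le> exp (ln 2 + r n * (- c'))"
      using elim unfolding exp_add by simp
    also have "\<dots> \<le> exp (r n * (- c))"
      using elim c' by (simp add: field_simps)
    finally show ?case .
  qed
qed

text \<open>The rate increases with |x|. A number c > 0 below its infimum over the closure forces
  |x| \<ge> sqrt (2 \<sigma>^2 c) on \<Gamma>, so the two-sided tail at this radius already gives
  the bound and no covering of compact sets is required.\<close>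

lemma ldp_upper:
  assumes "\<Gamma> \<in> sets borel"
  shows "limsup (\<lambda>n. ereal (1 / r n) * eln (prob {x \<in> space M. Y n x \<in> \<Gamma>}))
    \<le> - (INF x\<in>closure \<Gamma>. ereal (x\<^sup>2 / (2 * \<sigma>\<^sup>2)))" (is "limsup ?q \<le> - ?I")
proof -
  have meas: "{x \<in> space M. Y n x \<in> \<Gamma>} \<in> sets M" for n
    using assms by measurable
  have nonpos: "limsup ?q \<le> 0"
  proof (rule Limsup_bounded)
    show "\<forall>\<^sub>F n in sequentially. ?q n \<le> 0"
      using speed_pos
    proof eventually_elim
      case (elim n)
      show ?case using eln_scaled_le[OF elim, of "prob {x \<in> space M. Y n x \<in> \<Gamma>}" 0] 
        by (simp add: zero_ereal_def)
    qed
  qed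
  have key: "limsup ?q \<le> ereal (- c)" if c: "ereal c < ?I" for c
  proof (cases "c \<le> 0")
    case True
    then show ?thesis by (intro order_trans[OF nonpos]) simp
  next
    case False
    \<comment> \<open>The tail estimate asks for a strict inequality; it is applied below
      \<open>c\<close> and the limit is taken afterwards.\<close>
    have *: "limsup ?q \<le> ereal (- d)" if d: "0 < d" "d < c" for d
    proof (rule Limsup_bounded)
      define b where "b = sqrt (2 * \<sigma>\<^sup>2 * c)"
      have b: "0 < b" "b\<^sup>2 / (2 * \<sigma>\<^sup>2) = c"
        using False sigma_pos by (auto simp: b_def)
      have sub: "b \<le> \<bar>x\<bar>" if "x \<in> \<Gamma>" for x
      proof -
        have "ereal c < ereal (x\<^sup>2 / (2 * \<sigma>\<^sup>2))"
          using c INF_lower[of x "closure \<Gamma>" "\<lambda>x. ereal (x\<^sup>2 / (2 * \<sigma>\<^sup>2))"] that closure_subset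
          by (meson less_le_trans subsetD)
        then have "b\<^sup>2 / (2 * \<sigma>\<^sup>2) \<le> x\<^sup>2 / (2 * \<sigma>\<^sup>2)" using b by simp
        then have "b\<^sup>2 \<le> x\<^sup>2" using sigma_pos by (simp add: divide_le_cancel)
        then show ?thesis using abs_le_square_iff[of b x] b by simp
      qed
      have "\<forall>\<^sub>F n in sequentially. prob {x \<in> space M. b \<le> \<bar>Y n x\<bar>} \<le> exp (r n * (- d))"
        using d b by (intro two_sided_tail) auto
      then show "\<forall>\<^sub>F n in sequentially. ?q n \<le> ereal (- d)"
        using speed_pos
      proof eventually_elim
        case (elim n)
        have "prob {x \<in> space M. Y n x \<in> \<Gamma>} \<le> prob {x \<in> space M. b \<le> \<bar>Y n x\<bar>}"
          using sub by (intro finite_measure_mono) auto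
        also have "\<dots> \<le> exp (r n * (- d))" using elim by simp
        finally show ?case by (intro eln_scaled_le) (use elim in auto)
      qed
    qed
    show ?thesis
    proof (rule ereal_le_epsilon2)
      fix e :: real assume "0 < e"
      \<comment> \<open>Within \<open>e\<close> of \<open>c\<close>, yet positive and strictly below
        \<open>c\<close>.\<close>
      define d where "d = max (c - e) (c / 2)"
      have "limsup ?q \<le> ereal (- d)" by (rule *) (use False \<open>0 < e\<close> in \<open>auto simp: d_def\<close>)
      also have "\<dots> \<le> ereal (- c) + ereal e" by (auto simp: d_def)
      finally show "limsup ?q \<le> ereal (- c) + ereal e" .
    qed
  qed
  \<comment> \<open>The infimum is infinite when the closure is empty, hence the passage through
    real numbers below it.\<close>
  have "?I \<le> - limsup ?q"
  proof (rule dense_le)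
    fix z assume "z < ?I"
    then obtain c where "z < ereal c" "ereal c < ?I" using ereal_dense2 by blast
    then have "ereal c \<le> - limsup ?q" using key[of c] by (subst ereal_minus_le_minus[symmetric]) simp
    then show "z \<le> - limsup ?q" using \<open>z < ereal c\<close> by order
  qed
  then show ?thesis by (subst ereal_minus_le_minus[symmetric]) simp
qed

text \<open>\<open>mgf n (t + s) / mgf n t\<close> is the moment generating function at
  \<open>s\<close> of the law tilted by \<open>t\<close>, which concentrates at t \<sigma>^2. The
  bound is Chernoff's inequality for that law at distance \<open>d\<close> from this centre, and the
  sign of \<open>s\<close> selects the side. The factor 1/4 leaves half of the mass after both sides
  are removed.\<close>

lemma tilted_ratio_small:
  assumes "0 < d" "s\<^sup>2 * \<sigma>\<^sup>2 / 2 + \<bar>s\<bar> * (-d) < 0"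
  shows "\<forall>\<^sub>F n in sequentially.
    exp (- (r n * (s * (t * \<sigma>\<^sup>2) + \<bar>s\<bar> * d))) * mgf n (t + s) \<le> mgf n t / 4"
proof -
  \<comment> \<open>The exponential gap is 4 \<eta>: one \<eta> pays for each of the two
    approximations of \<open>mgf\<close>, and 2 \<eta> remain to beat ln 4.\<close>
  define \<eta> where "\<eta> = (\<bar>s\<bar> * d - s\<^sup>2 * \<sigma>\<^sup>2 / 2) / 4"
  have \<eta>: "0 < \<eta>" using assms by (simp add: \<eta>_def)
  have "\<forall>\<^sub>F n in sequentially. mgf n (t + s) \<le> exp (r n * ((t + s)\<^sup>2 * \<sigma>\<^sup>2 / 2 + \<eta>))"
    by (rule eventually_exp_le_of_log_limit[OF speed mgf_pos log_mgf']) (use \<eta> in auto)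
  moreover have "\<forall>\<^sub>F n in sequentially. exp (r n * (t\<^sup>2 * \<sigma>\<^sup>2 / 2 - \<eta>)) \<le> mgf n t"
    by (rule eventually_exp_ge_of_log_limit[OF speed mgf_pos log_mgf']) (use \<eta> in auto)
  moreover have "\<forall>\<^sub>F n in sequentially. ln 4 / (2 * \<eta>) < r n"
    using speed by (auto simp: filterlim_at_top_dense)
  ultimately show ?thesis
  proof eventually_elim
    case (elim n)
    have "exp (- (r n * (s * (t * \<sigma>\<^sup>2) + \<bar>s\<bar> * d))) * mgf n (t + s)
        \<le> exp (- (r n * (s * (t * \<sigma>\<^sup>2) + \<bar>s\<bar> * d))) * exp (r n * ((t + s)\<^sup>2 * \<sigma>\<^sup>2 / 2 + \<eta>))"
      using elim by simp
    also have "\<dots> = exp (r n * (t\<^sup>2 * \<sigma>\<^sup>2 / 2 - \<eta>) - r n * (2 * \<eta>))"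
    proof -
      have "(t + s)\<^sup>2 * \<sigma>\<^sup>2 / 2 + \<eta> - (s * (t * \<sigma>\<^sup>2) + \<bar>s\<bar> * d) = t\<^sup>2 * \<sigma>\<^sup>2 / 2 - \<eta> - 2 * \<eta>"
        by (simp add: \<eta>_def power2_eq_square field_simps)
      then have "r n * ((t + s)\<^sup>2 * \<sigma>\<^sup>2 / 2 + \<eta> - (s * (t * \<sigma>\<^sup>2) + \<bar>s\<bar> * d))
        = r n * (t\<^sup>2 * \<sigma>\<^sup>2 / 2 - \<eta> - 2 * \<eta>)"
        by (rule arg_cong)
      then show ?thesis
        unfolding exp_add[symmetric] right_diff_distrib by (intro arg_cong[of _ _ exp]) linarith
    qed
    also have "\<dots> \<le> exp (r n * (t\<^sup>2 * \<sigma>\<^sup>2 / 2 - \<eta>) - ln 4)"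
    proof -
      have "ln 4 < r n * (2 * \<eta>)" using elim(3) \<eta> by (subst (asm) pos_divide_less_eq) auto
      then show ?thesis by simp
    qed
    also have "\<dots> \<le> mgf n t / 4"
      using elim(2) by (simp add: exp_diff)
    finally show ?case .
  qed
qed

text \<open>Cramer's change of measure, carried out on integrals without forming the tilted law. For
  t = x / \<sigma>^2 that law concentrates at \<open>x\<close>. Each of the two tails outside the
  window of radius \<delta> takes at most a quarter of \<open>mgf n t\<close>, so the window keeps
  half, and there the weight is at most
  \<open>exp (r n * (t * x + \<bar>t\<bar> * \<delta>))\<close>.\<close>

lemma ldp_lower_point:
  assumes \<Gamma>: "\<Gamma> \<in> sets borel" and x: "0 < \<delta>" "ball x \<delta> \<subseteq> \<Gamma>"
  shows "\<forall>\<^sub>F n in sequentially.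
    exp (r n * (- (x\<^sup>2 / (2 * \<sigma>\<^sup>2)) - 2 * \<bar>x / \<sigma>\<^sup>2\<bar> * \<delta> - \<delta>)) \<le> prob {z \<in> space M. Y n z \<in> \<Gamma>}"
proof -
  define t where "t = x / \<sigma>\<^sup>2"
  \<comment> \<open>The minimiser of s^2 \<sigma>^2 / 2 - s \<delta>, that is, the best exponent for
    the tails of the tilted law.\<close>
  define s where "s = \<delta> / \<sigma>\<^sup>2"
  have s: "0 < s" using x sigma_pos by (simp add: s_def)
  have tx: "t * \<sigma>\<^sup>2 = x" using sigma_pos by (simp add: t_def)
  have small: "s\<^sup>2 * \<sigma>\<^sup>2 / 2 + \<bar>s\<bar> * (-\<delta>) < 0"
    using x sigma_pos by (simp add: s_def field_simps power2_eq_square)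
  then have small': "(-s)\<^sup>2 * \<sigma>\<^sup>2 / 2 + \<bar>-s\<bar> * (-\<delta>) < 0" by simp
  have "\<forall>\<^sub>F n in sequentially. exp (r n * (t\<^sup>2 * \<sigma>\<^sup>2 / 2 - \<delta> / 2)) \<le> mgf n t"
    by (rule eventually_exp_ge_of_log_limit[OF speed mgf_pos log_mgf']) (use x in auto)
  moreover have "\<forall>\<^sub>F n in sequentially. ln 2 / (\<delta> / 2) < r n"
    using speed by (auto simp: filterlim_at_top_dense)
  ultimately show ?thesis
    using tilted_ratio_small[OF x(1) small, of t] tilted_ratio_small[OF x(1) small', of t] speed_pos
  proof eventually_elim
    case (elim n)
    let ?A = "{z \<in> space M. Y n z \<in> \<Gamma>}"
    let ?E = "exp (r n * (t * x + \<bar>t\<bar> * \<delta>))"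
    have A: "?A \<in> sets M" using \<Gamma> by measurable
    \<comment> \<open>The three summands belong to the window, the upper tail and the lower tail; on
      each region the matching summand alone suffices, since the others are nonnegative.\<close>
    have pt: "exp (t * r n * Y n z) \<le> ?E * indicator ?A z
        + exp (- (r n * (s * x + s * \<delta>))) * exp ((t + s) * r n * Y n z)
        + exp (- (r n * ((-s) * x + s * \<delta>))) * exp ((t + - s) * r n * Y n z)"
      if "z \<in> space M" for z
    proof -
      have nn: "0 \<le> ?E * indicator ?A z"
        "0 \<le> exp (- (r n * (s * x + s * \<delta>))) * exp ((t + s) * r n * Y n z)"
        "0 \<le> exp (- (r n * ((-s) * x + s * \<delta>))) * exp ((t + - s) * r n * Y n z)"
        by simp_all
      consider "\<bar>Y n z - x\<bar> < \<delta>" | "x + \<delta> \<le> Y n z" | "Y n z \<le> x - \<delta>" by linarith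
      then show ?thesis
      proof cases
        case 1
        then have "Y n z \<in> \<Gamma>" using x by (auto simp: dist_real_def)
        have "t * (Y n z - x) \<le> \<bar>t\<bar> * \<bar>Y n z - x\<bar>" by (metis abs_ge_self abs_mult)
        also have "\<dots> \<le> \<bar>t\<bar> * \<delta>" using 1 by (intro mult_left_mono) auto
        finally have "r n * (t * (Y n z - x)) \<le> r n * (\<bar>t\<bar> * \<delta>)" using elim by simp
        then have "exp (t * r n * Y n z) \<le> ?E" by (simp add: algebra_simps)
        then have "exp (t * r n * Y n z) \<le> ?E * indicator ?A z"
          using \<open>Y n z \<in> \<Gamma>\<close> that by simp
        then show ?thesis using nn by linarith
      next
        case 2
        then have "0 \<le> (r n * s) * (Y n z - x - \<delta>)" using elim s by (intro mult_nonneg_nonneg) auto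
        then have "exp (t * r n * Y n z) \<le> exp (- (r n * (s * x + s * \<delta>)) + (t + s) * r n * Y n z)"
          unfolding exp_le_cancel_iff by (simp add: algebra_simps)
        then show ?thesis using nn unfolding exp_add by linarith
      next
        case 3
        then have "0 \<le> (r n * s) * (x - Y n z - \<delta>)" using elim s by (intro mult_nonneg_nonneg) auto
        then have "exp (t * r n * Y n z) \<le> exp (- (r n * ((-s) * x + s * \<delta>)) + (t + - s) * r n * Y n z)"
          unfolding exp_le_cancel_iff by (simp add: algebra_simps)
        then show ?thesis using nn unfolding exp_add by linarith
      qed
    qed
    have "mgf n t \<le> (\<integral>z. ?E * indicator ?A z
        + exp (- (r n * (s * x + s * \<delta>))) * exp ((t + s) * r n * Y n z)
        + exp (- (r n * ((-s) * x + s * \<delta>))) * exp ((t + - s) * r n * Y n z) \<partial>M)"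
      unfolding mgf_def
      by (intro integral_mono exp_integrable pt Bochner_Integration.integrable_add integrable_mult_right)
        (use A in \<open>auto simp: emeasure_eq_measure\<close>)
    also have "\<dots> = ?E * prob ?A + exp (- (r n * (s * x + s * \<delta>))) * mgf n (t + s)
        + exp (- (r n * ((-s) * x + s * \<delta>))) * mgf n (t + - s)"
    proof -
      have i1: "integrable M (\<lambda>z. ?E * indicator ?A z)"
        using A by (auto simp: emeasure_eq_measure)
      have i2: "integrable M (\<lambda>z. exp (- (r n * (s * x + s * \<delta>))) * exp ((t + s) * r n * Y n z))"
        "integrable M (\<lambda>z. exp (- (r n * ((-s) * x + s * \<delta>))) * exp ((t + - s) * r n * Y n z))"
        by (intro integrable_mult_right exp_integrable)+
      show ?thesis
        unfolding mgf_def
        apply (subst Bochner_Integration.integral_add[OF Bochner_Integration.integrable_add[OF i1 i2(1)] i2(2)])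
        apply (subst Bochner_Integration.integral_add[OF i1 i2(1)])
        using A by simp
    qed
    also have "\<dots> \<le> ?E * prob ?A + mgf n t / 4 + mgf n t / 4"
      using elim(3,4) s unfolding tx by (intro add_mono) auto
    finally have "mgf n t \<le> 2 * ?E * prob ?A" by simp
    then have "exp (r n * (t\<^sup>2 * \<sigma>\<^sup>2 / 2 - \<delta> / 2)) \<le> 2 * ?E * prob ?A"
      using elim(1) by linarith
    moreover have "exp (r n * (t\<^sup>2 * \<sigma>\<^sup>2 / 2 - \<delta> / 2)) =
        exp (r n * (t * x + \<bar>t\<bar> * \<delta>)) * exp (r n * (- (x\<^sup>2 / (2 * \<sigma>\<^sup>2)) - \<bar>t\<bar> * \<delta> - \<delta> / 2))"
    proof -
      have "t\<^sup>2 * \<sigma>\<^sup>2 / 2 = t * x - x\<^sup>2 / (2 * \<sigma>\<^sup>2)"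
        using sigma_pos by (simp add: t_def field_simps power2_eq_square)
      then have "t\<^sup>2 * \<sigma>\<^sup>2 / 2 - \<delta> / 2 =
          (t * x + \<bar>t\<bar> * \<delta>) + (- (x\<^sup>2 / (2 * \<sigma>\<^sup>2)) - \<bar>t\<bar> * \<delta> - \<delta> / 2)"
        by linarith
      then show ?thesis unfolding exp_add[symmetric] distrib_left[symmetric] by simp
    qed
    ultimately have "exp (r n * (- (x\<^sup>2 / (2 * \<sigma>\<^sup>2)) - \<bar>t\<bar> * \<delta> - \<delta> / 2)) \<le> 2 * prob ?A"
      by (simp add: mult.assoc mult.left_commute)
    then have "exp (r n * (- (x\<^sup>2 / (2 * \<sigma>\<^sup>2)) - \<bar>t\<bar> * \<delta> - \<delta> / 2) - ln 2) \<le> prob ?A"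
      by (simp add: exp_diff)
    moreover have "r n * (- (x\<^sup>2 / (2 * \<sigma>\<^sup>2)) - 2 * \<bar>x / \<sigma>\<^sup>2\<bar> * \<delta> - \<delta>)
      \<le> r n * (- (x\<^sup>2 / (2 * \<sigma>\<^sup>2)) - \<bar>t\<bar> * \<delta> - \<delta> / 2) - ln 2"
    proof -
      have "ln 2 \<le> r n * (\<delta> / 2)" using elim(2) x by (simp add: field_simps)
      moreover have "0 \<le> r n * (\<bar>t\<bar> * \<delta>)" using elim x by simp
      ultimately show ?thesis unfolding t_def[symmetric] by (simp add: algebra_simps)
    qed
    ultimately show ?case by (meson exp_le_cancel_iff order_trans)
  qed
qed

lemma ldp_lower:
  assumes \<Gamma>: "\<Gamma> \<in> sets borel"
  shows "- (INF x\<in>interior \<Gamma>. ereal (x\<^sup>2 / (2 * \<sigma>\<^sup>2)))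
    \<le> liminf (\<lambda>n. ereal (1 / r n) * eln (prob {x \<in> space M. Y n x \<in> \<Gamma>}))" (is "_ \<le> liminf ?q")
proof -
  have "- liminf ?q \<le> (INF x\<in>interior \<Gamma>. ereal (x\<^sup>2 / (2 * \<sigma>\<^sup>2)))"
  proof (rule INF_greatest)
    fix x assume "x \<in> interior \<Gamma>"
    then obtain \<delta>\<^sub>0 where d0: "0 < \<delta>\<^sub>0" "ball x \<delta>\<^sub>0 \<subseteq> \<Gamma>" by (auto simp: mem_interior)
    let ?k = "2 * \<bar>x / \<sigma>\<^sup>2\<bar> + 1"
    have "ereal (- (x\<^sup>2 / (2 * \<sigma>\<^sup>2))) \<le> liminf ?q"
    proof (rule ereal_le_epsilon2)
      fix e :: real assume "0 < e"
      have k: "0 < ?k" by (simp add: add_nonneg_pos)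
      \<comment> \<open>The loss in the pointwise bound is \<open>\<delta> * ?k\<close>, made at
        most \<open>e\<close> here.\<close>
      define \<delta> where "\<delta> = min \<delta>\<^sub>0 (e / ?k)"
      have \<delta>: "0 < \<delta>" "ball x \<delta> \<subseteq> \<Gamma>" using d0 \<open>0 < e\<close> k by (auto simp: \<delta>_def ball_def)
      have "\<delta> \<le> e / ?k" by (simp add: \<delta>_def)
      then have "\<delta> * ?k \<le> e" using k by (simp add: pos_le_divide_eq)
      then have "ereal (- (x\<^sup>2 / (2 * \<sigma>\<^sup>2)) - e)
        \<le> ereal (- (x\<^sup>2 / (2 * \<sigma>\<^sup>2)) - 2 * \<bar>x / \<sigma>\<^sup>2\<bar> * \<delta> - \<delta>)"
        by (simp add: algebra_simps)
      also have "\<dots> \<le> liminf ?q"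
      proof (rule Liminf_bounded)
        show "\<forall>\<^sub>F n in sequentially. ereal (- (x\<^sup>2 / (2 * \<sigma>\<^sup>2)) - 2 * \<bar>x / \<sigma>\<^sup>2\<bar> * \<delta> - \<delta>) \<le> ?q n"
          using ldp_lower_point[OF \<Gamma> \<delta>] speed_pos
          by eventually_elim (rule eln_scaled_ge)
      qed
      finally have "ereal (- (x\<^sup>2 / (2 * \<sigma>\<^sup>2)) - e) + ereal e \<le> liminf ?q + ereal e"
        by (intro add_right_mono)
      then show "ereal (- (x\<^sup>2 / (2 * \<sigma>\<^sup>2))) \<le> liminf ?q + ereal e" by simp
    qed
    then show "- liminf ?q \<le> ereal (x\<^sup>2 / (2 * \<sigma>\<^sup>2))"
      by (simp add: ereal_uminus_le_reorder)
  qed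
  then show ?thesis by (simp add: ereal_uminus_le_reorder)
qed

end

section \<open>Hoelder functions and transfer operators\<close>

lemma holderI:
  assumes "\<And>x. x \<in> S \<Longrightarrow> \<bar>g x\<bar> \<le> B"
    "\<And>x x'. x \<in> S \<Longrightarrow> x' \<in> S \<Longrightarrow> \<bar>g x - g x'\<bar> \<le> C * dist x x' powr \<alpha>"
  shows "holder \<alpha> S g"
  using assms unfolding holder_def by blast

lemma holderE:
  assumes "holder \<alpha> S g"
  obtains B C where "0 \<le> B" "0 \<le> C" "\<And>x. x \<in> S \<Longrightarrow> \<bar>g x\<bar> \<le> B"
    "\<And>x x'. x \<in> S \<Longrightarrow> x' \<in> S \<Longrightarrow> \<bar>g x - g x'\<bar> \<le> C * dist x x' powr \<alpha>"
proof -
  obtain B C where *: "\<forall>x\<in>S. \<bar>g x\<bar> \<le> B" "\<forall>x\<in>S. \<forall>x'\<in>S. \<bar>g x - g x'\<bar> \<le> C * dist x x' powr \<alpha>"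
    using assms unfolding holder_def by blast
  show ?thesis
  proof (rule that[of "max B 0" "max C 0"])
    fix x x' assume "x \<in> S" "x' \<in> S"
    then have "\<bar>g x - g x'\<bar> \<le> C * dist x x' powr \<alpha>" using * by blast
    also have "\<dots> \<le> max C 0 * dist x x' powr \<alpha>" by (intro mult_right_mono) auto
    finally show "\<bar>g x - g x'\<bar> \<le> max C 0 * dist x x' powr \<alpha>" .
  qed (use * in force)+
qed

lemma holder_const: "holder \<alpha> S (\<lambda>_. c)"
  by (rule holderI[of _ _ "\<bar>c\<bar>" 0]) auto

lemma holder_add:
  assumes "holder \<alpha> S f" "holder \<alpha> S g"
  shows "holder \<alpha> S (\<lambda>x. f x + g x)"
proof -
  obtain B C where f: "\<And>x. x \<in> S \<Longrightarrow> \<bar>f x\<bar> \<le> B"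
    "\<And>x x'. x \<in> S \<Longrightarrow> x' \<in> S \<Longrightarrow> \<bar>f x - f x'\<bar> \<le> C * dist x x' powr \<alpha>"
    using assms(1) by (rule holderE) (use that in blast)
  obtain B' C' where g: "\<And>x. x \<in> S \<Longrightarrow> \<bar>g x\<bar> \<le> B'"
    "\<And>x x'. x \<in> S \<Longrightarrow> x' \<in> S \<Longrightarrow> \<bar>g x - g x'\<bar> \<le> C' * dist x x' powr \<alpha>"
    using assms(2) by (rule holderE) (use that in blast)
  show ?thesis
  proof (rule holderI[of _ _ "B + B'" "C + C'"])
    show "\<bar>f x + g x\<bar> \<le> B + B'" if "x \<in> S" for x using f(1)[OF that] g(1)[OF that] by linarith
    show "\<bar>f x + g x - (f x' + g x')\<bar> \<le> (C + C') * dist x x' powr \<alpha>" if "x \<in> S" "x' \<in> S" for x x'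
      using f(2)[OF that] g(2)[OF that] by (simp add: distrib_right)
  qed
qed

lemma holder_mult:
  assumes "holder \<alpha> S f" "holder \<alpha> S g"
  shows "holder \<alpha> S (\<lambda>x. f x * g x)"
proof -
  obtain B C where f: "0 \<le> B" "0 \<le> C" "\<And>x. x \<in> S \<Longrightarrow> \<bar>f x\<bar> \<le> B"
    "\<And>x x'. x \<in> S \<Longrightarrow> x' \<in> S \<Longrightarrow> \<bar>f x - f x'\<bar> \<le> C * dist x x' powr \<alpha>"
    using assms(1) by (rule holderE) (use that in blast)
  obtain B' C' where g: "0 \<le> B'" "0 \<le> C'" "\<And>x. x \<in> S \<Longrightarrow> \<bar>g x\<bar> \<le> B'"
    "\<And>x x'. x \<in> S \<Longrightarrow> x' \<in> S \<Longrightarrow> \<bar>g x - g x'\<bar> \<le> C' * dist x x' powr \<alpha>"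
    using assms(2) by (rule holderE) (use that in blast)
  show ?thesis
  proof (rule holderI[of _ _ "B * B'" "B * C' + C * B'"])
    show "\<bar>f x * g x\<bar> \<le> B * B'" if "x \<in> S" for x
      using f(3)[OF that] g(3)[OF that] f(1) unfolding abs_mult by (intro mult_mono) auto
    show "\<bar>f x * g x - f x' * g x'\<bar> \<le> (B * C' + C * B') * dist x x' powr \<alpha>" if "x \<in> S" "x' \<in> S" for x x'
    proof -
      have "f x * g x - f x' * g x' = f x * (g x - g x') + (f x - f x') * g x'"
        by (simp add: algebra_simps)
      then have "\<bar>f x * g x - f x' * g x'\<bar> \<le> \<bar>f x\<bar> * \<bar>g x - g x'\<bar> + \<bar>f x - f x'\<bar> * \<bar>g x'\<bar>"
        by (metis abs_mult abs_triangle_ineq)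
      also have "\<dots> \<le> B * (C' * dist x x' powr \<alpha>) + (C * dist x x' powr \<alpha>) * B'"
        using that f g by (intro add_mono mult_mono) auto
      finally show ?thesis by (simp add: algebra_simps)
    qed
  qed
qed

lemma holder_cmult: "holder \<alpha> S f \<Longrightarrow> holder \<alpha> S (\<lambda>x. c * f x)"
  by (intro holder_mult holder_const)

lemma holder_minus: "holder \<alpha> S f \<Longrightarrow> holder \<alpha> S (\<lambda>x. - f x)"
  using holder_cmult[of \<alpha> S f "-1"] by simp

lemma holder_diff: "holder \<alpha> S f \<Longrightarrow> holder \<alpha> S g \<Longrightarrow> holder \<alpha> S (\<lambda>x. f x - g x)"
  using holder_add[of \<alpha> S f "\<lambda>x. - g x"] holder_minus[of \<alpha> S g] by simp

lemma holder_cong: "(\<And>x. x \<in> S \<Longrightarrow> f x = g x) \<Longrightarrow> holder \<alpha> S f \<longleftrightarrow> holder \<alpha> S g"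
  unfolding holder_def by (metis (no_types, lifting))

lemma holder_continuous_on:
  assumes "holder \<alpha> S f" "0 < \<alpha>"
  shows "continuous_on S f"
proof -
  obtain B C where f: "0 \<le> C"
    "\<And>x x'. x \<in> S \<Longrightarrow> x' \<in> S \<Longrightarrow> \<bar>f x - f x'\<bar> \<le> C * dist x x' powr \<alpha>"
    using assms(1) by (rule holderE) (use that in blast)
  show ?thesis
    unfolding continuous_on_def
  proof
    fix x assume x: "x \<in> S"
    have "((\<lambda>x'. dist x' x powr \<alpha>) \<longlongrightarrow> dist x x powr \<alpha>) (at x within S)"
    proof (rule tendsto_powr')
      show "((\<lambda>x'. dist x' x) \<longlongrightarrow> dist x x) (at x within S)" by (intro tendsto_intros)
    qed (use assms(2) in auto)
    then have "((\<lambda>x'. C * dist x' x powr \<alpha>) \<longlongrightarrow> 0) (at x within S)"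
      using tendsto_mult_left[of "\<lambda>x'. dist x' x powr \<alpha>" 0 _ C] by simp
    then have "((\<lambda>x'. f x' - f x) \<longlongrightarrow> 0) (at x within S)"
    proof (rule Lim_null_comparison[rotated])
      show "\<forall>\<^sub>F x' in at x within S. norm (f x' - f x) \<le> C * dist x' x powr \<alpha>"
        using f(2) x by (auto simp: eventually_at_filter)
    qed
    then show "(f \<longlongrightarrow> f x) (at x within S)" by (simp add: LIM_zero_iff)
  qed
qed

section \<open>Lipschitz functions determine finite Borel measures\<close>

text \<open>Closed subsets form an intersection-stable generator, and the indicator of a closed set
  F is the pointwise limit of max(0, 1 - k dist(x, F)), a k-Lipschitz function with values in
  [0, 1].\<close>

lemma finite_measures_eq_of_lipschitz:
  fixes K :: "'x::metric_space set"
  assumes K: "compact K"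
    and M: "finite_measure M" "sets M = sets (restrict_space borel K)"
    and N: "finite_measure N" "sets N = sets (restrict_space borel K)"
    and eq: "\<And>g C. (\<And>x x'. \<bar>g x - g x'\<bar> \<le> C * dist x x') \<Longrightarrow> (\<And>x. 0 \<le> g x \<and> g x \<le> 1)
      \<Longrightarrow> (\<integral>\<^sup>+x. ennreal (g x) \<partial>M) = (\<integral>\<^sup>+x. ennreal (g x) \<partial>N)"
  shows "M = N"
proof (rule measure_eqI_generator_eq)
  interpret M: finite_measure M by fact
  interpret N: finite_measure N by fact
  define C where "C = {A. closed A \<and> A \<subseteq> K}"
  have Kc: "closed K" using K by (rule compact_imp_closed)
  have C_eq: "C = (\<inter>) K ` Collect closed"
    using Kc by (auto simp: C_def image_iff)
  have gen: "sets (restrict_space borel K) = sigma_sets K C"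
    unfolding C_eq sets_restrict_space borel_eq_closed
    using sigma_sets_Int[of K UNIV "Collect closed"] Kc by (simp add: sigma_sets.Basic)
  show "sets M = sigma_sets K C" "sets N = sigma_sets K C" using M N gen by auto
  show "Int_stable C" by (auto simp: Int_stable_def C_def)
  show "C \<subseteq> Pow K" by (auto simp: C_def)
  show "range (\<lambda>_::nat. K) \<subseteq> C" using Kc by (auto simp: C_def)
  show "(\<Union>i::nat. K) = K" by simp
  show "emeasure M K \<noteq> \<infinity>" for i :: nat by simp
  have sub: "space M = K" "space N = K"
    using M(2) N(2) by (auto dest!: sets_eq_imp_space_eq simp: space_restrict_space)
  have lim: "(\<lambda>k. \<integral>\<^sup>+x. ennreal (max 0 (1 - real k * infdist x F)) \<partial>Q) \<longlonglongrightarrow> emeasure Q F"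
    if F: "closed F" "F \<subseteq> K" "F \<noteq> {}" and Q: "finite_measure Q" "sets Q = sets (restrict_space borel K)" for F Q
  proof -
    interpret Q: finite_measure Q by fact
    have FQ: "F \<in> sets Q" using F gen Q by (auto simp: C_def)
    have meas: "(\<lambda>x. ennreal (max 0 (1 - real k * infdist x F))) \<in> borel_measurable Q" for k
    proof -
      have "(\<lambda>x. max 0 (1 - real k * infdist x F)) \<in> borel_measurable (restrict_space borel K)"
        by (intro borel_measurable_continuous_on_restrict continuous_intros)
      then have "(\<lambda>x. max 0 (1 - real k * infdist x F)) \<in> borel_measurable Q"
        by (subst measurable_cong_sets[OF Q(2) refl])
      then show ?thesis by (rule measurable_compose[OF _ measurable_ennreal])
    qed
    have "(\<lambda>k. \<integral>\<^sup>+x. ennreal (max 0 (1 - real k * infdist x F)) \<partial>Q) \<longlonglongrightarrow> (\<integral>\<^sup>+x. indicator F x \<partial>Q)"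
    proof (rule nn_integral_dominated_convergence[where w="\<lambda>_. 1"])
      show "AE x in Q. (\<lambda>k. ennreal (max 0 (1 - real k * infdist x F))) \<longlonglongrightarrow> indicator F x"
      proof (rule AE_I2)
        fix x
        show "(\<lambda>k. ennreal (max 0 (1 - real k * infdist x F))) \<longlonglongrightarrow> indicator F x"
        proof (cases "x \<in> F")
          case False
          then have pos: "0 < infdist x F"
            using F by (metis in_closed_iff_infdist_zero infdist_nonneg less_eq_real_def)
          have "\<forall>\<^sub>F k in sequentially. 1 / infdist x F \<le> real k"
            by (meson eventually_sequentiallyI nat_ceiling_le_eq)
          then have "\<forall>\<^sub>F k in sequentially. ennreal (max 0 (1 - real k * infdist x F)) = indicator F x"
          proof eventually_elim
            case (elim k)
            then have "1 \<le> real k * infdist x F" using pos by (simp add: pos_divide_le_eq)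
            then show ?case using False by simp
          qed
          then show ?thesis by (rule tendsto_eventually)
        qed simp
      qed
      show "AE x in Q. ennreal (max 0 (1 - real k * infdist x F)) \<le> 1" for k
        by (intro AE_I2) (simp add: infdist_nonneg)
    qed (use meas FQ Q.emeasure_finite in \<open>auto simp: less_top[symmetric]\<close>)
    then show ?thesis using FQ by simp
  qed
  fix F assume F: "F \<in> C"
  \<comment> \<open>The empty set is treated apart: \<open>infdist\<close> to it is 0 by convention,
    so the approximating functions would be constantly 1.\<close>
  show "emeasure M F = emeasure N F"
  proof (cases "F = {}")
    case False
    have "(\<integral>\<^sup>+x. ennreal (max 0 (1 - real k * infdist x F)) \<partial>M)
        = (\<integral>\<^sup>+x. ennreal (max 0 (1 - real k * infdist x F)) \<partial>N)" for k
    proof (rule eq[of _ "real k"])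
      fix x x'
      have "\<bar>max 0 (1 - real k * infdist x F) - max 0 (1 - real k * infdist x' F)\<bar>
          \<le> \<bar>real k * infdist x F - real k * infdist x' F\<bar>" by linarith
      also have "\<dots> = real k * \<bar>infdist x F - infdist x' F\<bar>"
        by (metis abs_mult abs_of_nat right_diff_distrib)
      also have "\<dots> \<le> real k * dist x x'"
        by (intro mult_left_mono infdist_triangle_abs) auto
      finally show "\<bar>max 0 (1 - real k * infdist x F) - max 0 (1 - real k * infdist x' F)\<bar> \<le> real k * dist x x'" .
    qed (simp add: infdist_nonneg)
    then show ?thesis
      using lim[OF _ _ False M] lim[OF _ _ False N] F LIMSEQ_unique unfolding C_def by auto
  qed simp
qed

section \<open>Transfer operators of a random system of inverse branches\<close>

text \<open>What both settings share, at the level of single points. \<open>W\<close> stands for a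
  set of full measure that is invariant under \<theta> and its inverse, so almost sure hypotheses
  may be used at every point of every orbit and null sets disappear from the argument. Indices are
  natural numbers, so there are countably many branches.\<close>

locale branch_system =
  fixes W :: "'w set" and \<theta> \<theta>i :: "'w \<Rightarrow> 'w" and E :: "('w \<times> 'x::metric_space) set"
    and T :: "'w \<Rightarrow> 'x \<Rightarrow> 'x" and \<phi> :: "'w \<Rightarrow> 'x \<Rightarrow> real" and \<alpha> :: real
    and I :: "'w \<Rightarrow> nat set" and y :: "'w \<Rightarrow> nat \<Rightarrow> 'x \<Rightarrow> 'x" and Dd :: "'w \<Rightarrow> real"
  assumes alpha: "0 < \<alpha>" "\<alpha> \<le> 1"
    and th_in: "\<omega> \<in> W \<Longrightarrow> \<theta> \<omega> \<in> W" and thi_in: "\<omega> \<in> W \<Longrightarrow> \<theta>i \<omega> \<in> W"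
    and th_thi [simp]: "\<omega> \<in> W \<Longrightarrow> \<theta> (\<theta>i \<omega>) = \<omega>" and thi_th [simp]: "\<omega> \<in> W \<Longrightarrow> \<theta>i (\<theta> \<omega>) = \<omega>"
    and compact_fib: "\<omega> \<in> W \<Longrightarrow> compact (fib E \<omega>)"
    and diam: "\<omega> \<in> W \<Longrightarrow> x \<in> fib E \<omega> \<Longrightarrow> x' \<in> fib E \<omega> \<Longrightarrow> dist x x' \<le> 1"
    and fib_ne: "\<omega> \<in> W \<Longrightarrow> fib E \<omega> \<noteq> {}"
    and T_in: "\<omega> \<in> W \<Longrightarrow> x \<in> fib E \<omega> \<Longrightarrow> T \<omega> x \<in> fib E (\<theta> \<omega>)"
    and T_meas: "\<omega> \<in> W \<Longrightarrow> T \<omega> \<in> borel_measurable (restrict_space borel (fib E \<omega>))"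
    and branches: "\<omega> \<in> W \<Longrightarrow> x \<in> fib E (\<theta> \<omega>) \<Longrightarrow>
      bij_betw (\<lambda>i. y \<omega> i x) (I \<omega>) {z \<in> fib E \<omega>. T \<omega> z = x}"
    and y_cont: "\<omega> \<in> W \<Longrightarrow> i \<in> I \<omega> \<Longrightarrow> continuous_on (fib E (\<theta> \<omega>)) (y \<omega> i)"
    and phi_cont: "\<omega> \<in> W \<Longrightarrow> i \<in> I \<omega> \<Longrightarrow> continuous_on (fib E (\<theta> \<omega>)) (\<lambda>x. \<phi> \<omega> (y \<omega> i x))"
    and summ: "\<omega> \<in> W \<Longrightarrow> x \<in> fib E (\<theta> \<omega>) \<Longrightarrow>
      (\<lambda>z. exp (\<phi> \<omega> z)) summable_on {z \<in> fib E \<omega>. T \<omega> z = x}"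
    and summ_le: "\<omega> \<in> W \<Longrightarrow> x \<in> fib E (\<theta> \<omega>) \<Longrightarrow>
      infsum (\<lambda>z. exp (\<phi> \<omega> z)) {z \<in> fib E \<omega>. T \<omega> z = x} \<le> Dd \<omega>"
begin

abbreviation X :: "'w \<Rightarrow> 'x set" where "X \<equiv> fib E"

abbreviation L :: "'w \<Rightarrow> ('x \<Rightarrow> real) \<Rightarrow> 'x \<Rightarrow> real" where "L \<equiv> Lop E T \<phi>"

text \<open>\<open>infsum\<close> is 0 for a family that is not summable, so linearity and
  monotonicity of \<open>L\<close> need summability. Boundedness on the fibre guarantees it, and
  also suits functions without any regularity.\<close>

definition bdd_on :: "'w \<Rightarrow> ('x \<Rightarrow> real) \<Rightarrow> bool" where
  "bdd_on \<omega> g \<longleftrightarrow> (\<exists>B. \<forall>x\<in>X \<omega>. \<bar>g x\<bar> \<le> B)"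

lemma bdd_onI: "(\<And>x. x \<in> X \<omega> \<Longrightarrow> \<bar>g x\<bar> \<le> B) \<Longrightarrow> bdd_on \<omega> g"
  by (auto simp: bdd_on_def)

lemma holder_bdd: "holder \<alpha> (X \<omega>) g \<Longrightarrow> bdd_on \<omega> g"
  by (auto simp: bdd_on_def holder_def)

lemma bdd_on_const: "bdd_on \<omega> (\<lambda>_. c)" by (auto simp: bdd_on_def)

lemma bdd_on_add: "bdd_on \<omega> f \<Longrightarrow> bdd_on \<omega> g \<Longrightarrow> bdd_on \<omega> (\<lambda>x. f x + g x)"
  unfolding bdd_on_def by (metis abs_triangle_ineq add_mono order_trans)

lemma bdd_on_mult:
  assumes "bdd_on \<omega> f" "bdd_on \<omega> g"
  shows "bdd_on \<omega> (\<lambda>x. f x * g x)"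
proof -
  obtain B B' where *: "\<And>x. x \<in> X \<omega> \<Longrightarrow> \<bar>f x\<bar> \<le> B" "\<And>x. x \<in> X \<omega> \<Longrightarrow> \<bar>g x\<bar> \<le> B'"
    using assms unfolding bdd_on_def by blast
  show ?thesis
  proof (rule bdd_onI[of _ _ "B * B'"])
    show "\<bar>f x * g x\<bar> \<le> B * B'" if "x \<in> X \<omega>" for x
      unfolding abs_mult using *[OF that] by (intro mult_mono) (auto intro: order_trans[OF abs_ge_zero])
  qed
qed

lemma bdd_on_cmult: "bdd_on \<omega> g \<Longrightarrow> bdd_on \<omega> (\<lambda>x. c * g x)"
  by (intro bdd_on_mult bdd_on_const)

lemma L_summable:
  assumes "\<omega> \<in> W" "bdd_on \<omega> g" "x \<in> X (\<theta> \<omega>)"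
  shows "(\<lambda>z. exp (\<phi> \<omega> z) * g z) summable_on {z \<in> X \<omega>. T \<omega> z = x}"
proof -
  obtain B where B: "\<And>x. x \<in> X \<omega> \<Longrightarrow> \<bar>g x\<bar> \<le> B" using assms unfolding bdd_on_def by blast
  have "(\<lambda>z. B * exp (\<phi> \<omega> z)) summable_on {z \<in> X \<omega>. T \<omega> z = x}"
    using summ[OF assms(1,3)] by (rule summable_on_cmult_right)
  then have "(\<lambda>z. norm (B * exp (\<phi> \<omega> z))) summable_on {z \<in> X \<omega>. T \<omega> z = x}"
    by (rule iffD1[OF summable_on_iff_abs_summable_on_real])
  then have "(\<lambda>z. norm (exp (\<phi> \<omega> z) * g z)) summable_on {z \<in> X \<omega>. T \<omega> z = x}"
  proof (rule Infinite_Sum.abs_summable_on_comparison_test)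
    show "norm (exp (\<phi> \<omega> z) * g z) \<le> norm (B * exp (\<phi> \<omega> z))" if "z \<in> {z \<in> X \<omega>. T \<omega> z = x}" for z
      using B[of z] that by (simp add: abs_mult)
  qed
  then show ?thesis by (rule iffD2[OF summable_on_iff_abs_summable_on_real])
qed

lemma L_add:
  assumes "\<omega> \<in> W" "bdd_on \<omega> f" "bdd_on \<omega> g"
  shows "x \<in> X (\<theta> \<omega>) \<Longrightarrow> L \<omega> (\<lambda>x. f x + g x) x = L \<omega> f x + L \<omega> g x"
  unfolding Lop_def distrib_left using assms by (intro infsum_add L_summable)

lemma L_cmult: "L \<omega> (\<lambda>x. c * f x) x = c * L \<omega> f x"
  unfolding Lop_def by (subst infsum_cmult_right'[symmetric]) (simp add: algebra_simps)

lemma L_minus: "L \<omega> (\<lambda>x. - f x) x = - L \<omega> f x"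
  using L_cmult[of \<omega> "-1" f x] by simp

lemma L_diff:
  assumes "\<omega> \<in> W" "bdd_on \<omega> f" "bdd_on \<omega> g" "x \<in> X (\<theta> \<omega>)"
  shows "L \<omega> (\<lambda>x. f x - g x) x = L \<omega> f x - L \<omega> g x"
  using L_add[OF assms(1,2) bdd_on_cmult[OF assms(3), of "-1"] assms(4)]
  by (simp add: L_minus)

lemma L_cong: "(\<And>z. z \<in> X \<omega> \<Longrightarrow> f z = g z) \<Longrightarrow> L \<omega> f x = L \<omega> g x"
  unfolding Lop_def by (intro infsum_cong) auto

text \<open>A function of \<open>T \<omega> z\<close> is constant on the preimages of
  \<open>x\<close>; this is the algebraic half of the duality between \<open>L\<close> and
  composition with \<open>T\<close>.\<close>

lemma L_compose: "L \<omega> (\<lambda>z. k (T \<omega> z) * f z) x = k x * L \<omega> f x"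
proof -
  have "L \<omega> (\<lambda>z. k (T \<omega> z) * f z) x = L \<omega> (\<lambda>z. k x * f z) x"
    unfolding Lop_def by (intro infsum_cong) auto
  then show ?thesis by (simp add: L_cmult)
qed

lemma L_mono:
  assumes "\<omega> \<in> W" "bdd_on \<omega> f" "bdd_on \<omega> g" "\<And>z. z \<in> X \<omega> \<Longrightarrow> f z \<le> g z" "x \<in> X (\<theta> \<omega>)"
  shows "L \<omega> f x \<le> L \<omega> g x"
  unfolding Lop_def using assms by (intro infsum_mono L_summable) auto

lemma L_nonneg: "(\<And>z. z \<in> X \<omega> \<Longrightarrow> 0 \<le> f z) \<Longrightarrow> 0 \<le> L \<omega> f x"
  unfolding Lop_def by (intro infsum_nonneg) auto

lemma L_one_le: "\<omega> \<in> W \<Longrightarrow> x \<in> X (\<theta> \<omega>) \<Longrightarrow> L \<omega> (\<lambda>_. 1) x \<le> Dd \<omega>"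
  unfolding Lop_def using summ_le by simp

lemma L_abs_le:
  assumes "\<omega> \<in> W" "\<And>z. z \<in> X \<omega> \<Longrightarrow> \<bar>g z\<bar> \<le> f z" "bdd_on \<omega> f" "x \<in> X (\<theta> \<omega>)"
  shows "\<bar>L \<omega> g x\<bar> \<le> L \<omega> f x"
proof -
  obtain B where B: "\<And>x. x \<in> X \<omega> \<Longrightarrow> \<bar>f x\<bar> \<le> B" using assms(3) unfolding bdd_on_def by blast
  have g: "bdd_on \<omega> g"
    by (rule bdd_onI[of _ _ B]) (use assms(2) B in force)
  have "L \<omega> g x \<le> L \<omega> f x" using assms g by (intro L_mono) force+
  moreover have "L \<omega> (\<lambda>x. - g x) x \<le> L \<omega> f x"
    using assms bdd_on_cmult[OF g, of "-1"] by (intro L_mono) force+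
  ultimately show ?thesis by (simp add: L_minus abs_le_iff)
qed

lemma L_bdd:
  assumes "\<omega> \<in> W" "bdd_on \<omega> g"
  shows "bdd_on (\<theta> \<omega>) (L \<omega> g)"
proof -
  obtain B where B: "\<And>x. x \<in> X \<omega> \<Longrightarrow> \<bar>g x\<bar> \<le> B" using assms(2) unfolding bdd_on_def by blast
  obtain z where "z \<in> X \<omega>" using fib_ne[OF assms(1)] by blast
  then have "0 \<le> B" using B[of z] by linarith
  show ?thesis
  proof (rule bdd_onI)
    fix x assume x: "x \<in> X (\<theta> \<omega>)"
    have "\<bar>L \<omega> g x\<bar> \<le> L \<omega> (\<lambda>_. B * 1) x"
      using B x assms by (intro L_abs_le bdd_on_cmult bdd_on_const) auto
    also have "\<dots> \<le> B * Dd \<omega>"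
      unfolding L_cmult using L_one_le[OF assms(1) x] \<open>0 \<le> B\<close> by (rule mult_left_mono)
    finally show "\<bar>L \<omega> g x\<bar> \<le> B * Dd \<omega>" .
  qed
qed

lemma index_ne: "\<omega> \<in> W \<Longrightarrow> I \<omega> \<noteq> {}"
proof -
  assume "\<omega> \<in> W"
  obtain z where z: "z \<in> X \<omega>" using fib_ne[OF \<open>\<omega> \<in> W\<close>] by blast
  then show ?thesis
    using branches[OF \<open>\<omega> \<in> W\<close> T_in[OF \<open>\<omega> \<in> W\<close> z]] unfolding bij_betw_def by blast
qed

lemma L_pos:
  assumes "\<omega> \<in> W" "bdd_on \<omega> f" "\<And>z. z \<in> X \<omega> \<Longrightarrow> 0 < f z" "x \<in> X (\<theta> \<omega>)"
  shows "0 < L \<omega> f x"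
proof -
  obtain i where i: "i \<in> I \<omega>" using index_ne[OF assms(1)] by blast
  then have z: "y \<omega> i x \<in> {z \<in> X \<omega>. T \<omega> z = x}" (is "?z \<in> ?A")
    using branches[OF assms(1,4)] unfolding bij_betw_def by blast
  have "0 < exp (\<phi> \<omega> ?z) * f ?z" using z assms by auto
  also have "\<dots> = (\<Sum>z\<in>{?z}. exp (\<phi> \<omega> z) * f z)" by simp
  also have "\<dots> \<le> L \<omega> f x"
    unfolding Lop_def using z assms by (intro finite_sum_le_infsum L_summable) (auto simp: less_imp_le)
  finally show ?thesis .
qed

lemma y_in: "\<omega> \<in> W \<Longrightarrow> i \<in> I \<omega> \<Longrightarrow> x \<in> X (\<theta> \<omega>) \<Longrightarrow> y \<omega> i x \<in> X \<omega>"
  using branches unfolding bij_betw_def by blast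

lemma L_index: "\<omega> \<in> W \<Longrightarrow> x \<in> X (\<theta> \<omega>) \<Longrightarrow>
    L \<omega> g x = infsum (\<lambda>i. exp (\<phi> \<omega> (y \<omega> i x)) * g (y \<omega> i x)) (I \<omega>)"
  unfolding Lop_def by (rule infsum_reindex_bij_betw[OF branches, symmetric])

lemma L_index_summable:
  assumes "\<omega> \<in> W" "bdd_on \<omega> g" "x \<in> X (\<theta> \<omega>)"
  shows "(\<lambda>i. exp (\<phi> \<omega> (y \<omega> i x)) * g (y \<omega> i x)) summable_on I \<omega>"
  using summable_on_reindex_bij_betw[OF branches[OF assms(1,3)], of "\<lambda>z. exp (\<phi> \<omega> z) * g z"]
    L_summable[OF assms] by simp

text \<open>An integral over the counting measure of the indices can be exchanged with the integral
  over the fibre by Tonelli's theorem.\<close>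

lemma L_nn_integral:
  assumes "\<omega> \<in> W" "bdd_on \<omega> g" "x \<in> X (\<theta> \<omega>)" "\<And>z. z \<in> X \<omega> \<Longrightarrow> 0 \<le> g z"
  shows "ennreal (L \<omega> g x) = (\<integral>\<^sup>+i. ennreal (exp (\<phi> \<omega> (y \<omega> i x)) * g (y \<omega> i x)) \<partial>count_space (I \<omega>))"
proof -
  let ?f = "\<lambda>i. exp (\<phi> \<omega> (y \<omega> i x)) * g (y \<omega> i x)"
  have "Infinite_Sum.abs_summable_on ?f (I \<omega>)"
    using L_index_summable[OF assms(1-3)] by (rule iffD1[OF summable_on_iff_abs_summable_on_real])
  then have abs: "Infinite_Set_Sum.abs_summable_on ?f (I \<omega>)" by (rule iffD1[OF abs_summable_equivalent])
  show ?thesis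
    unfolding L_index[OF assms(1,3)] infsetsum_infsum[OF abs, symmetric]
    using assms y_in by (intro nn_integral_conv_infsetsum[symmetric] abs) auto
qed

lemma funpow_th_in: "\<omega> \<in> W \<Longrightarrow> (\<theta> ^^ n) \<omega> \<in> W"
  by (induction n) (auto simp: th_in)

lemma funpow_thi_in: "\<omega> \<in> W \<Longrightarrow> (\<theta>i ^^ n) \<omega> \<in> W"
  by (induction n) (auto simp: thi_in)

text \<open>The recursion of \<open>Lpow\<close> appends the last operator; here the first one is
  split off.\<close>

lemma Lpow_Suc_shift: "Lpow \<theta> L (Suc n) \<omega> g = Lpow \<theta> L n (\<theta> \<omega>) (L \<omega> g)"
  by (induction n) (auto simp: funpow_swap1)

lemma Lpow_bdd: "\<omega> \<in> W \<Longrightarrow> bdd_on \<omega> g \<Longrightarrow> bdd_on ((\<theta> ^^ n) \<omega>) (Lpow \<theta> L n \<omega> g)"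
  by (induction n) (auto simp: funpow_th_in L_bdd)

lemma Lpow_pos: "\<omega> \<in> W \<Longrightarrow> bdd_on \<omega> g \<Longrightarrow> (\<And>z. z \<in> X \<omega> \<Longrightarrow> 0 < g z) \<Longrightarrow>
   x \<in> X ((\<theta> ^^ n) \<omega>) \<Longrightarrow> 0 < Lpow \<theta> L n \<omega> g x"
proof (induction n arbitrary: x)
  case (Suc n)
  then show ?case using L_pos[OF funpow_th_in[OF Suc.prems(1)] Lpow_bdd[OF Suc.prems(1,2)]] by auto
qed simp

end

section \<open>Cocycles of operators contracting a family of cones\<close>

text \<open>An elementary substitute for Birkhoff's projective contraction.
  \<open>cone_contract\<close> says that on images of the operator the pointwise order implies the
  cone order, up to the factor \<open>\<kappa>\<^sub>0\<close>. \<open>cone_ratio\<close> bounds the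
  oscillation of images by \<open>b\<close>. \<open>cone_mult\<close> says that multiplication by a
  weight with sup bound \<open>A\<close> and Hoelder constant \<open>B\<close>, followed by the
  operator, is dominated in the cone order by \<open>m\<^sub>1 * A + m\<^sub>2 * B\<close> times the
  operator. \<open>contraction\<close> makes the uncontracted part of the distant past
  vanish.\<close>

locale cone_cocycle = branch_system W \<theta> \<theta>i E T \<phi> \<alpha> I y Dd
  for W :: "'w set" and \<theta> \<theta>i :: "'w \<Rightarrow> 'w" and E :: "('w \<times> 'x::metric_space) set"
    and T :: "'w \<Rightarrow> 'x \<Rightarrow> 'x" and \<phi> :: "'w \<Rightarrow> 'x \<Rightarrow> real" and \<alpha> :: real
    and I :: "'w \<Rightarrow> nat set" and y :: "'w \<Rightarrow> nat \<Rightarrow> 'x \<Rightarrow> 'x" and Dd :: "'w \<Rightarrow> real" +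
  fixes \<nu> :: "'w \<Rightarrow> 'x measure" and C :: "'w \<Rightarrow> ('x \<Rightarrow> real) set"
    and \<kappa>\<^sub>0 b m\<^sub>1 m\<^sub>2 :: "'w \<Rightarrow> real"
  assumes nu_prob: "\<omega> \<in> W \<Longrightarrow> prob_space (\<nu> \<omega>)"
    and nu_space: "\<omega> \<in> W \<Longrightarrow> space (\<nu> \<omega>) = fib E \<omega>"
    and nu_sets: "\<omega> \<in> W \<Longrightarrow> sets (\<nu> \<omega>) = sets (restrict_space borel (fib E \<omega>))"
    and nu_lim: "\<omega> \<in> W \<Longrightarrow> holder \<alpha> (fib E \<omega>) g \<Longrightarrow> (\<And>n. xs n \<in> fib E ((\<theta> ^^ n) \<omega>)) \<Longrightarrow>
        (\<lambda>n. Lpow \<theta> (Lop E T \<phi>) n \<omega> g (xs n) / Lpow \<theta> (Lop E T \<phi>) n \<omega> (\<lambda>_. 1) (xs n))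
          \<longlonglongrightarrow> integral\<^sup>L (\<nu> \<omega>) g"
    and cone_holder: "\<omega> \<in> W \<Longrightarrow> f \<in> C \<omega> \<Longrightarrow> holder \<alpha> (fib E \<omega>) f"
    and cone_nonneg: "\<omega> \<in> W \<Longrightarrow> f \<in> C \<omega> \<Longrightarrow> x \<in> fib E \<omega> \<Longrightarrow> 0 \<le> f x"
    and cone_add: "\<omega> \<in> W \<Longrightarrow> f \<in> C \<omega> \<Longrightarrow> g \<in> C \<omega> \<Longrightarrow> (\<lambda>x. f x + g x) \<in> C \<omega>"
    and cone_scale: "\<omega> \<in> W \<Longrightarrow> f \<in> C \<omega> \<Longrightarrow> 0 \<le> c \<Longrightarrow> (\<lambda>x. c * f x) \<in> C \<omega>"
    and cone_cong: "\<omega> \<in> W \<Longrightarrow> f \<in> C \<omega> \<Longrightarrow> (\<And>x. x \<in> fib E \<omega> \<Longrightarrow> f x = g x) \<Longrightarrow> g \<in> C \<omega>"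
    and cone_lim: "\<omega> \<in> W \<Longrightarrow> (\<And>n. fs n \<in> C \<omega>) \<Longrightarrow>
        (\<And>x. x \<in> fib E \<omega> \<Longrightarrow> (\<lambda>n. fs n x) \<longlonglongrightarrow> g x) \<Longrightarrow> g \<in> C \<omega>"
    and cone_one: "\<omega> \<in> W \<Longrightarrow> (\<lambda>_. 1) \<in> C \<omega>"
    and cone_absorbs: "\<omega> \<in> W \<Longrightarrow> holder \<alpha> (fib E \<omega>) g \<Longrightarrow> \<exists>c\<ge>0. (\<lambda>x. g x + c) \<in> C \<omega>"
    and cone_contract: "\<omega> \<in> W \<Longrightarrow> f \<in> C \<omega> \<Longrightarrow> f' \<in> C \<omega> \<Longrightarrow> 0 \<le> t \<Longrightarrow>
        (\<And>z. z \<in> fib E (\<theta> \<omega>) \<Longrightarrow> t * Lop E T \<phi> \<omega> f' z \<le> \<kappa>\<^sub>0 \<omega> * Lop E T \<phi> \<omega> f z) \<Longrightarrow>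
        (\<lambda>z. Lop E T \<phi> \<omega> f z - t * Lop E T \<phi> \<omega> f' z) \<in> C (\<theta> \<omega>)"
    and cone_ratio: "\<omega> \<in> W \<Longrightarrow> f \<in> C \<omega> \<Longrightarrow> x \<in> fib E (\<theta> \<omega>) \<Longrightarrow> x' \<in> fib E (\<theta> \<omega>) \<Longrightarrow>
        Lop E T \<phi> \<omega> f x \<le> b \<omega> * Lop E T \<phi> \<omega> f x'"
    and cone_mult: "\<omega> \<in> W \<Longrightarrow> f \<in> C \<omega> \<Longrightarrow> 0 \<le> A \<Longrightarrow> 0 \<le> B \<Longrightarrow>
        (\<And>x. x \<in> fib E \<omega> \<Longrightarrow> \<bar>w x\<bar> \<le> A) \<Longrightarrow>
        (\<And>x x'. x \<in> fib E \<omega> \<Longrightarrow> x' \<in> fib E \<omega> \<Longrightarrow> \<bar>w x - w x'\<bar> \<le> B * dist x x' powr \<alpha>) \<Longrightarrow>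
        (\<lambda>z. (m\<^sub>1 \<omega> * A + m\<^sub>2 \<omega> * B) * Lop E T \<phi> \<omega> f z + Lop E T \<phi> \<omega> (\<lambda>x. w x * f x) z) \<in> C (\<theta> \<omega>)"
    and k0_pos: "\<omega> \<in> W \<Longrightarrow> 0 < \<kappa>\<^sub>0 \<omega>" and k0_le: "\<omega> \<in> W \<Longrightarrow> \<kappa>\<^sub>0 \<omega> \<le> 1"
    and b_ge: "\<omega> \<in> W \<Longrightarrow> 1 \<le> b \<omega>"
    and m1_ge: "\<omega> \<in> W \<Longrightarrow> 1 \<le> m\<^sub>1 \<omega>" and m2_ge: "\<omega> \<in> W \<Longrightarrow> 0 \<le> m\<^sub>2 \<omega>"
    and contraction: "\<omega> \<in> W \<Longrightarrow>
        (\<lambda>n. \<Prod>j<n. 1 - \<kappa>\<^sub>0 ((\<theta>i ^^ Suc j) \<omega>) / (b ((\<theta>i ^^ Suc j) \<omega>))\<^sup>2) \<longlonglongrightarrow> 0"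
begin

section \<open>The conformal measures\<close>

text \<open>One factor \<open>b\<close> compares \<open>f\<close> with its mean and another compares
  \<open>f'\<close> with its mean, hence the square.\<close>

definition \<kappa> :: "'w \<Rightarrow> real" where "\<kappa> \<omega> = \<kappa>\<^sub>0 \<omega> / (b \<omega>)\<^sup>2"

lemma kappa_pos: "\<omega> \<in> W \<Longrightarrow> 0 < \<kappa> \<omega>"
  using k0_pos b_ge[of \<omega>] unfolding \<kappa>_def by (auto intro!: divide_pos_pos)

lemma kappa_le_one: "\<omega> \<in> W \<Longrightarrow> \<kappa> \<omega> \<le> 1"
proof -
  assume w: "\<omega> \<in> W"
  have "1 \<le> (b \<omega>)\<^sup>2" using b_ge[OF w] by (rule one_le_power)
  then show ?thesis using k0_le[OF w] unfolding \<kappa>_def by (simp add: divide_le_eq)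
qed

lemma cone_bdd: "\<omega> \<in> W \<Longrightarrow> f \<in> C \<omega> \<Longrightarrow> bdd_on \<omega> f"
  by (intro holder_bdd cone_holder)

lemma cone_const: "\<omega> \<in> W \<Longrightarrow> 0 \<le> c \<Longrightarrow> (\<lambda>_. c) \<in> C \<omega>"
  using cone_scale[OF _ cone_one, of \<omega> c] by simp

lemma cone_L: "\<omega> \<in> W \<Longrightarrow> f \<in> C \<omega> \<Longrightarrow> L \<omega> f \<in> C (\<theta> \<omega>)"
proof -
  assume a: "\<omega> \<in> W" "f \<in> C \<omega>"
  have "0 \<le> \<kappa>\<^sub>0 \<omega> * L \<omega> f z" for z
    using k0_pos[OF a(1)] L_nonneg[of \<omega> f z] cone_nonneg[OF a] by simp
  then show "L \<omega> f \<in> C (\<theta> \<omega>)" using cone_contract[OF a(1) a(2) a(2), of 0] by simp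
qed

text \<open>A Hoelder function is the difference of two cone elements, one of them constant, and the
  cone is preserved.\<close>

lemma holder_L:
  assumes w: "\<omega> \<in> W" and g: "holder \<alpha> (X \<omega>) g"
  shows "holder \<alpha> (X (\<theta> \<omega>)) (L \<omega> g)"
proof -
  obtain c where c: "0 \<le> c" "(\<lambda>x. g x + c) \<in> C \<omega>" using cone_absorbs[OF w g] by blast
  have "holder \<alpha> (X (\<theta> \<omega>)) (\<lambda>x. L \<omega> (\<lambda>x. g x + c) x - L \<omega> (\<lambda>_. c) x)"
    by (intro holder_diff cone_holder th_in cone_L cone_const w c)
  moreover have "L \<omega> (\<lambda>x. g x + c) x - L \<omega> (\<lambda>_. c) x = L \<omega> g x" if "x \<in> X (\<theta> \<omega>)" for x
    using L_add[OF w holder_bdd[OF g] bdd_on_const that] by simp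
  ultimately show ?thesis by (simp cong: holder_cong)
qed

lemma holder_meas:
  assumes "\<omega> \<in> W" "holder \<alpha> (X \<omega>) g"
  shows "g \<in> borel_measurable (\<nu> \<omega>)"
proof -
  have "g \<in> borel_measurable (restrict_space borel (X \<omega>))"
    using assms alpha by (intro borel_measurable_continuous_on_restrict holder_continuous_on)
  then show ?thesis by (subst measurable_cong_sets[OF nu_sets[OF assms(1)] refl])
qed

lemma bdd_integrable:
  assumes "\<omega> \<in> W" "bdd_on \<omega> g" "g \<in> borel_measurable (\<nu> \<omega>)"
  shows "integrable (\<nu> \<omega>) g"
proof -
  interpret prob_space "\<nu> \<omega>" using nu_prob assms(1) .
  obtain B where "\<And>x. x \<in> X \<omega> \<Longrightarrow> \<bar>g x\<bar> \<le> B" using assms(2) unfolding bdd_on_def by blast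
  then show ?thesis using assms nu_space
    by (intro integrable_const_bound[of _ B] AE_I2) auto
qed

lemma holder_integrable: "\<omega> \<in> W \<Longrightarrow> holder \<alpha> (X \<omega>) g \<Longrightarrow> integrable (\<nu> \<omega>) g"
  by (intro bdd_integrable holder_bdd holder_meas)

lemma nu_cong: "\<omega> \<in> W \<Longrightarrow> (\<And>x. x \<in> X \<omega> \<Longrightarrow> f x = g x) \<Longrightarrow> integral\<^sup>L (\<nu> \<omega>) f = integral\<^sup>L (\<nu> \<omega>) g"
  using nu_space by (intro Bochner_Integration.integral_cong) auto

lemma nu_mono:
  fixes f g :: "'x \<Rightarrow> real"
  assumes "\<omega> \<in> W" "integrable (\<nu> \<omega>) f" "integrable (\<nu> \<omega>) g" "\<And>x. x \<in> X \<omega> \<Longrightarrow> f x \<le> g x"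
  shows "integral\<^sup>L (\<nu> \<omega>) f \<le> integral\<^sup>L (\<nu> \<omega>) g"
  using assms(2,3) by (rule integral_mono) (use assms nu_space in auto)

lemma nu_const: "\<omega> \<in> W \<Longrightarrow> integral\<^sup>L (\<nu> \<omega>) (\<lambda>_. c) = (c::real)"
proof -
  assume "\<omega> \<in> W"
  then interpret prob_space "\<nu> \<omega>" by (rule nu_prob)
  show "integral\<^sup>L (\<nu> \<omega>) (\<lambda>_. c) = c" by (simp add: prob_space)
qed

abbreviation lm :: "'w \<Rightarrow> real" where "lm \<equiv> lam \<theta> L \<nu>"

lemma lm_pos:
  assumes w: "\<omega> \<in> W"
  shows "0 < lm \<omega>"
proof -
  have w': "\<theta> \<omega> \<in> W" using w by (rule th_in)
  obtain x0 where x0: "x0 \<in> X (\<theta> \<omega>)" using fib_ne[OF w'] by blast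
  have pos: "0 < L \<omega> (\<lambda>_. 1) x0" using w x0 by (intro L_pos bdd_on_const) auto
  have int: "integrable (\<nu> (\<theta> \<omega>)) (L \<omega> (\<lambda>_. 1))"
    by (intro holder_integrable w' holder_L w holder_const)
  have "L \<omega> (\<lambda>_. 1) x0 / b \<omega> = integral\<^sup>L (\<nu> (\<theta> \<omega>)) (\<lambda>_. L \<omega> (\<lambda>_. 1) x0 / b \<omega>)"
    using nu_const[OF w'] by simp
  also have "\<dots> \<le> lm \<omega>"
    unfolding lam_def
  proof (rule nu_mono[OF w' _ int])
    show "integrable (\<nu> (\<theta> \<omega>)) (\<lambda>_. L \<omega> (\<lambda>_. 1) x0 / b \<omega>)"
      by (intro holder_integrable w' holder_const)
    show "L \<omega> (\<lambda>_. 1) x0 / b \<omega> \<le> L \<omega> (\<lambda>_. 1) x" if "x \<in> X (\<theta> \<omega>)" for x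
      using cone_ratio[OF w cone_one[OF w] x0 that] b_ge[OF w] by (simp add: divide_le_eq mult.commute)
  qed
  finally show ?thesis using pos b_ge[OF w] by (smt (verit) divide_pos_pos)
qed

text \<open>The limits defining \<nu> over \<theta> \<omega> at \<open>L \<omega> g\<close> and at
  \<open>L \<omega> 1\<close> have the same denominators; in their quotient these cancel, which
  leaves the sequence defining \<nu> over \<omega>, shifted by one step.\<close>

lemma conformal_holder:
  assumes w: "\<omega> \<in> W" and g: "holder \<alpha> (X \<omega>) g"
  shows "integral\<^sup>L (\<nu> (\<theta> \<omega>)) (L \<omega> g) = lm \<omega> * integral\<^sup>L (\<nu> \<omega>) g"
proof -
  have w': "\<theta> \<omega> \<in> W" using w by (rule th_in)
  have "\<exists>x. x \<in> X ((\<theta> ^^ n) \<omega>)" for n using fib_ne[OF funpow_th_in[OF w]] by blast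
  then obtain xs where xs: "\<And>n. xs n \<in> X ((\<theta> ^^ n) \<omega>)" by metis
  have xs': "xs (Suc n) \<in> X ((\<theta> ^^ n) (\<theta> \<omega>))" for n using xs[of "Suc n"] by (simp add: funpow_swap1)
  let ?P = "\<lambda>n f. Lpow \<theta> L n (\<theta> \<omega>) f (xs (Suc n))"
  have one_ne: "?P n (\<lambda>_. 1) \<noteq> 0" for n
    using Lpow_pos[OF w' bdd_on_const _ xs', of 1 n] by auto
  have "(\<lambda>n. (?P n (L \<omega> g) / ?P n (\<lambda>_. 1)) / (?P n (L \<omega> (\<lambda>_. 1)) / ?P n (\<lambda>_. 1)))
      \<longlonglongrightarrow> integral\<^sup>L (\<nu> (\<theta> \<omega>)) (L \<omega> g) / lm \<omega>"
    unfolding lam_def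
    by (intro tendsto_divide nu_lim w' holder_L w g holder_const xs')
      (use lm_pos[OF w] in \<open>simp add: lam_def\<close>)
  then have "(\<lambda>n. ?P n (L \<omega> g) / ?P n (L \<omega> (\<lambda>_. 1))) \<longlonglongrightarrow> integral\<^sup>L (\<nu> (\<theta> \<omega>)) (L \<omega> g) / lm \<omega>"
    using one_ne by simp
  moreover have "(\<lambda>n. ?P n (L \<omega> g) / ?P n (L \<omega> (\<lambda>_. 1))) \<longlonglongrightarrow> integral\<^sup>L (\<nu> \<omega>) g"
    using LIMSEQ_Suc[OF nu_lim[OF w g xs]] unfolding Lpow_Suc_shift .
  ultimately have "integral\<^sup>L (\<nu> (\<theta> \<omega>)) (L \<omega> g) / lm \<omega> = integral\<^sup>L (\<nu> \<omega>) g"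
    by (rule LIMSEQ_unique)
  then show ?thesis using lm_pos[OF w] by (simp add: field_simps)
qed

lemma y_measurable:
  assumes w: "\<omega> \<in> W" and i: "i \<in> I \<omega>"
  shows "y \<omega> i \<in> measurable (\<nu> (\<theta> \<omega>)) (\<nu> \<omega>)"
proof -
  have "y \<omega> i \<in> measurable (restrict_space borel (X (\<theta> \<omega>))) borel"
    using y_cont[OF w i] by (rule borel_measurable_continuous_on_restrict)
  then have "y \<omega> i \<in> measurable (restrict_space borel (X (\<theta> \<omega>))) (restrict_space borel (X \<omega>))"
    using y_in[OF w i] by (intro measurable_restrict_space2) (auto simp: space_restrict_space)
  then show ?thesis
    by (subst measurable_cong_sets[OF nu_sets[OF th_in[OF w]] nu_sets[OF w]])
qed

lemma exp_phi_measurable: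
  assumes w: "\<omega> \<in> W" and i: "i \<in> I \<omega>"
  shows "(\<lambda>x. exp (\<phi> \<omega> (y \<omega> i x))) \<in> borel_measurable (\<nu> (\<theta> \<omega>))"
proof -
  have "(\<lambda>x. exp (\<phi> \<omega> (y \<omega> i x))) \<in> measurable (restrict_space borel (X (\<theta> \<omega>))) borel"
    using phi_cont[OF w i] by (intro borel_measurable_continuous_on_restrict continuous_intros)
  then show ?thesis by (subst measurable_cong_sets[OF nu_sets[OF th_in[OF w]] refl])
qed

text \<open>Both sides of the identity below are finite Borel measures in \<open>g\<close>, so it is enough to know it
  for Lipschitz \<open>g\<close>, where it is the conformality of \<open>\<nu>\<close>.\<close>

lemma conformal_nn:
  assumes w: "\<omega> \<in> W" and g: "g \<in> borel_measurable (\<nu> \<omega>)" "bdd_on \<omega> g" "\<And>x. x \<in> X \<omega> \<Longrightarrow> 0 \<le> g x"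
  shows "(\<lambda>x. ennreal (L \<omega> g x)) \<in> borel_measurable (\<nu> (\<theta> \<omega>))"
    and "(\<integral>\<^sup>+x. ennreal (L \<omega> g x) \<partial>\<nu> (\<theta> \<omega>)) = ennreal (lm \<omega>) * (\<integral>\<^sup>+x. ennreal (g x) \<partial>\<nu> \<omega>)"
proof -
  have w': "\<theta> \<omega> \<in> W" using w by (rule th_in)
  interpret N: prob_space "\<nu> \<omega>" using nu_prob w .
  interpret N': prob_space "\<nu> (\<theta> \<omega>)" using nu_prob w' .
  interpret CI: sigma_finite_measure "count_space (I \<omega>)"
    by (rule sigma_finite_measure_count_space_countable) auto
  interpret P: pair_sigma_finite "count_space (I \<omega>)" "\<nu> (\<theta> \<omega>)" ..
  let ?Q = "count_space (I \<omega>) \<Otimes>\<^sub>M \<nu> (\<theta> \<omega>)"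
  have my: "(\<lambda>(i, x). y \<omega> i x) \<in> measurable ?Q (\<nu> \<omega>)"
    by (rule measurable_pair_measure_countable1) (use y_measurable[OF w] in auto)
  have me: "(\<lambda>(i, x). ennreal (exp (\<phi> \<omega> (y \<omega> i x)))) \<in> borel_measurable ?Q"
    by (rule measurable_pair_measure_countable1) (use exp_phi_measurable[OF w] in auto)
  \<comment> \<open>The dual operator applied to the measure over \<theta> \<omega>: each branch
    carries a weighted copy of it to the fibre over \<omega>.\<close>
  define M where "M = distr (density ?Q (\<lambda>(i, x). ennreal (exp (\<phi> \<omega> (y \<omega> i x))))) (\<nu> \<omega>) (\<lambda>(i, x). y \<omega> i x)"
  have meas: "(\<lambda>x. ennreal (L \<omega> g x)) \<in> borel_measurable (\<nu> (\<theta> \<omega>))"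
    and int: "(\<integral>\<^sup>+x. ennreal (g x) \<partial>M) = (\<integral>\<^sup>+x. ennreal (L \<omega> g x) \<partial>\<nu> (\<theta> \<omega>))"
    if g: "g \<in> borel_measurable (\<nu> \<omega>)" "bdd_on \<omega> g" "\<And>x. x \<in> X \<omega> \<Longrightarrow> 0 \<le> g x" for g
  proof -
    have gy: "(\<lambda>p. ennreal (g (case p of (i, x) \<Rightarrow> y \<omega> i x))) \<in> borel_measurable ?Q"
      using measurable_compose[OF my g(1)] by measurable
    have f: "(\<lambda>(i, x). ennreal (exp (\<phi> \<omega> (y \<omega> i x)) * g (y \<omega> i x))) \<in> borel_measurable ?Q"
    proof (rule measurable_pair_measure_countable1)
      fix i assume i: "i \<in> I \<omega>"
      show "(\<lambda>x. case (i, x) of (i, x) \<Rightarrow> ennreal (exp (\<phi> \<omega> (y \<omega> i x)) * g (y \<omega> i x))) \<in> borel_measurable (\<nu> (\<theta> \<omega>))"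
        using exp_phi_measurable[OF w i] measurable_compose[OF y_measurable[OF w i] g(1)] by simp
    qed auto
    have eq: "ennreal (L \<omega> g x) = (\<integral>\<^sup>+i. (case (i, x) of (i, x) \<Rightarrow> ennreal (exp (\<phi> \<omega> (y \<omega> i x)) * g (y \<omega> i x))) \<partial>count_space (I \<omega>))"
      if "x \<in> space (\<nu> (\<theta> \<omega>))" for x
      using L_nn_integral[OF w g(2) _ g(3)] that nu_space[OF w'] by simp
    have "(\<lambda>x. \<integral>\<^sup>+i. (case (i, x) of (i, x) \<Rightarrow> ennreal (exp (\<phi> \<omega> (y \<omega> i x)) * g (y \<omega> i x))) \<partial>count_space (I \<omega>))
        \<in> borel_measurable (\<nu> (\<theta> \<omega>))"
      using CI.borel_measurable_nn_integral_fst[OF measurable_pair_swap[OF f]] by simp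
    then show "(\<lambda>x. ennreal (L \<omega> g x)) \<in> borel_measurable (\<nu> (\<theta> \<omega>))"
      by (simp cong: measurable_cong add: eq)
    have "(\<integral>\<^sup>+x. ennreal (g x) \<partial>M) = (\<integral>\<^sup>+p. (case p of (i, x) \<Rightarrow> ennreal (exp (\<phi> \<omega> (y \<omega> i x))))
        * ennreal (g (case p of (i, x) \<Rightarrow> y \<omega> i x)) \<partial>?Q)"
      unfolding M_def using g my me gy
      by (subst nn_integral_distr) (auto simp: nn_integral_density)
    also have "\<dots> = (\<integral>\<^sup>+p. (case p of (i, x) \<Rightarrow> ennreal (exp (\<phi> \<omega> (y \<omega> i x)) * g (y \<omega> i x))) \<partial>?Q)"
      by (intro nn_integral_cong) (auto simp: ennreal_mult')
    also have "\<dots> = (\<integral>\<^sup>+x. (\<integral>\<^sup>+i. (case (i, x) of (i, x) \<Rightarrow> ennreal (exp (\<phi> \<omega> (y \<omega> i x)) * g (y \<omega> i x))) \<partial>count_space (I \<omega>)) \<partial>\<nu> (\<theta> \<omega>))"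
      by (rule P.nn_integral_snd[symmetric, OF f])
    also have "\<dots> = (\<integral>\<^sup>+x. ennreal (L \<omega> g x) \<partial>\<nu> (\<theta> \<omega>))"
      by (intro nn_integral_cong) (simp only: eq)
    finally show "(\<integral>\<^sup>+x. ennreal (g x) \<partial>M) = (\<integral>\<^sup>+x. ennreal (L \<omega> g x) \<partial>\<nu> (\<theta> \<omega>))" .
  qed
  have holder_case: "(\<integral>\<^sup>+x. ennreal (g x) \<partial>M) = ennreal (lm \<omega>) * (\<integral>\<^sup>+x. ennreal (g x) \<partial>\<nu> \<omega>)"
    if g: "holder \<alpha> (X \<omega>) g" "\<And>x. x \<in> X \<omega> \<Longrightarrow> 0 \<le> g x" for g
  proof -
    have "(\<integral>\<^sup>+x. ennreal (g x) \<partial>M) = (\<integral>\<^sup>+x. ennreal (L \<omega> g x) \<partial>\<nu> (\<theta> \<omega>))"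
      by (intro int holder_meas w holder_bdd g)
    also have "\<dots> = ennreal (integral\<^sup>L (\<nu> (\<theta> \<omega>)) (L \<omega> g))"
      by (intro nn_integral_eq_integral holder_integrable w' holder_L w g AE_I2 L_nonneg)
    also have "\<dots> = ennreal (lm \<omega>) * ennreal (integral\<^sup>L (\<nu> \<omega>) g)"
      using lm_pos[OF w] by (simp add: conformal_holder[OF w g(1)] ennreal_mult')
    also have "ennreal (integral\<^sup>L (\<nu> \<omega>) g) = (\<integral>\<^sup>+x. ennreal (g x) \<partial>\<nu> \<omega>)"
      using g nu_space[OF w] by (intro nn_integral_eq_integral[symmetric] holder_integrable w AE_I2) auto
    finally show ?thesis .
  qed
  have "M = scale_measure (ennreal (lm \<omega>)) (\<nu> \<omega>)"
  proof (rule finite_measures_eq_of_lipschitz[OF compact_fib[OF w]])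
    have one: "(\<integral>\<^sup>+x. 1 \<partial>M) = ennreal (lm \<omega>)"
      using holder_case[OF holder_const, of 1] N.emeasure_space_1 by simp
    then show "finite_measure M" by (intro finite_measureI) simp
    show "finite_measure (scale_measure (ennreal (lm \<omega>)) (\<nu> \<omega>))"
      by (intro finite_measureI) (simp add: N.emeasure_space_1 ennreal_mult_eq_top_iff)
    show "sets M = sets (restrict_space borel (X \<omega>))" by (simp add: M_def nu_sets[OF w])
    show "sets (scale_measure (ennreal (lm \<omega>)) (\<nu> \<omega>)) = sets (restrict_space borel (X \<omega>))"
      by (simp add: nu_sets[OF w])
    fix g :: "'x \<Rightarrow> real" and c
    assume lip: "\<And>x x'. \<bar>g x - g x'\<bar> \<le> c * dist x x'" and bd: "\<And>x. 0 \<le> g x \<and> g x \<le> 1"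
    have h: "holder \<alpha> (X \<omega>) g"
    proof (rule holderI[of _ _ 1 "\<bar>c\<bar>"])
      show "\<bar>g x - g x'\<bar> \<le> \<bar>c\<bar> * dist x x' powr \<alpha>" if "x \<in> X \<omega>" "x' \<in> X \<omega>" for x x'
      proof -
        have "dist x x' \<le> dist x x' powr \<alpha>"
          using powr_mono'[of \<alpha> 1 "dist x x'"] alpha diam[OF w that] by (cases "x = x'") auto
        then have "\<bar>c\<bar> * dist x x' \<le> \<bar>c\<bar> * dist x x' powr \<alpha>" by (intro mult_left_mono) auto
        moreover have "c * dist x x' \<le> \<bar>c\<bar> * dist x x'" by (intro mult_right_mono) auto
        ultimately show ?thesis using lip[of x x'] by linarith
      qed
    qed (use bd in auto)
    show "(\<integral>\<^sup>+x. ennreal (g x) \<partial>M) = (\<integral>\<^sup>+x. ennreal (g x) \<partial>scale_measure (ennreal (lm \<omega>)) (\<nu> \<omega>))"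
      using holder_case[OF h] bd holder_meas[OF w h] by (subst nn_integral_scale_measure) auto
  qed
  then show "(\<integral>\<^sup>+x. ennreal (L \<omega> g x) \<partial>\<nu> (\<theta> \<omega>)) = ennreal (lm \<omega>) * (\<integral>\<^sup>+x. ennreal (g x) \<partial>\<nu> \<omega>)"
    using int[OF g] g(1) by (simp add: nn_integral_scale_measure)
  show "(\<lambda>x. ennreal (L \<omega> g x)) \<in> borel_measurable (\<nu> (\<theta> \<omega>))" by (rule meas[OF g])
qed

text \<open>Adding a constant reduces the claim to nonnegative functions. Bounded measurable
  functions have to be covered, since a test function composed with \<open>T\<close> has no
  regularity.\<close>

lemma conformal:
  assumes w: "\<omega> \<in> W" and g: "g \<in> borel_measurable (\<nu> \<omega>)" "bdd_on \<omega> g"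
  shows "L \<omega> g \<in> borel_measurable (\<nu> (\<theta> \<omega>))"
    and "integral\<^sup>L (\<nu> (\<theta> \<omega>)) (L \<omega> g) = lm \<omega> * integral\<^sup>L (\<nu> \<omega>) g"
proof -
  have w': "\<theta> \<omega> \<in> W" using w by (rule th_in)
  have nonneg: "L \<omega> g \<in> borel_measurable (\<nu> (\<theta> \<omega>)) \<and> integral\<^sup>L (\<nu> (\<theta> \<omega>)) (L \<omega> g) = lm \<omega> * integral\<^sup>L (\<nu> \<omega>) g"
    if g: "g \<in> borel_measurable (\<nu> \<omega>)" "bdd_on \<omega> g" "\<And>x. x \<in> X \<omega> \<Longrightarrow> 0 \<le> g x" for g
  proof
    have "(\<lambda>x. enn2real (ennreal (L \<omega> g x))) \<in> borel_measurable (\<nu> (\<theta> \<omega>))"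
      using conformal_nn(1)[OF w g] by (rule measurable_compose) measurable
    then show m: "L \<omega> g \<in> borel_measurable (\<nu> (\<theta> \<omega>))" using L_nonneg[OF g(3)] by simp
    have "integral\<^sup>L (\<nu> (\<theta> \<omega>)) (L \<omega> g) = enn2real (\<integral>\<^sup>+x. ennreal (L \<omega> g x) \<partial>\<nu> (\<theta> \<omega>))"
      by (intro integral_eq_nn_integral m AE_I2 L_nonneg g)
    also have "\<dots> = lm \<omega> * enn2real (\<integral>\<^sup>+x. ennreal (g x) \<partial>\<nu> \<omega>)"
      using lm_pos[OF w] by (simp add: conformal_nn(2)[OF w g] enn2real_mult)
    also have "enn2real (\<integral>\<^sup>+x. ennreal (g x) \<partial>\<nu> \<omega>) = integral\<^sup>L (\<nu> \<omega>) g"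
      using g nu_space[OF w] by (intro integral_eq_nn_integral[symmetric] AE_I2) auto
    finally show "integral\<^sup>L (\<nu> (\<theta> \<omega>)) (L \<omega> g) = lm \<omega> * integral\<^sup>L (\<nu> \<omega>) g" .
  qed
  obtain B where B: "\<And>x. x \<in> X \<omega> \<Longrightarrow> \<bar>g x\<bar> \<le> B" using g(2) unfolding bdd_on_def by blast
  obtain x0 where "x0 \<in> X \<omega>" using fib_ne[OF w] by blast
  then have B0: "0 \<le> B" using B[of x0] by linarith
  have gB: "(\<lambda>x. g x + B) \<in> borel_measurable (\<nu> \<omega>)" "bdd_on \<omega> (\<lambda>x. g x + B)"
    using g by (auto intro: bdd_on_add bdd_on_const)
  have gB0: "0 \<le> g x + B" if "x \<in> X \<omega>" for x using B[OF that] by linarith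
  note 1 = nonneg[OF gB gB0]
  note 2 = nonneg[OF _ bdd_on_const B0]
  have eq: "L \<omega> g x = L \<omega> (\<lambda>x. g x + B) x - L \<omega> (\<lambda>_. B) x" if "x \<in> X (\<theta> \<omega>)" for x
    using L_add[OF w g(2) bdd_on_const that] by simp
  have "(\<lambda>x. L \<omega> (\<lambda>x. g x + B) x - L \<omega> (\<lambda>_. B) x) \<in> borel_measurable (\<nu> (\<theta> \<omega>))"
    using 1 2 by (intro borel_measurable_diff) auto
  then show "L \<omega> g \<in> borel_measurable (\<nu> (\<theta> \<omega>))"
    using eq nu_space[OF w'] by (subst measurable_cong) auto
  have "integral\<^sup>L (\<nu> (\<theta> \<omega>)) (L \<omega> g) = integral\<^sup>L (\<nu> (\<theta> \<omega>)) (\<lambda>x. L \<omega> (\<lambda>x. g x + B) x - L \<omega> (\<lambda>_. B) x)"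
    by (intro nu_cong w' eq)
  also have "\<dots> = lm \<omega> * integral\<^sup>L (\<nu> \<omega>) (\<lambda>x. g x + B) - lm \<omega> * B"
    using 1 2 nu_const[OF w] by (subst Bochner_Integration.integral_diff)
      (auto intro!: bdd_integrable w' L_bdd w gB bdd_on_const)
  also have "integral\<^sup>L (\<nu> \<omega>) (\<lambda>x. g x + B) = integral\<^sup>L (\<nu> \<omega>) g + B"
    using nu_const[OF w] by (subst Bochner_Integration.integral_add)
      (auto intro!: bdd_integrable w g bdd_on_const)
  finally show "integral\<^sup>L (\<nu> (\<theta> \<omega>)) (L \<omega> g) = lm \<omega> * integral\<^sup>L (\<nu> \<omega>) g"
    by (simp add: algebra_simps)
qed

section \<open>The invariant density\<close>

lemma nu_mass: "\<omega> \<in> W \<Longrightarrow> Sigma_Algebra.measure (\<nu> \<omega>) (space (\<nu> \<omega>)) = 1"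
  by (rule prob_space.prob_space[OF nu_prob])

text \<open>The division makes integrals against \<nu> invariant, so cone elements of integral 1 are
  mapped to cone elements of integral 1.\<close>

definition Lt :: "'w \<Rightarrow> ('x \<Rightarrow> real) \<Rightarrow> 'x \<Rightarrow> real" where
  "Lt \<omega> f = (\<lambda>x. L \<omega> f x / lm \<omega>)"

lemma cone_Lt: "\<omega> \<in> W \<Longrightarrow> f \<in> C \<omega> \<Longrightarrow> Lt \<omega> f \<in> C (\<theta> \<omega>)"
  unfolding Lt_def using cone_scale[OF th_in cone_L, of \<omega> f "1 / lm \<omega>"] lm_pos[of \<omega>] by simp

lemma holder_Lt: "\<omega> \<in> W \<Longrightarrow> holder \<alpha> (X \<omega>) g \<Longrightarrow> holder \<alpha> (X (\<theta> \<omega>)) (Lt \<omega> g)"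
  unfolding Lt_def using holder_cmult[OF holder_L, of \<omega> g "1 / lm \<omega>"] by simp

lemma Lt_add:
  assumes "\<omega> \<in> W" "bdd_on \<omega> f" "bdd_on \<omega> g" "x \<in> X (\<theta> \<omega>)"
  shows "Lt \<omega> (\<lambda>x. f x + g x) x = Lt \<omega> f x + Lt \<omega> g x"
  unfolding Lt_def using L_add[OF assms] by (simp add: add_divide_distrib)

lemma Lt_diff:
  assumes "\<omega> \<in> W" "bdd_on \<omega> f" "bdd_on \<omega> g" "x \<in> X (\<theta> \<omega>)"
  shows "Lt \<omega> (\<lambda>x. f x - g x) x = Lt \<omega> f x - Lt \<omega> g x"
  unfolding Lt_def using L_diff[OF assms] by (simp add: diff_divide_distrib)

lemma Lt_cmult: "Lt \<omega> (\<lambda>x. c * f x) x = c * Lt \<omega> f x"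
  unfolding Lt_def by (simp add: L_cmult)

lemma Lt_minus: "Lt \<omega> (\<lambda>x. - f x) x = - Lt \<omega> f x"
  unfolding Lt_def by (simp add: L_minus)

lemma Lt_cong: "(\<And>z. z \<in> X \<omega> \<Longrightarrow> f z = g z) \<Longrightarrow> Lt \<omega> f x = Lt \<omega> g x"
  unfolding Lt_def using L_cong[of \<omega> f g x] by simp

lemma nu_Lt: "\<omega> \<in> W \<Longrightarrow> holder \<alpha> (X \<omega>) g \<Longrightarrow> integral\<^sup>L (\<nu> (\<theta> \<omega>)) (Lt \<omega> g) = integral\<^sup>L (\<nu> \<omega>) g"
  unfolding Lt_def using conformal_holder[of \<omega> g] lm_pos[of \<omega>] by simp

lemma Lt_ratio:
  assumes "\<omega> \<in> W" "f \<in> C \<omega>" "x \<in> X (\<theta> \<omega>)" "x' \<in> X (\<theta> \<omega>)"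
  shows "Lt \<omega> f x \<le> b \<omega> * Lt \<omega> f x'"
  unfolding Lt_def using cone_ratio[OF assms] lm_pos[OF assms(1)]
  by (simp add: divide_le_cancel)

text \<open>Integrate the ratio bound over one of its two points; the integral of
  \<open>Lt \<omega> f\<close> over the next fibre is that of \<open>f\<close>.\<close>

lemma Lt_le_nu:
  assumes "\<omega> \<in> W" "f \<in> C \<omega>" "x \<in> X (\<theta> \<omega>)"
  shows "Lt \<omega> f x \<le> b \<omega> * integral\<^sup>L (\<nu> \<omega>) f" "integral\<^sup>L (\<nu> \<omega>) f \<le> b \<omega> * Lt \<omega> f x"
proof -
  have w': "\<theta> \<omega> \<in> W" by (rule th_in) fact
  have int: "integrable (\<nu> (\<theta> \<omega>)) (Lt \<omega> f)"
    by (intro holder_integrable w' cone_holder cone_Lt assms)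
  have c: "integrable (\<nu> (\<theta> \<omega>)) (\<lambda>_. c)" for c :: real
    by (intro holder_integrable w' holder_const)
  have nu: "integral\<^sup>L (\<nu> (\<theta> \<omega>)) (Lt \<omega> f) = integral\<^sup>L (\<nu> \<omega>) f"
    by (intro nu_Lt cone_holder assms)
  have "integral\<^sup>L (\<nu> (\<theta> \<omega>)) (\<lambda>_. Lt \<omega> f x) \<le> integral\<^sup>L (\<nu> (\<theta> \<omega>)) (\<lambda>x. b \<omega> * Lt \<omega> f x)"
    using int by (intro nu_mono w' c Lt_ratio assms integrable_mult_right)
  then show "Lt \<omega> f x \<le> b \<omega> * integral\<^sup>L (\<nu> \<omega>) f"
    using nu_mass[OF w'] nu by simp
  have "integral\<^sup>L (\<nu> (\<theta> \<omega>)) (Lt \<omega> f) \<le> integral\<^sup>L (\<nu> (\<theta> \<omega>)) (\<lambda>_. b \<omega> * Lt \<omega> f x)"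
    by (intro nu_mono w' c int Lt_ratio assms)
  then show "integral\<^sup>L (\<nu> \<omega>) f \<le> b \<omega> * Lt \<omega> f x"
    using nu_mass[OF w'] nu by simp
qed

lemma nu_cone_nonneg: "\<omega> \<in> W \<Longrightarrow> f \<in> C \<omega> \<Longrightarrow> 0 \<le> integral\<^sup>L (\<nu> \<omega>) f"
  using cone_nonneg nu_space by (intro integral_nonneg_AE AE_I2) auto

text \<open>A Doeblin minorisation in the cone order: the image of \<open>f\<close> contains the
  share \<open>\<kappa> \<omega>\<close> of its mass in the form of the image of any normalised
  \<open>f'\<close>. By \<open>Lt_le_nu\<close> the images satisfy the pointwise inequality that
  \<open>cone_contract\<close> asks for.\<close>

lemma cone_Lt_contract:
  assumes w: "\<omega> \<in> W" and f: "f \<in> C \<omega>" and f': "f' \<in> C \<omega>" "integral\<^sup>L (\<nu> \<omega>) f' = 1"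
  shows "(\<lambda>z. Lt \<omega> f z - \<kappa> \<omega> * integral\<^sup>L (\<nu> \<omega>) f * Lt \<omega> f' z) \<in> C (\<theta> \<omega>)"
proof -
  define t where "t = \<kappa> \<omega> * integral\<^sup>L (\<nu> \<omega>) f"
  have t: "0 \<le> t"
    unfolding t_def using kappa_pos[OF w] nu_cone_nonneg[OF w f] by simp
  have "t * L \<omega> f' z \<le> \<kappa>\<^sub>0 \<omega> * L \<omega> f z" if z: "z \<in> X (\<theta> \<omega>)" for z
  proof -
    have b: "0 < b \<omega>" using b_ge[OF w] by simp
    have "integral\<^sup>L (\<nu> \<omega>) f * Lt \<omega> f' z \<le> (b \<omega> * Lt \<omega> f z) * b \<omega>"
      using Lt_le_nu(1)[OF w f'(1) z] Lt_le_nu(2)[OF w f z] f'(2)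
        cone_nonneg[OF th_in[OF w] cone_Lt[OF w f'(1)] z] nu_cone_nonneg[OF w f]
        cone_nonneg[OF th_in[OF w] cone_Lt[OF w f] z] b
      by (intro mult_mono) auto
    then have "\<kappa> \<omega> * (integral\<^sup>L (\<nu> \<omega>) f * Lt \<omega> f' z) \<le> \<kappa> \<omega> * ((b \<omega> * Lt \<omega> f z) * b \<omega>)"
      using kappa_pos[OF w] by (intro mult_left_mono) auto
    also have "\<dots> = \<kappa>\<^sub>0 \<omega> * Lt \<omega> f z"
      using b by (simp add: \<kappa>_def power2_eq_square)
    finally have "t * Lt \<omega> f' z \<le> \<kappa>\<^sub>0 \<omega> * Lt \<omega> f z" by (simp add: t_def mult.assoc)
    then show ?thesis
      using lm_pos[OF w] by (simp add: Lt_def divide_le_cancel)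
  qed
  then have "(\<lambda>z. L \<omega> f z - t * L \<omega> f' z) \<in> C (\<theta> \<omega>)"
    using t by (intro cone_contract w f f') auto
  then have "(\<lambda>z. 1 / lm \<omega> * (L \<omega> f z - t * L \<omega> f' z)) \<in> C (\<theta> \<omega>)"
    using lm_pos[OF w] by (intro cone_scale th_in w) auto
  then show ?thesis
    by (simp add: Lt_def t_def diff_divide_distrib)
qed

text \<open>\<open>It n \<omega>\<close> is the normalised \<open>n\<close>-step operator which ends, rather than starts, over \<open>\<omega>\<close>.\<close>

primrec It :: "nat \<Rightarrow> 'w \<Rightarrow> ('x \<Rightarrow> real) \<Rightarrow> 'x \<Rightarrow> real" where
  "It 0 \<omega> f = f"
| "It (Suc n) \<omega> f = Lt (\<theta>i \<omega>) (It n (\<theta>i \<omega>) f)"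

text \<open>The share of mass still uncoupled after \<open>n\<close> steps. The operator that ends
  over \<omega> uses the rates at the points 1 to \<open>n\<close> steps back, hence
  \<open>Suc j\<close>.\<close>

definition \<beta> :: "nat \<Rightarrow> 'w \<Rightarrow> real" where
  "\<beta> n \<omega> = (\<Prod>j<n. 1 - \<kappa> ((\<theta>i ^^ Suc j) \<omega>))"

lemma beta_Suc: "\<beta> (Suc n) \<omega> = (1 - \<kappa> (\<theta>i \<omega>)) * \<beta> n (\<theta>i \<omega>)"
  unfolding \<beta>_def by (subst prod.lessThan_Suc_shift) (simp add: funpow_swap1)

lemma beta_nonneg: "\<omega> \<in> W \<Longrightarrow> 0 \<le> \<beta> n \<omega>"
  unfolding \<beta>_def using kappa_le_one[OF funpow_thi_in[of \<omega> "Suc _"]] by (intro prod_nonneg) auto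

lemma beta_tendsto: "\<omega> \<in> W \<Longrightarrow> (\<lambda>n. \<beta> n \<omega>) \<longlonglongrightarrow> 0"
  unfolding \<beta>_def \<kappa>_def by (rule contraction)

lemma It_cone: "\<omega> \<in> W \<Longrightarrow> f \<in> C ((\<theta>i ^^ n) \<omega>) \<Longrightarrow> It n \<omega> f \<in> C \<omega>"
proof (induction n arbitrary: \<omega>)
  case (Suc n)
  then have "It n (\<theta>i \<omega>) f \<in> C (\<theta>i \<omega>)" by (intro Suc.IH thi_in) (auto simp: funpow_swap1)
  then show ?case using cone_Lt[OF thi_in[OF Suc.prems(1)]] Suc.prems(1) by simp
qed simp

lemma It_nu: "\<omega> \<in> W \<Longrightarrow> f \<in> C ((\<theta>i ^^ n) \<omega>) \<Longrightarrow>
    integral\<^sup>L (\<nu> \<omega>) (It n \<omega> f) = integral\<^sup>L (\<nu> ((\<theta>i ^^ n) \<omega>)) f"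
proof (induction n arbitrary: \<omega>)
  case (Suc n)
  have f: "f \<in> C ((\<theta>i ^^ n) (\<theta>i \<omega>))" using Suc.prems by (simp add: funpow_swap1)
  have w: "\<theta>i \<omega> \<in> W" using Suc.prems(1) by (rule thi_in)
  have "integral\<^sup>L (\<nu> \<omega>) (It (Suc n) \<omega> f) = integral\<^sup>L (\<nu> (\<theta>i \<omega>)) (It n (\<theta>i \<omega>) f)"
    using nu_Lt[OF w cone_holder[OF w It_cone[OF w f]]] Suc.prems(1) by simp
  also have "\<dots> = integral\<^sup>L (\<nu> ((\<theta>i ^^ n) (\<theta>i \<omega>))) f" by (rule Suc.IH[OF w f])
  finally show ?case by (simp add: funpow_swap1)
qed simp

text \<open>Coupling by induction: the part of the image of \<open>f\<close> not yet accounted for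
  by the image of \<open>f'\<close> is a cone element, to which the minorisation applies
  again.\<close>

lemma It_contract: "\<omega> \<in> W \<Longrightarrow> f \<in> C ((\<theta>i ^^ n) \<omega>) \<Longrightarrow> f' \<in> C ((\<theta>i ^^ n) \<omega>) \<Longrightarrow>
    integral\<^sup>L (\<nu> ((\<theta>i ^^ n) \<omega>)) f = 1 \<Longrightarrow> integral\<^sup>L (\<nu> ((\<theta>i ^^ n) \<omega>)) f' = 1 \<Longrightarrow>
    (\<lambda>x. It n \<omega> f x - (1 - \<beta> n \<omega>) * It n \<omega> f' x) \<in> C \<omega>"
proof (induction n arbitrary: \<omega>)
  case 0
  then show ?case by (simp add: \<beta>_def)
next
  case (Suc n)
  have w: "\<theta>i \<omega> \<in> W" using Suc.prems(1) by (rule thi_in)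
  have f: "f \<in> C ((\<theta>i ^^ n) (\<theta>i \<omega>))" "f' \<in> C ((\<theta>i ^^ n) (\<theta>i \<omega>))"
    "integral\<^sup>L (\<nu> ((\<theta>i ^^ n) (\<theta>i \<omega>))) f = 1" "integral\<^sup>L (\<nu> ((\<theta>i ^^ n) (\<theta>i \<omega>))) f' = 1"
    using Suc.prems by (simp_all add: funpow_swap1)
  let ?p = "It n (\<theta>i \<omega>) f" and ?p' = "It n (\<theta>i \<omega>) f'" and ?\<beta> = "\<beta> n (\<theta>i \<omega>)"
  have p: "?p \<in> C (\<theta>i \<omega>)" "?p' \<in> C (\<theta>i \<omega>)" using f w by (auto intro: It_cone)
  have np: "integral\<^sup>L (\<nu> (\<theta>i \<omega>)) ?p = 1" "integral\<^sup>L (\<nu> (\<theta>i \<omega>)) ?p' = 1"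
    using f w by (simp_all add: It_nu)
  \<comment> \<open>The uncoupled remainder. It has mass \<open>?\<beta>\<close>, of which the next
    step couples the fraction \<open>\<kappa>\<close>.\<close>
  define g where "g = (\<lambda>x. ?p x - (1 - ?\<beta>) * ?p' x)"
  have g: "g \<in> C (\<theta>i \<omega>)" unfolding g_def by (rule Suc.IH[OF w f])
  have hp: "holder \<alpha> (X (\<theta>i \<omega>)) ?p" "holder \<alpha> (X (\<theta>i \<omega>)) ?p'"
    using p w by (auto intro: cone_holder)
  have ng: "integral\<^sup>L (\<nu> (\<theta>i \<omega>)) g = ?\<beta>"
    unfolding g_def using hp w np
    by (subst Bochner_Integration.integral_diff) (auto intro!: holder_integrable holder_cmult)
  have "(\<lambda>z. Lt (\<theta>i \<omega>) g z - \<kappa> (\<theta>i \<omega>) * integral\<^sup>L (\<nu> (\<theta>i \<omega>)) g * Lt (\<theta>i \<omega>) ?p' z) \<in> C (\<theta> (\<theta>i \<omega>))"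
    by (rule cone_Lt_contract[OF w g p(2) np(2)])
  then have *: "(\<lambda>z. Lt (\<theta>i \<omega>) g z - \<kappa> (\<theta>i \<omega>) * ?\<beta> * Lt (\<theta>i \<omega>) ?p' z) \<in> C \<omega>"
    using ng Suc.prems(1) by simp
  show ?case
  proof (rule cone_cong[OF Suc.prems(1) *])
    fix x assume x: "x \<in> X \<omega>"
    have "Lt (\<theta>i \<omega>) g x = Lt (\<theta>i \<omega>) ?p x - (1 - ?\<beta>) * Lt (\<theta>i \<omega>) ?p' x"
      unfolding g_def using hp x Suc.prems(1) w
      by (subst Lt_diff) (auto simp: Lt_cmult intro: holder_bdd holder_cmult)
    then show "Lt (\<theta>i \<omega>) g x - \<kappa> (\<theta>i \<omega>) * ?\<beta> * Lt (\<theta>i \<omega>) ?p' x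
        = It (Suc n) \<omega> f x - (1 - \<beta> (Suc n) \<omega>) * It (Suc n) \<omega> f' x"
      by (simp add: beta_Suc algebra_simps)
  qed
qed

lemma It_add: "It (n + k) \<omega> f = It n \<omega> (It k ((\<theta>i ^^ n) \<omega>) f)"
  by (induction n arbitrary: \<omega>) (simp_all add: funpow_swap1)

text \<open>Removing the coupled part leaves at most \<open>\<beta>\<close> times the other image,
  and the last operator bounds a normalised image by \<open>b\<close>. At least one step is needed
  for that bound, hence \<open>Suc n\<close>.\<close>

lemma It_close:
  assumes w: "\<omega> \<in> W" and f: "f \<in> C ((\<theta>i ^^ Suc n) \<omega>)" "f' \<in> C ((\<theta>i ^^ Suc n) \<omega>)"
    "integral\<^sup>L (\<nu> ((\<theta>i ^^ Suc n) \<omega>)) f = 1" "integral\<^sup>L (\<nu> ((\<theta>i ^^ Suc n) \<omega>)) f' = 1"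
    and x: "x \<in> X \<omega>"
  shows "\<bar>It (Suc n) \<omega> f x - It (Suc n) \<omega> f' x\<bar> \<le> \<beta> (Suc n) \<omega> * b (\<theta>i \<omega>)"
proof -
  have one: "It (Suc n) \<omega> f' x - It (Suc n) \<omega> f x \<le> \<beta> (Suc n) \<omega> * b (\<theta>i \<omega>)"
    if f: "f \<in> C ((\<theta>i ^^ Suc n) \<omega>)" "f' \<in> C ((\<theta>i ^^ Suc n) \<omega>)"
      "integral\<^sup>L (\<nu> ((\<theta>i ^^ Suc n) \<omega>)) f = 1" "integral\<^sup>L (\<nu> ((\<theta>i ^^ Suc n) \<omega>)) f' = 1" for f f'
  proof -
    have w': "\<theta>i \<omega> \<in> W" using w by (rule thi_in)
    have "0 \<le> It (Suc n) \<omega> f x - (1 - \<beta> (Suc n) \<omega>) * It (Suc n) \<omega> f' x"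
      by (rule cone_nonneg[OF w It_contract[OF w f] x])
    moreover have "It (Suc n) \<omega> f' x \<le> b (\<theta>i \<omega>)"
    proof -
      have f'': "f' \<in> C ((\<theta>i ^^ n) (\<theta>i \<omega>))" using f(2) by (simp add: funpow_swap1)
      have "integral\<^sup>L (\<nu> (\<theta>i \<omega>)) (It n (\<theta>i \<omega>) f') = 1"
        using It_nu[OF w' f''] f(4) by (simp add: funpow_swap1)
      then show ?thesis using Lt_le_nu(1)[OF w' It_cone[OF w' f'']] x w by simp
    qed
    then have "\<beta> (Suc n) \<omega> * It (Suc n) \<omega> f' x \<le> \<beta> (Suc n) \<omega> * b (\<theta>i \<omega>)"
      using beta_nonneg[OF w] by (rule mult_left_mono)
    ultimately show ?thesis by (simp add: algebra_simps)
  qed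
  show ?thesis using one[OF f] one[OF f(2,1,4,3)] by (simp add: abs_le_iff)
qed

abbreviation one :: "'x \<Rightarrow> real" where "one \<equiv> (\<lambda>_. 1)"

text \<open>Translates between operators indexed by the starting point and operators indexed by the
  end point; \<open>n\<close> steps back and \<open>n\<close> steps forward lead to \<omega>
  again.\<close>

lemma Lpow_eq_It:
  "\<omega> \<in> W \<Longrightarrow> Lpow \<theta> L n ((\<theta>i ^^ n) \<omega>) f x = lamprod \<theta> L \<nu> ((\<theta>i ^^ n) \<omega>) n * It n \<omega> f x"
proof (induction n arbitrary: \<omega> x)
  case (Suc n)
  have w: "\<theta>i \<omega> \<in> W" using Suc.prems by (rule thi_in)
  have shift: "(\<theta>i ^^ Suc n) \<omega> = (\<theta>i ^^ n) (\<theta>i \<omega>)" by (simp add: funpow_swap1)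
  have th_thi_n: "(\<theta> ^^ n) ((\<theta>i ^^ n) \<omega>') = \<omega>'" if "\<omega>' \<in> W" for \<omega>'
    using that
  proof (induction n)
    case (Suc m)
    have "(\<theta> ^^ Suc m) ((\<theta>i ^^ Suc m) \<omega>') = (\<theta> ^^ m) (\<theta> (\<theta>i ((\<theta>i ^^ m) \<omega>')))"
      by (simp add: funpow_swap1)
    then show ?case using Suc funpow_thi_in by simp
  qed simp
  have "Lpow \<theta> L n ((\<theta>i ^^ n) (\<theta>i \<omega>)) f = (\<lambda>x. lamprod \<theta> L \<nu> ((\<theta>i ^^ n) (\<theta>i \<omega>)) n * It n (\<theta>i \<omega>) f x)"
    using Suc.IH[OF w] by auto
  then have "Lpow \<theta> L (Suc n) ((\<theta>i ^^ Suc n) \<omega>) f x =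
      lamprod \<theta> L \<nu> ((\<theta>i ^^ n) (\<theta>i \<omega>)) n * L (\<theta>i \<omega>) (It n (\<theta>i \<omega>) f) x"
    unfolding shift by (simp add: th_thi_n[OF w] L_cmult)
  also have "\<dots> = lamprod \<theta> L \<nu> ((\<theta>i ^^ Suc n) \<omega>) (Suc n) * It (Suc n) \<omega> f x"
    unfolding shift using lm_pos[OF w] by (simp add: lamprod_def th_thi_n[OF w] Lt_def)
  finally show ?case .
qed (simp add: lamprod_def)

lemma lamprod_pos: "\<omega> \<in> W \<Longrightarrow> 0 < lamprod \<theta> L \<nu> \<omega> n"
  unfolding lamprod_def by (intro prod_pos) (auto intro!: lm_pos funpow_th_in)

text \<open>The formula of \<open>hden\<close> with \<open>\<theta>i\<close> for the inverse map.
  The operator \<open>lim\<close> carries no information until \<open>h_tendsto\<close> establishes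
  convergence.\<close>

definition h :: "'w \<Rightarrow> 'x \<Rightarrow> real" where
  "h \<omega> x = lim (\<lambda>n. Lpow \<theta> L n ((\<theta>i ^^ n) \<omega>) (\<lambda>_. 1) x / lamprod \<theta> L \<nu> ((\<theta>i ^^ n) \<omega>) n)"

lemma h_eq_lim_It: "\<omega> \<in> W \<Longrightarrow> h \<omega> x = lim (\<lambda>n. It n \<omega> one x)"
proof -
  assume w: "\<omega> \<in> W"
  have "Lpow \<theta> L n ((\<theta>i ^^ n) \<omega>) (\<lambda>_. 1) x / lamprod \<theta> L \<nu> ((\<theta>i ^^ n) \<omega>) n = It n \<omega> one x" for n
    using Lpow_eq_It[OF w, of n one x] lamprod_pos[OF funpow_thi_in[OF w, of n], of n] by simp
  then show ?thesis unfolding h_def by simp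
qed

lemma It_one_cone: "\<omega> \<in> W \<Longrightarrow> It n \<omega> one \<in> C \<omega>"
  by (intro It_cone cone_one funpow_thi_in)

lemma It_one_nu: "\<omega> \<in> W \<Longrightarrow> integral\<^sup>L (\<nu> \<omega>) (It n \<omega> one) = 1"
  using It_nu[OF _ cone_one[OF funpow_thi_in], of \<omega> n] nu_const[OF funpow_thi_in, of \<omega> n 1] by simp

lemma It_one_close:
  assumes w: "\<omega> \<in> W" and x: "x \<in> X \<omega>"
  shows "\<bar>It (Suc n + k) \<omega> one x - It (Suc n) \<omega> one x\<bar> \<le> \<beta> (Suc n) \<omega> * b (\<theta>i \<omega>)"
proof -
  have w': "(\<theta>i ^^ Suc n) \<omega> \<in> W" using w by (rule funpow_thi_in)
  show ?thesis
    unfolding It_add[of "Suc n" k]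
    by (rule It_close[OF w It_one_cone[OF w'] cone_one[OF w'] It_one_nu[OF w'] nu_const[OF w'] x])
qed

text \<open>\<open>It (n + k)\<close> applied to 1 is \<open>It n\<close> applied to another
  normalised cone element, so \<open>It_close\<close> bounds the difference from \<open>It n\<close>
  of 1 uniformly in \<open>k\<close>.\<close>

lemma h_tendsto:
  assumes w: "\<omega> \<in> W" and x: "x \<in> X \<omega>"
  shows "(\<lambda>n. It n \<omega> one x) \<longlonglongrightarrow> h \<omega> x"
proof -
  have "Cauchy (\<lambda>n. It n \<omega> one x)"
  proof (rule CauchyI')
    fix e :: real assume e: "0 < e"
    have "(\<lambda>n. \<beta> n \<omega> * b (\<theta>i \<omega>)) \<longlonglongrightarrow> 0"
      using tendsto_mult_right[OF beta_tendsto[OF w], of "b (\<theta>i \<omega>)"] by simp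
    then have "\<forall>\<^sub>F n in sequentially. \<beta> n \<omega> * b (\<theta>i \<omega>) < e" using e by (rule order_tendstoD)
    then obtain N where N: "\<And>n. n \<ge> N \<Longrightarrow> \<beta> n \<omega> * b (\<theta>i \<omega>) < e"
      by (auto simp: eventually_sequentially)
    show "\<exists>M. \<forall>m\<ge>M. \<forall>n>m. dist (It m \<omega> one x) (It n \<omega> one x) < e"
    proof (intro exI[of _ "Suc N"] allI impI)
      fix m n assume m: "Suc N \<le> m" "m < n"
      obtain m' where m': "m = Suc m'" using m by (cases m) auto
      obtain k where k: "n = m + k" using m by (auto simp: less_iff_Suc_add)
      have "\<bar>It n \<omega> one x - It m \<omega> one x\<bar> \<le> \<beta> m \<omega> * b (\<theta>i \<omega>)"
        unfolding k m' by (rule It_one_close[OF w x])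
      also have "\<dots> < e" using N m by simp
      finally show "dist (It m \<omega> one x) (It n \<omega> one x) < e"
        by (simp add: dist_real_def abs_minus_commute)
    qed
  qed
  then have "convergent (\<lambda>n. It n \<omega> one x)" by (rule Cauchy_convergent)
  then show ?thesis unfolding h_eq_lim_It[OF w] by (rule convergent_LIMSEQ_iff[THEN iffD1])
qed

lemma h_close:
  assumes w: "\<omega> \<in> W" and x: "x \<in> X \<omega>"
  shows "\<bar>h \<omega> x - It (Suc n) \<omega> one x\<bar> \<le> \<beta> (Suc n) \<omega> * b (\<theta>i \<omega>)"
proof (rule LIMSEQ_le_const2)
  have "(\<lambda>k. It (k + Suc n) \<omega> one x) \<longlonglongrightarrow> h \<omega> x"
    by (rule LIMSEQ_ignore_initial_segment[OF h_tendsto[OF w x]])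
  then show "(\<lambda>k. \<bar>It (Suc n + k) \<omega> one x - It (Suc n) \<omega> one x\<bar>) \<longlonglongrightarrow> \<bar>h \<omega> x - It (Suc n) \<omega> one x\<bar>"
    by (intro tendsto_intros) (simp add: add.commute)
qed (use It_one_close[OF w x] in blast)

lemma h_cone: "\<omega> \<in> W \<Longrightarrow> h \<omega> \<in> C \<omega>"
  by (rule cone_lim[of \<omega> "\<lambda>n. It n \<omega> one"]) (auto intro: It_one_cone h_tendsto)

lemma h_holder: "\<omega> \<in> W \<Longrightarrow> holder \<alpha> (X \<omega>) (h \<omega>)"
  by (intro cone_holder h_cone)

lemma uniform_integral_bound:
  assumes w: "\<omega> \<in> W" and f: "holder \<alpha> (X \<omega>) f" and g: "holder \<alpha> (X \<omega>) g"
    and le: "\<And>x. x \<in> X \<omega> \<Longrightarrow> \<bar>f x - g x\<bar> \<le> e"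
  shows "\<bar>integral\<^sup>L (\<nu> \<omega>) f - integral\<^sup>L (\<nu> \<omega>) g\<bar> \<le> e"
proof -
  have if': "integrable (\<nu> \<omega>) f" "integrable (\<nu> \<omega>) g" using w f g by (auto intro: holder_integrable)
  have c: "integrable (\<nu> \<omega>) (\<lambda>_. c)" for c :: real by (intro holder_integrable w holder_const)
  have "integral\<^sup>L (\<nu> \<omega>) f \<le> integral\<^sup>L (\<nu> \<omega>) (\<lambda>x. g x + e)"
    using le by (intro nu_mono w if' Bochner_Integration.integrable_add c) (force simp: abs_le_iff)
  moreover have "integral\<^sup>L (\<nu> \<omega>) g \<le> integral\<^sup>L (\<nu> \<omega>) (\<lambda>x. f x + e)"
    using le by (intro nu_mono w if' Bochner_Integration.integrable_add c) (force simp: abs_le_iff)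
  ultimately show ?thesis using if' c nu_mass[OF w] by (simp add: abs_le_iff)
qed

lemma h_nu:
  assumes w: "\<omega> \<in> W"
  shows "integral\<^sup>L (\<nu> \<omega>) (h \<omega>) = 1"
proof -
  have "\<bar>integral\<^sup>L (\<nu> \<omega>) (h \<omega>) - 1\<bar> \<le> \<beta> (Suc n) \<omega> * b (\<theta>i \<omega>)" for n
    using uniform_integral_bound[OF w h_holder[OF w] cone_holder[OF w It_one_cone[OF w]] h_close[OF w], of n]
      It_one_nu[OF w, of "Suc n"] by simp
  moreover have "(\<lambda>n. \<beta> (Suc n) \<omega> * b (\<theta>i \<omega>)) \<longlonglongrightarrow> 0"
    using tendsto_mult_right[OF LIMSEQ_Suc[OF beta_tendsto[OF w]], of "b (\<theta>i \<omega>)"] by simp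
  ultimately have "\<bar>integral\<^sup>L (\<nu> \<omega>) (h \<omega>) - 1\<bar> \<le> 0"
    by (intro LIMSEQ_le_const) auto
  then show ?thesis by simp
qed

text \<open>The convergence to \<open>h\<close> is uniform on the fibre, so it passes through the
  possibly infinite sum over branches.\<close>

lemma h_invariant:
  assumes w: "\<omega> \<in> W" and x: "x \<in> X (\<theta> \<omega>)"
  shows "Lt \<omega> (h \<omega>) x = h (\<theta> \<omega>) x"
proof (rule LIMSEQ_unique)
  show "(\<lambda>n. It (Suc (Suc n)) (\<theta> \<omega>) one x) \<longlonglongrightarrow> h (\<theta> \<omega>) x"
    by (intro LIMSEQ_Suc h_tendsto th_in w x)
  have "(\<lambda>n. \<beta> (Suc n) \<omega> * b (\<theta>i \<omega>) * (L \<omega> one x / lm \<omega>)) \<longlonglongrightarrow> 0 * b (\<theta>i \<omega>) * (L \<omega> one x / lm \<omega>)"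
    by (intro tendsto_mult_right LIMSEQ_Suc beta_tendsto w)
  then have lim: "(\<lambda>n. \<beta> (Suc n) \<omega> * b (\<theta>i \<omega>) * (L \<omega> one x / lm \<omega>)) \<longlonglongrightarrow> 0" by simp
  have "(\<lambda>n. Lt \<omega> (It (Suc n) \<omega> one) x - Lt \<omega> (h \<omega>) x) \<longlonglongrightarrow> 0"
  proof (rule Lim_null_comparison[OF _ lim], intro always_eventually allI)
    fix n
    have bd: "bdd_on \<omega> (It (Suc n) \<omega> one)" "bdd_on \<omega> (h \<omega>)"
      by (intro cone_bdd w It_one_cone h_cone)+
    have "\<bar>L \<omega> (\<lambda>x. It (Suc n) \<omega> one x - h \<omega> x) x\<bar> \<le> L \<omega> (\<lambda>_. \<beta> (Suc n) \<omega> * b (\<theta>i \<omega>) * 1) x"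
      using h_close[OF w, of _ n] by (intro L_abs_le w x bdd_on_const) (simp add: abs_minus_commute)
    then have "\<bar>L \<omega> (\<lambda>x. It (Suc n) \<omega> one x - h \<omega> x) x\<bar> \<le> \<beta> (Suc n) \<omega> * b (\<theta>i \<omega>) * L \<omega> one x"
      unfolding L_cmult .
    then have "\<bar>L \<omega> (It (Suc n) \<omega> one) x - L \<omega> (h \<omega>) x\<bar> \<le> \<beta> (Suc n) \<omega> * b (\<theta>i \<omega>) * L \<omega> one x"
      by (subst L_diff[OF w bd x, symmetric])
    then have "\<bar>L \<omega> (It (Suc n) \<omega> one) x - L \<omega> (h \<omega>) x\<bar> / lm \<omega> \<le> \<beta> (Suc n) \<omega> * b (\<theta>i \<omega>) * L \<omega> one x / lm \<omega>"
      using lm_pos[OF w] by (intro divide_right_mono) auto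
    then show "norm (Lt \<omega> (It (Suc n) \<omega> one) x - Lt \<omega> (h \<omega>) x) \<le> \<beta> (Suc n) \<omega> * b (\<theta>i \<omega>) * (L \<omega> one x / lm \<omega>)"
      using lm_pos[OF w] by (simp only: Lt_def real_norm_def diff_divide_distrib[symmetric] abs_divide times_divide_eq_right)
  qed
  then show "(\<lambda>n. It (Suc (Suc n)) (\<theta> \<omega>) one x) \<longlonglongrightarrow> Lt \<omega> (h \<omega>) x"
    using w by (simp only: It.simps(2)[of "Suc _"] thi_th LIM_zero_iff)
qed

text \<open>\<open>h\<close> is its own image from the previous fibre, so the lower bound for images
  of normalised cone elements applies to it.\<close>

lemma h_pos:
  assumes w: "\<omega> \<in> W" and x: "x \<in> X \<omega>"
  shows "0 < h \<omega> x"
proof -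
  have w': "\<theta>i \<omega> \<in> W" using w by (rule thi_in)
  have "1 \<le> b (\<theta>i \<omega>) * h \<omega> x"
    using Lt_le_nu(2)[OF w' h_cone[OF w'], of x] h_nu[OF w'] h_invariant[OF w', of x] w x by simp
  then show ?thesis using b_ge[OF w'] by (smt (verit) mult_nonneg_nonpos)
qed

lemma T_measurable: "\<omega> \<in> W \<Longrightarrow> T \<omega> \<in> measurable (\<nu> \<omega>) (\<nu> (\<theta> \<omega>))"
proof -
  assume w: "\<omega> \<in> W"
  have "T \<omega> \<in> measurable (restrict_space borel (X \<omega>)) (restrict_space borel (X (\<theta> \<omega>)))"
    using T_meas[OF w] T_in[OF w] by (intro measurable_restrict_space2) (auto simp: space_restrict_space)
  then show ?thesis
    by (subst measurable_cong_sets[OF nu_sets[OF w] nu_sets[OF th_in[OF w]]])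
qed

text \<open>Combine \<open>L_compose\<close> with conformality of \<nu>. Here \<open>k\<close> is
  only bounded and measurable and \<open>T\<close> only measurable, which is why conformality was
  extended beyond Hoelder functions.\<close>

lemma transfer:
  assumes w: "\<omega> \<in> W" and k: "k \<in> borel_measurable (\<nu> (\<theta> \<omega>))" "bdd_on (\<theta> \<omega>) k" and f: "holder \<alpha> (X \<omega>) f"
  shows "(\<integral>x. k (T \<omega> x) * f x \<partial>\<nu> \<omega>) = (\<integral>x. k x * Lt \<omega> f x \<partial>\<nu> (\<theta> \<omega>))"
proof -
  have kT: "(\<lambda>x. k (T \<omega> x)) \<in> borel_measurable (\<nu> \<omega>)"
    by (rule measurable_compose[OF T_measurable[OF w] k(1)])
  have bT: "bdd_on \<omega> (\<lambda>x. k (T \<omega> x))"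
    using k(2) T_in[OF w] unfolding bdd_on_def by blast
  have "integral\<^sup>L (\<nu> (\<theta> \<omega>)) (L \<omega> (\<lambda>x. k (T \<omega> x) * f x)) = lm \<omega> * (\<integral>x. k (T \<omega> x) * f x \<partial>\<nu> \<omega>)"
    by (intro conformal(2) w borel_measurable_times kT holder_meas bdd_on_mult bT holder_bdd f)
  moreover have "L \<omega> (\<lambda>x. k (T \<omega> x) * f x) = (\<lambda>x. lm \<omega> * (k x * Lt \<omega> f x))"
    using lm_pos[OF w] by (intro ext) (simp add: L_compose Lt_def)
  ultimately have "lm \<omega> * (\<integral>x. k x * Lt \<omega> f x \<partial>\<nu> (\<theta> \<omega>)) = lm \<omega> * (\<integral>x. k (T \<omega> x) * f x \<partial>\<nu> \<omega>)"
    by (simp only: integral_mult_right_zero)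
  then show ?thesis using lm_pos[OF w] by simp
qed

end

section \<open>Remainder estimates for the exponential function\<close>

lemma exp_diff_le:
  fixes a a' s :: real
  assumes "a \<le> s" "a' \<le> s"
  shows "\<bar>exp a - exp a'\<bar> \<le> exp s * \<bar>a - a'\<bar>"
proof -
  have *: "exp a - exp a' \<le> exp s * (a - a')" if "a' \<le> a" "a \<le> s" for a a' :: real
  proof -
    have "exp a - exp a' = exp a * (1 - exp (- (a - a')))"
      by (simp add: algebra_simps flip: exp_add)
    also have "\<dots> \<le> exp a * (a - a')"
    proof -
      have "1 - exp (- (a - a')) \<le> a - a'" using exp_ge_add_one_self[of "- (a - a')"] by linarith
      then show ?thesis by (intro mult_left_mono) auto
    qed
    also have "\<dots> \<le> exp s * (a - a')" using that by (intro mult_right_mono) auto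
    finally show ?thesis .
  qed
  show ?thesis using *[of a' a] *[of a a'] assms by (cases "a' \<le> a") (auto simp: abs_le_iff abs_minus_commute)
qed

lemma exp_minus_one_bound:
  fixes a s :: real
  assumes "\<bar>a\<bar> \<le> s"
  shows "\<bar>exp a - 1\<bar> \<le> exp s * s"
proof -
  have "\<bar>exp a - 1\<bar> \<le> exp s * \<bar>a\<bar>" using exp_diff_le[of a s 0] assms by simp
  also have "\<dots> \<le> exp s * s" using assms by simp
  finally show ?thesis .
qed

text \<open>The derivative of exp x - 1 - x is exp x - 1, bounded by \<open>exp s * s\<close> for
  |x| \<le> s. Convexity of exp replaces the mean value theorem. The Lipschitz form is what Hoelder
  constants of the remainder require.\<close>

lemma exp_remainder_diff_bound:
  fixes a a' s :: real
  assumes "\<bar>a\<bar> \<le> s" "\<bar>a'\<bar> \<le> s"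
  shows "\<bar>(exp a - 1 - a) - (exp a' - 1 - a')\<bar> \<le> exp s * s * \<bar>a - a'\<bar>"
proof -
  have *: "\<bar>(exp a - 1 - a) - (exp a' - 1 - a')\<bar> \<le> exp s * s * (a - a')"
    if "a' \<le> a" "\<bar>a\<bar> \<le> s" "\<bar>a'\<bar> \<le> s" for a a' :: real
  proof -
    have "exp a - exp a' = exp a * (1 - exp (- (a - a')))" "exp a - exp a' = exp a' * (exp (a - a') - 1)"
      by (simp_all add: algebra_simps flip: exp_add)
    moreover have "exp a * (1 - exp (- (a - a'))) \<le> exp a * (a - a')"
    proof -
      have "1 - exp (- (a - a')) \<le> a - a'" using exp_ge_add_one_self[of "- (a - a')"] by linarith
      then show ?thesis by (intro mult_left_mono) auto
    qed
    moreover have "exp a' * (a - a') \<le> exp a' * (exp (a - a') - 1)"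
    proof -
      have "a - a' \<le> exp (a - a') - 1" using exp_ge_add_one_self[of "a - a'"] by linarith
      then show ?thesis by (intro mult_left_mono) auto
    qed
    moreover have "(exp a - 1) * (a - a') \<le> exp s * s * (a - a')"
      "(1 - exp a') * (a - a') \<le> exp s * s * (a - a')"
      using that exp_minus_one_bound[of a s] exp_minus_one_bound[of a' s]
      by (intro mult_right_mono; simp add: abs_le_iff)+
    ultimately show ?thesis by (simp add: abs_le_iff algebra_simps)
  qed
  show ?thesis
  proof (cases "a' \<le> a")
    case True then show ?thesis using *[OF True assms] by simp
  next
    case False then show ?thesis using *[of a a'] assms by (simp add: abs_minus_commute)
  qed
qed

lemma exp_remainder_bound:
  fixes a s :: real
  assumes "\<bar>a\<bar> \<le> s"
  shows "\<bar>exp a - 1 - a\<bar> \<le> exp s * s\<^sup>2"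
proof -
  have s: "0 \<le> s" using assms by linarith
  have "\<bar>exp a - 1 - a\<bar> \<le> exp s * s * \<bar>a\<bar>" using exp_remainder_diff_bound[of a s 0] assms s by simp
  also have "\<dots> \<le> exp s * s * s" using assms s by (intro mult_left_mono) auto
  finally show ?thesis by (simp add: power2_eq_square mult.assoc)
qed

lemma exp_remainder3_bound:
  fixes a s :: real
  assumes "\<bar>a\<bar> \<le> s"
  shows "\<bar>exp a - 1 - a - a\<^sup>2 / 2\<bar> \<le> exp s * s ^ 3"
proof -
  obtain t where t: "\<bar>t\<bar> \<le> \<bar>a\<bar>" "exp a = (\<Sum>m<3. a ^ m / fact m) + exp t / fact 3 * a ^ 3"
    using Maclaurin_exp_le[of a 3] by blast
  have eq: "exp a - 1 - a - a\<^sup>2 / 2 = exp t / 6 * a ^ 3"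
    using t(2) by (simp add: eval_nat_numeral)
  have "\<bar>exp a - 1 - a - a\<^sup>2 / 2\<bar> = exp t / 6 * \<bar>a\<bar> ^ 3"
    unfolding eq by (simp add: abs_mult power_abs)
  also have "\<dots> \<le> exp s * s ^ 3"
  proof (intro mult_mono power_mono)
    have "exp t \<le> exp s" using t(1) assms by simp
    moreover have "0 < exp t" by simp
    ultimately show "exp t / 6 \<le> exp s" by linarith
  qed (use assms in auto)
  finally show ?thesis .
qed

context cone_cocycle
begin

section \<open>Order-unit bounds\<close>

text \<open>The order-unit norm of \<open>g\<close> with unit \<open>h \<omega>\<close> is at most
  \<open>c\<close>: in the cone order \<open>g\<close> lies between - c h and c h. As a predicate it
  avoids the infimum over \<open>c\<close>.\<close>

definition Bd :: "'w \<Rightarrow> real \<Rightarrow> ('x \<Rightarrow> real) \<Rightarrow> bool" where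
  "Bd \<omega> c g \<longleftrightarrow> (\<lambda>x. c * h \<omega> x + g x) \<in> C \<omega> \<and> (\<lambda>x. c * h \<omega> x - g x) \<in> C \<omega>"

lemma Bd_cong:
  assumes "\<omega> \<in> W" "Bd \<omega> c g" "\<And>x. x \<in> X \<omega> \<Longrightarrow> g x = g' x"
  shows "Bd \<omega> c g'"
  using assms(2,3) cone_cong[OF assms(1), of "\<lambda>x. c * h \<omega> x + g x" "\<lambda>x. c * h \<omega> x + g' x"]
    cone_cong[OF assms(1), of "\<lambda>x. c * h \<omega> x - g x" "\<lambda>x. c * h \<omega> x - g' x"]
  unfolding Bd_def by auto

lemma Bd_abs:
  assumes "\<omega> \<in> W" "Bd \<omega> c g" "x \<in> X \<omega>"
  shows "\<bar>g x\<bar> \<le> c * h \<omega> x"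
  using cone_nonneg[OF assms(1) _ assms(3)] assms(2) unfolding Bd_def
  by (smt (verit))

lemma Bd_nonneg:
  assumes "\<omega> \<in> W" "Bd \<omega> c g"
  shows "0 \<le> c"
proof -
  obtain x where x: "x \<in> X \<omega>" using fib_ne[OF assms(1)] by blast
  have "0 \<le> c * h \<omega> x" using Bd_abs[OF assms x] by linarith
  then show ?thesis using h_pos[OF assms(1) x] by (simp add: zero_le_mult_iff)
qed

lemma Bd_holder:
  assumes "\<omega> \<in> W" "Bd \<omega> c g"
  shows "holder \<alpha> (X \<omega>) g"
proof -
  have "holder \<alpha> (X \<omega>) (\<lambda>x. (c * h \<omega> x + g x) - c * h \<omega> x)"
    using assms unfolding Bd_def by (intro holder_diff holder_cmult h_holder) (auto intro: cone_holder)
  then show ?thesis by simp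
qed

lemma Bd_add:
  assumes "\<omega> \<in> W" "Bd \<omega> c f" "Bd \<omega> d g"
  shows "Bd \<omega> (c + d) (\<lambda>x. f x + g x)"
proof -
  have "(\<lambda>x. (c * h \<omega> x + f x) + (d * h \<omega> x + g x)) \<in> C \<omega>"
    "(\<lambda>x. (c * h \<omega> x - f x) + (d * h \<omega> x - g x)) \<in> C \<omega>"
    using assms unfolding Bd_def by (auto intro: cone_add)
  then show ?thesis unfolding Bd_def by (simp add: algebra_simps)
qed

lemma Bd_minus: "Bd \<omega> c g \<Longrightarrow> Bd \<omega> c (\<lambda>x. - g x)"
  unfolding Bd_def by simp

lemma Bd_scale:
  assumes "\<omega> \<in> W" "Bd \<omega> c g"
  shows "Bd \<omega> (\<bar>a\<bar> * c) (\<lambda>x. a * g x)"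
proof -
  have *: "Bd \<omega> (a * c) (\<lambda>x. a * g x)" if "0 \<le> a" "Bd \<omega> c g" for a g
  proof -
    have "(\<lambda>x. a * (c * h \<omega> x + g x)) \<in> C \<omega>" "(\<lambda>x. a * (c * h \<omega> x - g x)) \<in> C \<omega>"
      using assms(1) that unfolding Bd_def by (auto intro: cone_scale)
    then show ?thesis unfolding Bd_def by (simp add: algebra_simps)
  qed
  show ?thesis
    using *[of a g] *[of "-a" "\<lambda>x. - g x"] Bd_minus[of \<omega> c g] assms(2) by (cases "0 \<le> a") auto
qed

lemma Bd_mono:
  assumes "\<omega> \<in> W" "Bd \<omega> c g" "c \<le> d"
  shows "Bd \<omega> d g"
proof -
  have hc: "(\<lambda>x. (d - c) * h \<omega> x) \<in> C \<omega>" using assms by (intro cone_scale h_cone) auto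
  have "(\<lambda>x. (d - c) * h \<omega> x + (c * h \<omega> x + g x)) \<in> C \<omega>"
    "(\<lambda>x. (d - c) * h \<omega> x + (c * h \<omega> x - g x)) \<in> C \<omega>"
    using assms unfolding Bd_def by (auto intro!: cone_add hc)
  then show ?thesis unfolding Bd_def by (simp add: algebra_simps)
qed

lemma Bd_h:
  assumes "\<omega> \<in> W"
  shows "Bd \<omega> \<bar>a\<bar> (\<lambda>x. a * h \<omega> x)"
proof -
  have "(\<lambda>x. (\<bar>a\<bar> + a) * h \<omega> x) \<in> C \<omega>" "(\<lambda>x. (\<bar>a\<bar> - a) * h \<omega> x) \<in> C \<omega>"
    using assms by (auto intro!: cone_scale h_cone)
  then show ?thesis unfolding Bd_def by (simp add: algebra_simps)
qed

lemma Bd_zero: "\<omega> \<in> W \<Longrightarrow> 0 \<le> c \<Longrightarrow> Bd \<omega> c (\<lambda>_. 0)"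
  using Bd_mono[OF _ Bd_h[of \<omega> 0]] by simp

text \<open>A sup bound pairs with an order-unit bound because |g| \<le> c h pointwise and
  \<open>h\<close> has integral 1.\<close>

lemma nu_mult_bound:
  assumes w: "\<omega> \<in> W" and f: "holder \<alpha> (X \<omega>) f" "\<And>x. x \<in> X \<omega> \<Longrightarrow> \<bar>f x\<bar> \<le> A"
    and g: "holder \<alpha> (X \<omega>) g" "\<And>x. x \<in> X \<omega> \<Longrightarrow> \<bar>g x\<bar> \<le> c * h \<omega> x" 
  shows "\<bar>\<integral>x. f x * g x \<partial>\<nu> \<omega>\<bar> \<le> A * c"
proof -
  have hh: "holder \<alpha> (X \<omega>) (\<lambda>x. A * c * h \<omega> x)" by (intro holder_cmult h_holder w)
  have i: "(\<integral>x. A * c * h \<omega> x \<partial>\<nu> \<omega>) = A * c" using h_nu[OF w] by simp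
  have le: "\<bar>f x * g x\<bar> \<le> A * c * h \<omega> x" if "x \<in> X \<omega>" for x
  proof -
    have "\<bar>f x * g x\<bar> \<le> A * (c * h \<omega> x)"
      unfolding abs_mult using f(2)[OF that] g(2)[OF that]
      by (intro mult_mono) (auto intro: order_trans[OF abs_ge_zero])
    then show ?thesis by (simp add: mult.assoc)
  qed
  have "(\<integral>x. f x * g x \<partial>\<nu> \<omega>) \<le> (\<integral>x. A * c * h \<omega> x \<partial>\<nu> \<omega>)"
    using le by (intro nu_mono w holder_integrable holder_mult f g hh) (force simp: abs_le_iff)
  moreover have "(\<integral>x. - (A * c * h \<omega> x) \<partial>\<nu> \<omega>) \<le> (\<integral>x. f x * g x \<partial>\<nu> \<omega>)"
    using le by (intro nu_mono w holder_integrable holder_mult holder_minus f g hh) (force simp: abs_le_iff)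
  ultimately show ?thesis using h_nu[OF w] by (simp add: abs_le_iff)
qed

lemma Bd_nu:
  assumes w: "\<omega> \<in> W" and g: "Bd \<omega> c g"
  shows "\<bar>integral\<^sup>L (\<nu> \<omega>) g\<bar> \<le> c"
  using nu_mult_bound[OF w holder_const[of _ _ 1] _ Bd_holder[OF w g] Bd_abs[OF w g], of 1] by simp

lemma Bd_center:
  assumes w: "\<omega> \<in> W" and g: "Bd \<omega> c g"
  shows "Bd \<omega> (2 * c) (\<lambda>x. g x - integral\<^sup>L (\<nu> \<omega>) g * h \<omega> x)"
proof -
  have "Bd \<omega> (c + c) (\<lambda>x. g x + - integral\<^sup>L (\<nu> \<omega>) g * h \<omega> x)"
    by (intro Bd_add w g Bd_mono[OF w Bd_h[OF w]]) (use Bd_nu[OF w g] in simp)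
  then show ?thesis by simp
qed

lemma Lt_shift:
  assumes w: "\<omega> \<in> W" and g: "holder \<alpha> (X \<omega>) g" and x: "x \<in> X (\<theta> \<omega>)"
  shows "Lt \<omega> (\<lambda>x. c * h \<omega> x + g x) x = c * h (\<theta> \<omega>) x + Lt \<omega> g x"
    "Lt \<omega> (\<lambda>x. c * h \<omega> x - g x) x = c * h (\<theta> \<omega>) x - Lt \<omega> g x"
proof -
  have b: "bdd_on \<omega> (\<lambda>x. c * h \<omega> x)" "bdd_on \<omega> g"
    using w g by (auto intro!: holder_bdd holder_cmult h_holder)
  show "Lt \<omega> (\<lambda>x. c * h \<omega> x + g x) x = c * h (\<theta> \<omega>) x + Lt \<omega> g x"
    by (simp add: Lt_add[OF w b x] Lt_cmult h_invariant[OF w x])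
  show "Lt \<omega> (\<lambda>x. c * h \<omega> x - g x) x = c * h (\<theta> \<omega>) x - Lt \<omega> g x"
    by (simp add: Lt_diff[OF w b x] Lt_cmult h_invariant[OF w x])
qed

lemma Bd_Lt:
  assumes w: "\<omega> \<in> W" and g: "Bd \<omega> c g"
  shows "Bd (\<theta> \<omega>) c (Lt \<omega> g)"
  unfolding Bd_def
proof
  have w': "\<theta> \<omega> \<in> W" using w by (rule th_in)
  note s = Lt_shift[OF w Bd_holder[OF w g]]
  show "(\<lambda>x. c * h (\<theta> \<omega>) x + Lt \<omega> g x) \<in> C (\<theta> \<omega>)"
    by (rule cone_cong[OF w' cone_Lt[OF w], of "\<lambda>x. c * h \<omega> x + g x"]) (use g s in \<open>auto simp: Bd_def\<close>)
  show "(\<lambda>x. c * h (\<theta> \<omega>) x - Lt \<omega> g x) \<in> C (\<theta> \<omega>)"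
    by (rule cone_cong[OF w' cone_Lt[OF w], of "\<lambda>x. c * h \<omega> x - g x"]) (use g s in \<open>auto simp: Bd_def\<close>)
qed

text \<open>For \<open>g\<close> of mean zero both c h + g and c h - g have mass \<open>c\<close>.
  The minorisation with f' = h removes \<kappa> c h from their images, and \<open>h\<close> is
  mapped to \<open>h\<close>.\<close>

lemma Bd_contract:
  assumes w: "\<omega> \<in> W" and g: "Bd \<omega> c g" "integral\<^sup>L (\<nu> \<omega>) g = 0"
  shows "Bd (\<theta> \<omega>) ((1 - \<kappa> \<omega>) * c) (Lt \<omega> g)"
  unfolding Bd_def
proof
  have w': "\<theta> \<omega> \<in> W" using w by (rule th_in)
  note hg = Bd_holder[OF w g(1)]
  note s = Lt_shift[OF w hg]
  have int: "integral\<^sup>L (\<nu> \<omega>) (\<lambda>x. c * h \<omega> x + g x) = c" "integral\<^sup>L (\<nu> \<omega>) (\<lambda>x. c * h \<omega> x - g x) = c"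
    using h_nu[OF w] g(2) holder_integrable[OF w hg] holder_integrable[OF w h_holder[OF w]]
    by simp_all
  show "(\<lambda>x. (1 - \<kappa> \<omega>) * c * h (\<theta> \<omega>) x + Lt \<omega> g x) \<in> C (\<theta> \<omega>)"
    by (rule cone_cong[OF w' cone_Lt_contract[OF w _ h_cone[OF w] h_nu[OF w], of "\<lambda>x. c * h \<omega> x + g x"]])
      (use g s int h_invariant[OF w] in \<open>auto simp: Bd_def algebra_simps\<close>)
  show "(\<lambda>x. (1 - \<kappa> \<omega>) * c * h (\<theta> \<omega>) x - Lt \<omega> g x) \<in> C (\<theta> \<omega>)"
    by (rule cone_cong[OF w' cone_Lt_contract[OF w _ h_cone[OF w] h_nu[OF w], of "\<lambda>x. c * h \<omega> x - g x"]])
      (use g s int h_invariant[OF w] in \<open>auto simp: Bd_def algebra_simps\<close>)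
qed

definition wlip :: "'w \<Rightarrow> ('x \<Rightarrow> real) \<Rightarrow> real \<Rightarrow> real \<Rightarrow> bool" where
  "wlip \<omega> w A B \<longleftrightarrow> 0 \<le> A \<and> 0 \<le> B \<and> (\<forall>x\<in>X \<omega>. \<bar>w x\<bar> \<le> A) \<and>
    (\<forall>x\<in>X \<omega>. \<forall>x'\<in>X \<omega>. \<bar>w x - w x'\<bar> \<le> B * dist x x' powr \<alpha>)"

lemma wlip_minus: "wlip \<omega> f A B \<Longrightarrow> wlip \<omega> (\<lambda>x. - f x) A B"
  unfolding wlip_def by (auto simp: abs_minus_commute)

lemma wlip_holder: "wlip \<omega> f A B \<Longrightarrow> holder \<alpha> (X \<omega>) f"
  unfolding wlip_def by (intro holderI[of _ _ A B]) auto

text \<open>The price, in units of \<open>h\<close>, of multiplying \<open>h\<close> by a weight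
  with bounds \<open>A\<close> and \<open>B\<close> before applying the operator.\<close>

definition gain :: "'w \<Rightarrow> real \<Rightarrow> real \<Rightarrow> real" where
  "gain \<omega> A B = m\<^sub>1 \<omega> * A + m\<^sub>2 \<omega> * B"

lemma gain_nonneg: "\<omega> \<in> W \<Longrightarrow> 0 \<le> A \<Longrightarrow> 0 \<le> B \<Longrightarrow> 0 \<le> gain \<omega> A B"
  unfolding gain_def using m1_ge[of \<omega>] m2_ge[of \<omega>] by auto

lemma cone_mult_Lt:
  assumes w: "\<omega> \<in> W" and f: "f \<in> C \<omega>" and v: "wlip \<omega> v A B"
  shows "(\<lambda>z. gain \<omega> A B * Lt \<omega> f z + Lt \<omega> (\<lambda>x. v x * f x) z) \<in> C (\<theta> \<omega>)"
    "(\<lambda>z. gain \<omega> A B * Lt \<omega> f z - Lt \<omega> (\<lambda>x. v x * f x) z) \<in> C (\<theta> \<omega>)"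
proof -
  have *: "(\<lambda>z. gain \<omega> A B * Lt \<omega> f z + Lt \<omega> (\<lambda>x. v x * f x) z) \<in> C (\<theta> \<omega>)" if v: "wlip \<omega> v A B" for v
  proof -
    have "(\<lambda>z. gain \<omega> A B * L \<omega> f z + L \<omega> (\<lambda>x. v x * f x) z) \<in> C (\<theta> \<omega>)"
      unfolding gain_def using v by (intro cone_mult w f) (auto simp: wlip_def)
    then have "(\<lambda>z. 1 / lm \<omega> * (gain \<omega> A B * L \<omega> f z + L \<omega> (\<lambda>x. v x * f x) z)) \<in> C (\<theta> \<omega>)"
      using lm_pos[OF w] by (intro cone_scale th_in w) auto
    then show ?thesis by (simp add: Lt_def add_divide_distrib)
  qed
  show "(\<lambda>z. gain \<omega> A B * Lt \<omega> f z + Lt \<omega> (\<lambda>x. v x * f x) z) \<in> C (\<theta> \<omega>)" by (rule *[OF v])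
  show "(\<lambda>z. gain \<omega> A B * Lt \<omega> f z - Lt \<omega> (\<lambda>x. v x * f x) z) \<in> C (\<theta> \<omega>)"
    using *[OF wlip_minus[OF v]] by (simp add: Lt_minus)
qed

lemma Bd_mult_h:
  assumes w: "\<omega> \<in> W" and v: "wlip \<omega> v A B"
  shows "Bd (\<theta> \<omega>) (gain \<omega> A B) (Lt \<omega> (\<lambda>x. v x * h \<omega> x))"
  unfolding Bd_def
  by (intro conjI; rule cone_cong[OF th_in[OF w]], rule cone_mult_Lt[OF w h_cone[OF w] v])
    (simp_all add: h_invariant[OF w])

text \<open>Write v g = v (c h + g) - c v h, with c h + g in the cone. The first term costs the gain
  times the image of c h + g, which is at most 2 c h; the second costs c times the gain. Together
  this gives the factor 3.\<close>

lemma Bd_mult: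
  assumes w: "\<omega> \<in> W" and v: "wlip \<omega> v A B" and g: "Bd \<omega> c g"
  shows "Bd (\<theta> \<omega>) (3 * gain \<omega> A B * c) (Lt \<omega> (\<lambda>x. v x * g x))"
proof -
  have w': "\<theta> \<omega> \<in> W" using w by (rule th_in)
  have c: "0 \<le> c" by (rule Bd_nonneg[OF w g])
  have ge: "0 \<le> gain \<omega> A B" using v by (intro gain_nonneg w) (auto simp: wlip_def)
  have *: "(\<lambda>z. 3 * gain \<omega> A B * c * h (\<theta> \<omega>) z + Lt \<omega> (\<lambda>x. v x * g x) z) \<in> C (\<theta> \<omega>)"
    if v: "wlip \<omega> v A B" for v
  proof -
    define f where "f = (\<lambda>x. c * h \<omega> x + g x)"
    have f: "f \<in> C \<omega>" using g by (simp add: Bd_def f_def)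
    note hg = Bd_holder[OF w g]
    note hv = wlip_holder[OF v]
    have 1: "(\<lambda>z. gain \<omega> A B * Lt \<omega> f z + Lt \<omega> (\<lambda>x. v x * f x) z) \<in> C (\<theta> \<omega>)"
      by (rule cone_mult_Lt(1)[OF w f v])
    have 2: "(\<lambda>z. c * (gain \<omega> A B * h (\<theta> \<omega>) z - Lt \<omega> (\<lambda>x. v x * h \<omega> x) z)) \<in> C (\<theta> \<omega>)"
      using Bd_mult_h[OF w v] by (intro cone_scale w' c) (simp add: Bd_def)
    have 3: "(\<lambda>z. gain \<omega> A B * (c * h (\<theta> \<omega>) z - Lt \<omega> g z)) \<in> C (\<theta> \<omega>)"
      using Bd_Lt[OF w g] by (intro cone_scale w' ge) (simp add: Bd_def)
    have sum: "(\<lambda>z. (gain \<omega> A B * Lt \<omega> f z + Lt \<omega> (\<lambda>x. v x * f x) z) +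
        (c * (gain \<omega> A B * h (\<theta> \<omega>) z - Lt \<omega> (\<lambda>x. v x * h \<omega> x) z) +
         gain \<omega> A B * (c * h (\<theta> \<omega>) z - Lt \<omega> g z))) \<in> C (\<theta> \<omega>)"
      by (intro cone_add w' 1 2 3)
    show ?thesis
    proof (rule cone_cong[OF w' sum])
      fix z assume z: "z \<in> X (\<theta> \<omega>)"
      have e1: "Lt \<omega> f z = c * h (\<theta> \<omega>) z + Lt \<omega> g z"
        unfolding f_def by (rule Lt_shift(1)[OF w hg z])
      have "Lt \<omega> (\<lambda>x. v x * f x) z = Lt \<omega> (\<lambda>x. c * (v x * h \<omega> x) + v x * g x) z"
        by (rule Lt_cong) (simp add: f_def algebra_simps)
      also have "\<dots> = c * Lt \<omega> (\<lambda>x. v x * h \<omega> x) z + Lt \<omega> (\<lambda>x. v x * g x) z"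
        by (subst Lt_add[OF w _ _ z])
          (auto simp: Lt_cmult intro!: holder_bdd holder_cmult holder_mult hv hg h_holder w)
      finally show "gain \<omega> A B * Lt \<omega> f z + Lt \<omega> (\<lambda>x. v x * f x) z +
        (c * (gain \<omega> A B * h (\<theta> \<omega>) z - Lt \<omega> (\<lambda>x. v x * h \<omega> x) z) +
         gain \<omega> A B * (c * h (\<theta> \<omega>) z - Lt \<omega> g z))
         = 3 * gain \<omega> A B * c * h (\<theta> \<omega>) z + Lt \<omega> (\<lambda>x. v x * g x) z"
        using e1 by (simp add: algebra_simps)
    qed
  qed
  show ?thesis
    using *[OF v] *[OF wlip_minus[OF v]] unfolding Bd_def by (simp add: Lt_minus)
qed

text \<open>Both bounds are multiples of the pair (U, V), so \<open>gain\<close>, being linear, is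
  multiplied by |t| exp U for the first-order remainder and by t^2 U exp U for the second. The
  restriction |t| \<le> 1 allows exp (|t| U) \<le> exp U.\<close>

lemma wlip_exp:
  assumes v: "wlip \<omega> v U V" and t: "\<bar>t\<bar> \<le> 1"
  shows "wlip \<omega> (\<lambda>x. exp (t * v x) - 1) (\<bar>t\<bar> * (exp U * U)) (\<bar>t\<bar> * (exp U * V))" (is ?A)
    and "wlip \<omega> (\<lambda>x. exp (t * v x) - 1 - t * v x) (t\<^sup>2 * U * (exp U * U)) (t\<^sup>2 * U * (exp U * V))" (is ?B)
proof -
  have UV: "0 \<le> U" "0 \<le> V" using v by (auto simp: wlip_def)
  define s where "s = \<bar>t\<bar> * U"
  have s: "0 \<le> s" "exp s \<le> exp U" using UV t by (auto simp: s_def mult_left_le_one_le)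
  have b: "\<bar>t * v x\<bar> \<le> s" if "x \<in> X \<omega>" for x
    using v that unfolding s_def wlip_def abs_mult by (intro mult_left_mono) auto
  have l: "\<bar>t * v x - t * v x'\<bar> \<le> \<bar>t\<bar> * (V * dist x x' powr \<alpha>)" if "x \<in> X \<omega>" "x' \<in> X \<omega>" for x x'
    using v that unfolding wlip_def right_diff_distrib[symmetric] abs_mult by (intro mult_left_mono) auto
  have tt: "\<bar>t\<bar> * \<bar>t\<bar> = t\<^sup>2" by (simp add: power2_eq_square)
  show ?A unfolding wlip_def
  proof (intro conjI ballI)
    fix x assume x: "x \<in> X \<omega>"
    have "\<bar>exp (t * v x) - 1\<bar> \<le> exp s * s" by (rule exp_minus_one_bound[OF b[OF x]])
    also have "\<dots> \<le> exp U * s" using s by (intro mult_right_mono)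
    finally show "\<bar>exp (t * v x) - 1\<bar> \<le> \<bar>t\<bar> * (exp U * U)" by (simp add: s_def mult_ac)
    fix x' assume x': "x' \<in> X \<omega>"
    have "\<bar>exp (t * v x) - exp (t * v x')\<bar> \<le> exp s * \<bar>t * v x - t * v x'\<bar>"
      using b[OF x] b[OF x'] by (intro exp_diff_le) auto
    also have "\<dots> \<le> exp U * (\<bar>t\<bar> * (V * dist x x' powr \<alpha>))"
      by (intro mult_mono s l x x') auto
    finally show "\<bar>exp (t * v x) - 1 - (exp (t * v x') - 1)\<bar> \<le> \<bar>t\<bar> * (exp U * V) * dist x x' powr \<alpha>"
      by (simp add: mult_ac)
  qed (use UV in auto)
  show ?B unfolding wlip_def
  proof (intro conjI ballI)
    fix x assume x: "x \<in> X \<omega>"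
    have "\<bar>exp (t * v x) - 1 - t * v x\<bar> \<le> exp s * s\<^sup>2" by (rule exp_remainder_bound[OF b[OF x]])
    also have "\<dots> \<le> exp U * s\<^sup>2" using s by (intro mult_right_mono) auto
    finally show "\<bar>exp (t * v x) - 1 - t * v x\<bar> \<le> t\<^sup>2 * U * (exp U * U)"
      by (simp add: s_def power2_eq_square mult_ac)
    fix x' assume x': "x' \<in> X \<omega>"
    have "\<bar>(exp (t * v x) - 1 - t * v x) - (exp (t * v x') - 1 - t * v x')\<bar> \<le> exp s * s * \<bar>t * v x - t * v x'\<bar>"
      by (rule exp_remainder_diff_bound[OF b[OF x] b[OF x']])
    also have "\<dots> \<le> exp U * s * (\<bar>t\<bar> * (V * dist x x' powr \<alpha>))"
      using s by (intro mult_mono l x x') auto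
    finally show "\<bar>exp (t * v x) - 1 - t * v x - (exp (t * v x') - 1 - t * v x')\<bar>
        \<le> t\<^sup>2 * U * (exp U * V) * dist x x' powr \<alpha>"
      by (simp add: s_def tt[symmetric] mult_ac)
  qed (use UV in auto)
qed

text \<open>One step of the second-order expansion. \<open>F\<close> is the normalised tilted
  density, \<open>r\<close> its first-order coefficient, and \<open>p\<close> the factor that this
  step contributes to the moment generating function. The hypotheses on \<open>F\<close>,
  \<open>r\<close> and the second-order remainder are returned over \<theta> \<omega> with the same
  constants, because each new contribution carries the factor \<open>\<kappa> \<omega>\<close>
  supplied by the assumption on \<open>A\<close>, while the old error loses the share
  \<open>\<kappa> \<omega>\<close>.\<close>

lemma tilt_step:
  fixes t A U V :: real and \<omega> :: 'w and F r v :: "'x \<Rightarrow> real"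
  defines "\<epsilon> \<equiv> \<bar>t\<bar> * A"
  defines "p \<equiv> (\<integral>x. exp (t * v x) * F x \<partial>\<nu> \<omega>)"
  assumes w: "\<omega> \<in> W" and v: "wlip \<omega> v U V" "(\<integral>x. v x * h \<omega> x \<partial>\<nu> \<omega>) = 0"
    and A: "1 \<le> A" "exp U * gain \<omega> U V \<le> A * \<kappa> \<omega>" and eps: "\<epsilon> \<le> 1 / 24"
    and F: "integral\<^sup>L (\<nu> \<omega>) F = 1" "Bd \<omega> (8 * \<epsilon>) (\<lambda>x. F x - h \<omega> x)"
    and r: "integral\<^sup>L (\<nu> \<omega>) r = 0" "Bd \<omega> A r"
    and R: "Bd \<omega> (60 * \<epsilon>\<^sup>2) (\<lambda>x. F x - h \<omega> x - t * r x)"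
  shows "\<bar>p - 1\<bar> \<le> 1 / 4"
    and "integral\<^sup>L (\<nu> (\<theta> \<omega>)) (\<lambda>z. Lt \<omega> (\<lambda>x. exp (t * v x) * F x) z / p) = 1"
    and "Bd (\<theta> \<omega>) (8 * \<epsilon>) (\<lambda>z. Lt \<omega> (\<lambda>x. exp (t * v x) * F x) z / p - h (\<theta> \<omega>) z)"
    and "integral\<^sup>L (\<nu> (\<theta> \<omega>)) (Lt \<omega> (\<lambda>x. r x + v x * h \<omega> x)) = 0"
    and "Bd (\<theta> \<omega>) A (Lt \<omega> (\<lambda>x. r x + v x * h \<omega> x))"
    and "Bd (\<theta> \<omega>) (60 * \<epsilon>\<^sup>2) (\<lambda>z. Lt \<omega> (\<lambda>x. exp (t * v x) * F x) z / p - h (\<theta> \<omega>) z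
      - t * Lt \<omega> (\<lambda>x. r x + v x * h \<omega> x) z)"
    and "\<bar>ln p - t\<^sup>2 * ((\<integral>x. v x * r x \<partial>\<nu> \<omega>) + (\<integral>x. (v x)\<^sup>2 * h \<omega> x \<partial>\<nu> \<omega>) / 2)\<bar> \<le> 130 * \<epsilon> ^ 3"
proof -
  have w': "\<theta> \<omega> \<in> W" using w by (rule th_in)
  have UV: "0 \<le> U" "0 \<le> V" using v by (auto simp: wlip_def)
  have kap: "0 < \<kappa> \<omega>" "\<kappa> \<omega> \<le> 1" using kappa_pos[OF w] kappa_le_one[OF w] .
  have e0: "0 \<le> \<epsilon>" using A by (simp add: \<epsilon>_def)
  have t1: "\<bar>t\<bar> \<le> 1"
  proof -
    have "\<bar>t\<bar> * 1 \<le> \<bar>t\<bar> * A" using A by (intro mult_left_mono) auto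
    then show ?thesis using eps by (simp add: \<epsilon>_def)
  qed
  \<comment> \<open>The gain with the exponential factor of \<open>wlip_exp\<close> included; after
    multiplication by |t| it is at most \<epsilon> \<kappa>.\<close>
  define c where "c = exp U * gain \<omega> U V"
  have g0: "0 \<le> gain \<omega> U V" by (rule gain_nonneg[OF w UV])
  have gc: "gain \<omega> U V \<le> c" using g0 UV unfolding c_def by (simp add: mult_le_cancel_right1)
  have cA: "c \<le> A * \<kappa> \<omega>" using A c_def by simp
  have tc: "\<bar>t\<bar> * c \<le> \<epsilon> * \<kappa> \<omega>"
    using mult_left_mono[OF cA, of "\<bar>t\<bar>"] by (simp add: \<epsilon>_def mult.assoc)
  have ek: "\<epsilon> * \<kappa> \<omega> \<le> \<epsilon>" using kap e0 by (simp add: mult_left_le)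
  have UeU: "exp U * U \<le> c"
  proof -
    have "1 * U \<le> m\<^sub>1 \<omega> * U" using m1_ge[OF w] UV by (intro mult_right_mono)
    then have "U \<le> gain \<omega> U V" using m2_ge[OF w] UV unfolding gain_def by (simp add: add_increasing2)
    then show ?thesis unfolding c_def by simp
  qed
  have UleeU: "U \<le> exp U * U" using UV by (simp add: mult_le_cancel_right1)
  have tU: "\<bar>t\<bar> * (exp U * U) \<le> \<epsilon>"
    using mult_left_mono[OF UeU, of "\<bar>t\<bar>"] tc ek by linarith
  have tU': "\<bar>t\<bar> * U \<le> \<epsilon>"
    using mult_left_mono[OF UleeU, of "\<bar>t\<bar>"] tU by linarith
  have hh: "holder \<alpha> (X \<omega>) (h \<omega>)" by (rule h_holder[OF w])
  have hv: "holder \<alpha> (X \<omega>) v" by (rule wlip_holder[OF v(1)])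
  have hr: "holder \<alpha> (X \<omega>) r" by (rule Bd_holder[OF w r(2)])
  define D where "D = (\<lambda>x. F x - h \<omega> x)"
  have D: "Bd \<omega> (8 * \<epsilon>) D" using F(2) by (simp add: D_def)
  have hD: "holder \<alpha> (X \<omega>) D" by (rule Bd_holder[OF w D])
  have FD: "F = (\<lambda>x. h \<omega> x + D x)" by (simp add: D_def)
  have hF: "holder \<alpha> (X \<omega>) F" unfolding FD by (intro holder_add hh hD)
  have D0: "integral\<^sup>L (\<nu> \<omega>) D = 0"
    using holder_integrable[OF w hF] holder_integrable[OF w hh] F(1) h_nu[OF w] by (simp add: D_def)
  \<comment> \<open>The second-order remainder of \<open>F\<close>. Its mean is zero because those
    of \<open>D\<close> and \<open>r\<close> are, so the contraction applies to it
    separately.\<close>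
  define RR where "RR = (\<lambda>x. D x - t * r x)"
  have RR: "Bd \<omega> (60 * \<epsilon>\<^sup>2) RR" using R by (simp add: RR_def D_def)
  have hRR: "holder \<alpha> (X \<omega>) RR" by (rule Bd_holder[OF w RR])
  have RR0: "integral\<^sup>L (\<nu> \<omega>) RR = 0"
    using holder_integrable[OF w hD] holder_integrable[OF w hr] D0 r(1) by (simp add: RR_def)
  define W1 where "W1 = (\<lambda>x. exp (t * v x) - 1)"
  define W2 where "W2 = (\<lambda>x. exp (t * v x) - 1 - t * v x)"
  have W1: "wlip \<omega> W1 (\<bar>t\<bar> * (exp U * U)) (\<bar>t\<bar> * (exp U * V))"
    and W2: "wlip \<omega> W2 (t\<^sup>2 * U * (exp U * U)) (t\<^sup>2 * U * (exp U * V))"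
    unfolding W1_def W2_def by (rule wlip_exp[OF v(1) t1])+
  have g1: "gain \<omega> (\<bar>t\<bar> * (exp U * U)) (\<bar>t\<bar> * (exp U * V)) = \<bar>t\<bar> * c"
    and g2: "gain \<omega> (t\<^sup>2 * U * (exp U * U)) (t\<^sup>2 * U * (exp U * V)) = t\<^sup>2 * U * c"
    by (simp_all add: gain_def c_def algebra_simps)
  have hW: "holder \<alpha> (X \<omega>) W1" "holder \<alpha> (X \<omega>) W2"
    using wlip_holder[OF W1] wlip_holder[OF W2] .
  have t2Uc: "t\<^sup>2 * U * c \<le> \<epsilon> * (\<epsilon> * \<kappa> \<omega>)"
  proof -
    have "(\<bar>t\<bar> * U) * (\<bar>t\<bar> * c) \<le> \<epsilon> * (\<epsilon> * \<kappa> \<omega>)"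
      by (rule mult_mono[OF tU' tc e0]) (use g0 gc in auto)
    moreover have "(\<bar>t\<bar> * U) * (\<bar>t\<bar> * c) = t\<^sup>2 * U * c" by (simp add: power2_eq_square mult_ac)
    ultimately show ?thesis by simp
  qed
  let ?vh = "\<lambda>x. v x * h \<omega> x"
  have hvh: "holder \<alpha> (X \<omega>) ?vh" by (intro holder_mult hv hh)
  \<comment> \<open>All contributions of this step of second order in \<epsilon>. The linear
    contribution t v h has mean zero, so the mean of \<open>Q\<close> is p - 1; hence the
    normalisation is a second-order effect. The bound 25 = 3 * 8 + 1 comes from
    \<open>Bd_mult\<close> on \<open>D\<close> and \<open>Bd_mult_h\<close>.\<close>
  define Q where "Q = (\<lambda>z. Lt \<omega> (\<lambda>x. W1 x * D x) z + Lt \<omega> (\<lambda>x. W2 x * h \<omega> x) z)"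
  have hWD: "holder \<alpha> (X \<omega>) (\<lambda>x. W1 x * D x)" "holder \<alpha> (X \<omega>) (\<lambda>x. W2 x * h \<omega> x)"
    "holder \<alpha> (X \<omega>) (\<lambda>x. W1 x * F x)"
    by (intro holder_mult hW hD hh hF)+
  have BQ: "Bd (\<theta> \<omega>) (25 * \<epsilon>\<^sup>2 * \<kappa> \<omega>) Q"
  proof -
    have "Bd (\<theta> \<omega>) (3 * (\<bar>t\<bar> * c) * (8 * \<epsilon>) + t\<^sup>2 * U * c) Q"
      unfolding Q_def
      by (intro Bd_add w') (use Bd_mult[OF w W1 D] Bd_mult_h[OF w W2] g1 g2 in auto)
    then show ?thesis
    proof (rule Bd_mono[OF w'])
      have "3 * (\<bar>t\<bar> * c) * (8 * \<epsilon>) \<le> 3 * (\<epsilon> * \<kappa> \<omega>) * (8 * \<epsilon>)"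
        using tc e0 by (intro mult_right_mono mult_left_mono) auto
      then show "3 * (\<bar>t\<bar> * c) * (8 * \<epsilon>) + t\<^sup>2 * U * c \<le> 25 * \<epsilon>\<^sup>2 * \<kappa> \<omega>"
        using t2Uc by (simp add: power2_eq_square algebra_simps)
    qed
  qed
  define \<delta> where "\<delta> = p - 1"
  have d1: "\<delta> = (\<integral>x. W1 x * F x \<partial>\<nu> \<omega>)"
  proof -
    have "p = (\<integral>x. F x + W1 x * F x \<partial>\<nu> \<omega>)"
      unfolding p_def W1_def by (simp add: algebra_simps)
    then show ?thesis
      using holder_integrable[OF w hF] holder_integrable[OF w hWD(3)] F(1) by (simp add: \<delta>_def)
  qed
  have W1F: "W1 x * F x = t * ?vh x + (W1 x * D x + W2 x * h \<omega> x)" for x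
    by (simp add: FD W1_def W2_def algebra_simps)
  have Qd: "integral\<^sup>L (\<nu> (\<theta> \<omega>)) Q = \<delta>"
  proof -
    have "integral\<^sup>L (\<nu> (\<theta> \<omega>)) Q = (\<integral>x. W1 x * D x \<partial>\<nu> \<omega>) + (\<integral>x. W2 x * h \<omega> x \<partial>\<nu> \<omega>)"
      unfolding Q_def using holder_integrable[OF w' holder_Lt[OF w hWD(1)]] holder_integrable[OF w' holder_Lt[OF w hWD(2)]]
      by (simp add: nu_Lt[OF w hWD(1)] nu_Lt[OF w hWD(2)])
    also have "\<dots> = \<delta>"
      unfolding d1 W1F
      using holder_integrable[OF w hWD(1)] holder_integrable[OF w hWD(2)] holder_integrable[OF w hvh] v(2)
      by simp
    finally show ?thesis .
  qed
  have dle: "\<bar>\<delta>\<bar> \<le> 25 * \<epsilon>\<^sup>2 * \<kappa> \<omega>" using Bd_nu[OF w' BQ] Qd by simp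
  have ee: "\<epsilon>\<^sup>2 \<le> \<epsilon> / 24"
    using mult_left_mono[OF eps e0] by (simp add: power2_eq_square)
  have e2k: "\<epsilon>\<^sup>2 * \<kappa> \<omega> \<le> \<epsilon> * \<kappa> \<omega> / 24"
  proof -
    have "\<epsilon>\<^sup>2 * \<kappa> \<omega> \<le> \<epsilon> / 24 * \<kappa> \<omega>" using kap by (intro mult_right_mono ee) auto
    then show ?thesis by (simp only: times_divide_eq_left)
  qed
  have dle': "\<bar>\<delta>\<bar> \<le> 25 / 24 * (\<epsilon> * \<kappa> \<omega>)"
    using e2k dle by linarith
  have dle'': "\<bar>\<delta>\<bar> \<le> 25 / 24 * \<epsilon>" using dle' ek by simp
  show p14: "\<bar>p - 1\<bar> \<le> 1 / 4" using dle'' eps by (simp add: \<delta>_def)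
  then have p0: "0 < p" by linarith
  have hexp: "holder \<alpha> (X \<omega>) (\<lambda>x. exp (t * v x) * F x)"
  proof -
    have "holder \<alpha> (X \<omega>) (\<lambda>x. F x + W1 x * F x)" by (intro holder_add hF hWD)
    then show ?thesis by (simp add: W1_def algebra_simps)
  qed
  show "integral\<^sup>L (\<nu> (\<theta> \<omega>)) (\<lambda>z. Lt \<omega> (\<lambda>x. exp (t * v x) * F x) z / p) = 1"
    using nu_Lt[OF w hexp] p0 by (simp add: p_def)
  let ?G = "Lt \<omega> (\<lambda>x. exp (t * v x) * F x)"
  have Gz: "?G z = h (\<theta> \<omega>) z + Lt \<omega> D z + t * Lt \<omega> ?vh z + Q z" if z: "z \<in> X (\<theta> \<omega>)" for z
  proof -
    note b = holder_bdd[OF hh] holder_bdd[OF hD] holder_bdd[OF hvh] holder_bdd[OF hWD(1)] holder_bdd[OF hWD(2)]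
    have "?G z = Lt \<omega> (\<lambda>x. (h \<omega> x + D x) + (t * ?vh x + (W1 x * D x + W2 x * h \<omega> x))) z"
    proof (rule Lt_cong)
      fix x
      have "exp (t * v x) * F x = F x + W1 x * F x" by (simp add: W1_def algebra_simps)
      then show "exp (t * v x) * F x = (h \<omega> x + D x) + (t * ?vh x + (W1 x * D x + W2 x * h \<omega> x))"
        unfolding W1F by (simp add: FD)
    qed
    also have "\<dots> = (Lt \<omega> (h \<omega>) z + Lt \<omega> D z) + (t * Lt \<omega> ?vh z + (Lt \<omega> (\<lambda>x. W1 x * D x) z + Lt \<omega> (\<lambda>x. W2 x * h \<omega> x) z))"
      by (simp add: Lt_add[OF w _ _ z] Lt_cmult b bdd_on_add bdd_on_cmult)
    finally show ?thesis by (simp add: Q_def h_invariant[OF w z])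
  qed
  have Bvh: "Bd (\<theta> \<omega>) (gain \<omega> U V) (Lt \<omega> ?vh)" by (rule Bd_mult_h[OF w v(1)])
  have Btvh: "Bd (\<theta> \<omega>) (\<epsilon> * \<kappa> \<omega>) (\<lambda>z. t * Lt \<omega> ?vh z)"
    by (rule Bd_mono[OF w' Bd_scale[OF w' Bvh]])
      (use mult_left_mono[OF gc, of "\<bar>t\<bar>"] tc in linarith)
  have BD: "Bd (\<theta> \<omega>) ((1 - \<kappa> \<omega>) * (8 * \<epsilon>)) (Lt \<omega> D)" by (rule Bd_contract[OF w D D0])
  have BQc: "Bd (\<theta> \<omega>) (2 * (25 * \<epsilon>\<^sup>2 * \<kappa> \<omega>)) (\<lambda>z. Q z - \<delta> * h (\<theta> \<omega>) z)"
    using Bd_center[OF w' BQ] Qd by simp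
  \<comment> \<open>Here \<epsilon> \<le> 1/24 is used, and 25/576 is below 1/20.\<close>
  have ed: "\<epsilon> * \<bar>\<delta>\<bar> \<le> \<epsilon> * \<kappa> \<omega> / 20"
  proof -
    have "\<epsilon> * \<bar>\<delta>\<bar> \<le> 1 / 24 * (25 / 24 * (\<epsilon> * \<kappa> \<omega>))" using eps dle' e0 kap by (intro mult_mono) auto
    also have "\<dots> \<le> \<epsilon> * \<kappa> \<omega> / 20" using e0 kap by simp
    finally show ?thesis .
  qed
  have e2d: "\<epsilon>\<^sup>2 * \<bar>\<delta>\<bar> \<le> \<epsilon>\<^sup>2 * \<kappa> \<omega> / 20"
    using mult_left_mono[OF ed e0] by (simp add: power2_eq_square mult_ac)
  show "Bd (\<theta> \<omega>) (8 * \<epsilon>) (\<lambda>z. ?G z / p - h (\<theta> \<omega>) z)"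
  proof -
    \<comment> \<open>Budget in units of \<epsilon> \<kappa>: 8 are gained by contraction; the
      linear term costs 1, the centred \<open>Q\<close> costs 50 \<epsilon> \<le> 50/24, and
      dividing by \<open>p\<close> costs 8/20.\<close>
    have "Bd (\<theta> \<omega>) ((1 - \<kappa> \<omega>) * (8 * \<epsilon>) + (\<epsilon> * \<kappa> \<omega> + 2 * (25 * \<epsilon>\<^sup>2 * \<kappa> \<omega>)))
      (\<lambda>z. Lt \<omega> D z + (t * Lt \<omega> ?vh z + (Q z - \<delta> * h (\<theta> \<omega>) z)))"
      by (intro Bd_add w' BD Btvh BQc)
    then have "Bd (\<theta> \<omega>) (8 * \<epsilon> * p) (\<lambda>z. Lt \<omega> D z + (t * Lt \<omega> ?vh z + (Q z - \<delta> * h (\<theta> \<omega>) z)))"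
    proof (rule Bd_mono[OF w'])
      have "8 * \<epsilon> * p = 8 * \<epsilon> + 8 * (\<epsilon> * \<delta>)" by (simp add: \<delta>_def algebra_simps)
      moreover have "- (\<epsilon> * \<bar>\<delta>\<bar>) \<le> \<epsilon> * \<delta>" using e0 by (simp add: abs_if split: if_splits)
      moreover have "(1 - \<kappa> \<omega>) * (8 * \<epsilon>) = 8 * \<epsilon> - 8 * (\<epsilon> * \<kappa> \<omega>)" by (simp add: algebra_simps)
      moreover have "0 \<le> \<epsilon> * \<kappa> \<omega>" using e0 kap by simp
      ultimately show "(1 - \<kappa> \<omega>) * (8 * \<epsilon>) + (\<epsilon> * \<kappa> \<omega> + 2 * (25 * \<epsilon>\<^sup>2 * \<kappa> \<omega>)) \<le> 8 * \<epsilon> * p"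
        using ed e2k by linarith
    qed
    from Bd_scale[OF w' this, of "1 / p"]
    have "Bd (\<theta> \<omega>) (8 * \<epsilon>) (\<lambda>z. 1 / p * (Lt \<omega> D z + (t * Lt \<omega> ?vh z + (Q z - \<delta> * h (\<theta> \<omega>) z))))"
      using p0 by simp
    then show ?thesis
    proof (rule Bd_cong[OF w'])
      fix z assume z: "z \<in> X (\<theta> \<omega>)"
      show "1 / p * (Lt \<omega> D z + (t * Lt \<omega> ?vh z + (Q z - \<delta> * h (\<theta> \<omega>) z))) = ?G z / p - h (\<theta> \<omega>) z"
        unfolding Gz[OF z] \<delta>_def using p0 by (simp add: field_simps)
    qed
  qed
  let ?r' = "Lt \<omega> (\<lambda>x. r x + ?vh x)"
  have hrv: "holder \<alpha> (X \<omega>) (\<lambda>x. r x + ?vh x)" by (intro holder_add hr hvh)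
  show "integral\<^sup>L (\<nu> (\<theta> \<omega>)) ?r' = 0"
    unfolding nu_Lt[OF w hrv] using holder_integrable[OF w hr] holder_integrable[OF w hvh] r(1) v(2) by simp
  have r'z: "?r' z = Lt \<omega> r z + Lt \<omega> ?vh z" if "z \<in> X (\<theta> \<omega>)" for z
    by (rule Lt_add[OF w holder_bdd[OF hr] holder_bdd[OF hvh] that])
  show Br': "Bd (\<theta> \<omega>) A ?r'"
  proof -
    have "Bd (\<theta> \<omega>) ((1 - \<kappa> \<omega>) * A + gain \<omega> U V) (\<lambda>z. Lt \<omega> r z + Lt \<omega> ?vh z)"
      by (intro Bd_add w' Bd_contract[OF w r(2,1)] Bvh)
    then have "Bd (\<theta> \<omega>) A (\<lambda>z. Lt \<omega> r z + Lt \<omega> ?vh z)"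
      by (rule Bd_mono[OF w']) (use gc cA in \<open>simp add: algebra_simps\<close>)
    then show ?thesis by (rule Bd_cong[OF w']) (simp add: r'z)
  qed
  show "Bd (\<theta> \<omega>) (60 * \<epsilon>\<^sup>2) (\<lambda>z. ?G z / p - h (\<theta> \<omega>) z - t * ?r' z)"
  proof -
    \<comment> \<open>Division by \<open>p\<close> also rescales the first-order term, which leaves
      (1 - p) t r', a term of third order.\<close>
    have B3: "Bd (\<theta> \<omega>) (\<bar>\<delta>\<bar> * \<epsilon>) (\<lambda>z. - (\<delta> * t) * ?r' z)"
      using Bd_scale[OF w' Br', of "- (\<delta> * t)"] by (simp add: abs_mult \<epsilon>_def mult.assoc)
    \<comment> \<open>Budget in units of \<epsilon>^2 \<kappa>: 60 are gained; the centred
      \<open>Q\<close> costs 50, \<open>B3\<close> costs 25/24, and dividing by \<open>p\<close>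
      costs 3.\<close>
    have "Bd (\<theta> \<omega>) ((1 - \<kappa> \<omega>) * (60 * \<epsilon>\<^sup>2) + (2 * (25 * \<epsilon>\<^sup>2 * \<kappa> \<omega>) + \<bar>\<delta>\<bar> * \<epsilon>))
      (\<lambda>z. Lt \<omega> RR z + ((Q z - \<delta> * h (\<theta> \<omega>) z) + - (\<delta> * t) * ?r' z))"
      by (intro Bd_add w' Bd_contract[OF w RR RR0] BQc B3)
    then have "Bd (\<theta> \<omega>) (60 * \<epsilon>\<^sup>2 * p) (\<lambda>z. Lt \<omega> RR z + ((Q z - \<delta> * h (\<theta> \<omega>) z) + - (\<delta> * t) * ?r' z))"
    proof (rule Bd_mono[OF w'])
      have 1: "60 * \<epsilon>\<^sup>2 * p = 60 * \<epsilon>\<^sup>2 + 60 * (\<epsilon>\<^sup>2 * \<delta>)" by (simp add: \<delta>_def algebra_simps)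
      have 2: "- (\<epsilon>\<^sup>2 * \<bar>\<delta>\<bar>) \<le> \<epsilon>\<^sup>2 * \<delta>" by (simp add: abs_if split: if_splits)
      have 3: "\<bar>\<delta>\<bar> * \<epsilon> \<le> 25 / 24 * (\<epsilon>\<^sup>2 * \<kappa> \<omega>)"
        using mult_right_mono[OF dle' e0] by (simp add: power2_eq_square mult_ac)
      have 4: "0 \<le> \<epsilon>\<^sup>2 * \<kappa> \<omega>" using kap by simp
      have 5: "(1 - \<kappa> \<omega>) * (60 * \<epsilon>\<^sup>2) = 60 * \<epsilon>\<^sup>2 - 60 * (\<epsilon>\<^sup>2 * \<kappa> \<omega>)" by (simp add: algebra_simps)
      show "(1 - \<kappa> \<omega>) * (60 * \<epsilon>\<^sup>2) + (2 * (25 * \<epsilon>\<^sup>2 * \<kappa> \<omega>) + \<bar>\<delta>\<bar> * \<epsilon>) \<le> 60 * \<epsilon>\<^sup>2 * p"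
        using 1 2 3 4 5 e2d by linarith
    qed
    from Bd_scale[OF w' this, of "1 / p"]
    have "Bd (\<theta> \<omega>) (60 * \<epsilon>\<^sup>2) (\<lambda>z. 1 / p * (Lt \<omega> RR z + ((Q z - \<delta> * h (\<theta> \<omega>) z) + - (\<delta> * t) * ?r' z)))"
      using p0 by simp
    then show ?thesis
    proof (rule Bd_cong[OF w'])
      fix z assume z: "z \<in> X (\<theta> \<omega>)"
      have "Lt \<omega> RR z = Lt \<omega> D z - t * Lt \<omega> r z"
        unfolding RR_def by (subst Lt_diff[OF w _ _ z]) (auto simp: Lt_cmult intro!: holder_bdd holder_cmult hD hr)
      then show "1 / p * (Lt \<omega> RR z + ((Q z - \<delta> * h (\<theta> \<omega>) z) + - (\<delta> * t) * ?r' z))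
          = ?G z / p - h (\<theta> \<omega>) z - t * ?r' z"
        unfolding Gz[OF z] r'z[OF z] \<delta>_def using p0 by (simp add: field_simps)
    qed
  qed
  show "\<bar>ln p - t\<^sup>2 * ((\<integral>x. v x * r x \<partial>\<nu> \<omega>) + (\<integral>x. (v x)\<^sup>2 * h \<omega> x \<partial>\<nu> \<omega>) / 2)\<bar> \<le> 130 * \<epsilon> ^ 3"
  proof -
    have hv2: "holder \<alpha> (X \<omega>) (\<lambda>x. v x * r x)" "holder \<alpha> (X \<omega>) (\<lambda>x. v x * RR x)"
      "holder \<alpha> (X \<omega>) (\<lambda>x. (v x)\<^sup>2)" "holder \<alpha> (X \<omega>) (\<lambda>x. W2 x * D x)"
      unfolding power2_eq_square by (intro holder_mult hv hr hRR hW hD)+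
    have hv2h: "holder \<alpha> (X \<omega>) (\<lambda>x. (v x)\<^sup>2 * h \<omega> x)" by (intro holder_mult hv2 hh)
    \<comment> \<open>Third-order part of the exponential. The error constant collects 1 from
      \<open>W3\<close>, 60 from \<open>RR\<close>, 8 from W2 D, and 53 from replacing ln p by p -
      1; the sum is below 130.\<close>
    define W3 where "W3 = (\<lambda>x. W2 x - t\<^sup>2 / 2 * (v x)\<^sup>2)"
    have hW3: "holder \<alpha> (X \<omega>) W3" unfolding W3_def by (intro holder_diff holder_cmult hW hv2)
    have hW3h: "holder \<alpha> (X \<omega>) (\<lambda>x. W3 x * h \<omega> x)" by (intro holder_mult hW3 hh)
    have eU: "0 \<le> \<bar>t\<bar> * U" using UV by simp
    have W3b: "\<bar>W3 x\<bar> \<le> \<epsilon> ^ 3" if x: "x \<in> X \<omega>" for x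
    proof -
      have s: "\<bar>t * v x\<bar> \<le> \<bar>t\<bar> * U"
        using v(1) x unfolding wlip_def abs_mult by (intro mult_left_mono) auto
      have "\<bar>W3 x\<bar> \<le> exp (\<bar>t\<bar> * U) * (\<bar>t\<bar> * U) ^ 3"
        using exp_remainder3_bound[OF s] by (simp add: W3_def W2_def power_mult_distrib)
      also have "\<dots> = (exp (\<bar>t\<bar> * U) * (\<bar>t\<bar> * U)) * (\<bar>t\<bar> * U)\<^sup>2"
        by (simp add: eval_nat_numeral)
      also have "\<dots> \<le> (exp U * (\<bar>t\<bar> * U)) * (\<bar>t\<bar> * U)\<^sup>2"
        using t1 UV eU by (intro mult_right_mono) (auto simp: mult_left_le_one_le)
      also have "\<dots> = (\<bar>t\<bar> * (exp U * U)) * (\<bar>t\<bar> * U)\<^sup>2" by simp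
      also have "\<dots> \<le> \<epsilon> * \<epsilon>\<^sup>2" using tU tU' e0 eU by (intro mult_mono power_mono) auto
      finally show ?thesis by (simp add: eval_nat_numeral)
    qed
    have "\<delta> = t * (\<integral>x. ?vh x \<partial>\<nu> \<omega>) + ((\<integral>x. W1 x * D x \<partial>\<nu> \<omega>) + (\<integral>x. W2 x * h \<omega> x \<partial>\<nu> \<omega>))"
      unfolding d1 W1F
      using holder_integrable[OF w hWD(1)] holder_integrable[OF w hWD(2)] holder_integrable[OF w hvh]
      by simp
    moreover have "(\<integral>x. W1 x * D x \<partial>\<nu> \<omega>) = t\<^sup>2 * (\<integral>x. v x * r x \<partial>\<nu> \<omega>) + t * (\<integral>x. v x * RR x \<partial>\<nu> \<omega>) + (\<integral>x. W2 x * D x \<partial>\<nu> \<omega>)"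
    proof -
      have "(\<lambda>x. W1 x * D x) = (\<lambda>x. t\<^sup>2 * (v x * r x) + t * (v x * RR x) + W2 x * D x)"
        by (intro ext) (simp add: W1_def W2_def RR_def power2_eq_square algebra_simps)
      then show ?thesis
        using holder_integrable[OF w hv2(1)] holder_integrable[OF w hv2(2)] holder_integrable[OF w hv2(4)]
        by simp
    qed
    moreover have "(\<integral>x. W2 x * h \<omega> x \<partial>\<nu> \<omega>) = (\<integral>x. W3 x * h \<omega> x \<partial>\<nu> \<omega>) + t\<^sup>2 / 2 * (\<integral>x. (v x)\<^sup>2 * h \<omega> x \<partial>\<nu> \<omega>)"
    proof -
      have "(\<lambda>x. W2 x * h \<omega> x) = (\<lambda>x. W3 x * h \<omega> x + t\<^sup>2 / 2 * ((v x)\<^sup>2 * h \<omega> x))"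
        by (intro ext) (simp add: W3_def algebra_simps)
      then show ?thesis using holder_integrable[OF w hW3h] holder_integrable[OF w hv2h] by simp
    qed
    moreover have "\<bar>\<integral>x. W3 x * h \<omega> x \<partial>\<nu> \<omega>\<bar> \<le> \<epsilon> ^ 3 * 1"
      using h_pos[OF w] by (intro nu_mult_bound w hW3 W3b hh) (auto simp: less_imp_le)
    moreover have "\<bar>t * (\<integral>x. v x * RR x \<partial>\<nu> \<omega>)\<bar> \<le> 60 * \<epsilon> ^ 3"
    proof -
      have "\<bar>\<integral>x. v x * RR x \<partial>\<nu> \<omega>\<bar> \<le> U * (60 * \<epsilon>\<^sup>2)"
        using v(1) by (intro nu_mult_bound w hv hRR Bd_abs[OF w RR]) (auto simp: wlip_def)
      then have "\<bar>t\<bar> * \<bar>\<integral>x. v x * RR x \<partial>\<nu> \<omega>\<bar> \<le> \<bar>t\<bar> * (U * (60 * \<epsilon>\<^sup>2))" by (intro mult_left_mono) auto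
      also have "\<dots> = (\<bar>t\<bar> * U) * (60 * \<epsilon>\<^sup>2)" by simp
      also have "\<dots> \<le> \<epsilon> * (60 * \<epsilon>\<^sup>2)" using tU' by (intro mult_right_mono) auto
      finally show ?thesis by (simp add: abs_mult eval_nat_numeral)
    qed
    moreover have "\<bar>\<integral>x. W2 x * D x \<partial>\<nu> \<omega>\<bar> \<le> 8 * \<epsilon> ^ 3"
    proof -
      have "\<bar>\<integral>x. W2 x * D x \<partial>\<nu> \<omega>\<bar> \<le> (t\<^sup>2 * U * (exp U * U)) * (8 * \<epsilon>)"
        using W2 by (intro nu_mult_bound w hW hD Bd_abs[OF w D]) (auto simp: wlip_def)
      also have "t\<^sup>2 * U * (exp U * U) = (\<bar>t\<bar> * U) * (\<bar>t\<bar> * (exp U * U))"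
        by (simp add: power2_eq_square mult_ac)
      also have "(\<bar>t\<bar> * U) * (\<bar>t\<bar> * (exp U * U)) * (8 * \<epsilon>) \<le> \<epsilon> * \<epsilon> * (8 * \<epsilon>)"
        using e0 UV by (intro mult_mono tU tU' mult_nonneg_nonneg) auto
      finally show ?thesis by (simp add: eval_nat_numeral)
    qed
    moreover have "\<bar>ln p - \<delta>\<bar> \<le> 53 * \<epsilon> ^ 3"
    proof -
      have "\<bar>ln (1 + \<delta>) - \<delta>\<bar> \<le> 2 * \<delta>\<^sup>2"
        using p14 by (intro abs_ln_one_plus_x_minus_x_bound) (simp add: \<delta>_def)
      moreover have "\<delta>\<^sup>2 \<le> (25 * \<epsilon>\<^sup>2) * (25 / 24 * \<epsilon>)"
      proof -
        have "25 * \<epsilon>\<^sup>2 * \<kappa> \<omega> \<le> 25 * \<epsilon>\<^sup>2" using kap by (simp add: mult_left_le)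
        then have "\<bar>\<delta>\<bar> * \<bar>\<delta>\<bar> \<le> (25 * \<epsilon>\<^sup>2) * (25 / 24 * \<epsilon>)"
          using dle dle'' by (intro mult_mono) auto
        then show ?thesis by (simp add: power2_eq_square)
      qed
      moreover have "(25 * \<epsilon>\<^sup>2) * (25 / 24 * \<epsilon>) = 625 / 24 * \<epsilon> ^ 3" by (simp add: eval_nat_numeral)
      moreover have "0 \<le> \<epsilon> ^ 3" using e0 by simp
      moreover have "ln p = ln (1 + \<delta>)" by (simp add: \<delta>_def)
      ultimately show ?thesis by linarith
    qed
    moreover have "t\<^sup>2 * ((\<integral>x. v x * r x \<partial>\<nu> \<omega>) + (\<integral>x. (v x)\<^sup>2 * h \<omega> x \<partial>\<nu> \<omega>) / 2)
       = t\<^sup>2 * (\<integral>x. v x * r x \<partial>\<nu> \<omega>) + t\<^sup>2 / 2 * (\<integral>x. (v x)\<^sup>2 * h \<omega> x \<partial>\<nu> \<omega>)"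
      by (simp add: algebra_simps)
    moreover have "0 \<le> \<epsilon> ^ 3" using e0 by simp
    ultimately show ?thesis using v(2) unfolding abs_le_iff by (simp add: algebra_simps)
  qed
qed

end

section \<open>Tilted densities and moments along one orbit\<close>

text \<open>A single orbit is fixed. The centred observables over its points are an arbitrary
  sequence \<open>v\<close> with numerical bounds \<open>U\<close> and \<open>V\<close>, so no
  measurability in \<omega> is involved from here to the final limit.\<close>

locale observed_orbit = cone_cocycle +
  fixes \<omega>\<^sub>0 :: 'a and v :: "nat \<Rightarrow> 'b \<Rightarrow> real" and U V :: "nat \<Rightarrow> real"
  assumes w0: "\<omega>\<^sub>0 \<in> W"
    and v_lip: "wlip ((\<theta> ^^ j) \<omega>\<^sub>0) (v j) (U j) (V j)"
    and v_mean: "(\<integral>x. v j x * h ((\<theta> ^^ j) \<omega>\<^sub>0) x \<partial>\<nu> ((\<theta> ^^ j) \<omega>\<^sub>0)) = 0"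
begin

abbreviation orb :: "nat \<Rightarrow> 'a" where "orb j \<equiv> (\<theta> ^^ j) \<omega>\<^sub>0"

abbreviation Tp :: "nat \<Rightarrow> 'b \<Rightarrow> 'b" where "Tp j \<equiv> Tpow \<theta> T j \<omega>\<^sub>0"

lemma orb_in: "orb j \<in> W" by (rule funpow_th_in[OF w0])

text \<open>For small \<open>t\<close>, the density with respect to \<nu> over \<open>orb n\<close>
  of the image under \<open>Tp n\<close> of the probability proportional to exp (t S_n) h \<nu>; see
  \<open>exp_transfer\<close>.\<close>

primrec F :: "real \<Rightarrow> nat \<Rightarrow> 'b \<Rightarrow> real" where
  "F t 0 = h \<omega>\<^sub>0"
| "F t (Suc j) = (\<lambda>z. Lt (orb j) (\<lambda>x. exp (t * v j x) * F t j x) z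
      / (\<integral>x. exp (t * v j x) * F t j x \<partial>\<nu> (orb j)))"

definition p :: "real \<Rightarrow> nat \<Rightarrow> real" where
  "p t j = (\<integral>x. exp (t * v j x) * F t j x \<partial>\<nu> (orb j))"

text \<open>The image of S_n h under the normalised n-step operator (\<open>transfer_S\<close>). It
  is the first-order coefficient of \<open>F\<close> in \<open>t\<close>, since centring removes the
  linear term of the normalisation.\<close>

primrec rr :: "nat \<Rightarrow> 'b \<Rightarrow> real" where
  "rr 0 = (\<lambda>_. 0)"
| "rr (Suc j) = Lt (orb j) (\<lambda>x. rr j x + v j x * h (orb j) x)"

definition S :: "nat \<Rightarrow> 'b \<Rightarrow> real" where
  "S n x = (\<Sum>j<n. v j (Tp j x))"

text \<open>The variance organised by the time of the later factor: each term has the square of v_j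
  and twice its correlation with the sum of all earlier observables, which is what
  \<open>rr j\<close> records.\<close>

definition Vsum :: "nat \<Rightarrow> real" where
  "Vsum n = (\<Sum>j<n. 2 * (\<integral>x. v j x * rr j x \<partial>\<nu> (orb j)) + (\<integral>x. (v j x)\<^sup>2 * h (orb j) x \<partial>\<nu> (orb j)))"

text \<open>At the start \<open>F\<close> is \<open>h\<close> and \<open>rr\<close> is 0, so all
  errors vanish. One constant \<open>A\<close> serves all steps below \<open>N\<close>, and the
  bounds do not grow with \<open>j\<close>.\<close>

lemma tilt_invariant:
  assumes A: "1 \<le> A" "\<And>j. j < N \<Longrightarrow> exp (U j) * gain (orb j) (U j) (V j) \<le> A * \<kappa> (orb j)"
    and eps: "\<bar>t\<bar> * A \<le> 1 / 24" and j: "j \<le> N"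
  shows "integral\<^sup>L (\<nu> (orb j)) (F t j) = 1 \<and> Bd (orb j) (8 * (\<bar>t\<bar> * A)) (\<lambda>x. F t j x - h (orb j) x) \<and>
    integral\<^sup>L (\<nu> (orb j)) (rr j) = 0 \<and> Bd (orb j) A (rr j) \<and>
    Bd (orb j) (60 * (\<bar>t\<bar> * A)\<^sup>2) (\<lambda>x. F t j x - h (orb j) x - t * rr j x)"
  using j
proof (induction j)
  case 0
  then show ?case using A(1) w0 by (auto simp: h_nu intro!: Bd_zero)
next
  case (Suc j)
  then have IH: "integral\<^sup>L (\<nu> (orb j)) (F t j) = 1" "Bd (orb j) (8 * (\<bar>t\<bar> * A)) (\<lambda>x. F t j x - h (orb j) x)"
    "integral\<^sup>L (\<nu> (orb j)) (rr j) = 0" "Bd (orb j) A (rr j)"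
    "Bd (orb j) (60 * (\<bar>t\<bar> * A)\<^sup>2) (\<lambda>x. F t j x - h (orb j) x - t * rr j x)" by auto
  note step = tilt_step[OF orb_in v_lip v_mean A(1) A(2) eps IH]
  show ?case using step(2-6) Suc.prems by simp
qed

lemma ln_p_bound:
  assumes A: "1 \<le> A" "\<And>j. j < N \<Longrightarrow> exp (U j) * gain (orb j) (U j) (V j) \<le> A * \<kappa> (orb j)"
    and eps: "\<bar>t\<bar> * A \<le> 1 / 24" and j: "j < N"
  shows "0 < p t j"
    and "\<bar>ln (p t j) - t\<^sup>2 / 2 * (2 * (\<integral>x. v j x * rr j x \<partial>\<nu> (orb j)) + (\<integral>x. (v j x)\<^sup>2 * h (orb j) x \<partial>\<nu> (orb j)))\<bar>
      \<le> 130 * (\<bar>t\<bar> * A) ^ 3"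
proof -
  from tilt_invariant[OF A eps, of j] j
  have IH: "integral\<^sup>L (\<nu> (orb j)) (F t j) = 1" "Bd (orb j) (8 * (\<bar>t\<bar> * A)) (\<lambda>x. F t j x - h (orb j) x)"
    "integral\<^sup>L (\<nu> (orb j)) (rr j) = 0" "Bd (orb j) A (rr j)"
    "Bd (orb j) (60 * (\<bar>t\<bar> * A)\<^sup>2) (\<lambda>x. F t j x - h (orb j) x - t * rr j x)" by auto
  note step = tilt_step[OF orb_in v_lip v_mean A(1) A(2)[OF j] eps IH]
  show "0 < p t j" using step(1) unfolding p_def by linarith
  show "\<bar>ln (p t j) - t\<^sup>2 / 2 * (2 * (\<integral>x. v j x * rr j x \<partial>\<nu> (orb j)) + (\<integral>x. (v j x)\<^sup>2 * h (orb j) x \<partial>\<nu> (orb j)))\<bar>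
      \<le> 130 * (\<bar>t\<bar> * A) ^ 3"
    using step(7) unfolding p_def by (simp add: distrib_left)
qed

lemma v_holder: "holder \<alpha> (X (orb j)) (v j)"
  by (rule wlip_holder[OF v_lip])

lemma exp_v_holder: "\<bar>t\<bar> \<le> 1 \<Longrightarrow> holder \<alpha> (X (orb j)) (\<lambda>x. exp (t * v j x))"
  using holder_add[OF wlip_holder[OF wlip_exp(1)[OF v_lip]] holder_const[of _ _ 1], of t j] by simp

lemma F_holder: "\<bar>t\<bar> \<le> 1 \<Longrightarrow> holder \<alpha> (X (orb j)) (F t j)"
proof (induction j)
  case 0
  then show ?case using h_holder[OF w0] by simp
next
  case (Suc j)
  have "holder \<alpha> (X (\<theta> (orb j))) (Lt (orb j) (\<lambda>x. exp (t * v j x) * F t j x))"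
    using Suc by (intro holder_Lt orb_in holder_mult exp_v_holder) auto
  then show ?case using holder_cmult[of _ _ _ "1 / p t j"] by (simp add: p_def)
qed

lemma rr_holder: "holder \<alpha> (X (orb j)) (rr j)"
proof (induction j)
  case (Suc j)
  have "holder \<alpha> (X (\<theta> (orb j))) (Lt (orb j) (\<lambda>x. rr j x + v j x * h (orb j) x))"
    using Suc by (intro holder_Lt orb_in holder_add holder_mult v_holder h_holder)
  then show ?case by simp
qed (simp add: holder_const)

lemma Tp_measurable: "Tp n \<in> measurable (\<nu> \<omega>\<^sub>0) (\<nu> (orb n))"
proof (induction n)
  case 0
  have "Tp 0 = (\<lambda>x. x)" by (simp add: fun_eq_iff)
  then show ?case by simp
next
  case (Suc n)
  have "(\<lambda>x. T (orb n) (Tp n x)) \<in> measurable (\<nu> \<omega>\<^sub>0) (\<nu> (\<theta> (orb n)))"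
    by (rule measurable_compose[OF Suc T_measurable[OF orb_in]])
  then show ?case by simp
qed

lemma Tp_in: "x \<in> X \<omega>\<^sub>0 \<Longrightarrow> Tp n x \<in> X (orb n)"
  using measurable_space[OF Tp_measurable] nu_space[OF orb_in] nu_space[OF w0] by auto

lemma S_measurable: "S n \<in> borel_measurable (\<nu> \<omega>\<^sub>0)"
  unfolding S_def
  by (intro borel_measurable_sum measurable_compose[OF Tp_measurable] holder_meas orb_in v_holder)

lemma S_bdd: "bdd_on \<omega>\<^sub>0 (S n)"
proof (rule bdd_onI[of _ _ "\<Sum>j<n. U j"])
  fix x assume x: "x \<in> X \<omega>\<^sub>0"
  show "\<bar>S n x\<bar> \<le> (\<Sum>j<n. U j)"
    unfolding S_def
    by (rule order_trans[OF sum_abs]) (use v_lip Tp_in[OF x] in \<open>auto intro!: sum_mono simp: wlip_def\<close>)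
qed

lemma bdd_compose_Tp: "bdd_on (orb n) k \<Longrightarrow> bdd_on \<omega>\<^sub>0 (\<lambda>x. k (Tp n x))"
  unfolding bdd_on_def using Tp_in by blast

lemma exp_bdd: "bdd_on \<omega> f \<Longrightarrow> bdd_on \<omega> (\<lambda>x. exp (t * f x))"
proof -
  assume "bdd_on \<omega> f"
  then obtain B where B: "\<And>x. x \<in> X \<omega> \<Longrightarrow> \<bar>f x\<bar> \<le> B" unfolding bdd_on_def by blast
  show ?thesis
  proof (rule bdd_onI[of _ _ "exp (\<bar>t\<bar> * B)"])
    fix x assume "x \<in> X \<omega>"
    then have "\<bar>t * f x\<bar> \<le> \<bar>t\<bar> * B" unfolding abs_mult using B by (intro mult_left_mono) auto
    then show "\<bar>exp (t * f x)\<bar> \<le> exp (\<bar>t\<bar> * B)" by simp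
  qed
qed

text \<open>Duality peels off one map per step; a general \<open>k\<close> is carried along so that
  \<open>k\<close> composed with \<open>T\<close>, times the next exponential factor, can serve as
  test function in the induction.\<close>

lemma exp_transfer:
  assumes "\<bar>t\<bar> \<le> 1" "\<And>j. j < n \<Longrightarrow> 0 < p t j" "k \<in> borel_measurable (\<nu> (orb n))" "bdd_on (orb n) k"
  shows "(\<integral>x. k (Tp n x) * (exp (t * S n x) * h \<omega>\<^sub>0 x) \<partial>\<nu> \<omega>\<^sub>0)
    = (\<Prod>j<n. p t j) * (\<integral>x. k x * F t n x \<partial>\<nu> (orb n))"
  using assms(2-)
proof (induction n arbitrary: k)
  case 0
  then show ?case by (simp add: S_def)
next
  case (Suc n)
  let ?k = "\<lambda>y. k (T (orb n) y) * exp (t * v n y)"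
  have k: "k \<in> borel_measurable (\<nu> (\<theta> (orb n)))" "bdd_on (\<theta> (orb n)) k" using Suc.prems by simp_all
  have "(\<integral>x. k (Tp (Suc n) x) * (exp (t * S (Suc n) x) * h \<omega>\<^sub>0 x) \<partial>\<nu> \<omega>\<^sub>0)
      = (\<integral>x. ?k (Tp n x) * (exp (t * S n x) * h \<omega>\<^sub>0 x) \<partial>\<nu> \<omega>\<^sub>0)"
    by (simp add: S_def distrib_left exp_add mult_ac)
  also have "\<dots> = (\<Prod>j<n. p t j) * (\<integral>x. ?k x * F t n x \<partial>\<nu> (orb n))"
  proof (rule Suc.IH)
    show "?k \<in> borel_measurable (\<nu> (orb n))"
      by (intro borel_measurable_times measurable_compose[OF T_measurable[OF orb_in] k(1)]
          holder_meas orb_in exp_v_holder assms(1))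
    show "bdd_on (orb n) ?k"
    proof (rule bdd_on_mult)
      show "bdd_on (orb n) (\<lambda>x. k (T (orb n) x))"
        using k(2) T_in[OF orb_in, of _ n] by (auto simp: bdd_on_def)
    qed (intro exp_bdd holder_bdd v_holder)
  qed (use Suc.prems in auto)
  also have "(\<integral>x. ?k x * F t n x \<partial>\<nu> (orb n)) = (\<integral>x. k (T (orb n) x) * (exp (t * v n x) * F t n x) \<partial>\<nu> (orb n))"
    by (simp add: mult.assoc)
  also have "\<dots> = (\<integral>x. k x * Lt (orb n) (\<lambda>x. exp (t * v n x) * F t n x) x \<partial>\<nu> (\<theta> (orb n)))"
    by (intro transfer orb_in k holder_mult exp_v_holder F_holder assms)
  also have "\<dots> = (\<integral>x. p t n * (k x * F t (Suc n) x) \<partial>\<nu> (orb (Suc n)))"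
    using Suc.prems(1)[of n] by (simp add: p_def mult_ac)
  finally show ?case by (simp add: mult.assoc)
qed

lemma transfer_Tp:
  assumes "k \<in> borel_measurable (\<nu> (orb n))" "bdd_on (orb n) k"
  shows "(\<integral>x. k (Tp n x) * h \<omega>\<^sub>0 x \<partial>\<nu> \<omega>\<^sub>0) = (\<integral>x. k x * h (orb n) x \<partial>\<nu> (orb n))"
  using assms
proof (induction n arbitrary: k)
  case (Suc n)
  have k: "k \<in> borel_measurable (\<nu> (\<theta> (orb n)))" "bdd_on (\<theta> (orb n)) k" using Suc.prems by simp_all
  have "(\<integral>x. k (Tp (Suc n) x) * h \<omega>\<^sub>0 x \<partial>\<nu> \<omega>\<^sub>0) = (\<integral>x. k (T (orb n) x) * h (orb n) x \<partial>\<nu> (orb n))"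
    using Suc.IH[of "\<lambda>x. k (T (orb n) x)"] measurable_compose[OF T_measurable[OF orb_in] k(1)] k(2)
      T_in[OF orb_in[of n]] by (auto simp: bdd_on_def)
  also have "\<dots> = (\<integral>x. k x * Lt (orb n) (h (orb n)) x \<partial>\<nu> (\<theta> (orb n)))"
    by (intro transfer orb_in k h_holder)
  also have "\<dots> = (\<integral>x. k x * h (\<theta> (orb n)) x \<partial>\<nu> (\<theta> (orb n)))"
    by (intro nu_cong th_in orb_in) (simp add: h_invariant[OF orb_in])
  finally show ?case by simp
qed simp

text \<open>Identifies \<open>rr\<close> as the transported first moment: the new observable is
  added before the operator is applied, as in its recursion.\<close>

lemma transfer_S:
  assumes "k \<in> borel_measurable (\<nu> (orb n))" "bdd_on (orb n) k"
  shows "(\<integral>x. k (Tp n x) * (S n x * h \<omega>\<^sub>0 x) \<partial>\<nu> \<omega>\<^sub>0) = (\<integral>x. k x * rr n x \<partial>\<nu> (orb n))"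
  using assms
proof (induction n arbitrary: k)
  case (Suc n)
  let ?k = "\<lambda>x. k (T (orb n) x)"
  have k: "k \<in> borel_measurable (\<nu> (\<theta> (orb n)))" "bdd_on (\<theta> (orb n)) k" using Suc.prems by simp_all
  have kT: "?k \<in> borel_measurable (\<nu> (orb n))" "bdd_on (orb n) ?k"
    using measurable_compose[OF T_measurable[OF orb_in] k(1)] k(2) T_in[OF orb_in[of n]] by (auto simp: bdd_on_def)
  have kv: "(\<lambda>x. ?k x * v n x) \<in> borel_measurable (\<nu> (orb n))" "bdd_on (orb n) (\<lambda>x. ?k x * v n x)"
    using holder_meas[OF orb_in v_holder, of n] holder_bdd[OF v_holder, of n] kT by (auto intro: bdd_on_mult)
  have i1: "integrable (\<nu> \<omega>\<^sub>0) (\<lambda>x. ?k (Tp n x) * (S n x * h \<omega>\<^sub>0 x))"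
    by (intro bdd_integrable w0 bdd_on_mult bdd_compose_Tp kT S_bdd holder_bdd h_holder
        borel_measurable_times measurable_compose[OF Tp_measurable] S_measurable holder_meas)
  have i2: "integrable (\<nu> \<omega>\<^sub>0) (\<lambda>x. (?k (Tp n x) * v n (Tp n x)) * h \<omega>\<^sub>0 x)"
    by (intro bdd_integrable w0 bdd_on_mult bdd_compose_Tp kT holder_bdd h_holder v_holder
        borel_measurable_times measurable_compose[OF Tp_measurable] holder_meas orb_in)
  have j1: "integrable (\<nu> (orb n)) (\<lambda>x. ?k x * rr n x)"
    by (intro bdd_integrable orb_in bdd_on_mult kT holder_bdd rr_holder borel_measurable_times holder_meas)
  have j2: "integrable (\<nu> (orb n)) (\<lambda>x. (?k x * v n x) * h (orb n) x)"
    by (intro bdd_integrable orb_in bdd_on_mult kv holder_bdd h_holder borel_measurable_times holder_meas)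
  have "(\<integral>x. k (Tp (Suc n) x) * (S (Suc n) x * h \<omega>\<^sub>0 x) \<partial>\<nu> \<omega>\<^sub>0)
      = (\<integral>x. ?k (Tp n x) * (S n x * h \<omega>\<^sub>0 x) + (?k (Tp n x) * v n (Tp n x)) * h \<omega>\<^sub>0 x \<partial>\<nu> \<omega>\<^sub>0)"
    by (simp add: S_def algebra_simps)
  also have "\<dots> = (\<integral>x. ?k x * rr n x \<partial>\<nu> (orb n)) + (\<integral>x. (?k x * v n x) * h (orb n) x \<partial>\<nu> (orb n))"
    using i1 i2 Suc.IH[OF kT] transfer_Tp[OF kv] by simp
  also have "\<dots> = (\<integral>x. ?k x * (rr n x + v n x * h (orb n) x) \<partial>\<nu> (orb n))"
    using j1 j2 by (simp add: algebra_simps)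
  also have "\<dots> = (\<integral>x. k x * Lt (orb n) (\<lambda>x. rr n x + v n x * h (orb n) x) x \<partial>\<nu> (\<theta> (orb n)))"
    by (intro transfer orb_in k holder_add holder_mult rr_holder v_holder h_holder)
  finally show ?case by simp
qed (simp add: S_def)

text \<open>Expand the square of S_(n+1); the cross term is \<open>transfer_S\<close> with k = v_n
  and the diagonal term is \<open>transfer_Tp\<close>.\<close>

lemma second_moment: "(\<integral>x. (S n x)\<^sup>2 * h \<omega>\<^sub>0 x \<partial>\<nu> \<omega>\<^sub>0) = Vsum n"
proof (induction n)
  case (Suc n)
  have v: "v n \<in> borel_measurable (\<nu> (orb n))" "bdd_on (orb n) (v n)"
    by (auto intro!: holder_meas orb_in v_holder holder_bdd)
  have v2: "(\<lambda>x. (v n x)\<^sup>2) \<in> borel_measurable (\<nu> (orb n))" "bdd_on (orb n) (\<lambda>x. (v n x)\<^sup>2)"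
    using v unfolding power2_eq_square by (auto intro!: borel_measurable_times bdd_on_mult)
  have i1: "integrable (\<nu> \<omega>\<^sub>0) (\<lambda>x. (S n x)\<^sup>2 * h \<omega>\<^sub>0 x)"
    unfolding power2_eq_square
    by (intro bdd_integrable w0 bdd_on_mult S_bdd holder_bdd h_holder borel_measurable_times S_measurable holder_meas)
  have i2: "integrable (\<nu> \<omega>\<^sub>0) (\<lambda>x. v n (Tp n x) * (S n x * h \<omega>\<^sub>0 x))"
    by (intro bdd_integrable w0 bdd_on_mult bdd_compose_Tp v S_bdd holder_bdd h_holder
        borel_measurable_times measurable_compose[OF Tp_measurable] S_measurable holder_meas)
  have i3: "integrable (\<nu> \<omega>\<^sub>0) (\<lambda>x. (v n (Tp n x))\<^sup>2 * h \<omega>\<^sub>0 x)"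
    by (intro bdd_integrable w0 bdd_on_mult bdd_compose_Tp v2 holder_bdd h_holder
        borel_measurable_times measurable_compose[OF Tp_measurable v2(1)] holder_meas)
  have "(\<integral>x. (S (Suc n) x)\<^sup>2 * h \<omega>\<^sub>0 x \<partial>\<nu> \<omega>\<^sub>0)
      = (\<integral>x. ((S n x)\<^sup>2 * h \<omega>\<^sub>0 x + 2 * (v n (Tp n x) * (S n x * h \<omega>\<^sub>0 x))) + (v n (Tp n x))\<^sup>2 * h \<omega>\<^sub>0 x \<partial>\<nu> \<omega>\<^sub>0)"
    by (simp add: S_def power2_eq_square algebra_simps)
  also have "\<dots> = Vsum (Suc n)"
    using i1 i2 i3 Suc transfer_S[OF v] transfer_Tp[OF v2] by (simp add: Vsum_def)
  finally show ?case .
qed (simp add: S_def Vsum_def)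

text \<open>For k = 1 the transfer formula turns the moment generating function into the product of
  the \<open>p t j\<close>, whose logarithms are known up to third order. Their second-order
  coefficients add up to the variance.\<close>

lemma log_mgf_bound:
  assumes A: "1 \<le> A" "\<And>j. j < N \<Longrightarrow> exp (U j) * gain (orb j) (U j) (V j) \<le> A * \<kappa> (orb j)"
    and eps: "\<bar>t\<bar> * A \<le> 1 / 24"
  shows "\<bar>ln (\<integral>x. exp (t * S N x) * h \<omega>\<^sub>0 x \<partial>\<nu> \<omega>\<^sub>0) - t\<^sup>2 / 2 * Vsum N\<bar> \<le> 130 * real N * (\<bar>t\<bar> * A) ^ 3"
proof -
  have t1: "\<bar>t\<bar> \<le> 1"
  proof -
    have "\<bar>t\<bar> * 1 \<le> \<bar>t\<bar> * A" using A by (intro mult_left_mono) auto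
    then show ?thesis using eps by simp
  qed
  have pos: "0 < p t j" if "j < N" for j by (rule ln_p_bound(1)[OF A eps that])
  have "(\<integral>x. exp (t * S N x) * h \<omega>\<^sub>0 x \<partial>\<nu> \<omega>\<^sub>0) = (\<Prod>j<N. p t j)"
    using exp_transfer[OF t1 pos _ bdd_on_const, of N 1] tilt_invariant[OF A eps, of N] by simp
  then have "ln (\<integral>x. exp (t * S N x) * h \<omega>\<^sub>0 x \<partial>\<nu> \<omega>\<^sub>0) = (\<Sum>j<N. ln (p t j))"
    by (simp only:) (intro ln_prod; use pos in force)
  then have "\<bar>ln (\<integral>x. exp (t * S N x) * h \<omega>\<^sub>0 x \<partial>\<nu> \<omega>\<^sub>0) - t\<^sup>2 / 2 * Vsum N\<bar>
    = \<bar>\<Sum>j<N. ln (p t j) - t\<^sup>2 / 2 * (2 * (\<integral>x. v j x * rr j x \<partial>\<nu> (orb j)) + (\<integral>x. (v j x)\<^sup>2 * h (orb j) x \<partial>\<nu> (orb j)))\<bar>"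
    unfolding Vsum_def by (simp add: sum_subtractf sum_distrib_left)
  also have "\<dots> \<le> (\<Sum>j<N. 130 * (\<bar>t\<bar> * A) ^ 3)"
    by (rule order_trans[OF sum_abs]) (intro sum_mono ln_p_bound(2)[OF A eps]; simp)
  finally show ?thesis by simp
qed

definition \<mu> :: "'b measure" where
  "\<mu> = density (\<nu> \<omega>\<^sub>0) (\<lambda>x. ennreal (h \<omega>\<^sub>0 x))"

lemma mu_simps: "space \<mu> = X \<omega>\<^sub>0" "sets \<mu> = sets (\<nu> \<omega>\<^sub>0)" "borel_measurable \<mu> = borel_measurable (\<nu> \<omega>\<^sub>0)"
  unfolding \<mu>_def by (auto simp: nu_space[OF w0])

lemma h_AE_nonneg: "AE x in \<nu> \<omega>\<^sub>0. 0 \<le> h \<omega>\<^sub>0 x"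
  using h_pos[OF w0] nu_space[OF w0] by (intro AE_I2) (auto simp: less_imp_le)

lemma h_meas: "h \<omega>\<^sub>0 \<in> borel_measurable (\<nu> \<omega>\<^sub>0)"
  by (intro holder_meas w0 h_holder)

lemma mu_integral: "g \<in> borel_measurable (\<nu> \<omega>\<^sub>0) \<Longrightarrow> integral\<^sup>L \<mu> g = (\<integral>x. g x * h \<omega>\<^sub>0 x \<partial>\<nu> \<omega>\<^sub>0)"
  unfolding \<mu>_def using h_AE_nonneg h_meas by (subst integral_density) (auto simp: mult.commute)

lemma mu_integrable: "g \<in> borel_measurable (\<nu> \<omega>\<^sub>0) \<Longrightarrow> bdd_on \<omega>\<^sub>0 g \<Longrightarrow> integrable \<mu> g"
  unfolding \<mu>_def using h_AE_nonneg h_meas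
  using bdd_integrable[OF w0 bdd_on_mult[OF holder_bdd[OF h_holder[OF w0]]], of g]
  by (subst integrable_density) auto

lemma mu_prob: "prob_space \<mu>"
proof (rule prob_spaceI)
  have "emeasure \<mu> (space \<mu>) = (\<integral>\<^sup>+x. ennreal (h \<omega>\<^sub>0 x) \<partial>\<nu> \<omega>\<^sub>0)"
    unfolding \<mu>_def using h_meas by (subst emeasure_density) (auto intro!: nn_integral_cong simp: indicator_def)
  also have "\<dots> = 1"
    using nn_integral_eq_integral[OF holder_integrable[OF w0 h_holder[OF w0]] h_AE_nonneg] h_nu[OF w0] by simp
  finally show "emeasure \<mu> (space \<mu>) = 1" .
qed

lemma S_mean: "integral\<^sup>L \<mu> (S n) = 0"
proof -
  have "(\<integral>x. S n x * h \<omega>\<^sub>0 x \<partial>\<nu> \<omega>\<^sub>0) = (\<Sum>j<n. \<integral>x. v j (Tp j x) * h \<omega>\<^sub>0 x \<partial>\<nu> \<omega>\<^sub>0)"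
    unfolding S_def sum_distrib_right
    by (intro Bochner_Integration.integral_sum bdd_integrable w0 bdd_on_mult bdd_compose_Tp holder_bdd v_holder h_holder
        borel_measurable_times measurable_compose[OF Tp_measurable] holder_meas orb_in)
  also have "\<dots> = (\<Sum>j<n. 0)"
    using transfer_Tp[OF holder_meas[OF orb_in v_holder] holder_bdd[OF v_holder]] v_mean by (intro sum.cong) auto
  finally show ?thesis using mu_integral[OF S_measurable] by simp
qed

text \<open>The constant admits uncentred Birkhoff sums, which differ from the centred ones by a sum
  of means.\<close>

lemma S_var: "mvar \<mu> (\<lambda>x. S n x + c) = Vsum n"
proof -
  interpret prob_space \<mu> by (rule mu_prob)
  have "integral\<^sup>L \<mu> (\<lambda>x. S n x + c) = c"
    using mu_integrable[OF S_measurable S_bdd] S_mean by (simp add: prob_space)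
  then have "mvar \<mu> (\<lambda>x. S n x + c) = integral\<^sup>L \<mu> (\<lambda>x. (S n x)\<^sup>2)" by (simp add: mvar_def)
  also have "\<dots> = Vsum n"
    using S_measurable by (subst mu_integral) (auto simp: second_moment)
  finally show ?thesis .
qed

text \<open>The tilt of S_n is s = t a_n / n. The error 130 n (|s| A)^3, divided by the speed a_n^2
  / n, equals 130 t^2 |s| A^3. With A^3 of order n^(8/q) this is of order a_n n^(8/q - 1), which
  tends to 0 by the upper growth condition on \<open>a\<close>.\<close>

lemma log_mgf_limit:
  fixes a :: "nat \<Rightarrow> real" and q \<sigma> t :: real
  assumes q: "0 < q" and growth: "0 \<le> G" "\<And>j. exp (U j) * gain (orb j) (U j) (V j) \<le> G * real (Suc j) powr (8 / (3 * q)) * \<kappa> (orb j)"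
    and var: "(\<lambda>n. Vsum n / real n) \<longlonglongrightarrow> \<sigma>\<^sup>2"
    and a: "\<And>n. 0 < a n" "(\<lambda>n. a n / real n powr (1 - 8 / q)) \<longlonglongrightarrow> 0"
  shows "(\<lambda>n. ln (\<integral>x. exp (t * ((a n)\<^sup>2 / real n) * (S n x / a n)) \<partial>\<mu>) / ((a n)\<^sup>2 / real n)) \<longlonglongrightarrow> t\<^sup>2 * \<sigma>\<^sup>2 / 2"
proof -
  \<comment> \<open>Adding 1 makes \<open>A n\<close> at least 1, as \<open>log_mgf_bound\<close>
    demands, also when \<open>G\<close> is small.\<close>
  define G' where "G' = G + 1"
  define A where "A = (\<lambda>n. G' * real n powr (8 / (3 * q)))"
  define s where "s = (\<lambda>n. t * (a n / real n))"
  have G': "1 \<le> G'" "0 \<le> G'" using growth(1) by (auto simp: G'_def)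
  have lim0: "(\<lambda>n. a n / real n * real n powr (8 / q)) \<longlonglongrightarrow> 0"
  proof (rule Lim_transform_eventually[OF a(2)])
    show "\<forall>\<^sub>F n in sequentially. a n / real n powr (1 - 8 / q) = a n / real n * real n powr (8 / q)"
      using eventually_gt_at_top[of 0] by eventually_elim (simp add: powr_diff)
  qed
  have A3: "A n ^ 3 = G' ^ 3 * real n powr (8 / q)" if "0 < n" for n
  proof -
    have "(real n powr (8 / (3 * q))) ^ 3 = real n powr (3 * (8 / (3 * q)))"
      using that by (subst powr_numeral[symmetric]) (auto simp: powr_powr mult.commute)
    then show ?thesis by (simp add: A_def power_mult_distrib)
  qed
  have A1: "1 \<le> A n" if "0 < n" for n
  proof -
    have "1 * 1 \<le> G' * real n powr (8 / (3 * q))"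
      using that q G' by (intro mult_mono ge_one_powr_ge_zero) auto
    then show ?thesis by (simp add: A_def)
  qed
  have err: "(\<lambda>n. \<bar>s n\<bar> * A n ^ 3) \<longlonglongrightarrow> 0"
  proof (rule Lim_transform_eventually)
    show "(\<lambda>n. \<bar>t\<bar> * G' ^ 3 * (a n / real n * real n powr (8 / q))) \<longlonglongrightarrow> 0"
      using tendsto_mult_left[OF lim0, of "\<bar>t\<bar> * G' ^ 3"] by simp
    show "\<forall>\<^sub>F n in sequentially. \<bar>t\<bar> * G' ^ 3 * (a n / real n * real n powr (8 / q)) = \<bar>s n\<bar> * A n ^ 3"
      using eventually_gt_at_top[of 0]
    proof eventually_elim
      case (elim n)
      then show ?case using a(1)[of n] by (simp add: A3 s_def abs_mult)
    qed
  qed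
  have small: "\<forall>\<^sub>F n in sequentially. \<bar>s n\<bar> * A n ^ 3 < 1 / 24"
    using err by (rule order_tendstoD) simp
  let ?r = "\<lambda>n. (a n)\<^sup>2 / real n"
  let ?M = "\<lambda>n. (\<integral>x. exp (t * ((a n)\<^sup>2 / real n) * (S n x / a n)) \<partial>\<mu>)"
  have main: "\<forall>\<^sub>F n in sequentially. norm (ln (?M n) / ?r n - t\<^sup>2 / 2 * (Vsum n / real n)) \<le> 130 * t\<^sup>2 * (\<bar>s n\<bar> * A n ^ 3)"
    using small eventually_gt_at_top[of 0]
  proof eventually_elim
    case (elim n)
    have n: "0 < n" "0 < real n" using elim by auto
    have M: "?M n = (\<integral>x. exp (s n * S n x) * h \<omega>\<^sub>0 x \<partial>\<nu> \<omega>\<^sub>0)"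
    proof -
      have "t * ((a n)\<^sup>2 / real n) * (S n x / a n) = s n * S n x" for x
        using a(1)[of n] n by (simp add: s_def power2_eq_square field_simps)
      then show ?thesis using S_measurable by (subst mu_integral[symmetric]) auto
    qed
    \<comment> \<open>Since A \<ge> 1, the limit \<open>err\<close> also supplies the smallness of
      |s| A.\<close>
    have "A n \<le> A n ^ 3" using A1[OF n(1)] by (simp add: self_le_power)
    then have "\<bar>s n\<bar> * A n \<le> \<bar>s n\<bar> * A n ^ 3" by (intro mult_left_mono) auto
    then have e: "\<bar>s n\<bar> * A n \<le> 1 / 24" using elim by linarith
    have AA: "exp (U j) * gain (orb j) (U j) (V j) \<le> A n * \<kappa> (orb j)" if "j < n" for j
    proof (rule order_trans[OF growth(2)], rule mult_right_mono)
      show "G * real (Suc j) powr (8 / (3 * q)) \<le> A n"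
        unfolding A_def using that q growth(1) by (intro mult_mono powr_mono2) (auto simp: G'_def)
    qed (use kappa_pos[OF orb_in] less_imp_le in blast)
    have "\<bar>ln (?M n) - (s n)\<^sup>2 / 2 * Vsum n\<bar> \<le> 130 * real n * (\<bar>s n\<bar> * A n) ^ 3"
      unfolding M by (rule log_mgf_bound[OF A1[OF n(1)] AA e])
    then have bound: "\<bar>ln (?M n) - (s n)\<^sup>2 / 2 * Vsum n\<bar> / ?r n \<le> 130 * real n * (\<bar>s n\<bar> * A n) ^ 3 / ?r n"
      using n by (intro divide_right_mono) auto
    have r: "0 < ?r n" using n a(1)[of n] by simp
    have sr: "(s n)\<^sup>2 = t\<^sup>2 / real n * ?r n"
      using n by (simp add: s_def power2_eq_square)
    have "ln (?M n) / ?r n - t\<^sup>2 / 2 * (Vsum n / real n) = (ln (?M n) - (s n)\<^sup>2 / 2 * Vsum n) / ?r n"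
      unfolding sr diff_divide_distrib using n a(1)[of n] by simp
    then have "norm (ln (?M n) / ?r n - t\<^sup>2 / 2 * (Vsum n / real n)) = \<bar>ln (?M n) - (s n)\<^sup>2 / 2 * Vsum n\<bar> / ?r n"
      unfolding real_norm_def by (simp only:) (subst abs_divide, subst abs_of_pos[OF r], rule refl)
    moreover have "130 * real n * (\<bar>s n\<bar> * A n) ^ 3 / ?r n = 130 * t\<^sup>2 * (\<bar>s n\<bar> * A n ^ 3)"
    proof -
      have "(\<bar>s n\<bar> * A n) ^ 3 = (s n)\<^sup>2 * (\<bar>s n\<bar> * A n ^ 3)"
        by (simp add: power_mult_distrib power3_eq_cube power2_eq_square)
      also have "\<dots> = t\<^sup>2 / real n * ?r n * (\<bar>s n\<bar> * A n ^ 3)" by (simp only: sr)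
      finally have eq: "(\<bar>s n\<bar> * A n) ^ 3 = ?r n * (t\<^sup>2 / real n * (\<bar>s n\<bar> * A n ^ 3))" by (simp only: mult_ac)
      show ?thesis unfolding eq using a(1)[of n] n by simp
    qed
    ultimately show ?case using bound by simp
  qed
  have "(\<lambda>n. ln (?M n) / ?r n - t\<^sup>2 / 2 * (Vsum n / real n)) \<longlonglongrightarrow> 0"
    using main by (rule Lim_null_comparison) (use tendsto_mult_left[OF err, of "130 * t\<^sup>2"] in simp)
  moreover have "(\<lambda>n. t\<^sup>2 / 2 * (Vsum n / real n)) \<longlonglongrightarrow> t\<^sup>2 / 2 * \<sigma>\<^sup>2"
    by (intro tendsto_mult_left var)
  ultimately have "(\<lambda>n. (ln (?M n) / ?r n - t\<^sup>2 / 2 * (Vsum n / real n)) + t\<^sup>2 / 2 * (Vsum n / real n)) \<longlonglongrightarrow> 0 + t\<^sup>2 / 2 * \<sigma>\<^sup>2"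
    by (rule tendsto_add)
  then show ?thesis by simp
qed

theorem moderate_deviations:
  fixes a :: "nat \<Rightarrow> real" and q \<sigma> :: real
  assumes q: "0 < q" and growth: "0 \<le> G" "\<And>j. exp (U j) * gain (orb j) (U j) (V j) \<le> G * real (Suc j) powr (8 / (3 * q)) * \<kappa> (orb j)"
    and var: "(\<lambda>n. Vsum n / real n) \<longlonglongrightarrow> \<sigma>\<^sup>2" and sigma: "0 < \<sigma>"
    and a: "\<And>n. 0 < a n" "(\<lambda>n. a n / real n powr (1 - 8 / q)) \<longlonglongrightarrow> 0"
      "filterlim (\<lambda>n. (a n)\<^sup>2 / real n) at_top sequentially"
    and \<Gamma>: "\<Gamma> \<in> sets borel"
  defines "Q \<equiv> \<lambda>n. ereal (real n / (a n)\<^sup>2) * eln (measure \<mu> {x \<in> X \<omega>\<^sub>0. S n x / a n \<in> \<Gamma>})"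
  shows "- (INF x\<in>interior \<Gamma>. ereal (x\<^sup>2 / (2 * \<sigma>\<^sup>2))) \<le> liminf Q"
    and "limsup Q \<le> - (INF x\<in>closure \<Gamma>. ereal (x\<^sup>2 / (2 * \<sigma>\<^sup>2)))"
proof -
  interpret D: quadratic_log_mgf \<mu> "\<lambda>n x. S n x / a n" "\<lambda>n. (a n)\<^sup>2 / real n" \<sigma>
  proof (intro quadratic_log_mgf.intro quadratic_log_mgf_axioms.intro mu_prob sigma a)
    fix n t
    show Ym: "(\<lambda>x. S n x / a n) \<in> borel_measurable \<mu>"
      unfolding mu_simps using S_measurable by simp
    show "integrable \<mu> (\<lambda>x. exp (t * ((a n)\<^sup>2 / real n) * (S n x / a n)))"
    proof (rule mu_integrable)
      show "(\<lambda>x. exp (t * ((a n)\<^sup>2 / real n) * (S n x / a n))) \<in> borel_measurable (\<nu> \<omega>\<^sub>0)"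
        using S_measurable by simp
      show "bdd_on \<omega>\<^sub>0 (\<lambda>x. exp (t * ((a n)\<^sup>2 / real n) * (S n x / a n)))"
        using bdd_on_cmult[OF S_bdd, of "1 / a n" n] by (intro exp_bdd) simp
    qed
    show "(\<lambda>n. ln (\<integral>x. exp (t * ((a n)\<^sup>2 / real n) * (S n x / a n)) \<partial>\<mu>) / ((a n)\<^sup>2 / real n)) \<longlonglongrightarrow> t\<^sup>2 * \<sigma>\<^sup>2 / 2"
      by (rule log_mgf_limit[OF q growth var a(1,2)])
  qed
  have Q: "Q = (\<lambda>n. ereal (1 / ((a n)\<^sup>2 / real n)) * eln (D.prob {x \<in> space \<mu>. S n x / a n \<in> \<Gamma>}))"
    unfolding Q_def by (simp add: mu_simps)
  show "- (INF x\<in>interior \<Gamma>. ereal (x\<^sup>2 / (2 * \<sigma>\<^sup>2))) \<le> liminf Q"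
    unfolding Q by (rule D.ldp_lower[OF \<Gamma>])
  show "limsup Q \<le> - (INF x\<in>closure \<Gamma>. ereal (x\<^sup>2 / (2 * \<sigma>\<^sup>2)))"
    unfolding Q by (rule D.ldp_upper[OF \<Gamma>])
qed

end

section \<open>Properly expanding maps\<close>

text \<open>For G = \<gamma>^\<alpha> this is the cone of Setting A; Hoelder regularity is not part
  of the body because on a set of diameter at most 1 it follows, see
  \<open>log_cone_holder\<close>.\<close>

definition log_cone :: "real \<Rightarrow> real \<Rightarrow> 'x::metric_space set \<Rightarrow> ('x \<Rightarrow> real) set" where
  "log_cone \<alpha> G S = {g. (\<forall>x\<in>S. 0 \<le> g x) \<and>
    (\<forall>x\<in>S. \<forall>x'\<in>S. g x \<le> exp (G * dist x x' powr \<alpha>) * g x')}"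

lemma log_coneD:
  assumes "g \<in> log_cone \<alpha> G S" "x \<in> S"
  shows "0 \<le> g x" "x' \<in> S \<Longrightarrow> g x \<le> exp (G * dist x x' powr \<alpha>) * g x'"
  using assms by (auto simp: log_cone_def)

lemma log_cone_mono:
  assumes "g \<in> log_cone \<alpha> G S" "G \<le> G'"
  shows "g \<in> log_cone \<alpha> G' S"
  unfolding log_cone_def
proof (intro CollectI conjI ballI)
  fix x x' assume x: "x \<in> S" "x' \<in> S"
  have "exp (G * dist x x' powr \<alpha>) \<le> exp (G' * dist x x' powr \<alpha>)"
    using assms(2) by (simp add: mult_right_mono)
  then have "exp (G * dist x x' powr \<alpha>) * g x' \<le> exp (G' * dist x x' powr \<alpha>) * g x'"
    using log_coneD(1)[OF assms(1) x(2)] by (rule mult_right_mono)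
  then show "g x \<le> exp (G' * dist x x' powr \<alpha>) * g x'" using log_coneD(2)[OF assms(1) x] by linarith
qed (use assms in \<open>auto simp: log_cone_def\<close>)

lemma log_cone_add: "f \<in> log_cone \<alpha> G S \<Longrightarrow> g \<in> log_cone \<alpha> G S \<Longrightarrow> (\<lambda>x. f x + g x) \<in> log_cone \<alpha> G S"
  unfolding log_cone_def by (auto simp: distrib_left intro: add_mono)

lemma log_cone_scale: "f \<in> log_cone \<alpha> G S \<Longrightarrow> 0 \<le> c \<Longrightarrow> (\<lambda>x. c * f x) \<in> log_cone \<alpha> G S"
  unfolding log_cone_def by (auto simp: mult.left_commute intro: mult_left_mono)

lemma log_cone_mult:
  assumes f: "f \<in> log_cone \<alpha> G S" and g: "g \<in> log_cone \<alpha> G' S"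
  shows "(\<lambda>x. f x * g x) \<in> log_cone \<alpha> (G + G') S"
  unfolding log_cone_def
proof (intro CollectI conjI ballI)
  fix x assume x: "x \<in> S"
  show "0 \<le> f x * g x" using log_coneD(1)[OF f x] log_coneD(1)[OF g x] by simp
  fix x' assume x': "x' \<in> S"
  have "f x * g x \<le> (exp (G * dist x x' powr \<alpha>) * f x') * (exp (G' * dist x x' powr \<alpha>) * g x')"
    using log_coneD[OF f x] log_coneD[OF g x] log_coneD[OF f x'] log_coneD[OF g x'] x'
    by (intro mult_mono) auto
  then show "f x * g x \<le> exp ((G + G') * dist x x' powr \<alpha>) * (f x' * g x')"
    by (simp add: distrib_right exp_add mult_ac)
qed

lemma log_cone_cong: "f \<in> log_cone \<alpha> G S \<Longrightarrow> (\<And>x. x \<in> S \<Longrightarrow> f x = g x) \<Longrightarrow> g \<in> log_cone \<alpha> G S"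
  unfolding log_cone_def by auto

lemma log_cone_lim:
  assumes "\<And>n. fs n \<in> log_cone \<alpha> G S" "\<And>x. x \<in> S \<Longrightarrow> (\<lambda>n. fs n x) \<longlonglongrightarrow> g x"
  shows "g \<in> log_cone \<alpha> G S"
  unfolding log_cone_def
proof (intro CollectI conjI ballI)
  fix x assume x: "x \<in> S"
  show "0 \<le> g x" by (rule LIMSEQ_le_const[OF assms(2)[OF x]]) (use assms(1) x in \<open>auto simp: log_cone_def\<close>)
  fix x' assume x': "x' \<in> S"
  show "g x \<le> exp (G * dist x x' powr \<alpha>) * g x'"
    by (rule LIMSEQ_le[OF assms(2)[OF x] tendsto_mult_left[OF assms(2)[OF x']]])
      (use assms(1) x x' in \<open>auto simp: log_cone_def\<close>)
qed

lemma log_cone_one: "0 \<le> G \<Longrightarrow> (\<lambda>_. 1) \<in> log_cone \<alpha> G S"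
  by (simp add: log_cone_def)

text \<open>A variation of at most G m relative to a lower bound m gives a ratio of at most 1 + G r,
  and 1 + x \<le> exp x.\<close>

lemma log_cone_lipschitz:
  assumes "0 \<le> G" "0 < m" "0 \<le> B" "B \<le> G * m" "\<And>x. x \<in> S \<Longrightarrow> m \<le> g x"
    "\<And>x x'. x \<in> S \<Longrightarrow> x' \<in> S \<Longrightarrow> \<bar>g x - g x'\<bar> \<le> B * dist x x' powr \<alpha>"
  shows "g \<in> log_cone \<alpha> G S"
  unfolding log_cone_def
proof (intro CollectI conjI ballI)
  fix x assume x: "x \<in> S"
  show "0 \<le> g x" using assms(2) assms(5)[OF x] by linarith
  fix x' assume x': "x' \<in> S"
  let ?r = "dist x x' powr \<alpha>"
  have "g x \<le> g x' + B * ?r" using assms(6)[OF x x'] by (simp add: abs_le_iff)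
  also have "B * ?r \<le> G * g x' * ?r"
  proof (rule mult_right_mono)
    have "G * m \<le> G * g x'" using assms(1) assms(5)[OF x'] by (rule mult_left_mono[rotated])
    then show "B \<le> G * g x'" using assms(4) by linarith
  qed simp
  also have "g x' + G * g x' * ?r = (1 + G * ?r) * g x'" by (simp add: algebra_simps)
  also have "\<dots> \<le> exp (G * ?r) * g x'"
    using assms(2) assms(5)[OF x'] by (intro mult_right_mono exp_ge_add_one_self) linarith
  finally show "g x \<le> exp (G * ?r) * g x'" by simp
qed

lemma log_cone_absorbs:
  assumes "0 < G" "holder \<alpha> S g"
  shows "\<exists>c\<ge>0. (\<lambda>x. g x + c) \<in> log_cone \<alpha> G S"
proof -
  obtain B C where g: "0 \<le> B" "0 \<le> C" "\<And>x. x \<in> S \<Longrightarrow> \<bar>g x\<bar> \<le> B"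
    "\<And>x x'. x \<in> S \<Longrightarrow> x' \<in> S \<Longrightarrow> \<bar>g x - g x'\<bar> \<le> C * dist x x' powr \<alpha>"
    using assms(2) by (rule holderE) (use that in blast)
  have "(\<lambda>x. g x + (B + (C + 1) / G)) \<in> log_cone \<alpha> G S"
  proof (rule log_cone_lipschitz[of _ "(C + 1) / G" C])
    show "(C + 1) / G \<le> g x + (B + (C + 1) / G)" if "x \<in> S" for x using g(3)[OF that] by linarith
  qed (use assms g in auto)
  moreover have "0 \<le> B + (C + 1) / G" using assms g by auto
  ultimately show ?thesis by blast
qed

lemma log_cone_ratio:
  assumes "g \<in> log_cone \<alpha> G S" "0 \<le> G" "0 < \<alpha>" "x \<in> S" "x' \<in> S" "dist x x' \<le> 1"
  shows "g x \<le> exp G * g x'"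
proof -
  have "dist x x' powr \<alpha> \<le> 1 powr \<alpha>" using assms by (intro powr_mono2) auto
  then have "exp (G * dist x x' powr \<alpha>) \<le> exp G" using assms by (simp add: mult_left_le)
  then have "exp (G * dist x x' powr \<alpha>) * g x' \<le> exp G * g x'"
    using log_coneD(1)[OF assms(1,5)] by (rule mult_right_mono)
  then show ?thesis using log_coneD(2)[OF assms(1,4,5)] by linarith
qed

lemma log_cone_holder:
  assumes g: "g \<in> log_cone \<alpha> G S" and G: "0 \<le> G" and \<alpha>: "0 < \<alpha>"
    and d: "\<And>x x'. x \<in> S \<Longrightarrow> x' \<in> S \<Longrightarrow> dist x x' \<le> 1"
  shows "holder \<alpha> S g"
proof (cases "S = {}")
  case True
  then show ?thesis by (simp add: holder_def)
next
  case False
  then obtain x0 where x0: "x0 \<in> S" by blast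
  define B where "B = exp G * g x0"
  have B: "g x \<le> B" if "x \<in> S" for x
    unfolding B_def by (rule log_cone_ratio[OF g G \<alpha> that x0 d[OF that x0]])
  have one: "g x - g x' \<le> exp G * G * B * dist x x' powr \<alpha>" if x: "x \<in> S" "x' \<in> S" for x x'
  proof -
    let ?r = "dist x x' powr \<alpha>"
    have r: "0 \<le> ?r" "?r \<le> 1" using powr_mono2[of \<alpha> "dist x x'" 1] d[OF x] \<alpha> by auto
    have gr: "0 \<le> G * ?r" "exp (G * ?r) \<le> exp G" using r G by (auto simp: mult_left_le)
    have "g x - g x' \<le> (exp (G * ?r) - 1) * g x'"
      using log_coneD(2)[OF g x] by (simp add: algebra_simps)
    also have "\<dots> \<le> (exp (G * ?r) * (G * ?r)) * g x'"
      using exp_minus_one_bound[of "G * ?r" "G * ?r"] gr log_coneD(1)[OF g x(2)]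
      by (intro mult_right_mono) auto
    also have "\<dots> \<le> (exp G * (G * ?r)) * B"
      using gr B[OF x(2)] log_coneD(1)[OF g x(2)] by (intro mult_mono) auto
    finally show ?thesis by (simp add: mult_ac)
  qed
  show ?thesis
  proof (rule holderI[of _ _ B "exp G * G * B"])
    show "\<bar>g x\<bar> \<le> B" if "x \<in> S" for x using B[OF that] log_coneD(1)[OF g that] by simp
    show "\<bar>g x - g x'\<bar> \<le> exp G * G * B * dist x x' powr \<alpha>" if "x \<in> S" "x' \<in> S" for x x'
      using one[OF that] one[OF that(2,1)] by (simp add: abs_le_iff dist_commute)
  qed
qed

text \<open>The quotient (exp s - exp (q s)) / (exp s - exp (- q s)) tends to (1 - q) / (1 + q) as s
  decreases to 0, and this is its infimum. The difference of the two sides, cleared of denominators,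
  vanishes at 0 and has a nonnegative derivative.\<close>

lemma exp_gap_ratio:
  fixes q s :: real
  assumes q: "0 \<le> q" "q < 1" and s: "0 \<le> s"
  shows "(1 - q) / (1 + q) * (exp s - exp (- (q * s))) \<le> exp s - exp (q * s)"
proof -
  define f where "f = (\<lambda>s. 2 * q * exp s - (1 + q) * exp (q * s) + (1 - q) * exp (- (q * s)))"
  have "f 0 \<le> f s"
  proof (rule DERIV_nonneg_imp_nondecreasing[OF s])
    fix x :: real assume x: "0 \<le> x" "x \<le> s"
    have d: "(f has_real_derivative q * (2 * exp x - (1 + q) * exp (q * x) - (1 - q) * exp (- (q * x)))) (at x)"
      unfolding f_def by (auto intro!: derivative_eq_intros simp: algebra_simps)
    have "q * x \<le> x" using x q by (simp add: mult_left_le_one_le)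
    then have "exp (q * x) \<le> exp x" by simp
    moreover have "exp (- (q * x)) \<le> exp x"
    proof -
      have "0 \<le> q * x" using x q by simp
      then have "- (q * x) \<le> x" using x by linarith
      then show ?thesis by simp
    qed
    ultimately have "(1 + q) * exp (q * x) + (1 - q) * exp (- (q * x)) \<le> (1 + q) * exp x + (1 - q) * exp x"
      using q by (intro add_mono mult_left_mono) auto
    also have "\<dots> = 2 * exp x" by (simp add: algebra_simps)
    finally have "0 \<le> q * (2 * exp x - (1 + q) * exp (q * x) - (1 - q) * exp (- (q * x)))"
      using q by (intro mult_nonneg_nonneg) auto
    then show "\<exists>y. (f has_real_derivative y) (at x) \<and> 0 \<le> y" using d by blast
  qed
  then have "(1 - q) * (exp s - exp (- (q * s))) \<le> (1 + q) * (exp s - exp (q * s))"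
    by (simp add: f_def algebra_simps)
  then show ?thesis using q by (simp add: pos_divide_le_eq mult.commute)
qed

text \<open>Both functions have the smaller aperture q G. In the worst case, between
  \<open>x\<close> and \<open>x'\<close>, \<open>F\<close> increases and \<open>F'\<close> decreases
  by the full factor exp (q s); \<open>exp_gap_ratio\<close> says that a multiple of
  \<open>F'\<close> below (1 - q) / (1 + q) times \<open>F\<close> can then still be
  subtracted.\<close>

lemma log_cone_contract:
  assumes F: "F \<in> log_cone \<alpha> (q * G) S" and F': "F' \<in> log_cone \<alpha> (q * G) S"
    and q: "0 \<le> q" "q < 1" and G: "0 \<le> G" and t: "0 \<le> t"
    and le: "\<And>z. z \<in> S \<Longrightarrow> t * F' z \<le> (1 - q) / (1 + q) * F z"
  shows "(\<lambda>z. F z - t * F' z) \<in> log_cone \<alpha> G S"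
  unfolding log_cone_def
proof (intro CollectI conjI ballI)
  fix x assume x: "x \<in> S"
  have k: "0 \<le> (1 - q) / (1 + q)" "(1 - q) / (1 + q) \<le> 1" using q by auto
  have "(1 - q) / (1 + q) * F x \<le> F x" using k log_coneD(1)[OF F x] by (intro mult_left_le_one_le)
  then show "0 \<le> F x - t * F' x" using le[OF x] by linarith
  fix x' assume x': "x' \<in> S"
  define s where "s = G * dist x x' powr \<alpha>"
  have s: "0 \<le> s" using G by (simp add: s_def)
  have F1: "F x \<le> exp (q * s) * F x'" using log_coneD(2)[OF F x x'] by (simp add: s_def mult.assoc)
  have "F' x' \<le> exp (q * s) * F' x" using log_coneD(2)[OF F' x' x] by (simp add: s_def mult.assoc dist_commute)
  then have F2: "exp (- (q * s)) * F' x' \<le> F' x"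
    by (simp add: exp_minus field_simps)
  have pos: "0 \<le> exp s - exp (- (q * s))"
  proof -
    have "0 \<le> q * s" using s q by simp
    then have "- (q * s) \<le> s" using s by linarith
    then show ?thesis by simp
  qed
  have "t * (exp s * F' x' - F' x) \<le> t * ((exp s - exp (- (q * s))) * F' x')"
    using F2 t by (intro mult_left_mono) (auto simp: left_diff_distrib)
  also have "\<dots> = (exp s - exp (- (q * s))) * (t * F' x')" by simp
  also have "\<dots> \<le> (exp s - exp (- (q * s))) * ((1 - q) / (1 + q) * F x')"
    using le[OF x'] pos by (rule mult_left_mono)
  also have "\<dots> = ((1 - q) / (1 + q) * (exp s - exp (- (q * s)))) * F x'" by simp
  also have "\<dots> \<le> (exp s - exp (q * s)) * F x'"
    using exp_gap_ratio[OF q s] log_coneD(1)[OF F x'] by (rule mult_right_mono)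
  also have "\<dots> \<le> exp s * F x' - F x" using F1 by (simp add: left_diff_distrib)
  finally show "F x - t * F' x \<le> exp (G * dist x x' powr \<alpha>) * (F x' - t * F' x')"
    by (simp add: s_def[symmetric] algebra_simps)
qed

section \<open>Cone estimates for expanding branches\<close>

text \<open>\<open>gap\<close> is the strict inequality q(\<omega>) < 1, which finiteness of
  E_\<omega> supplies.\<close>

locale expanding_branches = branch_system +
  fixes \<gamma> H :: "'a \<Rightarrow> real"
  assumes gamma_gt: "\<omega> \<in> W \<Longrightarrow> 1 < \<gamma> \<omega>" and H_ge: "\<omega> \<in> W \<Longrightarrow> 0 \<le> H \<omega>"
    and y_contracts: "\<omega> \<in> W \<Longrightarrow> x \<in> fib E (\<theta> \<omega>) \<Longrightarrow> x' \<in> fib E (\<theta> \<omega>) \<Longrightarrow> i \<in> I \<omega> \<Longrightarrow>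
      dist (y \<omega> i x) (y \<omega> i x') \<le> dist x x' / \<gamma> \<omega>"
    and phi_var: "\<omega> \<in> W \<Longrightarrow> x \<in> fib E (\<theta> \<omega>) \<Longrightarrow> x' \<in> fib E (\<theta> \<omega>) \<Longrightarrow> i \<in> I \<omega> \<Longrightarrow>
      \<bar>\<phi> \<omega> (y \<omega> i x) - \<phi> \<omega> (y \<omega> i x')\<bar> \<le> H \<omega> * dist x x' powr \<alpha>"
    and gap: "\<omega> \<in> W \<Longrightarrow> H \<omega> + 1 < \<gamma> (\<theta> \<omega>) powr \<alpha>"
begin

definition q :: "'a \<Rightarrow> real" where "q \<omega> = (H \<omega> + 1) / \<gamma> (\<theta> \<omega>) powr \<alpha>"

lemma G_gt: "\<omega> \<in> W \<Longrightarrow> 1 < \<gamma> \<omega> powr \<alpha>"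
  using gamma_gt alpha by (simp add: gr_one_powr)

lemma q_bounds: "\<omega> \<in> W \<Longrightarrow> 0 \<le> q \<omega>" "\<omega> \<in> W \<Longrightarrow> q \<omega> < 1"
  using gap[of \<omega>] H_ge[of \<omega>] unfolding q_def by (auto simp: divide_less_eq)

text \<open>Contracting branches divide the aperture by \<gamma>^\<alpha> and the weights add
  \<open>H\<close>, branch by branch. For G = \<gamma>^\<alpha> the result is H + 1, that is, q
  times the aperture of the next cone.\<close>

lemma L_log_cone:
  assumes w: "\<omega> \<in> W" and f: "f \<in> log_cone \<alpha> G (X \<omega>)" and G: "0 \<le> G"
  shows "L \<omega> f \<in> log_cone \<alpha> (H \<omega> + G / \<gamma> \<omega> powr \<alpha>) (X (\<theta> \<omega>))"
  unfolding log_cone_def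
proof (intro CollectI conjI ballI)
  have g: "0 < \<gamma> \<omega>" using gamma_gt[OF w] by simp
  fix x assume x: "x \<in> X (\<theta> \<omega>)"
  show "0 \<le> L \<omega> f x" using log_coneD(1)[OF f] by (rule L_nonneg)
  fix x' assume x': "x' \<in> X (\<theta> \<omega>)"
  let ?r = "dist x x' powr \<alpha>"
  let ?e = "exp ((H \<omega> + G / \<gamma> \<omega> powr \<alpha>) * ?r)"
  have bf: "bdd_on \<omega> f"
    by (intro holder_bdd log_cone_holder[OF f G alpha(1)] diam[OF w])
  have "L \<omega> f x = infsum (\<lambda>i. exp (\<phi> \<omega> (y \<omega> i x)) * f (y \<omega> i x)) (I \<omega>)" by (rule L_index[OF w x])
  also have "\<dots> \<le> infsum (\<lambda>i. ?e * (exp (\<phi> \<omega> (y \<omega> i x')) * f (y \<omega> i x'))) (I \<omega>)"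
  proof (rule infsum_mono)
    show "(\<lambda>i. exp (\<phi> \<omega> (y \<omega> i x)) * f (y \<omega> i x)) summable_on I \<omega>"
      by (rule L_index_summable[OF w bf x])
    show "(\<lambda>i. ?e * (exp (\<phi> \<omega> (y \<omega> i x')) * f (y \<omega> i x'))) summable_on I \<omega>"
      by (intro summable_on_cmult_right L_index_summable[OF w bf x'])
    fix i assume i: "i \<in> I \<omega>"
    have yi: "y \<omega> i x \<in> X \<omega>" "y \<omega> i x' \<in> X \<omega>" using y_in[OF w i] x x' by auto
    have "dist (y \<omega> i x) (y \<omega> i x') powr \<alpha> \<le> (dist x x' / \<gamma> \<omega>) powr \<alpha>"
      using y_contracts[OF w x x' i] alpha by (intro powr_mono2) auto
    then have d: "dist (y \<omega> i x) (y \<omega> i x') powr \<alpha> \<le> ?r / \<gamma> \<omega> powr \<alpha>"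
      using g by (simp add: powr_divide)
    have "G * dist (y \<omega> i x) (y \<omega> i x') powr \<alpha> \<le> G / \<gamma> \<omega> powr \<alpha> * ?r"
      using mult_left_mono[OF d G] by simp
    then have "exp (G * dist (y \<omega> i x) (y \<omega> i x') powr \<alpha>) * f (y \<omega> i x') \<le> exp (G / \<gamma> \<omega> powr \<alpha> * ?r) * f (y \<omega> i x')"
      using log_coneD(1)[OF f yi(2)] by (intro mult_right_mono) auto
    then have 1: "f (y \<omega> i x) \<le> exp (G / \<gamma> \<omega> powr \<alpha> * ?r) * f (y \<omega> i x')"
      using log_coneD(2)[OF f yi] by linarith
    have "\<phi> \<omega> (y \<omega> i x) \<le> H \<omega> * ?r + \<phi> \<omega> (y \<omega> i x')"
      using phi_var[OF w x x' i] by (simp add: abs_le_iff)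
    then have 2: "exp (\<phi> \<omega> (y \<omega> i x)) \<le> exp (H \<omega> * ?r) * exp (\<phi> \<omega> (y \<omega> i x'))"
      by (simp add: exp_add[symmetric])
    have "exp (\<phi> \<omega> (y \<omega> i x)) * f (y \<omega> i x)
        \<le> (exp (H \<omega> * ?r) * exp (\<phi> \<omega> (y \<omega> i x'))) * (exp (G / \<gamma> \<omega> powr \<alpha> * ?r) * f (y \<omega> i x'))"
      using log_coneD(1)[OF f yi(1)] by (intro mult_mono 1 2) auto
    moreover have "?e = exp (H \<omega> * ?r) * exp (G / \<gamma> \<omega> powr \<alpha> * ?r)" by (simp only: distrib_right exp_add)
    ultimately show "exp (\<phi> \<omega> (y \<omega> i x)) * f (y \<omega> i x) \<le> ?e * (exp (\<phi> \<omega> (y \<omega> i x')) * f (y \<omega> i x'))"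
      by (simp only: mult_ac)
  qed
  also have "\<dots> = ?e * L \<omega> f x'" by (simp add: infsum_cmult_right' L_index[OF w x'])
  finally show "L \<omega> f x \<le> ?e * L \<omega> f x'" .
qed

lemma L_log_cone_image:
  assumes w: "\<omega> \<in> W" and f: "f \<in> log_cone \<alpha> (\<gamma> \<omega> powr \<alpha>) (X \<omega>)"
  shows "L \<omega> f \<in> log_cone \<alpha> (q \<omega> * \<gamma> (\<theta> \<omega>) powr \<alpha>) (X (\<theta> \<omega>))"
  using L_log_cone[OF w f] gamma_gt[OF w] gamma_gt[OF th_in[OF w]] by (simp add: q_def)

text \<open>For c \<ge> 2 A the function c + g is at least c / 2, so it lies in the log cone of
  aperture 2 B / c, and apertures add under products. The image fits into the next cone if H + 1 + 2
  B / (c \<gamma>^\<alpha>) \<le> \<gamma>(\<theta> \<omega>)^\<alpha>, which determines the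
  coefficient of \<open>B\<close>.\<close>

lemma expanding_mult:
  assumes w: "\<omega> \<in> W" and f: "f \<in> log_cone \<alpha> (\<gamma> \<omega> powr \<alpha>) (X \<omega>)"
    and AB: "0 \<le> A" "0 \<le> B" and g: "\<And>x. x \<in> X \<omega> \<Longrightarrow> \<bar>g x\<bar> \<le> A"
      "\<And>x x'. x \<in> X \<omega> \<Longrightarrow> x' \<in> X \<omega> \<Longrightarrow> \<bar>g x - g x'\<bar> \<le> B * dist x x' powr \<alpha>"
  shows "(\<lambda>z. (2 * A + 2 * \<gamma> \<omega> powr (-\<alpha>) / (\<gamma> (\<theta> \<omega>) powr \<alpha> - 1 - H \<omega>) * B) * L \<omega> f z + L \<omega> (\<lambda>x. g x * f x) z)
    \<in> log_cone \<alpha> (\<gamma> (\<theta> \<omega>) powr \<alpha>) (X (\<theta> \<omega>))"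
proof -
  define G where "G = \<gamma> \<omega> powr \<alpha>"
  have G: "1 < G" using G_gt[OF w] by (simp add: G_def)
  define c where "c = 2 * A + 2 * \<gamma> \<omega> powr (-\<alpha>) / (\<gamma> (\<theta> \<omega>) powr \<alpha> - 1 - H \<omega>) * B"
  have Gi: "\<gamma> \<omega> powr (-\<alpha>) = 1 / G" by (simp add: G_def powr_minus_divide)
  have gp: "0 < \<gamma> (\<theta> \<omega>) powr \<alpha> - 1 - H \<omega>" using gap[OF w] by simp
  have c: "0 \<le> c" "2 * A \<le> c" "2 / G / (\<gamma> (\<theta> \<omega>) powr \<alpha> - 1 - H \<omega>) * B \<le> c"
    using AB G gp by (auto simp: c_def Gi)
  have bf: "bdd_on \<omega> f"
    using G by (intro holder_bdd log_cone_holder[OF f _ alpha(1)] diam[OF w]) (auto simp: G_def)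
  have bg: "bdd_on \<omega> g" by (rule bdd_onI[OF g(1)])
  have sum: "c * L \<omega> f z + L \<omega> (\<lambda>x. g x * f x) z = L \<omega> (\<lambda>x. (c + g x) * f x) z" if z: "z \<in> X (\<theta> \<omega>)" for z
    unfolding distrib_right by (simp add: L_add[OF w bdd_on_cmult[OF bf] bdd_on_mult[OF bg bf] z] L_cmult)
  have "L \<omega> (\<lambda>x. (c + g x) * f x) \<in> log_cone \<alpha> (\<gamma> (\<theta> \<omega>) powr \<alpha>) (X (\<theta> \<omega>))"
  \<comment> \<open>Degenerate case: \<open>c = 0\<close> forces \<open>A = 0\<close>, so
    \<open>g\<close> vanishes and 2 B / c must not be formed.\<close>
  proof (cases "c = 0")
    case True
    then have "A = 0" using c AB by simp
    then have "L \<omega> (\<lambda>x. (c + g x) * f x) z = L \<omega> (\<lambda>x. 0 * f x) z" for z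
      using g True by (intro L_cong) simp
    then have "L \<omega> (\<lambda>x. (c + g x) * f x) z = 0" for z by (simp only: L_cmult)
    then show ?thesis by (simp add: log_cone_def)
  next
    case False
    then have c0: "0 < c" using c by simp
    have "(\<lambda>x. c + g x) \<in> log_cone \<alpha> (2 * B / c) (X \<omega>)"
    proof (rule log_cone_lipschitz[of _ "c / 2" B])
      show "c / 2 \<le> c + g x" if "x \<in> X \<omega>" for x using g(1)[OF that] c(2) by linarith
    qed (use AB c0 g in auto)
    then have "(\<lambda>x. (c + g x) * f x) \<in> log_cone \<alpha> (2 * B / c + G) (X \<omega>)"
      using f unfolding G_def by (rule log_cone_mult)
    then have "L \<omega> (\<lambda>x. (c + g x) * f x) \<in> log_cone \<alpha> (H \<omega> + (2 * B / c + G) / \<gamma> \<omega> powr \<alpha>) (X (\<theta> \<omega>))"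
      using AB c0 G by (intro L_log_cone w) auto
    then show ?thesis
    proof (rule log_cone_mono)
      have "2 / G * B \<le> c * (\<gamma> (\<theta> \<omega>) powr \<alpha> - 1 - H \<omega>)"
        using mult_right_mono[OF c(3) less_imp_le[OF gp]] gp by simp
      then have "2 * B / c / G \<le> \<gamma> (\<theta> \<omega>) powr \<alpha> - 1 - H \<omega>"
        using c0 G by (simp add: field_simps)
      then show "H \<omega> + (2 * B / c + G) / \<gamma> \<omega> powr \<alpha> \<le> \<gamma> (\<theta> \<omega>) powr \<alpha>"
        using G by (simp add: G_def[symmetric] add_divide_distrib)
    qed
  qed
  then show ?thesis
    unfolding c_def[symmetric] by (rule log_cone_cong) (simp add: sum)
qed

end

lemma exp_le_cosh:
  fixes x :: real
  shows "exp x \<le> 2 * (1 + cosh x)"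
proof -
  have "2 * cosh x = exp x + exp (- x)" by (simp add: cosh_field_def)
  moreover have "0 < exp (- x)" by simp
  ultimately show ?thesis by (simp only: distrib_left)
qed

text \<open>\<open>c\<^sub>0\<close> dominates half of the bracket on the left, and the cosh factor
  dominates half of the reciprocal of the contraction rate, which is the last factor on the right.
  The sup norm U is at most \<open>c\<^sub>0\<close>, hence at most \<open>C\<close>, which gives
  exp C.\<close>

lemma expanding_growth:
  fixes U V H G g C :: real
  assumes "1 < G" "0 \<le> H" "H + 1 < G" "0 \<le> U" "0 \<le> V" "0 \<le> g"
    and "g * V + H < G - 1"
  defines "q \<equiv> (H + 1) / G"
  defines "D \<equiv> G + 2 * ln ((1 + q) / (1 - q))"
  defines "c\<^sub>0 \<equiv> 3 * U + (g * V + H) / (G - 1 - (g * V + H))"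
  assumes C: "c\<^sub>0 * (1 + cosh (7 * D / 2)) \<le> C"
  shows "exp U * (2 * U + 2 * g / (G - 1 - H) * V) \<le> 4 * C * exp C * ((1 - q) / (1 + q) / (exp G)\<^sup>2)"
proof -
  have q: "0 \<le> q" "q < 1" using assms by (auto simp: q_def)
  define R where "R = (1 + q) / (1 - q)"
  have R: "1 \<le> R" using q by (simp add: R_def)
  have gV: "0 \<le> g * V" using assms by simp
  have x: "U + g * V / (G - 1 - H) \<le> c\<^sub>0"
  proof -
    have "g * V / (G - 1 - H) \<le> (g * V + H) / (G - 1 - (g * V + H))"
      using assms gV by (intro frac_le) auto
    then show ?thesis using assms by (simp add: c\<^sub>0_def)
  qed
  have x0: "0 \<le> g * V / (G - 1 - H)" by (intro divide_nonneg_nonneg gV) (use assms(3) in linarith)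
  have c0: "0 \<le> c\<^sub>0" "U \<le> c\<^sub>0" using x x0 assms(4) by linarith+
  have "c\<^sub>0 * 1 \<le> c\<^sub>0 * (1 + cosh (7 * D / 2))" using c0 cosh_real_nonneg[of "7 * D / 2"] by (intro mult_left_mono) auto
  then have cC: "c\<^sub>0 \<le> C" using C by simp
  have lnR: "0 \<le> ln R" using R by simp
  \<comment> \<open>The reciprocal of the rate is exp (2 G) R, while 7 D / 2 = 7 G / 2 + 7 ln
    R.\<close>
  have "2 * G + ln R \<le> 7 * D / 2" using lnR assms(1) by (simp add: D_def R_def[symmetric])
  then have "exp (2 * G + ln R) \<le> exp (7 * D / 2)" by simp
  then have "(exp G)\<^sup>2 * R \<le> exp (7 * D / 2)"
    using R by (simp add: exp_add exp_double)
  also have "exp (7 * D / 2) \<le> 2 * (1 + cosh (7 * D / 2))" by (rule exp_le_cosh)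
  finally have "(exp G)\<^sup>2 * R \<le> 2 * (1 + cosh (7 * D / 2))" .
  then have "c\<^sub>0 * ((exp G)\<^sup>2 * R) \<le> c\<^sub>0 * (2 * (1 + cosh (7 * D / 2)))" using c0 by (intro mult_left_mono)
  also have "\<dots> = 2 * (c\<^sub>0 * (1 + cosh (7 * D / 2)))" by (simp only: mult.left_commute)
  finally have "c\<^sub>0 * ((exp G)\<^sup>2 * R) \<le> 2 * C" using C by linarith
  then have cb: "c\<^sub>0 \<le> 2 * C * ((1 - q) / (1 + q) / (exp G)\<^sup>2)"
  proof -
    have "0 < (exp G)\<^sup>2 * R" using R by (intro mult_pos_pos) auto
    then have "c\<^sub>0 \<le> 2 * C / ((exp G)\<^sup>2 * R)"
      using \<open>c\<^sub>0 * ((exp G)\<^sup>2 * R) \<le> 2 * C\<close> by (simp only: pos_le_divide_eq)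
    also have "\<dots> = 2 * C * ((1 - q) / (1 + q) / (exp G)\<^sup>2)" by (simp add: R_def)
    finally show ?thesis .
  qed
  have "exp U * (2 * U + 2 * g / (G - 1 - H) * V) = exp U * (2 * (U + g * V / (G - 1 - H)))" by simp
  also have "\<dots> \<le> exp C * (2 * c\<^sub>0)" using x x0 c0 cC assms(4) by (intro mult_mono) auto
  also have "\<dots> \<le> exp C * (2 * (2 * C * ((1 - q) / (1 + q) / (exp G)\<^sup>2)))" by (intro mult_left_mono cb) auto
  finally show ?thesis by (simp add: mult_ac)
qed

section \<open>Partially expanding maps\<close>

text \<open>The condition v(g) \<le> G inf g, with seminorm and infimum spelled out by quantifiers,
  so that it passes to sums and pointwise limits. Nonnegativity in place of positivity makes the
  cone closed and puts 0 into it.\<close>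

definition lin_cone :: "real \<Rightarrow> real \<Rightarrow> 'x::metric_space set \<Rightarrow> ('x \<Rightarrow> real) set" where
  "lin_cone \<alpha> G S = {g. (\<forall>x\<in>S. 0 \<le> g x) \<and>
    (\<forall>x\<in>S. \<forall>x'\<in>S. \<forall>z\<in>S. \<bar>g x - g x'\<bar> \<le> G * dist x x' powr \<alpha> * g z)}"

lemma lin_coneD:
  assumes "g \<in> lin_cone \<alpha> G S" "x \<in> S"
  shows "0 \<le> g x" "x' \<in> S \<Longrightarrow> z \<in> S \<Longrightarrow> \<bar>g x - g x'\<bar> \<le> G * dist x x' powr \<alpha> * g z"
  using assms by (auto simp: lin_cone_def)

lemma lin_cone_add:
  assumes f: "f \<in> lin_cone \<alpha> G S" and g: "g \<in> lin_cone \<alpha> G S"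
  shows "(\<lambda>x. f x + g x) \<in> lin_cone \<alpha> G S"
  unfolding lin_cone_def
proof (intro CollectI conjI ballI)
  fix x assume x: "x \<in> S"
  show "0 \<le> f x + g x" using lin_coneD(1)[OF f x] lin_coneD(1)[OF g x] by simp
  fix x' z assume x': "x' \<in> S" "z \<in> S"
  show "\<bar>f x + g x - (f x' + g x')\<bar> \<le> G * dist x x' powr \<alpha> * (f z + g z)"
    using lin_coneD(2)[OF f x x'] lin_coneD(2)[OF g x x'] by (simp add: distrib_left)
qed

lemma lin_cone_scale:
  assumes f: "f \<in> lin_cone \<alpha> G S" and c: "0 \<le> c"
  shows "(\<lambda>x. c * f x) \<in> lin_cone \<alpha> G S"
  unfolding lin_cone_def
proof (intro CollectI conjI ballI)
  fix x assume x: "x \<in> S"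
  show "0 \<le> c * f x" using lin_coneD(1)[OF f x] c by simp
  fix x' z assume x': "x' \<in> S" "z \<in> S"
  have "\<bar>c * f x - c * f x'\<bar> = c * \<bar>f x - f x'\<bar>"
    using c by (simp add: abs_mult flip: right_diff_distrib)
  also have "\<dots> \<le> c * (G * dist x x' powr \<alpha> * f z)"
    using lin_coneD(2)[OF f x x'] c by (rule mult_left_mono)
  finally show "\<bar>c * f x - c * f x'\<bar> \<le> G * dist x x' powr \<alpha> * (c * f z)" by (simp add: mult_ac)
qed

lemma lin_cone_cong: "f \<in> lin_cone \<alpha> G S \<Longrightarrow> (\<And>x. x \<in> S \<Longrightarrow> f x = g x) \<Longrightarrow> g \<in> lin_cone \<alpha> G S"
  unfolding lin_cone_def by auto

lemma lin_cone_lim: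
  assumes "\<And>n. fs n \<in> lin_cone \<alpha> G S" "\<And>x. x \<in> S \<Longrightarrow> (\<lambda>n. fs n x) \<longlonglongrightarrow> g x"
  shows "g \<in> lin_cone \<alpha> G S"
  unfolding lin_cone_def
proof (intro CollectI conjI ballI)
  fix x assume x: "x \<in> S"
  show "0 \<le> g x" by (rule LIMSEQ_le_const[OF assms(2)[OF x]]) (use assms(1) x in \<open>auto simp: lin_cone_def\<close>)
  fix x' z assume x': "x' \<in> S" "z \<in> S"
  show "\<bar>g x - g x'\<bar> \<le> G * dist x x' powr \<alpha> * g z"
    by (rule LIMSEQ_le[OF tendsto_rabs[OF tendsto_diff[OF assms(2)[OF x] assms(2)[OF x'(1)]]]
          tendsto_mult_left[OF assms(2)[OF x'(2)]]])
      (use assms(1) x x' in \<open>auto simp: lin_cone_def\<close>)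
qed

lemma lin_cone_one: "0 \<le> G \<Longrightarrow> (\<lambda>_. 1) \<in> lin_cone \<alpha> G S"
  by (simp add: lin_cone_def)

lemma lin_cone_absorbs:
  assumes "0 < G" "holder \<alpha> S g"
  shows "\<exists>c\<ge>0. (\<lambda>x. g x + c) \<in> lin_cone \<alpha> G S"
proof -
  obtain B C where g: "0 \<le> B" "0 \<le> C" "\<And>x. x \<in> S \<Longrightarrow> \<bar>g x\<bar> \<le> B"
    "\<And>x x'. x \<in> S \<Longrightarrow> x' \<in> S \<Longrightarrow> \<bar>g x - g x'\<bar> \<le> C * dist x x' powr \<alpha>"
    using assms(2) by (rule holderE) (use that in blast)
  have CG: "0 \<le> C / G" using assms g by simp
  have "(\<lambda>x. g x + (B + C / G)) \<in> lin_cone \<alpha> G S"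
    unfolding lin_cone_def
  proof (intro CollectI conjI ballI)
    have low: "C / G \<le> g z + (B + C / G)" if "z \<in> S" for z using g(3)[OF that] by linarith
    fix x assume x: "x \<in> S"
    show "0 \<le> g x + (B + C / G)" using low[OF x] CG by linarith
    fix x' z assume x': "x' \<in> S" "z \<in> S"
    have "\<bar>g x - g x'\<bar> \<le> C * dist x x' powr \<alpha>" by (rule g(4)[OF x x'(1)])
    also have "\<dots> = G * dist x x' powr \<alpha> * (C / G)" using assms(1) by simp
    also have "\<dots> \<le> G * dist x x' powr \<alpha> * (g z + (B + C / G))"
      using low[OF x'(2)] assms(1) by (intro mult_left_mono) auto
    finally show "\<bar>g x + (B + C / G) - (g x' + (B + C / G))\<bar> \<le> G * dist x x' powr \<alpha> * (g z + (B + C / G))"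
      by simp
  qed
  then show ?thesis using CG g(1) by (intro exI[of _ "B + C / G"]) auto
qed

lemma powr_dist_le_one:
  assumes "dist x x' \<le> 1" "0 < \<alpha>"
  shows "dist x x' powr \<alpha> \<le> 1"
  using powr_mono2[of \<alpha> "dist x x'" 1] assms by auto

lemma lin_cone_ratio:
  assumes g: "g \<in> lin_cone \<alpha> G S" and "0 \<le> G" "0 < \<alpha>" "x \<in> S" "x' \<in> S" "dist x x' \<le> 1" "z \<in> S"
  shows "\<bar>g x - g x'\<bar> \<le> G * g z"
proof -
  have "\<bar>g x - g x'\<bar> \<le> G * dist x x' powr \<alpha> * g z" using assms by (intro lin_coneD(2)[OF g]) auto
  also have "\<dots> \<le> G * 1 * g z"
    using powr_dist_le_one[OF assms(6,3)] assms lin_coneD(1)[OF g]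
    by (intro mult_right_mono mult_left_mono) auto
  finally show ?thesis by simp
qed

lemma lin_cone_holder:
  assumes g: "g \<in> lin_cone \<alpha> G S" and G: "0 \<le> G" and \<alpha>: "0 < \<alpha>"
    and d: "\<And>x x'. x \<in> S \<Longrightarrow> x' \<in> S \<Longrightarrow> dist x x' \<le> 1"
  shows "holder \<alpha> S g"
proof (cases "S = {}")
  case True
  then show ?thesis by (simp add: holder_def)
next
  case False
  then obtain z where z: "z \<in> S" by blast
  show ?thesis
  proof (rule holderI[of _ _ "g z + G * g z" "G * g z"])
    show "\<bar>g x\<bar> \<le> g z + G * g z" if "x \<in> S" for x
      using lin_cone_ratio[OF g G \<alpha> that z d[OF that z] z] lin_coneD(1)[OF g that] by linarith
    show "\<bar>g x - g x'\<bar> \<le> G * g z * dist x x' powr \<alpha>" if "x \<in> S" "x' \<in> S" for x x'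
      using lin_coneD(2)[OF g that z] by (simp add: mult_ac)
  qed
qed

text \<open>The cone aperture is \<open>2 / s\<close>, twice that of the paper: with this choice the contraction
  rate \<open>\<kappa>\<^sub>0\<close> is bounded below by a function of \<open>s\<close> alone, hence by a measurable function, which is
  not clear for \<open>1 - \<zeta>\<close>.\<close>

locale partially_expanding_branches = branch_system +
  fixes s e H lo hi :: "'a \<Rightarrow> real" and N :: "'a \<Rightarrow> nat" and \<Lambda> :: "'a \<Rightarrow> nat \<Rightarrow> real"
  assumes finite_I: "\<omega> \<in> W \<Longrightarrow> finite (I \<omega>)" and card_I: "\<omega> \<in> W \<Longrightarrow> card (I \<omega>) = N \<omega>"
    and H_ge: "\<omega> \<in> W \<Longrightarrow> 0 \<le> H \<omega>"
    and y_lip: "\<omega> \<in> W \<Longrightarrow> x \<in> fib E (\<theta> \<omega>) \<Longrightarrow> x' \<in> fib E (\<theta> \<omega>) \<Longrightarrow> i \<in> I \<omega> \<Longrightarrow>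
      dist (y \<omega> i x) (y \<omega> i x') powr \<alpha> \<le> \<Lambda> \<omega> i * dist x x' powr \<alpha>"
    and sum_lip: "\<omega> \<in> W \<Longrightarrow> e \<omega> * (\<Sum>i\<in>I \<omega>. \<Lambda> \<omega> i) = real (N \<omega>) * s \<omega>"
    and phi_bounds: "\<omega> \<in> W \<Longrightarrow> x \<in> fib E \<omega> \<Longrightarrow> lo \<omega> \<le> \<phi> \<omega> x \<and> \<phi> \<omega> x \<le> hi \<omega>"
    and e_def: "\<omega> \<in> W \<Longrightarrow> e \<omega> = exp (hi \<omega> - lo \<omega>)"
    and phi_var: "\<omega> \<in> W \<Longrightarrow> x \<in> fib E (\<theta> \<omega>) \<Longrightarrow> x' \<in> fib E (\<theta> \<omega>) \<Longrightarrow> i \<in> I \<omega> \<Longrightarrow>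
      \<bar>\<phi> \<omega> (y \<omega> i x) - \<phi> \<omega> (y \<omega> i x')\<bar> \<le> H \<omega> * dist x x' powr \<alpha>"
    and s_pos: "\<omega> \<in> W \<Longrightarrow> 0 < s \<omega>" and s_less: "\<omega> \<in> W \<Longrightarrow> s \<omega> < 1"
    and gap: "\<omega> \<in> W \<Longrightarrow> e \<omega> * H \<omega> \<le> (1 / s (\<theta> \<omega>) - 1) / (1 + 1 / s \<omega>)"
begin

text \<open>The aperture of images of the cone of aperture 2 / s: the summand 2 is s * (2 / s), from
  the distortion of the branches, and the rest is the variation of the weights times the largest
  ratio 1 + 2 / s of function values.\<close>

definition Y :: "'a \<Rightarrow> real" where "Y \<omega> = 2 + (1 + 2 / s \<omega>) * (e \<omega> * H \<omega>)"

lemma e_pos: "\<omega> \<in> W \<Longrightarrow> 0 < e \<omega>" by (simp add: e_def)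

lemma Y_ge: "\<omega> \<in> W \<Longrightarrow> 2 \<le> Y \<omega>"
  using s_pos[of \<omega>] e_pos[of \<omega>] H_ge[of \<omega>] by (simp add: Y_def)

text \<open>The hypothesis on e H is stated for the aperture 1 / s. Doubling the aperture multiplies
  the factor 1 + 1 / s by 2 - s / (1 + s), which is less than 2, and this deficit is the
  quantitative gap.\<close>

lemma Y_gap:
  assumes w: "\<omega> \<in> W"
  shows "(1 / s (\<theta> \<omega>) - 1) * (s \<omega> / (1 + s \<omega>)) \<le> 2 / s (\<theta> \<omega>) - Y \<omega>"
proof -
  let ?d = "1 / s (\<theta> \<omega>) - 1"
  have s: "0 < s \<omega>" by (rule s_pos[OF w])
  have "(1 + 2 / s \<omega>) * (e \<omega> * H \<omega>) \<le> (1 + 2 / s \<omega>) * (?d / (1 + 1 / s \<omega>))"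
    using gap[OF w] s by (intro mult_left_mono) auto
  also have "\<dots> = ?d * ((1 + 2 / s \<omega>) / (1 + 1 / s \<omega>))" by simp
  also have "(1 + 2 / s \<omega>) / (1 + 1 / s \<omega>) = 2 - s \<omega> / (1 + s \<omega>)"
  proof -
    have "1 + 2 / s \<omega> = (2 + s \<omega>) / s \<omega>" "1 + 1 / s \<omega> = (1 + s \<omega>) / s \<omega>" using s by (simp_all add: field_simps)
    then have "(1 + 2 / s \<omega>) / (1 + 1 / s \<omega>) = (2 + s \<omega>) / (1 + s \<omega>)" using s by simp
    also have "\<dots> = 2 - s \<omega> / (1 + s \<omega>)" using s by (simp add: field_simps)
    finally show ?thesis .
  qed
  finally show ?thesis unfolding Y_def by (simp add: algebra_simps)
qed

lemma Y_less:
  assumes w: "\<omega> \<in> W"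
  shows "Y \<omega> < 2 / s (\<theta> \<omega>)"
proof -
  have "0 < (1 / s (\<theta> \<omega>) - 1) * (s \<omega> / (1 + s \<omega>))"
    using s_pos[OF w] s_pos[OF th_in[OF w]] s_less[OF th_in[OF w]] by (intro mult_pos_pos) auto
  then show ?thesis using Y_gap[OF w] by linarith
qed

lemma L_finite: "\<omega> \<in> W \<Longrightarrow> x \<in> X (\<theta> \<omega>) \<Longrightarrow> L \<omega> g x = (\<Sum>i\<in>I \<omega>. exp (\<phi> \<omega> (y \<omega> i x)) * g (y \<omega> i x))"
  using L_index[of \<omega> x g] finite_I by simp

text \<open>The smallest value \<open>m\<close> of \<open>f\<close> on the preimages of
  \<open>z\<close> bounds \<open>L \<omega> f z\<close> below by N exp(lo) m, and all values of
  \<open>f\<close> above by (1 + 2 / s) m. Summing the variation over branches and using exp(hi) = e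
  exp(lo) brings in e times the sum of distortions, which is N s. The weight \<open>g\<close> is
  included so that the same estimate serves the plain operator and multiplication.\<close>

lemma L_weighted_variation:
  assumes w: "\<omega> \<in> W" and f: "f \<in> lin_cone \<alpha> (2 / s \<omega>) (X \<omega>)"
    and AB: "0 \<le> A" "0 \<le> B" and g: "\<And>x. x \<in> X \<omega> \<Longrightarrow> \<bar>g x\<bar> \<le> A"
      "\<And>x x'. x \<in> X \<omega> \<Longrightarrow> x' \<in> X \<omega> \<Longrightarrow> \<bar>g x - g x'\<bar> \<le> B * dist x x' powr \<alpha>"
    and x: "x \<in> X (\<theta> \<omega>)" "x' \<in> X (\<theta> \<omega>)" "z \<in> X (\<theta> \<omega>)"
  shows "\<bar>L \<omega> (\<lambda>x. g x * f x) x - L \<omega> (\<lambda>x. g x * f x) x'\<bar> \<le> (A * Y \<omega> + 3 * B) * dist x x' powr \<alpha> * L \<omega> f z"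
proof -
  let ?r = "dist x x' powr \<alpha>"
  have s: "0 < s \<omega>" "s \<omega> < 1" using s_pos[OF w] s_less[OF w] .
  have s2: "0 \<le> 2 / s \<omega>" using s by simp
  have "finite ((\<lambda>i. f (y \<omega> i z)) ` I \<omega>)" "(\<lambda>i. f (y \<omega> i z)) ` I \<omega> \<noteq> {}"
    using finite_I[OF w] index_ne[OF w] by auto
  \<comment> \<open>The minimising branch; its value is comparable with \<open>f\<close> everywhere
    on the fibre through the cone condition.\<close>
  then obtain k where k: "k \<in> I \<omega>" "\<And>i. i \<in> I \<omega> \<Longrightarrow> f (y \<omega> k z) \<le> f (y \<omega> i z)"
    using ex_min_if_finite[of "(\<lambda>i. f (y \<omega> i z)) ` I \<omega>"] by (force simp: not_less)
  define m where "m = f (y \<omega> k z)"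
  have yk: "y \<omega> k z \<in> X \<omega>" by (rule y_in[OF w k(1) x(3)])
  have m0: "0 \<le> m" unfolding m_def by (rule lin_coneD(1)[OF f yk])
  have fm: "f u \<le> (1 + 2 / s \<omega>) * m" if u: "u \<in> X \<omega>" for u
    using lin_cone_ratio[OF f s2 alpha(1) u yk diam[OF w u yk] yk] by (simp add: m_def distrib_right)
  have f0: "0 \<le> f u" if "u \<in> X \<omega>" for u by (rule lin_coneD(1)[OF f that])
  let ?V = "A * (2 / s \<omega>) * m + B * ((1 + 2 / s \<omega>) * m)"
  let ?S = "A * ((1 + 2 / s \<omega>) * m)"
  have V0: "0 \<le> ?V" "0 \<le> ?S" using AB m0 s by auto
  have term_bound: "\<bar>exp (\<phi> \<omega> (y \<omega> i x)) * (g (y \<omega> i x) * f (y \<omega> i x)) - exp (\<phi> \<omega> (y \<omega> i x')) * (g (y \<omega> i x') * f (y \<omega> i x'))\<bar>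
      \<le> exp (hi \<omega>) * (\<Lambda> \<omega> i * ?r * ?V) + exp (hi \<omega>) * (H \<omega> * ?r) * ?S" if i: "i \<in> I \<omega>" for i
  proof -
    define u u' where "u = y \<omega> i x" "u' = y \<omega> i x'"
    have u: "u \<in> X \<omega>" "u' \<in> X \<omega>" using y_in[OF w i] x by (auto simp: u_u'_def)
    have hi: "\<phi> \<omega> u \<le> hi \<omega>" "\<phi> \<omega> u' \<le> hi \<omega>" using phi_bounds[OF w] u by auto
    have d: "dist u u' powr \<alpha> \<le> \<Lambda> \<omega> i * ?r" unfolding u_u'_def by (rule y_lip[OF w x(1,2) i])
    have "g u * f u - g u' * f u' = g u * (f u - f u') + (g u - g u') * f u'" by (simp add: algebra_simps)
    then have "\<bar>g u * f u - g u' * f u'\<bar> \<le> \<bar>g u\<bar> * \<bar>f u - f u'\<bar> + \<bar>g u - g u'\<bar> * \<bar>f u'\<bar>"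
      by (metis abs_mult abs_triangle_ineq)
    also have "\<dots> \<le> A * (2 / s \<omega> * dist u u' powr \<alpha> * m) + (B * dist u u' powr \<alpha>) * ((1 + 2 / s \<omega>) * m)"
      using lin_coneD(2)[OF f u yk] g(1)[OF u(1)] g(2)[OF u] fm[OF u(2)] f0[OF u(2)] AB
      by (intro add_mono mult_mono) (auto simp: m_def)
    also have "\<dots> = dist u u' powr \<alpha> * ?V" by (simp add: algebra_simps)
    also have "\<dots> \<le> \<Lambda> \<omega> i * ?r * ?V" using d V0(1) by (rule mult_right_mono)
    finally have 1: "\<bar>g u * f u - g u' * f u'\<bar> \<le> \<Lambda> \<omega> i * ?r * ?V" .
    have 2: "\<bar>g u' * f u'\<bar> \<le> ?S"
      unfolding abs_mult using g(1)[OF u(2)] fm[OF u(2)] f0[OF u(2)] AB by (intro mult_mono) auto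
    have 3: "\<bar>exp (\<phi> \<omega> u) - exp (\<phi> \<omega> u')\<bar> \<le> exp (hi \<omega>) * (H \<omega> * ?r)"
    proof -
      have "\<bar>\<phi> \<omega> u - \<phi> \<omega> u'\<bar> \<le> H \<omega> * ?r" unfolding u_u'_def by (rule phi_var[OF w x(1,2) i])
      then have "exp (hi \<omega>) * \<bar>\<phi> \<omega> u - \<phi> \<omega> u'\<bar> \<le> exp (hi \<omega>) * (H \<omega> * ?r)" by (intro mult_left_mono) auto
      then show ?thesis using exp_diff_le[OF hi] by linarith
    qed
    have "exp (\<phi> \<omega> u) * (g u * f u) - exp (\<phi> \<omega> u') * (g u' * f u')
        = exp (\<phi> \<omega> u) * (g u * f u - g u' * f u') + (exp (\<phi> \<omega> u) - exp (\<phi> \<omega> u')) * (g u' * f u')"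
      by (simp add: algebra_simps)
    then have "\<bar>exp (\<phi> \<omega> u) * (g u * f u) - exp (\<phi> \<omega> u') * (g u' * f u')\<bar>
        \<le> exp (\<phi> \<omega> u) * \<bar>g u * f u - g u' * f u'\<bar> + \<bar>exp (\<phi> \<omega> u) - exp (\<phi> \<omega> u')\<bar> * \<bar>g u' * f u'\<bar>"
      by (metis abs_exp_cancel abs_mult abs_triangle_ineq)
    also have "\<dots> \<le> exp (hi \<omega>) * (\<Lambda> \<omega> i * ?r * ?V) + exp (hi \<omega>) * (H \<omega> * ?r) * ?S"
      using 1 2 3 hi H_ge[OF w] by (intro add_mono mult_mono) auto
    finally show ?thesis by (simp only: u_u'_def)
  qed
  have "\<bar>L \<omega> (\<lambda>x. g x * f x) x - L \<omega> (\<lambda>x. g x * f x) x'\<bar>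
      = \<bar>\<Sum>i\<in>I \<omega>. exp (\<phi> \<omega> (y \<omega> i x)) * (g (y \<omega> i x) * f (y \<omega> i x)) - exp (\<phi> \<omega> (y \<omega> i x')) * (g (y \<omega> i x') * f (y \<omega> i x'))\<bar>"
    using x by (simp add: L_finite[OF w] sum_subtractf)
  also have "\<dots> \<le> (\<Sum>i\<in>I \<omega>. exp (hi \<omega>) * (\<Lambda> \<omega> i * ?r * ?V) + exp (hi \<omega>) * (H \<omega> * ?r) * ?S)"
    by (rule order_trans[OF sum_abs]) (intro sum_mono term_bound)
  also have "\<dots> = exp (hi \<omega>) * (\<Sum>i\<in>I \<omega>. \<Lambda> \<omega> i) * ?r * ?V + real (N \<omega>) * (exp (hi \<omega>) * (H \<omega> * ?r) * ?S)"
    by (simp add: sum.distrib card_I[OF w] sum_distrib_left[symmetric] sum_distrib_right[symmetric] mult.assoc)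
  \<comment> \<open>From upper to lower weight bound: the factor \<open>e \<omega>\<close> joins
    \<open>sum_lip\<close>, and exp(lo) joins the lower bound for
    \<open>L \<omega> f z\<close>.\<close>
  also have "exp (hi \<omega>) = e \<omega> * exp (lo \<omega>)" by (simp add: e_def[OF w] exp_add[symmetric])
  also have "e \<omega> * exp (lo \<omega>) * (\<Sum>i\<in>I \<omega>. \<Lambda> \<omega> i) * ?r * ?V + real (N \<omega>) * (e \<omega> * exp (lo \<omega>) * (H \<omega> * ?r) * ?S)
      = ((e \<omega> * (\<Sum>i\<in>I \<omega>. \<Lambda> \<omega> i)) * ?V + real (N \<omega>) * (e \<omega> * H \<omega> * ?S)) * exp (lo \<omega>) * ?r"
    by (simp add: algebra_simps)
  also have "\<dots> = (s \<omega> * (A * (2 / s \<omega>) + B * (1 + 2 / s \<omega>)) + e \<omega> * H \<omega> * (A * (1 + 2 / s \<omega>))) * ?r * (real (N \<omega>) * exp (lo \<omega>) * m)"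
    unfolding sum_lip[OF w] by (simp add: algebra_simps)
  also have "s \<omega> * (A * (2 / s \<omega>) + B * (1 + 2 / s \<omega>)) + e \<omega> * H \<omega> * (A * (1 + 2 / s \<omega>)) = A * Y \<omega> + B * (s \<omega> + 2)"
    using s by (simp add: Y_def field_simps)
  also have "(A * Y \<omega> + B * (s \<omega> + 2)) * ?r * (real (N \<omega>) * exp (lo \<omega>) * m) \<le> (A * Y \<omega> + 3 * B) * ?r * L \<omega> f z"
  proof -
    have "real (N \<omega>) * exp (lo \<omega>) * m = (\<Sum>i\<in>I \<omega>. exp (lo \<omega>) * m)" by (simp add: card_I[OF w])
    also have "\<dots> \<le> L \<omega> f z"
      unfolding L_finite[OF w x(3)]
    proof (intro sum_mono mult_mono)
      fix i assume i: "i \<in> I \<omega>"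
      show "exp (lo \<omega>) \<le> exp (\<phi> \<omega> (y \<omega> i z))" using phi_bounds[OF w y_in[OF w i x(3)]] by simp
      show "m \<le> f (y \<omega> i z)" unfolding m_def by (rule k(2)[OF i])
    qed (use m0 in auto)
    finally have 1: "real (N \<omega>) * exp (lo \<omega>) * m \<le> L \<omega> f z" .
    have "B * (s \<omega> + 2) \<le> B * 3" using s AB by (intro mult_left_mono) auto
    then have 2: "(A * Y \<omega> + B * (s \<omega> + 2)) * ?r \<le> (A * Y \<omega> + 3 * B) * ?r" by (intro mult_right_mono) auto
    have 3: "0 \<le> (A * Y \<omega> + 3 * B) * ?r" using AB Y_ge[OF w] by simp
    show ?thesis by (rule mult_mono[OF 2 1 3]) (use m0 in auto)
  qed
  finally show ?thesis .
qed

lemma L_variation: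
  assumes w: "\<omega> \<in> W" and f: "f \<in> lin_cone \<alpha> (2 / s \<omega>) (X \<omega>)"
    and x: "x \<in> X (\<theta> \<omega>)" "x' \<in> X (\<theta> \<omega>)" "z \<in> X (\<theta> \<omega>)"
  shows "\<bar>L \<omega> f x - L \<omega> f x'\<bar> \<le> Y \<omega> * dist x x' powr \<alpha> * L \<omega> f z"
  using L_weighted_variation[OF w f _ _ _ _ x, of 1 0 "\<lambda>_. 1"] by simp

lemma lin_cone_bdd: "\<omega> \<in> W \<Longrightarrow> f \<in> lin_cone \<alpha> (2 / s \<omega>) (X \<omega>) \<Longrightarrow> bdd_on \<omega> f"
  using s_pos[of \<omega>] by (intro holder_bdd lin_cone_holder[OF _ _ alpha(1)] diam) auto

lemma L_ratio:
  assumes w: "\<omega> \<in> W" and f: "f \<in> lin_cone \<alpha> (2 / s \<omega>) (X \<omega>)"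
    and x: "x \<in> X (\<theta> \<omega>)" "x' \<in> X (\<theta> \<omega>)"
  shows "L \<omega> f x \<le> (1 + Y \<omega>) * L \<omega> f x'"
proof -
  have "\<bar>L \<omega> f x - L \<omega> f x'\<bar> \<le> Y \<omega> * dist x x' powr \<alpha> * L \<omega> f x'" by (rule L_variation[OF w f x x(2)])
  also have "\<dots> \<le> Y \<omega> * 1 * L \<omega> f x'"
    using powr_dist_le_one[OF diam[OF th_in[OF w] x] alpha(1)] Y_ge[OF w] L_nonneg[of \<omega> f x'] lin_coneD(1)[OF f]
    by (intro mult_right_mono mult_left_mono) auto
  finally show ?thesis by (simp add: distrib_right)
qed

text \<open>With R = 2 / s(\<theta> \<omega>) the hypothesis rearranges to Y (L f + t L f') \<le> R
  (L f - t L f') at \<open>z\<close>, and the left side bounds the variation of the difference. The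
  constant is (1 - q) / (1 + q) for the ratio q = Y / R of apertures, as for the log cone.\<close>

lemma lin_cone_contract:
  assumes w: "\<omega> \<in> W" and f: "f \<in> lin_cone \<alpha> (2 / s \<omega>) (X \<omega>)" "f' \<in> lin_cone \<alpha> (2 / s \<omega>) (X \<omega>)" and t: "0 \<le> t"
    and le: "\<And>z. z \<in> X (\<theta> \<omega>) \<Longrightarrow> t * L \<omega> f' z \<le> (2 / s (\<theta> \<omega>) - Y \<omega>) / (2 / s (\<theta> \<omega>) + Y \<omega>) * L \<omega> f z"
  shows "(\<lambda>z. L \<omega> f z - t * L \<omega> f' z) \<in> lin_cone \<alpha> (2 / s (\<theta> \<omega>)) (X (\<theta> \<omega>))"
  unfolding lin_cone_def
proof (intro CollectI conjI ballI)
  define R where "R = 2 / s (\<theta> \<omega>)"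
  have R: "Y \<omega> < R" "0 < R + Y \<omega>" using Y_less[OF w] Y_ge[OF w] by (auto simp: R_def)
  have F0: "0 \<le> L \<omega> f x" for x using lin_coneD(1)[OF f(1)] by (rule L_nonneg)
  fix x assume x: "x \<in> X (\<theta> \<omega>)"
  have "(R - Y \<omega>) / (R + Y \<omega>) * L \<omega> f x \<le> L \<omega> f x"
    using R Y_ge[OF w] F0 by (intro mult_left_le_one_le) (auto simp: divide_le_eq)
  then show "0 \<le> L \<omega> f x - t * L \<omega> f' x" using le[OF x] by (simp add: R_def)
  fix x' z assume x': "x' \<in> X (\<theta> \<omega>)" "z \<in> X (\<theta> \<omega>)"
  let ?r = "dist x x' powr \<alpha>"
  have "t * \<bar>L \<omega> f' x - L \<omega> f' x'\<bar> \<le> t * (Y \<omega> * ?r * L \<omega> f' z)"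
    using L_variation[OF w f(2) x x'] t by (rule mult_left_mono)
  moreover have "\<bar>(L \<omega> f x - t * L \<omega> f' x) - (L \<omega> f x' - t * L \<omega> f' x')\<bar>
      \<le> \<bar>L \<omega> f x - L \<omega> f x'\<bar> + t * \<bar>L \<omega> f' x - L \<omega> f' x'\<bar>"
  proof -
    have "(L \<omega> f x - t * L \<omega> f' x) - (L \<omega> f x' - t * L \<omega> f' x') = (L \<omega> f x - L \<omega> f x') - t * (L \<omega> f' x - L \<omega> f' x')"
      by (simp add: algebra_simps)
    then have "\<bar>(L \<omega> f x - t * L \<omega> f' x) - (L \<omega> f x' - t * L \<omega> f' x')\<bar> \<le> \<bar>L \<omega> f x - L \<omega> f x'\<bar> + \<bar>t * (L \<omega> f' x - L \<omega> f' x')\<bar>"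
      by linarith
    then show ?thesis using t by (simp add: abs_mult)
  qed
  moreover have "t * L \<omega> f' z * (R + Y \<omega>) \<le> (R - Y \<omega>) * L \<omega> f z"
    using le[OF x'(2)] R by (simp add: R_def[symmetric] pos_le_divide_eq)
  then have "?r * (t * L \<omega> f' z * (R + Y \<omega>)) \<le> ?r * ((R - Y \<omega>) * L \<omega> f z)" by (intro mult_left_mono) auto
  ultimately show "\<bar>(L \<omega> f x - t * L \<omega> f' x) - (L \<omega> f x' - t * L \<omega> f' x')\<bar>
      \<le> 2 / s (\<theta> \<omega>) * ?r * (L \<omega> f z - t * L \<omega> f' z)"
    using L_variation[OF w f(1) x x'] unfolding R_def[symmetric] by (simp add: algebra_simps)
qed

text \<open>Let \<zeta> = Y s(\<theta> \<omega>) / 2 be the ratio of the image aperture to that of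
  the next cone. The choice of \<open>m\<close> makes c (1 - \<zeta>) equal to 2 A + 2 B, and the
  cone condition reduces to A \<zeta> + 3/2 s(\<theta> \<omega>) B \<le> A + 2 B.\<close>

lemma lin_cone_mult:
  assumes w: "\<omega> \<in> W" and f: "f \<in> lin_cone \<alpha> (2 / s \<omega>) (X \<omega>)"
    and AB: "0 \<le> A" "0 \<le> B" and g: "\<And>x. x \<in> X \<omega> \<Longrightarrow> \<bar>g x\<bar> \<le> A"
      "\<And>x x'. x \<in> X \<omega> \<Longrightarrow> x' \<in> X \<omega> \<Longrightarrow> \<bar>g x - g x'\<bar> \<le> B * dist x x' powr \<alpha>"
  defines "m \<equiv> 2 / (1 - Y \<omega> * s (\<theta> \<omega>) / 2)"
  shows "(\<lambda>z. (m * A + m * B) * L \<omega> f z + L \<omega> (\<lambda>x. g x * f x) z) \<in> lin_cone \<alpha> (2 / s (\<theta> \<omega>)) (X (\<theta> \<omega>))"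
  unfolding lin_cone_def
proof (intro CollectI conjI ballI)
  define c where "c = m * A + m * B"
  define s1 where "s1 = s (\<theta> \<omega>)"
  have s1: "0 < s1" "s1 < 1" using s_pos[OF th_in[OF w]] s_less[OF th_in[OF w]] by (auto simp: s1_def)
  define \<zeta> where "\<zeta> = Y \<omega> * s1 / 2"
  have z0: "0 \<le> \<zeta>" "\<zeta> < 1"
    using Y_less[OF w] Y_ge[OF w] s1 by (auto simp: \<zeta>_def s1_def[symmetric] field_simps)
  have cz: "c * (1 - \<zeta>) = 2 * A + 2 * B"
  proof -
    have "1 - \<zeta> \<noteq> 0" using z0 by simp
    then have "m * (1 - \<zeta>) = 2"
      unfolding m_def s1_def[symmetric] \<zeta>_def[symmetric] times_divide_eq_left
      by (rule nonzero_mult_div_cancel_right)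
    moreover have "c * (1 - \<zeta>) = (m * (1 - \<zeta>)) * (A + B)" by (simp add: c_def algebra_simps)
    ultimately show ?thesis by simp
  qed
  have c0: "0 \<le> c" using AB z0 unfolding c_def m_def s1_def[symmetric] \<zeta>_def[symmetric] by simp
  have "c * (1 - \<zeta>) \<le> c * 1" using c0 z0 by (intro mult_left_mono) auto
  then have cA: "A \<le> c" using cz AB by simp
  have F0: "0 \<le> L \<omega> f x" for x using lin_coneD(1)[OF f] by (rule L_nonneg)
  have Lg: "\<bar>L \<omega> (\<lambda>x. g x * f x) x\<bar> \<le> A * L \<omega> f x" if x: "x \<in> X (\<theta> \<omega>)" for x
  proof -
    have "\<bar>L \<omega> (\<lambda>x. g x * f x) x\<bar> \<le> L \<omega> (\<lambda>x. A * f x) x"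
      using g(1) lin_coneD(1)[OF f]
      by (intro L_abs_le w x bdd_on_cmult lin_cone_bdd f) (auto simp: abs_mult intro!: mult_right_mono)
    then show ?thesis by (simp add: L_cmult)
  qed
  fix x assume x: "x \<in> X (\<theta> \<omega>)"
  have "A * L \<omega> f x \<le> c * L \<omega> f x" using cA F0 by (rule mult_right_mono)
  then show "0 \<le> (m * A + m * B) * L \<omega> f x + L \<omega> (\<lambda>x. g x * f x) x"
    using Lg[OF x] unfolding c_def[symmetric] by linarith
  fix x' z assume x': "x' \<in> X (\<theta> \<omega>)" "z \<in> X (\<theta> \<omega>)"
  let ?r = "dist x x' powr \<alpha>"
  have "c * \<bar>L \<omega> f x - L \<omega> f x'\<bar> \<le> c * (Y \<omega> * ?r * L \<omega> f z)"
    using L_variation[OF w f x x'] c0 by (rule mult_left_mono)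
  moreover have "\<bar>(c * L \<omega> f x + L \<omega> (\<lambda>x. g x * f x) x) - (c * L \<omega> f x' + L \<omega> (\<lambda>x. g x * f x) x')\<bar>
      \<le> c * \<bar>L \<omega> f x - L \<omega> f x'\<bar> + \<bar>L \<omega> (\<lambda>x. g x * f x) x - L \<omega> (\<lambda>x. g x * f x) x'\<bar>"
  proof -
    have "c * \<bar>L \<omega> f x - L \<omega> f x'\<bar> = \<bar>c * L \<omega> f x - c * L \<omega> f x'\<bar>"
      using c0 by (simp add: abs_mult flip: right_diff_distrib)
    then show ?thesis by linarith
  qed
  moreover have "\<bar>L \<omega> (\<lambda>x. g x * f x) x - L \<omega> (\<lambda>x. g x * f x) x'\<bar> \<le> (A * Y \<omega> + 3 * B) * ?r * L \<omega> f z"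
    by (rule L_weighted_variation[OF w f AB g x x'])
  ultimately have "\<bar>(c * L \<omega> f x + L \<omega> (\<lambda>x. g x * f x) x) - (c * L \<omega> f x' + L \<omega> (\<lambda>x. g x * f x) x')\<bar>
      \<le> (c * Y \<omega> + A * Y \<omega> + 3 * B) * (?r * L \<omega> f z)" by (simp add: algebra_simps)
  also have "\<dots> \<le> (2 / s1 * (c - A)) * (?r * L \<omega> f z)"
  proof (rule mult_right_mono)
    have Yz: "Y \<omega> = 2 / s1 * \<zeta>" using s1 by (simp add: \<zeta>_def)
    have "A * \<zeta> \<le> A * 1" using AB z0 by (intro mult_left_mono) auto
    moreover have "s1 * B \<le> 1 * B" using AB s1 by (intro mult_right_mono) auto
    moreover have "c * \<zeta> = c - 2 * A - 2 * B" using cz by (simp add: algebra_simps)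
    ultimately have "c * \<zeta> + A * \<zeta> + 3 / 2 * (s1 * B) \<le> c - A" using AB by linarith
    then have "2 / s1 * (c * \<zeta> + A * \<zeta> + 3 / 2 * (s1 * B)) \<le> 2 / s1 * (c - A)" using s1 by (intro mult_left_mono) auto
    moreover have "2 / s1 * (c * \<zeta> + A * \<zeta> + 3 / 2 * (s1 * B)) = c * Y \<omega> + A * Y \<omega> + 3 * B"
      using s1 unfolding Yz by (simp add: field_simps)
    ultimately show "c * Y \<omega> + A * Y \<omega> + 3 * B \<le> 2 / s1 * (c - A)" by simp
  qed (use F0 in auto)
  also have "\<dots> = 2 / s1 * ?r * (c * L \<omega> f z - A * L \<omega> f z)"
    by (simp only: left_diff_distrib[symmetric] mult_ac)
  also have "\<dots> \<le> 2 / s1 * ?r * (c * L \<omega> f z + L \<omega> (\<lambda>x. g x * f x) z)"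
    using Lg[OF x'(2)] s1 by (intro mult_left_mono) auto
  finally show "\<bar>((m * A + m * B) * L \<omega> f x + L \<omega> (\<lambda>x. g x * f x) x) - ((m * A + m * B) * L \<omega> f x' + L \<omega> (\<lambda>x. g x * f x) x')\<bar>
      \<le> 2 / s (\<theta> \<omega>) * ?r * ((m * A + m * B) * L \<omega> f z + L \<omega> (\<lambda>x. g x * f x) z)"
    by (simp add: c_def s1_def)
qed

end

lemma partially_expanding_growth:
  fixes U V H s s\<^sub>1 \<epsilon> \<Phi> C :: real
  assumes s: "0 < s" "0 < s\<^sub>1" "s\<^sub>1 < 1" and nn: "0 \<le> H" "0 \<le> U" "0 \<le> V" "0 \<le> \<epsilon>" "\<epsilon> \<le> 2 * \<Phi>"
  defines "\<zeta> \<equiv> s\<^sub>1 * (1 + (1 + 1 / s) * exp \<epsilon> * H)"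
  assumes z: "\<zeta> < 1"
  defines "D \<equiv> 2 * ln ((1 + \<zeta>) / (1 - \<zeta>)) + 2 * ln (1 + \<zeta> / s)"
  defines "c\<^sub>0 \<equiv> 32 * s\<^sub>1 * (1 + 2 / s) * exp (U + 2 * \<Phi>) * (U + V) * (1 + H) / (1 - \<zeta>)"
  assumes C: "c\<^sub>0 * (1 + cosh (7 * D / 2)) \<le> C"
  defines "Y \<equiv> 2 + (1 + 2 / s) * (exp \<epsilon> * H)"
  defines "m \<equiv> 2 / (1 - Y * s\<^sub>1 / 2)"
  shows "exp U * (m * U + m * V) \<le> 3 * C / s\<^sub>1\<^sup>2 * ((2 / s\<^sub>1 - Y) / (2 / s\<^sub>1 + Y) / (1 + Y)\<^sup>2)"
proof -
  \<comment> \<open>\<open>Z\<close> links the two apertures: \<zeta> = s_1 Z, while Y is at most 2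
    Z, so estimates in \<zeta> carry over to the doubled cone.\<close>
  define Z where "Z = 1 + (1 + 1 / s) * exp \<epsilon> * H"
  have Z: "1 \<le> Z" "\<zeta> = s\<^sub>1 * Z" using s nn by (auto simp: Z_def \<zeta>_def)
  have zpos: "0 < \<zeta>" using Z s by simp
  have eH: "0 \<le> exp \<epsilon> * H" using nn by simp
  have YZ: "Y \<le> 2 * Z" "2 \<le> Y" using eH s by (auto simp: Y_def Z_def algebra_simps)
  have Z1: "Z \<le> 1 / s\<^sub>1" using z Z s by (simp add: field_simps)
  define t where "t = Y * s\<^sub>1 / 2"
  have t: "0 \<le> t" "t \<le> \<zeta>" using mult_right_mono[OF YZ(1), of s\<^sub>1] YZ(2) s Z z by (auto simp: t_def)
  then have t1: "t < 1" using z by linarith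
  have k0: "(2 / s\<^sub>1 - Y) / (2 / s\<^sub>1 + Y) = (1 - t) / (1 + t)"
  proof -
    have eq: "2 / s\<^sub>1 - Y = 2 / s\<^sub>1 * (1 - t)" "2 / s\<^sub>1 + Y = 2 / s\<^sub>1 * (1 + t)"
      using s by (auto simp: t_def field_simps)
    have "2 / s\<^sub>1 \<noteq> 0" using s by simp
    then show ?thesis unfolding eq by (rule mult_divide_mult_cancel_left)
  qed
  \<comment> \<open>18 = 2 * 9: a factor 2 from 1 + t \<le> 2, and 9 from 1 + Y \<le> 3 Z.\<close>
  have k: "(1 - \<zeta>) / (18 * Z\<^sup>2) \<le> (2 / s\<^sub>1 - Y) / (2 / s\<^sub>1 + Y) / (1 + Y)\<^sup>2"
  proof -
    have "(1 - \<zeta>) / 2 \<le> (1 - t) / (1 + t)" using t z by (intro frac_le) auto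
    moreover have "(1 + Y)\<^sup>2 \<le> (3 * Z)\<^sup>2" using YZ Z by (intro power_mono) auto
    ultimately have "(1 - \<zeta>) / 2 / (3 * Z)\<^sup>2 \<le> (1 - t) / (1 + t) / (1 + Y)\<^sup>2"
      using z t YZ by (intro frac_le) auto
    then show ?thesis unfolding k0 by (simp add: power_mult_distrib)
  qed
  define x where "x = exp U * (U + V)"
  have x0: "0 \<le> x" using nn by (simp add: x_def)
  have lnR: "- ln (1 - \<zeta>) \<le> ln ((1 + \<zeta>) / (1 - \<zeta>))" using z zpos by (simp add: ln_div)
  moreover have "0 \<le> - ln (1 - \<zeta>)" using z zpos by simp
  moreover have "0 \<le> ln (1 + \<zeta> / s)" using zpos s by simp
  moreover have "x \<le> 7 * (2 * P + 2 * Q) / 2" if "x \<le> P" "0 \<le> x" "0 \<le> Q" for x P Q :: real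
    using that by simp
  ultimately have "- ln (1 - \<zeta>) \<le> 7 * D / 2" unfolding D_def by blast
  then have "exp (- ln (1 - \<zeta>)) \<le> exp (7 * D / 2)" by simp
  then have "1 / (1 - \<zeta>) \<le> exp (7 * D / 2)" using z by (simp add: exp_minus inverse_eq_divide)
  then have ch: "1 / (1 - \<zeta>) \<le> 2 * (1 + cosh (7 * D / 2))" using exp_le_cosh[of "7 * D / 2"] by linarith
  have c0: "32 * s\<^sub>1 * Z * x / (1 - \<zeta>) \<le> c\<^sub>0"
  proof -
    have e1: "1 \<le> exp \<epsilon>" "exp \<epsilon> \<le> exp (2 * \<Phi>)" using nn by auto
    have "Z \<le> (1 + 2 / s) * (1 + H) * exp \<epsilon>"
    proof -
      have "(1 + 2 / s) * (1 + H) * exp \<epsilon> - Z = (exp \<epsilon> - 1) + 2 / s * exp \<epsilon> + 1 / s * (exp \<epsilon> * H)"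
        by (simp add: Z_def algebra_simps add_divide_distrib)
      moreover have "0 \<le> 2 / s * exp \<epsilon>" "0 \<le> 1 / s * (exp \<epsilon> * H)" using s eH by auto
      ultimately show ?thesis using e1 by linarith
    qed
    also have "\<dots> \<le> (1 + 2 / s) * (1 + H) * exp (2 * \<Phi>)"
      using e1 s nn by (intro mult_left_mono) auto
    finally have "32 * s\<^sub>1 * x * Z \<le> 32 * s\<^sub>1 * x * ((1 + 2 / s) * (1 + H) * exp (2 * \<Phi>))"
      using s x0 by (intro mult_left_mono) auto
    then have "32 * s\<^sub>1 * x * Z / (1 - \<zeta>) \<le> 32 * s\<^sub>1 * x * ((1 + 2 / s) * (1 + H) * exp (2 * \<Phi>)) / (1 - \<zeta>)"
      using z by (intro divide_right_mono) auto
    also have "\<dots> = c\<^sub>0" unfolding c\<^sub>0_def x_def exp_add by (simp only: mult_ac)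
    finally show ?thesis by (simp add: mult_ac)
  qed
  have c00: "0 \<le> 32 * s\<^sub>1 * Z * x / (1 - \<zeta>)" using s Z x0 z by simp
  have "(32 * s\<^sub>1 * Z * x / (1 - \<zeta>)) * (1 / (1 - \<zeta>)) \<le> c\<^sub>0 * (2 * (1 + cosh (7 * D / 2)))"
    using c0 ch c00 z by (intro mult_mono) auto
  also have "\<dots> = 2 * (c\<^sub>0 * (1 + cosh (7 * D / 2)))" by (simp only: mult.left_commute)
  also have "\<dots> \<le> 2 * C" using C by simp
  finally have "32 * s\<^sub>1 * Z * x / (1 - \<zeta>) / (1 - \<zeta>) \<le> 2 * C" by simp
  then have "32 * s\<^sub>1 * Z * x / (1 - \<zeta>) \<le> 2 * C * (1 - \<zeta>)" using z by (subst (asm) pos_divide_le_eq) auto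
  moreover have "32 * s\<^sub>1 * Z * x / (1 - \<zeta>) = 2 * (16 * s\<^sub>1 * Z * x / (1 - \<zeta>))" by simp
  ultimately have main: "16 * s\<^sub>1 * Z * x / (1 - \<zeta>) \<le> C * (1 - \<zeta>)" by linarith
  have C0: "0 \<le> C"
  proof -
    have "0 \<le> 16 * s\<^sub>1 * Z * x / (1 - \<zeta>)" using s Z x0 z by simp
    then have "0 \<le> C * (1 - \<zeta>)" using main by linarith
    then show ?thesis using z by (simp add: zero_le_mult_iff)
  qed
  have "exp U * (m * U + m * V) = x * m" by (simp add: x_def algebra_simps)
  also have "\<dots> \<le> x * (2 / (1 - \<zeta>))"
    unfolding m_def t_def[symmetric] using t z x0 by (intro mult_left_mono frac_le) auto
  also have "x * (2 / (1 - \<zeta>)) = (16 * s\<^sub>1 * Z * x / (1 - \<zeta>)) / (8 * s\<^sub>1 * Z)"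
  proof -
    have "x * (2 / k) = (16 * s\<^sub>1 * Z * x / k) / (8 * s\<^sub>1 * Z)" for k
      using s Z(1) by (cases "k = 0") (auto simp: field_simps)
    then show ?thesis .
  qed
  also have "\<dots> \<le> C * (1 - \<zeta>) / (8 * s\<^sub>1 * Z)" using main s Z by (intro divide_right_mono) auto
  also have "\<dots> = (18 / 8 * C * (Z / s\<^sub>1)) * ((1 - \<zeta>) / (18 * Z\<^sup>2))"
    using s Z(1) by (simp add: power2_eq_square)
  also have "\<dots> \<le> (3 * C / s\<^sub>1\<^sup>2) * ((2 / s\<^sub>1 - Y) / (2 / s\<^sub>1 + Y) / (1 + Y)\<^sup>2)"
  proof (intro mult_mono k)
    have "Z / s\<^sub>1 \<le> 1 / s\<^sub>1 / s\<^sub>1" using Z1 s by (intro divide_right_mono) auto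
    then have "18 / 8 * C * (Z / s\<^sub>1) \<le> 3 * C * (1 / s\<^sub>1 / s\<^sub>1)"
      using C0 Z s by (intro mult_mono) auto
    then show "18 / 8 * C * (Z / s\<^sub>1) \<le> 3 * C / s\<^sub>1\<^sup>2" by (simp add: power2_eq_square)
  qed (use C0 s z Z in auto)
  finally show ?thesis .
qed

section \<open>Measure-preserving dynamics\<close>

lemma funpow_AE:
  assumes f: "f \<in> measurable M M" "distr M M f = M" and Q: "AE x in M. Q x"
  shows "AE x in M. Q ((f ^^ n) x)"
proof (induction n)
  case (Suc n)
  have "AE x in distr M M f. Q ((f ^^ n) x)" unfolding f(2) by (rule Suc)
  then have "AE x in M. Q ((f ^^ n) (f x))" by (rule AE_distrD[OF f(1)])
  then show ?case by (simp add: funpow_swap1)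
qed (use Q in simp)

lemma ergodic_inverse:
  assumes "ergodic_ip P \<theta>"
  shows "thinv P \<theta> \<in> measurable P P" "distr P P (thinv P \<theta>) = P"
    and "\<omega> \<in> space P \<Longrightarrow> \<theta> (thinv P \<theta> \<omega>) = \<omega>" "\<omega> \<in> space P \<Longrightarrow> thinv P \<theta> (\<theta> \<omega>) = \<omega>"
proof -
  have b: "bij_betw \<theta> (space P) (space P)" and m: "\<theta> \<in> measurable P P" and d: "distr P P \<theta> = P"
    using assms by (auto simp: ergodic_ip_def)
  show mi: "thinv P \<theta> \<in> measurable P P" using assms by (simp add: ergodic_ip_def thinv_def)
  show "\<omega> \<in> space P \<Longrightarrow> \<theta> (thinv P \<theta> \<omega>) = \<omega>"
    unfolding thinv_def using b by (intro f_the_inv_into_f) (auto simp: bij_betw_def)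
  show inv: "\<omega> \<in> space P \<Longrightarrow> thinv P \<theta> (\<theta> \<omega>) = \<omega>" for \<omega>
    unfolding thinv_def using b by (intro the_inv_into_f_f) (auto simp: bij_betw_def)
  have "distr P P (thinv P \<theta>) = distr (distr P P \<theta>) P (thinv P \<theta>)" by (simp add: d)
  also have "\<dots> = distr P P (thinv P \<theta> \<circ> \<theta>)" by (rule distr_distr[OF mi m])
  also have "\<dots> = distr P P (\<lambda>x. x)" by (rule distr_cong) (auto simp: inv)
  also have "\<dots> = P" by (rule distr_id)
  finally show "distr P P (thinv P \<theta>) = P" .
qed

text \<open>Points whose whole two-sided orbit satisfies \<open>Q\<close>. It is invariant by
  construction and, as \<open>Q\<close> holds almost surely, contains almost every point; no
  measurability of \<open>Q\<close> or of the set is asked.\<close>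

definition orbit_set :: "'w measure \<Rightarrow> ('w \<Rightarrow> 'w) \<Rightarrow> ('w \<Rightarrow> bool) \<Rightarrow> 'w set" where
  "orbit_set P \<theta> Q = {\<omega> \<in> space P. \<forall>n. Q ((\<theta> ^^ n) \<omega>) \<and> Q ((thinv P \<theta> ^^ n) \<omega>)}"

lemma orbit_setD: "\<omega> \<in> orbit_set P \<theta> Q \<Longrightarrow> Q \<omega>" "\<omega> \<in> orbit_set P \<theta> Q \<Longrightarrow> \<omega> \<in> space P"
  by (auto simp: orbit_set_def dest: spec[of _ 0])

lemma orbit_set_AE:
  assumes "ergodic_ip P \<theta>" "AE \<omega> in P. Q \<omega>"
  shows "AE \<omega> in P. \<omega> \<in> orbit_set P \<theta> Q"
proof -
  have m: "\<theta> \<in> measurable P P" "distr P P \<theta> = P" using assms by (auto simp: ergodic_ip_def)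
  have "AE \<omega> in P. \<forall>n. Q ((\<theta> ^^ n) \<omega>)" "AE \<omega> in P. \<forall>n. Q ((thinv P \<theta> ^^ n) \<omega>)"
    unfolding AE_all_countable
    using funpow_AE[OF m assms(2)] funpow_AE[OF ergodic_inverse(1,2)[OF assms(1)] assms(2)] by auto
  then show ?thesis using AE_space by eventually_elim (auto simp: orbit_set_def)
qed

lemma orbit_set_invariant:
  assumes e: "ergodic_ip P \<theta>" and w: "\<omega> \<in> orbit_set P \<theta> Q"
  shows "\<theta> \<omega> \<in> orbit_set P \<theta> Q" "thinv P \<theta> \<omega> \<in> orbit_set P \<theta> Q"
proof -
  have m: "\<theta> \<in> measurable P P" using e by (simp add: ergodic_ip_def)
  note inv = ergodic_inverse[OF e]
  have s: "\<omega> \<in> space P" and Q: "\<And>n. Q ((\<theta> ^^ n) \<omega>)" "\<And>n. Q ((thinv P \<theta> ^^ n) \<omega>)"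
    using w by (auto simp: orbit_set_def)
  have "Q ((\<theta> ^^ n) (\<theta> \<omega>))" "Q ((thinv P \<theta> ^^ n) (thinv P \<theta> \<omega>))" for n
    using Q(1)[of "Suc n"] Q(2)[of "Suc n"] by (simp_all add: funpow_swap1)
  moreover have "Q ((thinv P \<theta> ^^ n) (\<theta> \<omega>))" for n
    using Q(1)[of 1] Q(2) inv(4)[OF s] by (cases n) (auto simp: funpow_swap1)
  moreover have "Q ((\<theta> ^^ n) (thinv P \<theta> \<omega>))" for n
    using Q(2)[of 1] Q(1) inv(3)[OF s] by (cases n) (auto simp: funpow_swap1)
  moreover have "\<theta> \<omega> \<in> space P" "thinv P \<theta> \<omega> \<in> space P"
    using measurable_space[OF m s] measurable_space[OF inv(1) s] by auto
  ultimately show "\<theta> \<omega> \<in> orbit_set P \<theta> Q" "thinv P \<theta> \<omega> \<in> orbit_set P \<theta> Q"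
    by (auto simp: orbit_set_def)
qed

text \<open>The points of \<open>A\<close> that never return form a set whose iterated preimages are
  disjoint and of equal measure, hence a null set. A last visit to \<open>A\<close> would be a point
  of that set.\<close>

lemma poincare_recurrence:
  assumes P: "prob_space P" and f: "f \<in> measurable P P" "distr P P f = P" and A: "A \<in> sets P"
  shows "AE x in P. x \<in> A \<longrightarrow> (\<forall>N. \<exists>n>N. (f ^^ n) x \<in> A)"
proof -
  interpret prob_space P by fact
  have fn: "f ^^ n \<in> measurable P P" for n by (rule measurable_compose_n[OF f(1)])
  define B where "B = {x \<in> space P. x \<in> A \<and> (\<forall>n. (f ^^ Suc n) x \<notin> A)}"
  have B: "B \<in> sets P"
    unfolding B_def using A fn by measurable
  let ?B = "\<lambda>n. (f ^^ n) -` B \<inter> space P"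
  have Bn: "?B n \<in> sets P" for n by (rule measurable_sets[OF fn B])
  have eq: "prob (?B n) = prob B" for n
  proof (induction n)
    case (Suc n)
    have "?B (Suc n) = f -` ?B n \<inter> space P"
      using measurable_space[OF f(1)] by (auto simp: funpow_swap1)
    then have "prob (?B (Suc n)) = measure (distr P P f) (?B n)"
      using Bn f(1) by (simp add: measure_distr)
    then show ?case using Suc f(2) by (simp add: o_def)
  qed (use sets.sets_into_space[OF B] in \<open>simp add: Int_absorb2\<close>)
  have disj: "disjoint_family ?B"
  proof -
    have "?B m \<inter> ?B n = {}" if "m < n" for m n
    proof -
      have False if x: "x \<in> ?B m" "x \<in> ?B n" for x
      proof -
        obtain k where k: "n = m + Suc k" using \<open>m < n\<close> by (auto simp: less_iff_Suc_add)
        have "(f ^^ Suc k) ((f ^^ m) x) = (f ^^ n) x"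
          unfolding k by (subst add.commute, subst funpow_add) simp
        moreover have "(f ^^ Suc k) ((f ^^ m) x) \<notin> A" "(f ^^ n) x \<in> A"
          using x unfolding B_def by blast+
        ultimately show False by metis
      qed
      then show ?thesis by blast
    qed
    then show ?thesis unfolding disjoint_family_on_def by (metis Int_commute linorder_neqE_nat)
  qed
  have "real N * prob B \<le> 1" for N
  proof -
    have "real N * prob B = (\<Sum>n<N. prob (?B n))" by (simp only: eq) simp
    also have "\<dots> = prob (\<Union>n<N. ?B n)"
      using Bn disj by (intro finite_measure_finite_Union[symmetric]) (auto simp: disjoint_family_on_def)
    also have "\<dots> \<le> 1" by (rule prob_le_1)
    finally show ?thesis .
  qed
  then have "prob B = 0"
    by (metis linorder_not_less measure_nonneg mult.commute order_le_less reals_Archimedean3)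
  then have "AE x in P. x \<notin> B" using B by (intro AE_not_in) (auto simp: null_sets_def emeasure_eq_measure)
  then have "AE x in P. \<forall>n. (f ^^ n) x \<notin> B"
    unfolding AE_all_countable by (intro allI funpow_AE[OF f])
  then show ?thesis using AE_space
  proof eventually_elim
    case (elim x)
    show ?case
    proof (rule impI, rule ccontr)
      assume xA: "x \<in> A" and "\<not> (\<forall>N. \<exists>n>N. (f ^^ n) x \<in> A)"
      then obtain N where N: "\<And>n. (f ^^ n) x \<in> A \<Longrightarrow> n \<le> N" by (meson linorder_not_less)
      \<comment> \<open>The time of the last visit, which exists if visits stop after time
        \<open>N\<close>.\<close>
      define m where "m = (GREATEST n. (f ^^ n) x \<in> A)"
      have mA: "(f ^^ m) x \<in> A"
        unfolding m_def by (rule GreatestI_nat[where k = 0 and b = N]) (use xA N in auto)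
      have mx: "n \<le> m" if "(f ^^ n) x \<in> A" for n
        unfolding m_def by (rule Greatest_le_nat[where b = N]) (use that N in auto)
      have "(f ^^ m) x \<in> B"
        unfolding B_def
      proof (intro CollectI conjI allI)
        show "(f ^^ m) x \<in> space P" using measurable_space[OF fn] elim(2) by auto
        fix n
        have "(f ^^ Suc n) ((f ^^ m) x) = (f ^^ (Suc n + m)) x" by (simp add: funpow_add)
        then show "(f ^^ Suc n) ((f ^^ m) x) \<notin> A" using mx[of "Suc n + m"] by auto
      qed (rule mA)
      then show False using elim(1) by blast
    qed
  qed
qed

section \<open>Almost sure decay of products and growth of functions along orbits\<close>

text \<open>The partial products decrease. Were the limit l positive, infinitely many steps would
  lower them by at least l d, although consecutive differences tend to 0.\<close>

lemma prod_tendsto_zero: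
  fixes k :: "nat \<Rightarrow> real"
  assumes k: "\<And>n. 0 \<le> k n" "\<And>n. k n \<le> 1" and d: "0 < d" and io: "\<And>N. \<exists>n>N. d \<le> k n"
  shows "(\<lambda>n. \<Prod>j<n. 1 - k j) \<longlonglongrightarrow> 0"
proof -
  let ?p = "\<lambda>n. \<Prod>j<n. 1 - k j"
  have p0: "0 \<le> ?p n" for n using k by (intro prod_nonneg) auto
  have dec: "?p (Suc n) \<le> ?p n" for n using p0[of n] k[of n] by (simp add: mult_left_le)
  obtain l where l: "?p \<longlonglongrightarrow> l" "\<And>n. l \<le> ?p n"
    using decseq_convergent[of ?p 0] p0 dec by (auto simp: decseq_Suc_iff)
  have "l \<le> 0"
  proof (rule ccontr)
    assume "\<not> l \<le> 0"
    then have ld: "0 < l * d" using d by simp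
    have "(\<lambda>n. ?p n - ?p (Suc n)) \<longlonglongrightarrow> l - l" by (intro tendsto_diff l LIMSEQ_Suc)
    then have "\<forall>\<^sub>F n in sequentially. ?p n - ?p (Suc n) < l * d" using ld by (intro order_tendstoD) auto
    then obtain N where N: "\<And>n. n \<ge> N \<Longrightarrow> ?p n - ?p (Suc n) < l * d" by (auto simp: eventually_sequentially)
    obtain n where n: "n > N" "d \<le> k n" using io by blast
    have "l * d \<le> ?p n * k n" using l(2)[of n] n(2) d p0[of n] by (intro mult_mono) auto
    also have "\<dots> = ?p n - ?p (Suc n)" by (simp add: algebra_simps)
    finally show False using N[of n] n by simp
  qed
  moreover have "0 \<le> l" by (rule LIMSEQ_le_const[OF l(1)]) (use p0 in auto)
  ultimately show ?thesis using l(1) by simp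
qed

text \<open>Almost every point lies in some level set where \<open>k\<close> is at least 1 / (m +
  1), and by recurrence it revisits that level set infinitely often. The level depends on the point,
  so no uniform lower bound on \<open>k\<close> is involved.\<close>

lemma recurrent_product_tendsto_zero:
  assumes P: "prob_space P" and f: "f \<in> measurable P P" "distr P P f = P"
    and k: "k \<in> borel_measurable P" and pos: "AE x in P. 0 < k x \<and> k x \<le> (1::real)"
  shows "AE x in P. (\<lambda>n. \<Prod>j<n. 1 - k ((f ^^ Suc j) x)) \<longlonglongrightarrow> 0"
proof -
  have "AE x in P. \<forall>m::nat. x \<in> {x \<in> space P. 1 / real (Suc m) \<le> k x} \<longrightarrow>
      (\<forall>N. \<exists>n>N. (f ^^ n) x \<in> {x \<in> space P. 1 / real (Suc m) \<le> k x})"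
    unfolding AE_all_countable using k by (intro allI poincare_recurrence P f) measurable
  moreover have "AE x in P. \<forall>n. 0 < k ((f ^^ n) x) \<and> k ((f ^^ n) x) \<le> 1"
    unfolding AE_all_countable using funpow_AE[OF f pos] by auto
  ultimately show ?thesis using AE_space
  proof eventually_elim
    case (elim x)
    have "0 < k x" using elim(2)[rule_format, of 0] by simp
    then obtain m where m: "1 / real (Suc m) < k x"
      using reals_Archimedean[of "k x"] by (auto simp: inverse_eq_divide)
    then have io: "\<exists>n>N. 1 / real (Suc m) \<le> k ((f ^^ n) x)" for N
      using elim(1)[rule_format, of m N] elim(3) by auto
    show ?case
    proof (rule prod_tendsto_zero[of _ "1 / real (Suc m)"])
      fix N
      obtain n where "n > Suc N" "1 / real (Suc m) \<le> k ((f ^^ n) x)" using io by blast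
      then show "\<exists>n>N. 1 / real (Suc m) \<le> k ((f ^^ Suc n) x)" by (intro exI[of _ "n - 1"]) (cases n; auto)
    qed (use elim(2) in \<open>auto simp: less_imp_le simp del: funpow.simps\<close>)
  qed
qed

text \<open>The weights (j + 1)^(-4/3) are summable and the p-th moment is the same at every time,
  so the weighted sum has finite expectation and is almost surely finite; each single term is below
  the sum.\<close>

lemma Lp_orbit_growth:
  assumes f: "f \<in> measurable P P" "distr P P f = P" and K: "in_Lp P p K"
  shows "AE x in P. \<exists>C\<ge>0. \<forall>j. \<bar>K ((f ^^ j) x)\<bar> powr p \<le> C * real (Suc j) powr (4 / 3)"
proof -
  have Km: "K \<in> borel_measurable P" and Ki: "integrable P (\<lambda>x. \<bar>K x\<bar> powr p)"
    using K by (auto simp: in_Lp_def)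
  have fn: "f ^^ n \<in> measurable P P" for n by (rule measurable_compose_n[OF f(1)])
  have dn: "distr P P (f ^^ n) = P" for n
  proof (induction n)
    case 0
    have "f ^^ 0 = (\<lambda>x. x)" by auto
    then show ?case using distr_id[of P] by metis
  next
    case (Suc n)
    have "distr P P (f ^^ Suc n) = distr (distr P P (f ^^ n)) P f"
      using distr_distr[OF f(1) fn[of n]] by simp
    then show ?case using Suc f(2) by (simp add: o_def)
  qed
  define I where "I = (\<integral>\<^sup>+x. ennreal (\<bar>K x\<bar> powr p) \<partial>P)"
  have I: "I < \<infinity>" unfolding I_def using Ki by (simp add: integrable_iff_bounded)
  define c where "c = (\<lambda>j. real (Suc j) powr (- (4 / 3)))"
  have c: "summable c" "\<And>j. 0 < c j"
    using summable_real_powr_iff[of "- (4 / 3)"] summable_Suc_iff[of "\<lambda>j. real j powr (- (4 / 3))"] by (auto simp: c_def)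
  define F where "F = (\<lambda>x. \<Sum>j. ennreal (c j) * ennreal (\<bar>K ((f ^^ j) x)\<bar> powr p))"
  have Kj: "(\<lambda>x. ennreal (\<bar>K ((f ^^ j) x)\<bar> powr p)) \<in> borel_measurable P" for j
    using measurable_compose[OF fn Km] by measurable
  have Ij: "(\<integral>\<^sup>+x. ennreal (\<bar>K ((f ^^ j) x)\<bar> powr p) \<partial>P) = I" for j
  proof -
    have "I = (\<integral>\<^sup>+x. ennreal (\<bar>K x\<bar> powr p) \<partial>distr P P (f ^^ j))" by (simp add: I_def dn)
    also have "\<dots> = (\<integral>\<^sup>+x. ennreal (\<bar>K ((f ^^ j) x)\<bar> powr p) \<partial>P)"
      using Km by (intro nn_integral_distr fn) (simp add: dn)
    finally show ?thesis by simp
  qed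
  have "(\<integral>\<^sup>+x. F x \<partial>P) = (\<Sum>j. \<integral>\<^sup>+x. ennreal (c j) * ennreal (\<bar>K ((f ^^ j) x)\<bar> powr p) \<partial>P)"
    unfolding F_def using Kj by (intro nn_integral_suminf) auto
  also have "\<dots> = (\<Sum>j. ennreal (c j) * I)"
    using Kj by (intro suminf_cong) (simp add: nn_integral_cmult Ij)
  also have "\<dots> = ennreal (suminf c) * I"
    using c by (simp add: ennreal_suminf_multc suminf_ennreal2 less_imp_le)
  also have "\<dots> < \<infinity>" using I by (simp add: ennreal_mult_less_top)
  finally have "AE x in P. F x \<noteq> \<infinity>"
    using Kj unfolding F_def by (intro nn_integral_PInf_AE borel_measurable_suminf) auto
  then show ?thesis
  proof eventually_elim
    case (elim x)
    define C where "C = enn2real (F x)"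
    show ?case
    proof (intro exI[of _ C] conjI allI)
      fix j
      have "(\<Sum>i\<in>{j}. ennreal (c i) * ennreal (\<bar>K ((f ^^ i) x)\<bar> powr p)) \<le> F x"
        unfolding F_def by (rule sum_le_suminf) auto
      then have "ennreal (c j * \<bar>K ((f ^^ j) x)\<bar> powr p) \<le> F x"
        using c(2)[of j] by (simp add: ennreal_mult' less_imp_le)
      also have "F x = ennreal C" using elim by (simp add: C_def less_top)
      finally have "c j * \<bar>K ((f ^^ j) x)\<bar> powr p \<le> C" by (simp add: C_def)
      then show "\<bar>K ((f ^^ j) x)\<bar> powr p \<le> C * real (Suc j) powr (4 / 3)"
        by (simp add: c_def powr_minus field_simps)
    qed (simp add: C_def)
  qed
qed

section \<open>Assembling the moderate deviations principle\<close>

lemma supabs_ge: "holder \<alpha> S g \<Longrightarrow> x \<in> S \<Longrightarrow> \<bar>g x\<bar> \<le> supabs S g"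
  unfolding supabs_def by (rule cSup_upper) (auto simp: holder_def bdd_above_def)

lemma hv_set_bdd:
  assumes "holder \<alpha> S g"
  shows "bdd_above ({0} \<union> {\<bar>g x - g x'\<bar> / dist x x' powr \<alpha> | x x'. x \<in> S \<and> x' \<in> S \<and> x \<noteq> x'})"
proof -
  obtain B C where C: "0 \<le> C" "\<And>x x'. x \<in> S \<Longrightarrow> x' \<in> S \<Longrightarrow> \<bar>g x - g x'\<bar> \<le> C * dist x x' powr \<alpha>"
    using assms by (rule holderE) (use that in blast)
  have "\<bar>g x - g x'\<bar> / dist x x' powr \<alpha> \<le> C" if "x \<in> S" "x' \<in> S" "x \<noteq> x'" for x x'
    using C(2)[OF that(1,2)] that(3) by (simp add: divide_le_eq)
  then show ?thesis using C(1) by (intro bdd_aboveI[of _ C]) auto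
qed

lemma hv_nonneg: "holder \<alpha> S g \<Longrightarrow> 0 \<le> hv \<alpha> S g"
  unfolding hv_def by (rule cSup_upper) (use hv_set_bdd in auto)

lemma hv_ge:
  assumes "holder \<alpha> S g" "x \<in> S" "x' \<in> S"
  shows "\<bar>g x - g x'\<bar> \<le> hv \<alpha> S g * dist x x' powr \<alpha>"
proof (cases "x = x'")
  case False
  have "\<bar>g x - g x'\<bar> / dist x x' powr \<alpha> \<le> hv \<alpha> S g"
    unfolding hv_def by (rule cSup_upper[OF _ hv_set_bdd[OF assms(1)]]) (use False assms in blast)
  then show ?thesis using False by (simp add: divide_le_eq)
qed simp

lemma hv_cent: "hv \<alpha> S (cent \<mu> u \<omega>) = hv \<alpha> S (u \<omega>)"
  by (simp add: hv_def cent_def)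

lemma holder_cent: "holder \<alpha> S (u \<omega>) \<Longrightarrow> holder \<alpha> S (cent \<mu> u \<omega>)"
  unfolding cent_def by (intro holder_diff holder_const)

context cone_cocycle
begin

text \<open>The interface to the two settings: once cones are supplied, only the growth inequality
  along the orbit has to be checked. It also identifies the measure \<open>gmu\<close> with
  \<open>h\<close> times \<nu>, through \<open>\<theta>i = thinv P \<theta>\<close>.\<close>

lemma mdp_from_growth:
  fixes P :: "'w measure" and u :: "'w \<Rightarrow> 'x \<Rightarrow> real" and a :: "nat \<Rightarrow> real" and p \<sigma> :: real
  defines "\<mu> \<equiv> gmu P \<theta> E T \<phi> \<nu>"
  defines "U \<equiv> \<lambda>\<omega>. supabs (X \<omega>) (cent \<mu> u \<omega>)" and "V \<equiv> \<lambda>\<omega>. hv \<alpha> (X \<omega>) (u \<omega>)"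
  assumes inv: "\<theta>i = thinv P \<theta>" and u: "\<And>\<omega>. \<omega> \<in> W \<Longrightarrow> holder \<alpha> (X \<omega>) (u \<omega>)" and w: "\<omega> \<in> W"
    and p: "0 < p" and G: "0 \<le> G"
    and growth: "\<And>j. exp (U ((\<theta> ^^ j) \<omega>)) * (m\<^sub>1 ((\<theta> ^^ j) \<omega>) * U ((\<theta> ^^ j) \<omega>) + m\<^sub>2 ((\<theta> ^^ j) \<omega>) * V ((\<theta> ^^ j) \<omega>))
      \<le> G * real (Suc j) powr (8 / (3 * p)) * (\<kappa>\<^sub>0 ((\<theta> ^^ j) \<omega>) / (b ((\<theta> ^^ j) \<omega>))\<^sup>2)"
    and var: "(\<lambda>n. mvar (\<mu> \<omega>) (bsum \<theta> T u n \<omega>) / real n) \<longlonglongrightarrow> \<sigma>\<^sup>2" and sigma: "0 < \<sigma>"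
    and a: "\<And>n. 0 < a n" "(\<lambda>n. a n / real n powr (1 - 8 / p)) \<longlonglongrightarrow> 0"
      "filterlim (\<lambda>n. (a n)\<^sup>2 / real n) at_top sequentially"
    and \<Gamma>: "\<Gamma> \<in> sets borel"
  shows "- (INF x\<in>interior \<Gamma>. ereal (x\<^sup>2 / (2 * \<sigma>\<^sup>2))) \<le> liminf (mdq \<theta> E T \<mu> u a \<omega> \<Gamma>)"
    and "limsup (mdq \<theta> E T \<mu> u a \<omega> \<Gamma>) \<le> - (INF x\<in>closure \<Gamma>. ereal (x\<^sup>2 / (2 * \<sigma>\<^sup>2)))"
proof -
  have mu: "\<mu> \<omega> = density (\<nu> \<omega>) (\<lambda>x. ennreal (h \<omega> x))" for \<omega>
    unfolding \<mu>_def gmu_def hden_def h_def inv[symmetric] ..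
  have cent0: "(\<integral>x. cent \<mu> u \<omega> x * h \<omega> x \<partial>\<nu> \<omega>) = 0" if w: "\<omega> \<in> W" for \<omega>
  proof -
    have "AE x in \<nu> \<omega>. 0 \<le> h \<omega> x"
      using h_pos[OF w] nu_space[OF w] by (intro AE_I2) (auto simp: less_imp_le)
    then have "integral\<^sup>L (\<mu> \<omega>) (u \<omega>) = (\<integral>x. u \<omega> x * h \<omega> x \<partial>\<nu> \<omega>)"
      unfolding mu using holder_meas[OF w u[OF w]] holder_meas[OF w h_holder[OF w]]
      by (subst integral_density) (auto simp: mult.commute)
    then show ?thesis
      using holder_integrable[OF w holder_mult[OF u[OF w] h_holder[OF w]]]
        holder_integrable[OF w h_holder[OF w]] h_nu[OF w]
      by (simp add: cent_def left_diff_distrib)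
  qed
  interpret O: observed_orbit W \<theta> \<theta>i E T \<phi> \<alpha> I y Dd \<nu> C \<kappa>\<^sub>0 b m\<^sub>1 m\<^sub>2 \<omega>
    "\<lambda>j. cent \<mu> u ((\<theta> ^^ j) \<omega>)" "\<lambda>j. U ((\<theta> ^^ j) \<omega>)" "\<lambda>j. V ((\<theta> ^^ j) \<omega>)"
  proof
    fix j
    have wj: "(\<theta> ^^ j) \<omega> \<in> W" by (rule funpow_th_in[OF w])
    have hc: "holder \<alpha> (X ((\<theta> ^^ j) \<omega>)) (cent \<mu> u ((\<theta> ^^ j) \<omega>))"
      by (rule holder_cent) (rule u[OF wj])
    show "(\<integral>x. cent \<mu> u ((\<theta> ^^ j) \<omega>) x * h ((\<theta> ^^ j) \<omega>) x \<partial>\<nu> ((\<theta> ^^ j) \<omega>)) = 0" by (rule cent0[OF wj])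
    obtain x where x: "x \<in> X ((\<theta> ^^ j) \<omega>)" using fib_ne[OF wj] by blast
    show "wlip ((\<theta> ^^ j) \<omega>) (cent \<mu> u ((\<theta> ^^ j) \<omega>)) (U ((\<theta> ^^ j) \<omega>)) (V ((\<theta> ^^ j) \<omega>))"
      unfolding wlip_def U_def V_def
      using supabs_ge[OF hc] hv_ge[OF hc] hv_nonneg[OF u[OF wj]] order_trans[OF abs_ge_zero supabs_ge[OF hc x]]
      by (auto simp: hv_cent)
  qed (rule w)
  have mu_eq: "\<mu> \<omega> = O.\<mu>" unfolding mu O.\<mu>_def ..
  have S_eq: "O.S n x = bsum \<theta> T (cent \<mu> u) n \<omega> x" for n x by (simp add: O.S_def bsum_def)
  have "bsum \<theta> T u n \<omega> = (\<lambda>x. O.S n x + (\<Sum>j<n. integral\<^sup>L (\<mu> ((\<theta> ^^ j) \<omega>)) (u ((\<theta> ^^ j) \<omega>))))" for n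
    by (intro ext) (simp add: O.S_def bsum_def cent_def sum_subtractf)
  then have var': "(\<lambda>n. O.Vsum n / real n) \<longlonglongrightarrow> \<sigma>\<^sup>2" using var by (simp add: mu_eq O.S_var)
  have gr: "exp (U ((\<theta> ^^ j) \<omega>)) * gain ((\<theta> ^^ j) \<omega>) (U ((\<theta> ^^ j) \<omega>)) (V ((\<theta> ^^ j) \<omega>))
      \<le> G * real (Suc j) powr (8 / (3 * p)) * \<kappa> ((\<theta> ^^ j) \<omega>)" for j
    using growth[of j] unfolding gain_def \<kappa>_def .
  note M = O.moderate_deviations[OF p G gr var' sigma a \<Gamma>]
  have eq: "mdq \<theta> E T \<mu> u a \<omega> \<Gamma> = (\<lambda>n. ereal (real n / (a n)\<^sup>2) * eln (measure O.\<mu> {x \<in> X \<omega>. O.S n x / a n \<in> \<Gamma>}))"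
    by (intro ext) (simp add: mdq_def mu_eq S_eq)
  show "- (INF x\<in>interior \<Gamma>. ereal (x\<^sup>2 / (2 * \<sigma>\<^sup>2))) \<le> liminf (mdq \<theta> E T \<mu> u a \<omega> \<Gamma>)"
    unfolding eq by (rule M(1))
  show "limsup (mdq \<theta> E T \<mu> u a \<omega> \<Gamma>) \<le> - (INF x\<in>closure \<Gamma>. ereal (x\<^sup>2 / (2 * \<sigma>\<^sup>2)))"
    unfolding eq by (rule M(2))
qed

end

lemma T_section_measurable:
  assumes "(\<lambda>(\<omega>, x). T \<omega> x) \<in> restrict_space (P \<Otimes>\<^sub>M borel) E \<rightarrow>\<^sub>M borel" "\<omega> \<in> space P"
  shows "T \<omega> \<in> borel_measurable (restrict_space borel (fib E \<omega>))"
proof -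
  have "(\<lambda>x. (\<omega>, x)) \<in> measurable (restrict_space borel (fib E \<omega>)) (P \<Otimes>\<^sub>M borel)"
    using assms(2) by (intro measurable_restrict_space1) simp
  then have "(\<lambda>x. (\<omega>, x)) \<in> measurable (restrict_space borel (fib E \<omega>)) (restrict_space (P \<Otimes>\<^sub>M borel) E)"
    by (rule measurable_restrict_space2[rotated]) (auto simp: fib_def space_restrict_space)
  from measurable_compose[OF this assms(1)] show ?thesis by simp
qed

text \<open>The exponent is at least 1/2, so a_n / sqrt n tends to infinity; its square is the
  speed.\<close>

lemma squared_scale_at_top:
  fixes a :: "nat \<Rightarrow> real"
  assumes a: "\<And>n. 0 < a n" and lower: "filterlim (\<lambda>n. a n * real n powr (- max (6 / p) (1 / 2))) at_top sequentially"
  shows "filterlim (\<lambda>n. (a n)\<^sup>2 / real n) at_top sequentially"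
proof -
  have "filterlim (\<lambda>n. (a n * real n powr (- max (6 / p) (1 / 2))) * (a n * real n powr (- max (6 / p) (1 / 2)))) at_top sequentially"
    by (rule filterlim_at_top_mult_at_top[OF lower lower])
  then show ?thesis
  proof (rule filterlim_at_top_mono)
    show "\<forall>\<^sub>F n in sequentially. (a n * real n powr (- max (6 / p) (1 / 2))) * (a n * real n powr (- max (6 / p) (1 / 2))) \<le> (a n)\<^sup>2 / real n"
      using eventually_gt_at_top[of 0]
    proof eventually_elim
      case (elim n)
      have "real n powr (- max (6 / p) (1 / 2)) \<le> real n powr (- (1 / 2))"
        using elim by (intro powr_mono) auto
      then have "a n * real n powr (- max (6 / p) (1 / 2)) \<le> a n * real n powr (- (1 / 2))"
        using a[of n] by (intro mult_left_mono) auto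
      then have "(a n * real n powr (- max (6 / p) (1 / 2))) * (a n * real n powr (- max (6 / p) (1 / 2)))
        \<le> (a n * real n powr (- (1 / 2))) * (a n * real n powr (- (1 / 2)))"
        using a[of n] by (intro mult_mono) auto
      also have "\<dots> = (a n)\<^sup>2 * (real n powr (- (1 / 2)) * real n powr (- (1 / 2)))" by (simp add: power2_eq_square)
      also have "real n powr (- (1 / 2)) * real n powr (- (1 / 2)) = 1 / real n"
        using elim by (simp add: powr_add[symmetric] powr_minus_divide)
      finally show ?case by simp
    qed
  qed
qed

text \<open>\<open>EA\<close> is infinite when q = 1 or when the denominator of c_0 is not positive,
  so a finite bound excludes these cases and turns the weak inequalities of the setting into strict
  ones.\<close>

lemma EA_leD:
  fixes E :: "('w \<times> 'x::metric_space) set"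
  assumes "EA \<theta> E \<alpha> \<gamma> H \<mu> u \<omega> \<le> ereal C" "0 < \<gamma> (\<theta> \<omega>)"
  defines "G \<equiv> \<gamma> (\<theta> \<omega>) powr \<alpha>" and "q \<equiv> (H \<omega> + 1) / \<gamma> (\<theta> \<omega>) powr \<alpha>"
    and "Ht \<equiv> \<gamma> \<omega> powr (-\<alpha>) * hv \<alpha> (fib E \<omega>) (u \<omega>) + H \<omega>"
  shows "H \<omega> + 1 < G" "Ht < G - 1"
    "(3 * supabs (fib E \<omega>) (cent \<mu> u \<omega>) + Ht / (G - 1 - Ht)) * (1 + cosh (7 * (G + 2 * ln ((1 + q) / (1 - q))) / 2)) \<le> C"
proof -
  have q: "(H \<omega> + 1) * \<gamma> (\<theta> \<omega>) powr (-\<alpha>) = q" by (simp add: q_def powr_minus_divide)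
  have 1: "q < 1 \<and> Ht < G - 1"
    using assms(1) unfolding EA_def Let_def q HtA_def Ht_def[symmetric] G_def[symmetric] by (auto split: if_splits)
  then show "(3 * supabs (fib E \<omega>) (cent \<mu> u \<omega>) + Ht / (G - 1 - Ht)) * (1 + cosh (7 * (G + 2 * ln ((1 + q) / (1 - q))) / 2)) \<le> C"
    using assms(1) unfolding EA_def Let_def q HtA_def Ht_def[symmetric] G_def[symmetric] by simp
  show "Ht < G - 1" using 1 by simp
  have "0 < G" using assms(2) by (simp add: G_def)
  then show "H \<omega> + 1 < G" using 1 by (simp add: q_def G_def[symmetric] divide_less_eq)
qed

lemma EB_leD:
  fixes E :: "('w \<times> 'x::metric_space) set"
  assumes "EB \<theta> E \<phi> \<alpha> l sg q dd y \<mu> u \<omega> \<le> ereal C"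
  defines "z \<equiv> zetaB \<theta> E \<phi> \<alpha> l sg q dd y \<omega>" and "s \<equiv> sB E \<phi> \<alpha> l sg q dd \<omega>"
    and "s\<^sub>1 \<equiv> sB E \<phi> \<alpha> l sg q dd (\<theta> \<omega>)" and "U \<equiv> supabs (fib E \<omega>) (cent \<mu> u \<omega>)"
  shows "z < 1"
    "32 * s\<^sub>1 * (1 + 2 / s) * exp (U + 2 * supabs (fib E \<omega>) (\<phi> \<omega>)) * (U + hv \<alpha> (fib E \<omega>) (u \<omega>))
      * (1 + HB \<theta> E \<phi> \<alpha> dd y \<omega>) / (1 - z) * (1 + cosh (7 * (2 * ln ((1 + z) / (1 - z)) + 2 * ln (1 + z / s)) / 2)) \<le> C"
  using assms(1) unfolding EB_def Let_def hv_cent z_def[symmetric] s_def[symmetric] s\<^sub>1_def[symmetric] U_def[symmetric]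
  by (auto split: if_splits)

text \<open>The pointwise content of \<open>nu_limit\<close>, separated from the quantifier over
  \<omega> so that it can be required along whole orbits.\<close>

definition nu_limit_at :: "('w \<Rightarrow> 'w) \<Rightarrow> ('w \<times> 'x::metric_space) set
    \<Rightarrow> ('w \<Rightarrow> ('x \<Rightarrow> real) \<Rightarrow> 'x \<Rightarrow> real) \<Rightarrow> real \<Rightarrow> ('w \<Rightarrow> 'x measure) \<Rightarrow> 'w \<Rightarrow> bool" where
  "nu_limit_at \<theta> E L \<alpha> \<nu> \<omega> \<longleftrightarrow> prob_space (\<nu> \<omega>) \<and> space (\<nu> \<omega>) = fib E \<omega> \<and>
        sets (\<nu> \<omega>) = sets (restrict_space borel (fib E \<omega>)) \<and>
        (\<forall>g. holder \<alpha> (fib E \<omega>) g \<longrightarrow>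
           (\<forall>xs. (\<forall>n. xs n \<in> fib E ((\<theta> ^^ n) \<omega>)) \<longrightarrow>
              (\<lambda>n. Lpow \<theta> L n \<omega> g (xs n) / Lpow \<theta> L n \<omega> (\<lambda>_. 1) (xs n))
                \<longlonglongrightarrow> integral\<^sup>L (\<nu> \<omega>) g))"

section \<open>Verification of the two settings\<close>

lemma mdp_setting_A:
  fixes P :: "'w measure" and E :: "('w \<times> 'x::metric_space) set" and T :: "'w \<Rightarrow> 'x \<Rightarrow> 'x"
    and a :: "nat \<Rightarrow> real"
  assumes st: "standing P \<theta> Xs E T \<alpha> \<phi> u" and nu: "nu_limit P \<theta> E (Lop E T \<phi>) \<alpha> \<nu>"
    and A: "settingA P \<theta> E T \<alpha> \<phi> \<gamma> H Dd I y"
    and EA: "AE \<omega> in P. EA \<theta> E \<alpha> \<gamma> H (gmu P \<theta> E T \<phi> \<nu>) u \<omega> \<le> ereal c"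
    and p: "0 < p" and sigma: "0 < \<sigma>"
    and var: "AE \<omega> in P. (\<lambda>n. mvar (gmu P \<theta> E T \<phi> \<nu> \<omega>) (bsum \<theta> T u n \<omega>) / real n) \<longlonglongrightarrow> \<sigma>\<^sup>2"
    and a: "\<And>n. 0 < a n" "(\<lambda>n. a n / real n powr (1 - 8 / p)) \<longlonglongrightarrow> 0"
      "filterlim (\<lambda>n. (a n)\<^sup>2 / real n) at_top sequentially"
  shows "AE \<omega> in P. \<forall>\<Gamma>\<in>sets borel.
    - (INF x\<in>interior \<Gamma>. ereal (x\<^sup>2 / (2 * \<sigma>\<^sup>2))) \<le> liminf (mdq \<theta> E T (gmu P \<theta> E T \<phi> \<nu>) u a \<omega> \<Gamma>) \<and>
    limsup (mdq \<theta> E T (gmu P \<theta> E T \<phi> \<nu>) u a \<omega> \<Gamma>) \<le> - (INF x\<in>closure \<Gamma>. ereal (x\<^sup>2 / (2 * \<sigma>\<^sup>2)))"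
proof -
  have e: "ergodic_ip P \<theta>" and dXs: "\<And>x y. x \<in> Xs \<Longrightarrow> y \<in> Xs \<Longrightarrow> dist x y \<le> 1"
    and E: "E \<subseteq> space P \<times> Xs" and cf: "\<And>\<omega>. \<omega> \<in> space P \<Longrightarrow> compact (fib E \<omega>)"
    and Tin: "\<And>\<omega> x. \<omega> \<in> space P \<Longrightarrow> x \<in> fib E \<omega> \<Longrightarrow> T \<omega> x \<in> fib E (\<theta> \<omega>)"
    and Tm: "(\<lambda>(\<omega>, x). T \<omega> x) \<in> restrict_space (P \<Otimes>\<^sub>M borel) E \<rightarrow>\<^sub>M borel"
    and al: "0 < \<alpha>" "\<alpha> \<le> 1" and uh: "\<And>\<omega>. \<omega> \<in> space P \<Longrightarrow> holder \<alpha> (fib E \<omega>) (u \<omega>)"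
    using st unfolding standing_def by blast+
  have \<gamma>m: "\<gamma> \<in> borel_measurable P" and Hm: "H \<in> borel_measurable P"
    and \<gamma>1: "\<And>\<omega>. \<omega> \<in> space P \<Longrightarrow> 1 < \<gamma> \<omega>" and H0: "\<And>\<omega>. \<omega> \<in> space P \<Longrightarrow> 0 \<le> H \<omega>"
    using A unfolding settingA_def by blast+
  have th: "\<theta> \<in> measurable P P" and P: "prob_space P" using e by (auto simp: ergodic_ip_def)
  note inv = ergodic_inverse[OF e]
  define q where "q = (\<lambda>\<omega>. (H \<omega> + 1) / \<gamma> (\<theta> \<omega>) powr \<alpha>)"
  \<comment> \<open>The contraction rate of the cocycle as an explicit measurable function, to which
    recurrence of the inverse map applies.\<close>
  define k where "k = (\<lambda>\<omega>. (1 - q \<omega>) / (1 + q \<omega>) / (exp (\<gamma> (\<theta> \<omega>) powr \<alpha>))\<^sup>2)"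
  define Br where "Br = (\<lambda>\<omega>.
        (\<forall>x\<in>fib E (\<theta> \<omega>). bij_betw (\<lambda>i. y \<omega> i x) (I \<omega>) {z \<in> fib E \<omega>. T \<omega> z = x}) \<and>
        (\<forall>x\<in>fib E (\<theta> \<omega>). \<forall>x'\<in>fib E (\<theta> \<omega>). \<forall>i\<in>I \<omega>.
            dist (y \<omega> i x) (y \<omega> i x') \<le> dist x x' / \<gamma> \<omega> \<and>
            \<bar>\<phi> \<omega> (y \<omega> i x) - \<phi> \<omega> (y \<omega> i x')\<bar> \<le> H \<omega> * dist x x' powr \<alpha>) \<and>
        H \<omega> \<le> \<gamma> (\<theta> \<omega>) powr \<alpha> - 1 \<and>
        (\<forall>x\<in>fib E (\<theta> \<omega>). (\<lambda>z. exp (\<phi> \<omega> z)) summable_on {z \<in> fib E \<omega>. T \<omega> z = x} \<and>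
            infsum (\<lambda>z. exp (\<phi> \<omega> z)) {z \<in> fib E \<omega>. T \<omega> z = x} \<le> Dd \<omega>))"
  have Br: "AE \<omega> in P. Br \<omega>" using A unfolding settingA_def Br_def by blast
  have \<gamma>th: "1 < \<gamma> (\<theta> \<omega>)" if "\<omega> \<in> space P" for \<omega> by (rule \<gamma>1[OF measurable_space[OF th that]])
  have gap: "AE \<omega> in P. H \<omega> + 1 < \<gamma> (\<theta> \<omega>) powr \<alpha>"
    using EA AE_space by eventually_elim (use EA_leD(1) \<gamma>th in force)
  have qb: "0 \<le> q \<omega> \<and> q \<omega> < 1" if "\<omega> \<in> space P" "H \<omega> + 1 < \<gamma> (\<theta> \<omega>) powr \<alpha>" for \<omega>
    using that H0[OF that(1)] \<gamma>th[OF that(1)] by (auto simp: q_def divide_less_eq)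
  have k_pos: "AE \<omega> in P. 0 < k \<omega> \<and> k \<omega> \<le> 1"
    using gap AE_space
  proof eventually_elim
    case (elim \<omega>)
    have q: "0 \<le> q \<omega>" "q \<omega> < 1" using qb elim by auto
    have "1 \<le> (exp (\<gamma> (\<theta> \<omega>) powr \<alpha>))\<^sup>2" by (rule one_le_power) simp
    then have "k \<omega> \<le> 1 / 1" unfolding k_def using q by (intro frac_le) (auto simp: divide_le_eq)
    moreover have "0 < k \<omega>" unfolding k_def using q by (intro divide_pos_pos) auto
    ultimately show ?case by simp
  qed
  have k_meas: "k \<in> borel_measurable P"
  proof -
    have [measurable]: "\<gamma> \<in> borel_measurable P" "H \<in> borel_measurable P" "\<theta> \<in> measurable P P" by fact+
    show ?thesis unfolding k_def q_def by measurable
  qed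
  have rec: "AE \<omega> in P. (\<lambda>n. \<Prod>j<n. 1 - k ((thinv P \<theta> ^^ Suc j) \<omega>)) \<longlonglongrightarrow> 0"
    by (rule recurrent_product_tendsto_zero[OF P inv(1,2) k_meas k_pos])
  define Q where "Q = (\<lambda>\<omega>. nu_limit_at \<theta> E (Lop E T \<phi>) \<alpha> \<nu> \<omega> \<and> Br \<omega> \<and>
    EA \<theta> E \<alpha> \<gamma> H (gmu P \<theta> E T \<phi> \<nu>) u \<omega> \<le> ereal c \<and> (\<lambda>n. \<Prod>j<n. 1 - k ((thinv P \<theta> ^^ Suc j) \<omega>)) \<longlonglongrightarrow> 0)"
  have "AE \<omega> in P. Q \<omega>"
    using nu Br EA rec unfolding Q_def nu_limit_def nu_limit_at_def by (simp add: AE_conj_iff)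
  \<comment> \<open>All almost sure properties, including the vanishing of the backward products,
    hold at every point of \<open>W\<close>.\<close>
  define W where "W = orbit_set P \<theta> Q"
  have W: "AE \<omega> in P. \<omega> \<in> W" unfolding W_def by (rule orbit_set_AE[OF e]) fact
  have WP: "\<omega> \<in> space P" if "\<omega> \<in> W" for \<omega> using that unfolding W_def by (rule orbit_setD(2))
  have Wth: "\<theta> \<omega> \<in> W" "thinv P \<theta> \<omega> \<in> W" if "\<omega> \<in> W" for \<omega>
    using orbit_set_invariant[OF e that[unfolded W_def]] by (auto simp: W_def)
  have WQ: "nu_limit_at \<theta> E (Lop E T \<phi>) \<alpha> \<nu> \<omega>" "Br \<omega>" "EA \<theta> E \<alpha> \<gamma> H (gmu P \<theta> E T \<phi> \<nu>) u \<omega> \<le> ereal c"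
    "(\<lambda>n. \<Prod>j<n. 1 - k ((thinv P \<theta> ^^ Suc j) \<omega>)) \<longlonglongrightarrow> 0" if "\<omega> \<in> W" for \<omega>
    using orbit_setD(1)[OF that[unfolded W_def]] by (auto simp: Q_def)
  have Wgap: "H \<omega> + 1 < \<gamma> (\<theta> \<omega>) powr \<alpha>" if "\<omega> \<in> W" for \<omega>
    using EA_leD(1)[OF WQ(3)[OF that]] \<gamma>th[OF WP[OF that]] by simp
  have nuD: "prob_space (\<nu> \<omega>)" "space (\<nu> \<omega>) = fib E \<omega>" "sets (\<nu> \<omega>) = sets (restrict_space borel (fib E \<omega>))"
    if "\<omega> \<in> W" for \<omega> using WQ(1)[OF that] by (auto simp: nu_limit_at_def)
  have br: "bij_betw (\<lambda>i. y \<omega> i x) (I \<omega>) {z \<in> fib E \<omega>. T \<omega> z = x}"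
    if "\<omega> \<in> W" "x \<in> fib E (\<theta> \<omega>)" for \<omega> x using WQ(2)[OF that(1)] that(2) by (auto simp: Br_def)
  have yc: "dist (y \<omega> i x) (y \<omega> i x') \<le> dist x x' / \<gamma> \<omega>"
    and pv: "\<bar>\<phi> \<omega> (y \<omega> i x) - \<phi> \<omega> (y \<omega> i x')\<bar> \<le> H \<omega> * dist x x' powr \<alpha>"
    if "\<omega> \<in> W" "x \<in> fib E (\<theta> \<omega>)" "x' \<in> fib E (\<theta> \<omega>)" "i \<in> I \<omega>" for \<omega> x x' i
    using WQ(2)[OF that(1)] that(2-) by (auto simp: Br_def)
  interpret A: expanding_branches W \<theta> "thinv P \<theta>" E T \<phi> \<alpha> I y Dd \<gamma> H
  proof
    fix \<omega> assume w: "\<omega> \<in> W"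
    show "\<theta> (thinv P \<theta> \<omega>) = \<omega>" "thinv P \<theta> (\<theta> \<omega>) = \<omega>" using inv(3,4)[OF WP[OF w]] by auto
    show "\<theta> \<omega> \<in> W" "thinv P \<theta> \<omega> \<in> W" using Wth[OF w] by auto
    show "compact (fib E \<omega>)" by (rule cf[OF WP[OF w]])
    show "fib E \<omega> \<noteq> {}" using prob_space.not_empty[OF nuD(1)[OF w]] nuD(2)[OF w] by simp
    show "T \<omega> \<in> borel_measurable (restrict_space borel (fib E \<omega>))" by (rule T_section_measurable[OF Tm WP[OF w]])
    show "1 < \<gamma> \<omega>" "0 \<le> H \<omega>" using \<gamma>1 H0 WP[OF w] by auto
    show "H \<omega> + 1 < \<gamma> (\<theta> \<omega>) powr \<alpha>" by (rule Wgap[OF w])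
    show "T \<omega> x \<in> fib E (\<theta> \<omega>)" if "x \<in> fib E \<omega>" for x by (rule Tin[OF WP[OF w] that])
    show "dist x x' \<le> 1" if "x \<in> fib E \<omega>" "x' \<in> fib E \<omega>" for x x' using dXs E that by (auto simp: fib_def)
    fix i assume i: "i \<in> I \<omega>"
    show "continuous_on (fib E (\<theta> \<omega>)) (y \<omega> i)"
    proof (rule lipschitz_on_continuous_on)
      show "(1 / \<gamma> \<omega>)-lipschitz_on (fib E (\<theta> \<omega>)) (y \<omega> i)"
        using yc[OF w _ _ i] \<gamma>1[OF WP[OF w]] by (intro lipschitz_onI) auto
    qed
    show "continuous_on (fib E (\<theta> \<omega>)) (\<lambda>x. \<phi> \<omega> (y \<omega> i x))"
    proof (cases "fib E (\<theta> \<omega>) = {}")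
      case False
      then obtain x0 where x0: "x0 \<in> fib E (\<theta> \<omega>)" by blast
      have "holder \<alpha> (fib E (\<theta> \<omega>)) (\<lambda>x. \<phi> \<omega> (y \<omega> i x))"
      proof (rule holderI[of _ _ "\<bar>\<phi> \<omega> (y \<omega> i x0)\<bar> + H \<omega>" "H \<omega>"])
        fix x assume x: "x \<in> fib E (\<theta> \<omega>)"
        have "dist x x0 \<le> 1" using dXs E x x0 by (auto simp: fib_def)
        then have "H \<omega> * dist x x0 powr \<alpha> \<le> H \<omega> * 1"
          using H0[OF WP[OF w]] al by (intro mult_left_mono powr_dist_le_one) auto
        then show "\<bar>\<phi> \<omega> (y \<omega> i x)\<bar> \<le> \<bar>\<phi> \<omega> (y \<omega> i x0)\<bar> + H \<omega>" using pv[OF w x x0 i] by linarith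
      qed (rule pv[OF w _ _ i])
      then show ?thesis using al(1) by (rule holder_continuous_on)
    qed simp
  qed (use al br yc pv in \<open>auto simp: Br_def dest: WQ(2)\<close>)
  define C where "C = (\<lambda>\<omega>. log_cone \<alpha> (\<gamma> \<omega> powr \<alpha>) (fib E \<omega>))"
  have qA: "A.q \<omega> = q \<omega>" for \<omega> by (simp add: A.q_def q_def)
  have G0: "0 \<le> \<gamma> \<omega> powr \<alpha>" for \<omega> by simp
  interpret cone_cocycle W \<theta> "thinv P \<theta>" E T \<phi> \<alpha> I y Dd \<nu> C "\<lambda>\<omega>. (1 - q \<omega>) / (1 + q \<omega>)"
    "\<lambda>\<omega>. exp (\<gamma> (\<theta> \<omega>) powr \<alpha>)" "\<lambda>_. 2" "\<lambda>\<omega>. 2 * \<gamma> \<omega> powr (-\<alpha>) / (\<gamma> (\<theta> \<omega>) powr \<alpha> - 1 - H \<omega>)"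
  proof (intro cone_cocycle.intro cone_cocycle_axioms.intro A.branch_system_axioms)
    fix \<omega> assume w: "\<omega> \<in> W"
    note q = A.q_bounds[OF w, unfolded qA]
    show "prob_space (\<nu> \<omega>)" "space (\<nu> \<omega>) = fib E \<omega>" "sets (\<nu> \<omega>) = sets (restrict_space borel (fib E \<omega>))"
      by (rule nuD[OF w])+
    show "(\<lambda>n. Lpow \<theta> (Lop E T \<phi>) n \<omega> g (xs n) / Lpow \<theta> (Lop E T \<phi>) n \<omega> (\<lambda>_. 1) (xs n)) \<longlonglongrightarrow> integral\<^sup>L (\<nu> \<omega>) g"
      if "holder \<alpha> (fib E \<omega>) g" "\<And>n. xs n \<in> fib E ((\<theta> ^^ n) \<omega>)" for g xs
      using WQ(1)[OF w] that by (auto simp: nu_limit_at_def)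
    show "(\<lambda>n. \<Prod>j<n. 1 - (1 - q ((thinv P \<theta> ^^ Suc j) \<omega>)) / (1 + q ((thinv P \<theta> ^^ Suc j) \<omega>)) /
        (exp (\<gamma> (\<theta> ((thinv P \<theta> ^^ Suc j) \<omega>)) powr \<alpha>))\<^sup>2) \<longlonglongrightarrow> 0"
      using WQ(4)[OF w] unfolding k_def .
    show "0 < (1 - q \<omega>) / (1 + q \<omega>)" "(1 - q \<omega>) / (1 + q \<omega>) \<le> 1" using q by auto
    show "1 \<le> exp (\<gamma> (\<theta> \<omega>) powr \<alpha>)" by simp
    show "0 \<le> 2 * \<gamma> \<omega> powr (-\<alpha>) / (\<gamma> (\<theta> \<omega>) powr \<alpha> - 1 - H \<omega>)" using A.gap[OF w] by (intro divide_nonneg_nonneg) auto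
    show "(\<lambda>_. 1) \<in> C \<omega>" unfolding C_def by (rule log_cone_one) simp
    show "\<exists>c\<ge>0. (\<lambda>x. g x + c) \<in> C \<omega>" if "holder \<alpha> (fib E \<omega>) g" for g
      unfolding C_def using A.G_gt[OF w] that by (intro log_cone_absorbs) auto
    show "g \<in> C \<omega>" if "\<And>n. fs n \<in> C \<omega>" "\<And>x. x \<in> fib E \<omega> \<Longrightarrow> (\<lambda>n. fs n x) \<longlonglongrightarrow> g x" for fs g
      using that unfolding C_def by (rule log_cone_lim)
    fix f assume f: "f \<in> C \<omega>"
    note f' = f[unfolded C_def]
    show "holder \<alpha> (fib E \<omega>) f" by (rule log_cone_holder[OF f' G0 al(1) A.diam[OF w]])
    show "0 \<le> f x" if "x \<in> fib E \<omega>" for x by (rule log_coneD(1)[OF f' that])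
    show "(\<lambda>x. f x + g x) \<in> C \<omega>" if "g \<in> C \<omega>" for g using f that unfolding C_def by (rule log_cone_add)
    show "(\<lambda>x. c * f x) \<in> C \<omega>" if "0 \<le> c" for c using f that unfolding C_def by (rule log_cone_scale)
    show "g \<in> C \<omega>" if "\<And>x. x \<in> fib E \<omega> \<Longrightarrow> f x = g x" for g using f that unfolding C_def by (rule log_cone_cong)
    show "(\<lambda>z. Lop E T \<phi> \<omega> f z - t * Lop E T \<phi> \<omega> g z) \<in> C (\<theta> \<omega>)"
      if "g \<in> C \<omega>" "0 \<le> t" "\<And>z. z \<in> fib E (\<theta> \<omega>) \<Longrightarrow> t * Lop E T \<phi> \<omega> g z \<le> (1 - q \<omega>) / (1 + q \<omega>) * Lop E T \<phi> \<omega> f z" for g t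
      unfolding C_def
      using A.L_log_cone_image[OF w f'] A.L_log_cone_image[OF w that(1)[unfolded C_def]] q G0 that(2,3)
      unfolding qA by (rule log_cone_contract)
    show "Lop E T \<phi> \<omega> f x \<le> exp (\<gamma> (\<theta> \<omega>) powr \<alpha>) * Lop E T \<phi> \<omega> f x'"
      if x: "x \<in> fib E (\<theta> \<omega>)" "x' \<in> fib E (\<theta> \<omega>)" for x x'
    proof (rule log_cone_ratio[OF log_cone_mono[OF A.L_log_cone_image[OF w f']] G0 al(1) x A.diam[OF A.th_in[OF w] x]])
      show "A.q \<omega> * \<gamma> (\<theta> \<omega>) powr \<alpha> \<le> \<gamma> (\<theta> \<omega>) powr \<alpha>" unfolding qA using q by (intro mult_left_le_one_le) auto
    qed
    show "(\<lambda>z. (2 * a + 2 * \<gamma> \<omega> powr (-\<alpha>) / (\<gamma> (\<theta> \<omega>) powr \<alpha> - 1 - H \<omega>) * b) * Lop E T \<phi> \<omega> f z + Lop E T \<phi> \<omega> (\<lambda>x. g x * f x) z) \<in> C (\<theta> \<omega>)"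
      if "0 \<le> a" "0 \<le> b" "\<And>x. x \<in> fib E \<omega> \<Longrightarrow> \<bar>g x\<bar> \<le> a"
        "\<And>x x'. x \<in> fib E \<omega> \<Longrightarrow> x' \<in> fib E \<omega> \<Longrightarrow> \<bar>g x - g x'\<bar> \<le> b * dist x x' powr \<alpha>" for a b g
      unfolding C_def by (rule A.expanding_mult[OF w f' that])
  qed simp_all
  \<comment> \<open>In Setting A the constant does not depend on the point, so the power of
    \<open>Suc j\<close> in the growth hypothesis enters below only through being at least 1. The
    absolute value guards against a negative bound \<open>c\<close>.\<close>
  have growth: "exp (supabs (fib E \<omega>) (cent (gmu P \<theta> E T \<phi> \<nu>) u \<omega>)) *
      (2 * supabs (fib E \<omega>) (cent (gmu P \<theta> E T \<phi> \<nu>) u \<omega>) + 2 * \<gamma> \<omega> powr (-\<alpha>) / (\<gamma> (\<theta> \<omega>) powr \<alpha> - 1 - H \<omega>) * hv \<alpha> (fib E \<omega>) (u \<omega>))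
      \<le> 4 * \<bar>c\<bar> * exp c * ((1 - q \<omega>) / (1 + q \<omega>) / (exp (\<gamma> (\<theta> \<omega>) powr \<alpha>))\<^sup>2)" if w: "\<omega> \<in> W" for \<omega>
  proof -
    note EA' = EA_leD[OF WQ(3)[OF w] less_trans[OF zero_less_one \<gamma>th[OF WP[OF w]]]]
    have hu: "holder \<alpha> (fib E \<omega>) (u \<omega>)" by (rule uh[OF WP[OF w]])
    obtain x where x: "x \<in> fib E \<omega>" using A.fib_ne[OF w] by blast
    have U0: "0 \<le> supabs (fib E \<omega>) (cent (gmu P \<theta> E T \<phi> \<nu>) u \<omega>)"
      using supabs_ge[OF holder_cent x, of \<alpha> u \<omega> "gmu P \<theta> E T \<phi> \<nu>"] hu by simp
    have "exp (supabs (fib E \<omega>) (cent (gmu P \<theta> E T \<phi> \<nu>) u \<omega>)) *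
      (2 * supabs (fib E \<omega>) (cent (gmu P \<theta> E T \<phi> \<nu>) u \<omega>) + 2 * \<gamma> \<omega> powr (-\<alpha>) / (\<gamma> (\<theta> \<omega>) powr \<alpha> - 1 - H \<omega>) * hv \<alpha> (fib E \<omega>) (u \<omega>))
      \<le> 4 * c * exp c * ((1 - q \<omega>) / (1 + q \<omega>) / (exp (\<gamma> (\<theta> \<omega>) powr \<alpha>))\<^sup>2)"
      unfolding q_def
      by (rule expanding_growth[OF A.G_gt[OF A.th_in[OF w]] A.H_ge[OF w] EA'(1) U0 hv_nonneg[OF hu] _ EA'(2,3)]) simp
    also have "\<dots> \<le> 4 * \<bar>c\<bar> * exp c * ((1 - q \<omega>) / (1 + q \<omega>) / (exp (\<gamma> (\<theta> \<omega>) powr \<alpha>))\<^sup>2)"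
      using A.q_bounds[OF w, unfolded qA] by (intro mult_right_mono) auto
    finally show ?thesis .
  qed
  show ?thesis
    using W var
  proof eventually_elim
    case (elim \<omega>)
    show ?case
    proof
      fix \<Gamma> :: "real set" assume \<Gamma>: "\<Gamma> \<in> sets borel"
      have gr: "exp (supabs (fib E ((\<theta> ^^ j) \<omega>)) (cent (gmu P \<theta> E T \<phi> \<nu>) u ((\<theta> ^^ j) \<omega>))) *
        (2 * supabs (fib E ((\<theta> ^^ j) \<omega>)) (cent (gmu P \<theta> E T \<phi> \<nu>) u ((\<theta> ^^ j) \<omega>)) +
          2 * \<gamma> ((\<theta> ^^ j) \<omega>) powr (-\<alpha>) / (\<gamma> (\<theta> ((\<theta> ^^ j) \<omega>)) powr \<alpha> - 1 - H ((\<theta> ^^ j) \<omega>)) * hv \<alpha> (fib E ((\<theta> ^^ j) \<omega>)) (u ((\<theta> ^^ j) \<omega>)))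
        \<le> (4 * \<bar>c\<bar> * exp c) * real (Suc j) powr (8 / (3 * p)) *
          ((1 - q ((\<theta> ^^ j) \<omega>)) / (1 + q ((\<theta> ^^ j) \<omega>)) / (exp (\<gamma> (\<theta> ((\<theta> ^^ j) \<omega>)) powr \<alpha>))\<^sup>2)" for j
      proof (rule order_trans[OF growth[OF A.funpow_th_in[OF elim(1)]] mult_right_mono])
        have "1 \<le> real (Suc j) powr (8 / (3 * p))" using p by (intro ge_one_powr_ge_zero) auto
        then have "(4 * \<bar>c\<bar> * exp c) * 1 \<le> (4 * \<bar>c\<bar> * exp c) * real (Suc j) powr (8 / (3 * p))"
          by (intro mult_left_mono) auto
        then show "4 * \<bar>c\<bar> * exp c \<le> (4 * \<bar>c\<bar> * exp c) * real (Suc j) powr (8 / (3 * p))" by simp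
        show "0 \<le> (1 - q ((\<theta> ^^ j) \<omega>)) / (1 + q ((\<theta> ^^ j) \<omega>)) / (exp (\<gamma> (\<theta> ((\<theta> ^^ j) \<omega>)) powr \<alpha>))\<^sup>2"
          using A.q_bounds[OF A.funpow_th_in[OF elim(1), of j], unfolded qA] by (intro divide_nonneg_nonneg) auto
      qed
      note M = mdp_from_growth[of P u \<omega> p "4 * \<bar>c\<bar> * exp c" \<sigma> a \<Gamma>, OF refl uh[OF WP] elim(1) p _ gr elim(2) sigma a \<Gamma>]
      show "- (INF x\<in>interior \<Gamma>. ereal (x\<^sup>2 / (2 * \<sigma>\<^sup>2))) \<le> liminf (mdq \<theta> E T (gmu P \<theta> E T \<phi> \<nu>) u a \<omega> \<Gamma>) \<and>
        limsup (mdq \<theta> E T (gmu P \<theta> E T \<phi> \<nu>) u a \<omega> \<Gamma>) \<le> - (INF x\<in>closure \<Gamma>. ereal (x\<^sup>2 / (2 * \<sigma>\<^sup>2)))"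
        using M by auto
    qed
  qed
qed

lemma mdp_setting_B:
  fixes P :: "'w measure" and E :: "('w \<times> 'x::metric_space) set" and T :: "'w \<Rightarrow> 'x \<Rightarrow> 'x"
    and a :: "nat \<Rightarrow> real"
  assumes st: "standing P \<theta> Xs E T \<alpha> \<phi> u" and nu: "nu_limit P \<theta> E (Lop E T \<phi>) \<alpha> \<nu>"
    and B: "settingB P \<theta> E T \<alpha> \<phi> l sg q dd y"
    and EB: "AE \<omega> in P. EB \<theta> E \<phi> \<alpha> l sg q dd y (gmu P \<theta> E T \<phi> \<nu>) u \<omega> \<le> ereal c"
    and K: "in_Lp P p (KB E \<phi> \<alpha> l sg q dd)"
    and p: "0 < p" and sigma: "0 < \<sigma>"
    and var: "AE \<omega> in P. (\<lambda>n. mvar (gmu P \<theta> E T \<phi> \<nu> \<omega>) (bsum \<theta> T u n \<omega>) / real n) \<longlonglongrightarrow> \<sigma>\<^sup>2"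
    and a: "\<And>n. 0 < a n" "(\<lambda>n. a n / real n powr (1 - 8 / p)) \<longlonglongrightarrow> 0"
      "filterlim (\<lambda>n. (a n)\<^sup>2 / real n) at_top sequentially"
  shows "AE \<omega> in P. \<forall>\<Gamma>\<in>sets borel.
    - (INF x\<in>interior \<Gamma>. ereal (x\<^sup>2 / (2 * \<sigma>\<^sup>2))) \<le> liminf (mdq \<theta> E T (gmu P \<theta> E T \<phi> \<nu>) u a \<omega> \<Gamma>) \<and>
    limsup (mdq \<theta> E T (gmu P \<theta> E T \<phi> \<nu>) u a \<omega> \<Gamma>) \<le> - (INF x\<in>closure \<Gamma>. ereal (x\<^sup>2 / (2 * \<sigma>\<^sup>2)))"
proof -
  have e: "ergodic_ip P \<theta>" and dXs: "\<And>x y. x \<in> Xs \<Longrightarrow> y \<in> Xs \<Longrightarrow> dist x y \<le> 1"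
    and E: "E \<subseteq> space P \<times> Xs" and cf: "\<And>\<omega>. \<omega> \<in> space P \<Longrightarrow> compact (fib E \<omega>)"
    and Tin: "\<And>\<omega> x. \<omega> \<in> space P \<Longrightarrow> x \<in> fib E \<omega> \<Longrightarrow> T \<omega> x \<in> fib E (\<theta> \<omega>)"
    and Tm: "(\<lambda>(\<omega>, x). T \<omega> x) \<in> restrict_space (P \<Otimes>\<^sub>M borel) E \<rightarrow>\<^sub>M borel"
    and al: "0 < \<alpha>" "\<alpha> \<le> 1" and uh: "\<And>\<omega>. \<omega> \<in> space P \<Longrightarrow> holder \<alpha> (fib E \<omega>) (u \<omega>)"
    and pb: "\<And>\<omega>. \<omega> \<in> space P \<Longrightarrow> \<exists>B. \<forall>x\<in>fib E \<omega>. \<bar>\<phi> \<omega> x\<bar> \<le> B"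
    using st unfolding standing_def by blast+
  have lsq: "\<And>\<omega>. \<omega> \<in> space P \<Longrightarrow> 1 \<le> l \<omega> \<and> 1 < sg \<omega> \<and> 0 < q \<omega> \<and> q \<omega> < dd \<omega>"
    using B unfolding settingB_def by blast
  have th: "\<theta> \<in> measurable P P" "distr P P \<theta> = P" and P: "prob_space P" using e by (auto simp: ergodic_ip_def)
  note inv = ergodic_inverse[OF e]
  define s where "s = sB E \<phi> \<alpha> l sg q dd"
  define H where "H = HB \<theta> E \<phi> \<alpha> dd y"
  define eps where "eps = epsB E \<phi>"
  define hi where "hi = (\<lambda>\<omega>. supf (fib E \<omega>) (\<phi> \<omega>))"
  define lo where "lo = (\<lambda>\<omega>. inff (fib E \<omega>) (\<phi> \<omega>))"
  define \<Lambda> where "\<Lambda> = (\<lambda>\<omega> i. if i \<le> q \<omega> then l \<omega> powr \<alpha> else sg \<omega> powr (-\<alpha>))"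
  define Br where "Br = (\<lambda>\<omega>.
        (\<forall>x\<in>fib E (\<theta> \<omega>). bij_betw (\<lambda>i. y \<omega> i x) {1..dd \<omega>} {z \<in> fib E \<omega>. T \<omega> z = x}) \<and>
        (\<forall>x\<in>fib E (\<theta> \<omega>). \<forall>x'\<in>fib E (\<theta> \<omega>).
            (\<forall>i\<in>{1..q \<omega>}. dist (y \<omega> i x) (y \<omega> i x') \<le> l \<omega> * dist x x') \<and>
            (\<forall>i\<in>{q \<omega><..dd \<omega>}. dist (y \<omega> i x) (y \<omega> i x') \<le> dist x x' / sg \<omega>)) \<and>
        (\<forall>i\<in>{1..dd \<omega>}. holder \<alpha> (fib E (\<theta> \<omega>)) (\<lambda>x. \<phi> \<omega> (y \<omega> i x))) \<and>
        s \<omega> < 1 \<and> exp (eps \<omega>) * H \<omega> \<le> (1 / s (\<theta> \<omega>) - 1) / (1 + 1 / s \<omega>))"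
  have Br: "AE \<omega> in P. Br \<omega>" using B unfolding settingB_def Br_def s_def H_def eps_def by blast
  have aB: "0 < aB \<alpha> l sg q dd \<omega>" if "\<omega> \<in> space P" for \<omega>
  proof -
    have "0 < real (q \<omega>) * l \<omega> powr \<alpha>" using lsq[OF that] by (intro mult_pos_pos) auto
    moreover have "0 \<le> (real (dd \<omega>) - real (q \<omega>)) * sg \<omega> powr (-\<alpha>)" using lsq[OF that] by (intro mult_nonneg_nonneg) auto
    ultimately show ?thesis unfolding aB_def using lsq[OF that] by (intro divide_pos_pos add_pos_nonneg) auto
  qed
  have s0: "0 < s \<omega>" if "\<omega> \<in> space P" for \<omega> unfolding s_def sB_def using aB[OF that] by simp
  \<comment> \<open>A lower bound for the contraction rate in terms of \<open>s\<close> at \<omega>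
    and \<theta> \<omega> alone: \<open>Y_gap\<close> bounds its numerator from below, and Y < 2 /
    s(\<theta> \<omega>) bounds both denominators.\<close>
  define k where "k = (\<lambda>\<omega>. (1 / s (\<theta> \<omega>) - 1) * (s \<omega> / (1 + s \<omega>)) / (4 / s (\<theta> \<omega>)) / (1 + 2 / s (\<theta> \<omega>))\<^sup>2)"
  have s_less: "AE \<omega> in P. s \<omega> < 1" using Br by eventually_elim (simp add: Br_def)
  have k_pos: "AE \<omega> in P. 0 < k \<omega> \<and> k \<omega> \<le> 1"
    using s_less funpow_AE[OF th s_less, of 1] AE_space
  proof eventually_elim
    case (elim \<omega>)
    let ?t = "s (\<theta> \<omega>)"
    have t: "0 < ?t" "?t < 1" using s0[OF measurable_space[OF th(1) elim(3)]] elim(2) by auto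
    have sw: "0 < s \<omega>" by (rule s0[OF elim(3)])
    have "(1 / ?t - 1) * (s \<omega> / (1 + s \<omega>)) \<le> 1 / ?t * 1"
      using t sw by (intro mult_mono) auto
    also have "\<dots> \<le> 4 / ?t" using t by (simp add: divide_right_mono)
    finally have le: "(1 / ?t - 1) * (s \<omega> / (1 + s \<omega>)) \<le> 4 / ?t" .
    have "0 < 4 / ?t" using t by simp
    then have 1: "(1 / ?t - 1) * (s \<omega> / (1 + s \<omega>)) / (4 / ?t) \<le> 1" using le by (rule iffD2[OF divide_le_eq_1_pos])
    have 2: "1 \<le> (1 + 2 / ?t)\<^sup>2" using t by (intro one_le_power) simp
    have pos: "0 < (1 / ?t - 1) * (s \<omega> / (1 + s \<omega>)) / (4 / ?t)"
      using t sw by (intro divide_pos_pos mult_pos_pos) auto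
    have "k \<omega> \<le> 1 / 1" unfolding k_def using 1 2 pos by (intro frac_le) auto
    moreover have "0 < k \<omega>" unfolding k_def using pos 2 by (intro divide_pos_pos[OF pos]) linarith
    ultimately show ?case by simp
  qed
  have k_meas: "k \<in> borel_measurable P"
  proof -
    have K': "KB E \<phi> \<alpha> l sg q dd \<in> borel_measurable P" using K by (simp add: in_Lp_def)
    \<comment> \<open>Measurability of \<open>s\<close> is read off from that of K = 1 + 2 / s, part
      of the integrability hypothesis.\<close>
    have "s = (\<lambda>\<omega>. 2 / (KB E \<phi> \<alpha> l sg q dd \<omega> - 1))" by (intro ext) (simp add: KB_def s_def)
    then have [measurable]: "s \<in> borel_measurable P" using K' by simp
    have [measurable]: "\<theta> \<in> measurable P P" by fact
    show ?thesis unfolding k_def by measurable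
  qed
  have rec: "AE \<omega> in P. (\<lambda>n. \<Prod>j<n. 1 - k ((thinv P \<theta> ^^ Suc j) \<omega>)) \<longlonglongrightarrow> 0"
    by (rule recurrent_product_tendsto_zero[OF P inv(1,2) k_meas k_pos])
  define Q where "Q = (\<lambda>\<omega>. nu_limit_at \<theta> E (Lop E T \<phi>) \<alpha> \<nu> \<omega> \<and> Br \<omega> \<and>
    EB \<theta> E \<phi> \<alpha> l sg q dd y (gmu P \<theta> E T \<phi> \<nu>) u \<omega> \<le> ereal c \<and>
    (\<lambda>n. \<Prod>j<n. 1 - k ((thinv P \<theta> ^^ Suc j) \<omega>)) \<longlonglongrightarrow> 0)"
  have "AE \<omega> in P. Q \<omega>"
    using nu Br EB rec unfolding Q_def nu_limit_def nu_limit_at_def by (simp add: AE_conj_iff)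
  define W where "W = orbit_set P \<theta> Q"
  have W: "AE \<omega> in P. \<omega> \<in> W" unfolding W_def by (rule orbit_set_AE[OF e]) fact
  have WP: "\<omega> \<in> space P" if "\<omega> \<in> W" for \<omega> using that unfolding W_def by (rule orbit_setD(2))
  have Wth: "\<theta> \<omega> \<in> W" "thinv P \<theta> \<omega> \<in> W" if "\<omega> \<in> W" for \<omega>
    using orbit_set_invariant[OF e that[unfolded W_def]] by (auto simp: W_def)
  have WQ: "nu_limit_at \<theta> E (Lop E T \<phi>) \<alpha> \<nu> \<omega>" "Br \<omega>"
    "EB \<theta> E \<phi> \<alpha> l sg q dd y (gmu P \<theta> E T \<phi> \<nu>) u \<omega> \<le> ereal c"
    "(\<lambda>n. \<Prod>j<n. 1 - k ((thinv P \<theta> ^^ Suc j) \<omega>)) \<longlonglongrightarrow> 0" if "\<omega> \<in> W" for \<omega>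
    using orbit_setD(1)[OF that[unfolded W_def]] by (auto simp: Q_def)
  have nuD: "prob_space (\<nu> \<omega>)" "space (\<nu> \<omega>) = fib E \<omega>" "sets (\<nu> \<omega>) = sets (restrict_space borel (fib E \<omega>))"
    if "\<omega> \<in> W" for \<omega> using WQ(1)[OF that] by (auto simp: nu_limit_at_def)
  have fne: "fib E \<omega> \<noteq> {}" if "\<omega> \<in> W" for \<omega>
    using prob_space.not_empty[OF nuD(1)[OF that]] nuD(2)[OF that] by simp
  have br: "bij_betw (\<lambda>i. y \<omega> i x) {1..dd \<omega>} {z \<in> fib E \<omega>. T \<omega> z = x}"
    if "\<omega> \<in> W" "x \<in> fib E (\<theta> \<omega>)" for \<omega> x using WQ(2)[OF that(1)] that(2) by (auto simp: Br_def)
  have ph: "holder \<alpha> (fib E (\<theta> \<omega>)) (\<lambda>x. \<phi> \<omega> (y \<omega> i x))" if "\<omega> \<in> W" "i \<in> {1..dd \<omega>}" for \<omega> i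
    using WQ(2)[OF that(1)] that(2) by (auto simp: Br_def)
  have s1: "s \<omega> < 1" and gp: "exp (eps \<omega>) * H \<omega> \<le> (1 / s (\<theta> \<omega>) - 1) / (1 + 1 / s \<omega>)" if "\<omega> \<in> W" for \<omega>
    using WQ(2)[OF that] by (auto simp: Br_def)
  have yl: "dist (y \<omega> i x) (y \<omega> i x') \<le> l \<omega> * dist x x'"
    "i \<le> q \<omega> \<or> dist (y \<omega> i x) (y \<omega> i x') \<le> dist x x' / sg \<omega>"
    if w: "\<omega> \<in> W" and x: "x \<in> fib E (\<theta> \<omega>)" "x' \<in> fib E (\<theta> \<omega>)" and i: "i \<in> {1..dd \<omega>}" for \<omega> x x' i
  proof -
    note b = WQ(2)[OF w, unfolded Br_def]
    have 1: "dist (y \<omega> i x) (y \<omega> i x') \<le> l \<omega> * dist x x'" if "i \<le> q \<omega>" using b x i that by auto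
    have 2: "dist (y \<omega> i x) (y \<omega> i x') \<le> dist x x' / sg \<omega>" if "\<not> i \<le> q \<omega>" using b x i that by auto
    have ls: "1 \<le> l \<omega>" "1 < sg \<omega>" using lsq[OF WP[OF w]] by auto
    have "dist x x' / sg \<omega> \<le> dist x x'" using ls by (simp add: divide_le_eq mult_le_cancel_left1)
    also have "\<dots> \<le> l \<omega> * dist x x'" using ls by (simp add: mult_le_cancel_right1)
    finally show "dist (y \<omega> i x) (y \<omega> i x') \<le> l \<omega> * dist x x'" using 1 2 by (cases "i \<le> q \<omega>") auto
    show "i \<le> q \<omega> \<or> dist (y \<omega> i x) (y \<omega> i x') \<le> dist x x' / sg \<omega>" using 2 by blast
  qed
  have phb: "lo \<omega> \<le> \<phi> \<omega> x" "\<phi> \<omega> x \<le> hi \<omega>" "\<bar>\<phi> \<omega> x\<bar> \<le> supabs (fib E \<omega>) (\<phi> \<omega>)" if w: "\<omega> \<in> W" and x: "x \<in> fib E \<omega>" for \<omega> x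
  proof -
    obtain M where M: "\<And>x. x \<in> fib E \<omega> \<Longrightarrow> \<bar>\<phi> \<omega> x\<bar> \<le> M" using pb[OF WP[OF w]] by blast
    have M': "\<phi> \<omega> x \<le> M" "- M \<le> \<phi> \<omega> x" if "x \<in> fib E \<omega>" for x using M[OF that] by auto
    show "lo \<omega> \<le> \<phi> \<omega> x" unfolding lo_def inff_def using x M' by (intro cInf_lower bdd_belowI2[of _ "- M"]) auto
    show "\<phi> \<omega> x \<le> hi \<omega>" unfolding hi_def supf_def using x M' by (intro cSup_upper bdd_aboveI2[of _ _ M]) auto
    show "\<bar>\<phi> \<omega> x\<bar> \<le> supabs (fib E \<omega>) (\<phi> \<omega>)" unfolding supabs_def using x M by (intro cSup_upper bdd_aboveI2[of _ _ M]) auto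
  qed
  have hv_H: "hv \<alpha> (fib E (\<theta> \<omega>)) (\<lambda>x. \<phi> \<omega> (y \<omega> i x)) \<le> H \<omega>" if "i \<in> {1..dd \<omega>}" for \<omega> i
    unfolding H_def HB_def using that by (intro Max_ge) auto
  have H0: "0 \<le> H \<omega>" if w: "\<omega> \<in> W" for \<omega>
  proof -
    have i: "1 \<in> {1..dd \<omega>}" using lsq[OF WP[OF w]] by auto
    show ?thesis using hv_nonneg[OF ph[OF w i]] hv_H[OF i] by linarith
  qed
  have pv: "\<bar>\<phi> \<omega> (y \<omega> i x) - \<phi> \<omega> (y \<omega> i x')\<bar> \<le> H \<omega> * dist x x' powr \<alpha>"
    if w: "\<omega> \<in> W" and x: "x \<in> fib E (\<theta> \<omega>)" "x' \<in> fib E (\<theta> \<omega>)" and i: "i \<in> {1..dd \<omega>}" for \<omega> x x' i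
    using hv_ge[OF ph[OF w i] x] mult_right_mono[OF hv_H[OF i], of "dist x x' powr \<alpha>"] by fastforce
  have sumL: "exp (eps \<omega>) * (\<Sum>i\<in>{1..dd \<omega>}. \<Lambda> \<omega> i) = real (dd \<omega>) * s \<omega>" if w: "\<omega> \<in> W" for \<omega>
  proof -
    have qd: "q \<omega> < dd \<omega>" "0 < dd \<omega>" using lsq[OF WP[OF w]] by auto
    have split: "{1..dd \<omega>} = {1..q \<omega>} \<union> {q \<omega><..dd \<omega>}" using qd by auto
    have "(\<Sum>i\<in>{1..dd \<omega>}. \<Lambda> \<omega> i) = (\<Sum>i\<in>{1..q \<omega>}. \<Lambda> \<omega> i) + (\<Sum>i\<in>{q \<omega><..dd \<omega>}. \<Lambda> \<omega> i)"
      unfolding split by (rule sum.union_disjoint) auto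
    also have "(\<Sum>i\<in>{1..q \<omega>}. \<Lambda> \<omega> i) = real (q \<omega>) * l \<omega> powr \<alpha>" by (simp add: \<Lambda>_def)
    also have "(\<Sum>i\<in>{q \<omega><..dd \<omega>}. \<Lambda> \<omega> i) = (real (dd \<omega>) - real (q \<omega>)) * sg \<omega> powr (-\<alpha>)"
      using qd by (simp add: \<Lambda>_def of_nat_diff)
    finally have "(\<Sum>i\<in>{1..dd \<omega>}. \<Lambda> \<omega> i) = real (dd \<omega>) * aB \<alpha> l sg q dd \<omega>" using qd by (simp add: aB_def)
    then show ?thesis by (simp add: s_def sB_def eps_def)
  qed
  interpret B: partially_expanding_branches W \<theta> "thinv P \<theta>" E T \<phi> \<alpha> "\<lambda>\<omega>. {1..dd \<omega>}" y
    "\<lambda>\<omega>. real (dd \<omega>) * exp (hi \<omega>)" s "\<lambda>\<omega>. exp (eps \<omega>)" H lo hi dd \<Lambda>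
  proof
    fix \<omega> assume w: "\<omega> \<in> W"
    show "\<theta> (thinv P \<theta> \<omega>) = \<omega>" "thinv P \<theta> (\<theta> \<omega>) = \<omega>" using inv(3,4)[OF WP[OF w]] by auto
    show "\<theta> \<omega> \<in> W" "thinv P \<theta> \<omega> \<in> W" using Wth[OF w] by auto
    show "compact (fib E \<omega>)" by (rule cf[OF WP[OF w]])
    show "fib E \<omega> \<noteq> {}" by (rule fne[OF w])
    show "T \<omega> \<in> borel_measurable (restrict_space borel (fib E \<omega>))" by (rule T_section_measurable[OF Tm WP[OF w]])
    show "T \<omega> x \<in> fib E (\<theta> \<omega>)" if "x \<in> fib E \<omega>" for x by (rule Tin[OF WP[OF w] that])
    show "dist x x' \<le> 1" if "x \<in> fib E \<omega>" "x' \<in> fib E \<omega>" for x x' using dXs E that by (auto simp: fib_def)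
    show "bij_betw (\<lambda>i. y \<omega> i x) {1..dd \<omega>} {z \<in> fib E \<omega>. T \<omega> z = x}" if "x \<in> fib E (\<theta> \<omega>)" for x by (rule br[OF w that])
    show "continuous_on (fib E (\<theta> \<omega>)) (y \<omega> i)" if i: "i \<in> {1..dd \<omega>}" for i
    proof (rule lipschitz_on_continuous_on)
      show "(l \<omega>)-lipschitz_on (fib E (\<theta> \<omega>)) (y \<omega> i)"
        using yl(1)[OF w _ _ i] lsq[OF WP[OF w]] by (intro lipschitz_onI) auto
    qed
    show "continuous_on (fib E (\<theta> \<omega>)) (\<lambda>x. \<phi> \<omega> (y \<omega> i x))" if i: "i \<in> {1..dd \<omega>}" for i
      by (rule holder_continuous_on[OF ph[OF w i] al(1)])
    have fin: "finite {z \<in> fib E \<omega>. T \<omega> z = x}" "card {z \<in> fib E \<omega>. T \<omega> z = x} = dd \<omega>" if x: "x \<in> fib E (\<theta> \<omega>)" for x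
      using bij_betw_finite[OF br[OF w x]] bij_betw_same_card[OF br[OF w x]] by auto
    show "(\<lambda>z. exp (\<phi> \<omega> z)) summable_on {z \<in> fib E \<omega>. T \<omega> z = x}" if x: "x \<in> fib E (\<theta> \<omega>)" for x
      using fin(1)[OF x] by (rule summable_on_finite)
    show "infsum (\<lambda>z. exp (\<phi> \<omega> z)) {z \<in> fib E \<omega>. T \<omega> z = x} \<le> real (dd \<omega>) * exp (hi \<omega>)" if x: "x \<in> fib E (\<theta> \<omega>)" for x
    proof -
      have "(\<Sum>z\<in>{z \<in> fib E \<omega>. T \<omega> z = x}. exp (\<phi> \<omega> z)) \<le> of_nat (card {z \<in> fib E \<omega>. T \<omega> z = x}) * exp (hi \<omega>)"
        using phb(2)[OF w] by (intro sum_bounded_above) auto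
      then show ?thesis using fin[OF x] by simp
    qed
    show "dist (y \<omega> i x) (y \<omega> i x') powr \<alpha> \<le> \<Lambda> \<omega> i * dist x x' powr \<alpha>"
      if x: "x \<in> fib E (\<theta> \<omega>)" "x' \<in> fib E (\<theta> \<omega>)" and i: "i \<in> {1..dd \<omega>}" for i x x'
    proof (cases "i \<le> q \<omega>")
      case True
      have "dist (y \<omega> i x) (y \<omega> i x') powr \<alpha> \<le> (l \<omega> * dist x x') powr \<alpha>"
        using yl(1)[OF w x i] al by (intro powr_mono2) auto
      then show ?thesis using True lsq[OF WP[OF w]] by (simp add: \<Lambda>_def powr_mult)
    next
      case False
      have "dist (y \<omega> i x) (y \<omega> i x') powr \<alpha> \<le> (dist x x' / sg \<omega>) powr \<alpha>"
        using yl(2)[OF w x i] False al by (intro powr_mono2) auto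
      then show ?thesis using False lsq[OF WP[OF w]] by (simp add: \<Lambda>_def powr_divide powr_minus_divide)
    qed
    show "exp (eps \<omega>) * (\<Sum>i\<in>{1..dd \<omega>}. \<Lambda> \<omega> i) = real (dd \<omega>) * s \<omega>" by (rule sumL[OF w])
    show "exp (eps \<omega>) = exp (hi \<omega> - lo \<omega>)" by (simp add: eps_def epsB_def hi_def lo_def)
    show "lo \<omega> \<le> \<phi> \<omega> x \<and> \<phi> \<omega> x \<le> hi \<omega>" if "x \<in> fib E \<omega>" for x using phb[OF w that] by simp
    show "\<bar>\<phi> \<omega> (y \<omega> i x) - \<phi> \<omega> (y \<omega> i x')\<bar> \<le> H \<omega> * dist x x' powr \<alpha>"
      if "x \<in> fib E (\<theta> \<omega>)" "x' \<in> fib E (\<theta> \<omega>)" "i \<in> {1..dd \<omega>}" for i x x' by (rule pv[OF w that])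
    show "0 < s \<omega>" by (rule s0[OF WP[OF w]])
    show "s \<omega> < 1" by (rule s1[OF w])
    show "exp (eps \<omega>) * H \<omega> \<le> (1 / s (\<theta> \<omega>) - 1) / (1 + 1 / s \<omega>)" by (rule gp[OF w])
    show "0 \<le> H \<omega>" by (rule H0[OF w])
  qed (use al in auto)
  define C where "C = (\<lambda>\<omega>. lin_cone \<alpha> (2 / s \<omega>) (fib E \<omega>))"
  define \<kappa>\<^sub>0 where "\<kappa>\<^sub>0 = (\<lambda>\<omega>. (2 / s (\<theta> \<omega>) - B.Y \<omega>) / (2 / s (\<theta> \<omega>) + B.Y \<omega>))"
  define m where "m = (\<lambda>\<omega>. 2 / (1 - B.Y \<omega> * s (\<theta> \<omega>) / 2))"
  have Yb: "2 \<le> B.Y \<omega>" "B.Y \<omega> < 2 / s (\<theta> \<omega>)" if "\<omega> \<in> W" for \<omega> using B.Y_ge[OF that] B.Y_less[OF that] .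
  have k0: "0 < \<kappa>\<^sub>0 \<omega>" "\<kappa>\<^sub>0 \<omega> \<le> 1" if "\<omega> \<in> W" for \<omega>
    using Yb[OF that] by (auto simp: \<kappa>\<^sub>0_def divide_le_eq_1)
  have kk: "k \<omega> \<le> \<kappa>\<^sub>0 \<omega> / (1 + B.Y \<omega>)\<^sup>2" if w: "\<omega> \<in> W" for \<omega>
  proof -
    have t: "0 < s (\<theta> \<omega>)" "s (\<theta> \<omega>) < 1" "0 < s \<omega>" using B.s_pos B.s_less w Wth by auto
    have "(1 / s (\<theta> \<omega>) - 1) * (s \<omega> / (1 + s \<omega>)) / (4 / s (\<theta> \<omega>)) \<le> \<kappa>\<^sub>0 \<omega>"
      unfolding \<kappa>\<^sub>0_def using B.Y_gap[OF w] Yb[OF w] t by (intro frac_le) auto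
    then show ?thesis
      unfolding k_def using Yb[OF w] k0[OF w] by (intro frac_le power_mono) auto
  qed
  have kn: "0 \<le> k \<omega>" if w: "\<omega> \<in> W" for \<omega>
  proof -
    have t: "0 < s (\<theta> \<omega>)" "s (\<theta> \<omega>) < 1" "0 < s \<omega>" using B.s_pos B.s_less w Wth by auto
    then show ?thesis unfolding k_def by (intro divide_nonneg_nonneg mult_nonneg_nonneg) auto
  qed
  have kap1: "\<kappa>\<^sub>0 \<omega> / (1 + B.Y \<omega>)\<^sup>2 \<le> 1" if w: "\<omega> \<in> W" for \<omega>
  proof -
    have "1 \<le> (1 + B.Y \<omega>)\<^sup>2" using Yb[OF w] by (intro one_le_power) simp
    then have "\<kappa>\<^sub>0 \<omega> \<le> (1 + B.Y \<omega>)\<^sup>2" using k0[OF w] by linarith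
    then show ?thesis by (simp add: divide_le_eq_1)
  qed
  have m1: "1 \<le> m \<omega>" if w: "\<omega> \<in> W" for \<omega>
  proof -
    have t: "0 < s (\<theta> \<omega>)" using B.s_pos w Wth by auto
    have "B.Y \<omega> * s (\<theta> \<omega>) < 2" using Yb(2)[OF w] t by (simp add: less_divide_eq)
    moreover have "0 \<le> B.Y \<omega> * s (\<theta> \<omega>)" using Yb(1)[OF w] t by simp
    ultimately show ?thesis by (simp add: m_def le_divide_eq)
  qed
  interpret cone_cocycle W \<theta> "thinv P \<theta>" E T \<phi> \<alpha> "\<lambda>\<omega>. {1..dd \<omega>}" y "\<lambda>\<omega>. real (dd \<omega>) * exp (hi \<omega>)"
    \<nu> C \<kappa>\<^sub>0 "\<lambda>\<omega>. 1 + B.Y \<omega>" m m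
  proof (intro cone_cocycle.intro cone_cocycle_axioms.intro B.branch_system_axioms)
    fix \<omega> assume w: "\<omega> \<in> W"
    have s2: "0 \<le> 2 / s \<omega>" "0 < 2 / s \<omega>" using B.s_pos[OF w] by auto
    show "prob_space (\<nu> \<omega>)" "space (\<nu> \<omega>) = fib E \<omega>" "sets (\<nu> \<omega>) = sets (restrict_space borel (fib E \<omega>))"
      by (rule nuD[OF w])+
    show "(\<lambda>n. Lpow \<theta> (Lop E T \<phi>) n \<omega> g (xs n) / Lpow \<theta> (Lop E T \<phi>) n \<omega> (\<lambda>_. 1) (xs n)) \<longlonglongrightarrow> integral\<^sup>L (\<nu> \<omega>) g"
      if "holder \<alpha> (fib E \<omega>) g" "\<And>n. xs n \<in> fib E ((\<theta> ^^ n) \<omega>)" for g xs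
      using WQ(1)[OF w] that by (auto simp: nu_limit_at_def)
    show "(\<lambda>n. \<Prod>j<n. 1 - \<kappa>\<^sub>0 ((thinv P \<theta> ^^ Suc j) \<omega>) / (1 + B.Y ((thinv P \<theta> ^^ Suc j) \<omega>))\<^sup>2) \<longlonglongrightarrow> 0"
    \<comment> \<open>The rate is at least \<open>k\<close>, so its products lie between 0 and those
      of \<open>k\<close>, which vanish by recurrence.\<close>
    proof (rule tendsto_sandwich[OF _ _ tendsto_const WQ(4)[OF w]]; intro always_eventually allI)
      fix n
      have wj: "(thinv P \<theta> ^^ Suc j) \<omega> \<in> W" for j by (rule B.funpow_thi_in[OF w])
      show "0 \<le> (\<Prod>j<n. 1 - \<kappa>\<^sub>0 ((thinv P \<theta> ^^ Suc j) \<omega>) / (1 + B.Y ((thinv P \<theta> ^^ Suc j) \<omega>))\<^sup>2)"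
        using kap1[OF wj] by (intro prod_nonneg) (simp del: funpow.simps)
      show "(\<Prod>j<n. 1 - \<kappa>\<^sub>0 ((thinv P \<theta> ^^ Suc j) \<omega>) / (1 + B.Y ((thinv P \<theta> ^^ Suc j) \<omega>))\<^sup>2)
          \<le> (\<Prod>j<n. 1 - k ((thinv P \<theta> ^^ Suc j) \<omega>))"
        using kap1[OF wj] kk[OF wj] by (intro prod_mono) (simp del: funpow.simps)
    qed
    show "0 < \<kappa>\<^sub>0 \<omega>" "\<kappa>\<^sub>0 \<omega> \<le> 1" by (rule k0[OF w])+
    show "1 \<le> 1 + B.Y \<omega>" using Yb[OF w] by simp
    show "1 \<le> m \<omega>" by (rule m1[OF w])
    then show "0 \<le> m \<omega>" by simp
    show "(\<lambda>_. 1) \<in> C \<omega>" unfolding C_def by (rule lin_cone_one[OF s2(1)])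
    show "\<exists>c\<ge>0. (\<lambda>x. g x + c) \<in> C \<omega>" if "holder \<alpha> (fib E \<omega>) g" for g
      unfolding C_def by (rule lin_cone_absorbs[OF s2(2) that])
    show "g \<in> C \<omega>" if "\<And>n. fs n \<in> C \<omega>" "\<And>x. x \<in> fib E \<omega> \<Longrightarrow> (\<lambda>n. fs n x) \<longlonglongrightarrow> g x" for fs g
      using that unfolding C_def by (rule lin_cone_lim)
    fix f assume f: "f \<in> C \<omega>"
    note f' = f[unfolded C_def]
    show "holder \<alpha> (fib E \<omega>) f" by (rule lin_cone_holder[OF f' s2(1) al(1) B.diam[OF w]])
    show "0 \<le> f x" if "x \<in> fib E \<omega>" for x by (rule lin_coneD(1)[OF f' that])
    show "(\<lambda>x. f x + g x) \<in> C \<omega>" if "g \<in> C \<omega>" for g using f that unfolding C_def by (rule lin_cone_add)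
    show "(\<lambda>x. c * f x) \<in> C \<omega>" if "0 \<le> c" for c using f that unfolding C_def by (rule lin_cone_scale)
    show "g \<in> C \<omega>" if "\<And>x. x \<in> fib E \<omega> \<Longrightarrow> f x = g x" for g using f that unfolding C_def by (rule lin_cone_cong)
    show "(\<lambda>z. Lop E T \<phi> \<omega> f z - t * Lop E T \<phi> \<omega> g z) \<in> C (\<theta> \<omega>)"
      if "g \<in> C \<omega>" "0 \<le> t" "\<And>z. z \<in> fib E (\<theta> \<omega>) \<Longrightarrow> t * Lop E T \<phi> \<omega> g z \<le> \<kappa>\<^sub>0 \<omega> * Lop E T \<phi> \<omega> f z" for g t
      unfolding C_def by (rule B.lin_cone_contract[OF w f' that(1)[unfolded C_def] that(2) that(3)[unfolded \<kappa>\<^sub>0_def]])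
    show "Lop E T \<phi> \<omega> f x \<le> (1 + B.Y \<omega>) * Lop E T \<phi> \<omega> f x'" if x: "x \<in> fib E (\<theta> \<omega>)" "x' \<in> fib E (\<theta> \<omega>)" for x x'
      by (rule B.L_ratio[OF w f' x])
    show "(\<lambda>z. (m \<omega> * a + m \<omega> * b) * Lop E T \<phi> \<omega> f z + Lop E T \<phi> \<omega> (\<lambda>x. g x * f x) z) \<in> C (\<theta> \<omega>)"
      if "0 \<le> a" "0 \<le> b" "\<And>x. x \<in> fib E \<omega> \<Longrightarrow> \<bar>g x\<bar> \<le> a"
        "\<And>x x'. x \<in> fib E \<omega> \<Longrightarrow> x' \<in> fib E \<omega> \<Longrightarrow> \<bar>g x - g x'\<bar> \<le> b * dist x x' powr \<alpha>" for a b g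
      unfolding C_def m_def by (rule B.lin_cone_mult[OF w f' that])
  qed
  \<comment> \<open>The factor 1 / s^2 sits at the next point \<theta> \<omega>, which is why
    \<open>Suc j\<close> appears in the growth of K below.\<close>
  have growth: "exp (supabs (fib E \<omega>) (cent (gmu P \<theta> E T \<phi> \<nu>) u \<omega>)) *
      (m \<omega> * supabs (fib E \<omega>) (cent (gmu P \<theta> E T \<phi> \<nu>) u \<omega>) + m \<omega> * hv \<alpha> (fib E \<omega>) (u \<omega>))
      \<le> 3 * \<bar>c\<bar> * (KB E \<phi> \<alpha> l sg q dd (\<theta> \<omega>))\<^sup>2 * (\<kappa>\<^sub>0 \<omega> / (1 + B.Y \<omega>)\<^sup>2)" if w: "\<omega> \<in> W" for \<omega>
  proof -
    have hu: "holder \<alpha> (fib E \<omega>) (u \<omega>)" by (rule uh[OF WP[OF w]])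
    obtain x where x: "x \<in> fib E \<omega>" using fne[OF w] by blast
    have U0: "0 \<le> supabs (fib E \<omega>) (cent (gmu P \<theta> E T \<phi> \<nu>) u \<omega>)"
      using supabs_ge[OF holder_cent x, of \<alpha> u \<omega> "gmu P \<theta> E T \<phi> \<nu>"] hu by simp
    have t: "0 < s (\<theta> \<omega>)" "s (\<theta> \<omega>) < 1" "0 < s \<omega>" using B.s_pos B.s_less w Wth by auto
    have ep: "eps \<omega> = hi \<omega> - lo \<omega>" by (simp add: eps_def epsB_def hi_def lo_def)
    have eps0: "0 \<le> eps \<omega>" using phb(1,2)[OF w x] by (simp add: ep)
    have "hi \<omega> \<le> supabs (fib E \<omega>) (\<phi> \<omega>)" unfolding hi_def supf_def
      by (rule cSup_least) (use fne[OF w] phb(3)[OF w] in \<open>auto simp: abs_le_iff\<close>)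
    moreover have "- supabs (fib E \<omega>) (\<phi> \<omega>) \<le> lo \<omega>" unfolding lo_def inff_def
      by (rule cInf_greatest) (use fne[OF w] phb(3)[OF w] in \<open>force simp: abs_le_iff\<close>)+
    ultimately have eps2: "eps \<omega> \<le> 2 * supabs (fib E \<omega>) (\<phi> \<omega>)" by (simp add: ep)
    have z: "zetaB \<theta> E \<phi> \<alpha> l sg q dd y \<omega> = s (\<theta> \<omega>) * (1 + (1 + 1 / s \<omega>) * exp (eps \<omega>) * H \<omega>)"
      by (simp add: zetaB_def s_def eps_def H_def)
    note EB' = EB_leD[OF WQ(3)[OF w], unfolded z, folded s_def H_def]
    have "exp (supabs (fib E \<omega>) (cent (gmu P \<theta> E T \<phi> \<nu>) u \<omega>)) *
      (m \<omega> * supabs (fib E \<omega>) (cent (gmu P \<theta> E T \<phi> \<nu>) u \<omega>) + m \<omega> * hv \<alpha> (fib E \<omega>) (u \<omega>))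
      \<le> 3 * c / (s (\<theta> \<omega>))\<^sup>2 * (\<kappa>\<^sub>0 \<omega> / (1 + B.Y \<omega>)\<^sup>2)"
      unfolding m_def \<kappa>\<^sub>0_def B.Y_def
      by (rule partially_expanding_growth[OF t(3,1,2) H0[OF w] U0 hv_nonneg[OF hu] eps0 eps2 EB'])
    also have "\<dots> \<le> 3 * \<bar>c\<bar> * (KB E \<phi> \<alpha> l sg q dd (\<theta> \<omega>))\<^sup>2 * (\<kappa>\<^sub>0 \<omega> / (1 + B.Y \<omega>)\<^sup>2)"
    proof (rule mult_right_mono)
      have "(1 / s (\<theta> \<omega>))\<^sup>2 \<le> (KB E \<phi> \<alpha> l sg q dd (\<theta> \<omega>))\<^sup>2"
      proof (rule power_mono)
        have "0 < 1 / s (\<theta> \<omega>)" using t by simp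
        then show "1 / s (\<theta> \<omega>) \<le> KB E \<phi> \<alpha> l sg q dd (\<theta> \<omega>)" unfolding KB_def s_def[symmetric] by linarith
      qed (use t in simp)
      then have "3 * \<bar>c\<bar> * (1 / s (\<theta> \<omega>))\<^sup>2 \<le> 3 * \<bar>c\<bar> * (KB E \<phi> \<alpha> l sg q dd (\<theta> \<omega>))\<^sup>2"
        by (intro mult_left_mono) auto
      moreover have "3 * c * (1 / s (\<theta> \<omega>))\<^sup>2 \<le> 3 * \<bar>c\<bar> * (1 / s (\<theta> \<omega>))\<^sup>2" by (intro mult_right_mono) auto
      ultimately have "3 * c * (1 / s (\<theta> \<omega>))\<^sup>2 \<le> 3 * \<bar>c\<bar> * (KB E \<phi> \<alpha> l sg q dd (\<theta> \<omega>))\<^sup>2" by linarith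
      then show "3 * c / (s (\<theta> \<omega>))\<^sup>2 \<le> 3 * \<bar>c\<bar> * (KB E \<phi> \<alpha> l sg q dd (\<theta> \<omega>))\<^sup>2" by (simp add: power_divide)
      show "0 \<le> \<kappa>\<^sub>0 \<omega> / (1 + B.Y \<omega>)\<^sup>2" using k0[OF w] by simp
    qed
    finally show ?thesis .
  qed
  have Kgr: "AE \<omega> in P. \<exists>C\<ge>0. \<forall>j. \<bar>KB E \<phi> \<alpha> l sg q dd ((\<theta> ^^ j) \<omega>)\<bar> powr p \<le> C * real (Suc j) powr (4 / 3)"
    by (rule Lp_orbit_growth[OF th K])
  show ?thesis
    using W var Kgr
  proof eventually_elim
    case (elim \<omega>)
    obtain D where D: "0 \<le> D" "\<And>j. \<bar>KB E \<phi> \<alpha> l sg q dd ((\<theta> ^^ j) \<omega>)\<bar> powr p \<le> D * real (Suc j) powr (4 / 3)"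
      using elim(3) by blast
    have wj: "(\<theta> ^^ j) \<omega> \<in> W" for j by (rule B.funpow_th_in[OF elim(1)])
    have K2: "(KB E \<phi> \<alpha> l sg q dd ((\<theta> ^^ Suc j) \<omega>))\<^sup>2 \<le> (D * 2 powr (4 / 3)) powr (2 / p) * real (Suc j) powr (8 / (3 * p))" for j
    proof -
      define x where "x = KB E \<phi> \<alpha> l sg q dd ((\<theta> ^^ Suc j) \<omega>)"
      have x: "0 < x" unfolding x_def KB_def s_def[symmetric] using B.s_pos[OF wj] by (auto intro!: add_pos_pos simp del: funpow.simps)
      have "x powr p \<le> D * real (Suc (Suc j)) powr (4 / 3)" using D(2)[of "Suc j"] x by (simp add: x_def)
      \<comment> \<open>The time shift costs only the constant 2^(4/3). Raising to the power 2/p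
        then gives the exponent (4/3)(2/p) = 8/(3p), whose triple is 8/p.\<close>
      also have "\<dots> \<le> D * (2 * real (Suc j)) powr (4 / 3)" using D(1) by (intro mult_left_mono powr_mono2) auto
      also have "\<dots> = (D * 2 powr (4 / 3)) * real (Suc j) powr (4 / 3)" by (subst powr_mult) (auto simp: mult.assoc)
      finally have "(x powr p) powr (2 / p) \<le> ((D * 2 powr (4 / 3)) * real (Suc j) powr (4 / 3)) powr (2 / p)"
        using p by (intro powr_mono2) auto
      moreover have "(x powr p) powr (2 / p) = x\<^sup>2" using p x by (simp add: powr_powr)
      moreover have "((D * 2 powr (4 / 3)) * real (Suc j) powr (4 / 3)) powr (2 / p)
          = (D * 2 powr (4 / 3)) powr (2 / p) * real (Suc j) powr (8 / (3 * p))"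
        using D(1) by (simp add: powr_mult powr_powr)
      ultimately show ?thesis by (simp add: x_def)
    qed
    define G where "G = 3 * \<bar>c\<bar> * (D * 2 powr (4 / 3)) powr (2 / p)"
    have G: "0 \<le> G" by (simp add: G_def)
    have gr: "exp (supabs (fib E ((\<theta> ^^ j) \<omega>)) (cent (gmu P \<theta> E T \<phi> \<nu>) u ((\<theta> ^^ j) \<omega>))) *
      (m ((\<theta> ^^ j) \<omega>) * supabs (fib E ((\<theta> ^^ j) \<omega>)) (cent (gmu P \<theta> E T \<phi> \<nu>) u ((\<theta> ^^ j) \<omega>)) +
        m ((\<theta> ^^ j) \<omega>) * hv \<alpha> (fib E ((\<theta> ^^ j) \<omega>)) (u ((\<theta> ^^ j) \<omega>)))
      \<le> G * real (Suc j) powr (8 / (3 * p)) * (\<kappa>\<^sub>0 ((\<theta> ^^ j) \<omega>) / (1 + B.Y ((\<theta> ^^ j) \<omega>))\<^sup>2)" for j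
    proof (rule order_trans[OF growth[OF wj] mult_right_mono])
      have "3 * \<bar>c\<bar> * (KB E \<phi> \<alpha> l sg q dd ((\<theta> ^^ Suc j) \<omega>))\<^sup>2
        \<le> 3 * \<bar>c\<bar> * ((D * 2 powr (4 / 3)) powr (2 / p) * real (Suc j) powr (8 / (3 * p)))"
        by (intro mult_left_mono K2) auto
      then show "3 * \<bar>c\<bar> * (KB E \<phi> \<alpha> l sg q dd (\<theta> ((\<theta> ^^ j) \<omega>)))\<^sup>2 \<le> G * real (Suc j) powr (8 / (3 * p))"
        by (simp add: G_def mult.assoc)
      show "0 \<le> \<kappa>\<^sub>0 ((\<theta> ^^ j) \<omega>) / (1 + B.Y ((\<theta> ^^ j) \<omega>))\<^sup>2" using k0[OF wj] by (intro divide_nonneg_nonneg) (auto simp: less_imp_le)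
    qed
    show ?case
    proof
      fix \<Gamma> :: "real set" assume \<Gamma>: "\<Gamma> \<in> sets borel"
      note M = mdp_from_growth[of P u \<omega> p G \<sigma> a \<Gamma>, OF refl uh[OF WP] elim(1) p G gr elim(2) sigma a \<Gamma>]
      show "- (INF x\<in>interior \<Gamma>. ereal (x\<^sup>2 / (2 * \<sigma>\<^sup>2))) \<le> liminf (mdq \<theta> E T (gmu P \<theta> E T \<phi> \<nu>) u a \<omega> \<Gamma>) \<and>
        limsup (mdq \<theta> E T (gmu P \<theta> E T \<phi> \<nu>) u a \<omega> \<Gamma>) \<le> - (INF x\<in>closure \<Gamma>. ereal (x\<^sup>2 / (2 * \<sigma>\<^sup>2)))"
        using M by auto
    qed
  qed
qed

theorem mainTheorem6:
  fixes P :: "'w measure" and \<theta> :: "'w \<Rightarrow> 'w" and Xs :: "'x::metric_space set"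
    and E :: "('w \<times> 'x) set" and T :: "'w \<Rightarrow> 'x \<Rightarrow> 'x" and \<alpha> :: real
    and \<phi> u :: "'w \<Rightarrow> 'x \<Rightarrow> real" and \<nu> :: "'w \<Rightarrow> 'x measure"
    and \<gamma> HA DA :: "'w \<Rightarrow> real" and IA :: "'w \<Rightarrow> nat set" and yA :: "'w \<Rightarrow> nat \<Rightarrow> 'x \<Rightarrow> 'x"
    and l sg :: "'w \<Rightarrow> real" and q dd :: "'w \<Rightarrow> nat" and yB :: "'w \<Rightarrow> nat \<Rightarrow> 'x \<Rightarrow> 'x"
    and p \<sigma> :: real and a :: "nat \<Rightarrow> real"
  assumes standing_setup: "standing P \<theta> Xs E T \<alpha> \<phi> u"
    and gibbs: "nu_limit P \<theta> E (Lop E T \<phi>) \<alpha> \<nu>"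
    and p_gt: "8 < p"
    and settings:
      "(settingA P \<theta> E T \<alpha> \<phi> \<gamma> HA DA IA yA \<and>
        (\<exists>C::real. AE \<omega> in P. EA \<theta> E \<alpha> \<gamma> HA (gmu P \<theta> E T \<phi> \<nu>) u \<omega> \<le> ereal C) \<and>
        (AE \<omega> in P. HtA E \<alpha> \<gamma> HA u \<omega> \<le> \<gamma> (\<theta> \<omega>) powr \<alpha> - 1) \<and>
        in_Lp P (2 * p) (DbarA E \<alpha> \<gamma> HA DA (gmu P \<theta> E T \<phi> \<nu>) u) \<and>
        in_Lp P p (KA \<alpha> \<gamma>) \<and> in_Lp P p (MA \<alpha> \<gamma>) \<and>
        in_Lp P p (\<lambda>\<omega>. supabs (fib E \<omega>) (cent (gmu P \<theta> E T \<phi> \<nu>) u \<omega>)))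
       \<or>
       (settingB P \<theta> E T \<alpha> \<phi> l sg q dd yB \<and>
        (\<exists>C::real. AE \<omega> in P. EB \<theta> E \<phi> \<alpha> l sg q dd yB (gmu P \<theta> E T \<phi> \<nu>) u \<omega> \<le> ereal C) \<and>
        in_Lp P (2 * p) (DbarB \<theta> E \<phi> \<alpha> dd yB (gmu P \<theta> E T \<phi> \<nu>) u) \<and>
        in_Lp P p (KB E \<phi> \<alpha> l sg q dd) \<and> in_Lp P p (MB E \<phi> \<alpha> l sg q dd) \<and>
        in_Lp P p (\<lambda>\<omega>. supabs (fib E \<omega>) (cent (gmu P \<theta> E T \<phi> \<nu>) u \<omega>)))"
    and sigma_pos: "0 < \<sigma>"
    and sigma_lim: "AE \<omega> in P.
          (\<lambda>n. mvar (gmu P \<theta> E T \<phi> \<nu> \<omega>) (bsum \<theta> T u n \<omega>) / real n) \<longlonglongrightarrow> \<sigma>\<^sup>2"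
    and a_pos: "\<forall>n. 0 < a n"
    and a_lower: "filterlim (\<lambda>n. a n * real n powr (- max (6 / p) (1 / 2))) at_top sequentially"
    and a_upper: "(\<lambda>n. a n / real n powr (1 - 8 / p)) \<longlonglongrightarrow> 0"
  shows "AE \<omega> in P. \<forall>\<Gamma> \<in> sets (borel :: real measure).
           - (INF x\<in>interior \<Gamma>. ereal (x\<^sup>2 / (2 * \<sigma>\<^sup>2)))
              \<le> liminf (mdq \<theta> E T (gmu P \<theta> E T \<phi> \<nu>) u a \<omega> \<Gamma>) \<and>
           liminf (mdq \<theta> E T (gmu P \<theta> E T \<phi> \<nu>) u a \<omega> \<Gamma>)
              \<le> limsup (mdq \<theta> E T (gmu P \<theta> E T \<phi> \<nu>) u a \<omega> \<Gamma>) \<and>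
           limsup (mdq \<theta> E T (gmu P \<theta> E T \<phi> \<nu>) u a \<omega> \<Gamma>)
              \<le> - (INF x\<in>closure \<Gamma>. ereal (x\<^sup>2 / (2 * \<sigma>\<^sup>2)))"
proof -
  have p: "0 < p" using p_gt by simp
  have a: "\<And>n. 0 < a n" using a_pos by blast
  note sq = squared_scale_at_top[OF a a_lower]
  have "AE \<omega> in P. \<forall>\<Gamma>\<in>sets borel.
    - (INF x\<in>interior \<Gamma>. ereal (x\<^sup>2 / (2 * \<sigma>\<^sup>2))) \<le> liminf (mdq \<theta> E T (gmu P \<theta> E T \<phi> \<nu>) u a \<omega> \<Gamma>) \<and>
    limsup (mdq \<theta> E T (gmu P \<theta> E T \<phi> \<nu>) u a \<omega> \<Gamma>) \<le> - (INF x\<in>closure \<Gamma>. ereal (x\<^sup>2 / (2 * \<sigma>\<^sup>2)))"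
    using settings
  proof (elim disjE conjE exE)
    fix C :: real
    assume "settingA P \<theta> E T \<alpha> \<phi> \<gamma> HA DA IA yA"
      and "AE \<omega> in P. EA \<theta> E \<alpha> \<gamma> HA (gmu P \<theta> E T \<phi> \<nu>) u \<omega> \<le> ereal C"
    then show ?thesis
      by (rule mdp_setting_A[OF standing_setup gibbs _ _ p sigma_pos sigma_lim a a_upper sq])
  next
    fix C :: real
    assume "settingB P \<theta> E T \<alpha> \<phi> l sg q dd yB"
      and "AE \<omega> in P. EB \<theta> E \<phi> \<alpha> l sg q dd yB (gmu P \<theta> E T \<phi> \<nu>) u \<omega> \<le> ereal C"
      and "in_Lp P p (KB E \<phi> \<alpha> l sg q dd)"
    then show ?thesis
      by (rule mdp_setting_B[OF standing_setup gibbs _ _ _ p sigma_pos sigma_lim a a_upper sq])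
  qed
  then show ?thesis
    by eventually_elim (auto intro: Liminf_le_Limsup)
qed

end
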